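(* Let $(\hat\alpha,\hat m)$ be the mean field Nash equilibrium. Let $\theta^{\hat m}$ be the solution of $$\dot\theta^{\hat m}_t+\psi_t\frac{d\hat m_t}{dt}+A_t^\top\theta^{\hat m}_t+q_t-(\phi_tB_t+S_t^\top)R_t^{-1}(B_t^\top\theta^{\hat m}_t+r_t)=0,\qquad\theta^{\hat m}_T=0,$$ and set $\Theta^{\hat m}_t=R_t^{-1}(B_t^\top\theta^{\hat m}_t+r_t)$. Let $(\lambda,\mu)\in\mathcal G$ correspond to some $\delta\in\mathbb H^2(\mathcal F_0)$ independent of $\xi$ and $W$. Then $\mathfrak J(\lambda,\mu)\ge\mathfrak J(\hat\alpha,\hat m)$ if and only if $$\begin{aligned} \int_0^T\Big(&\tfrac12\big(\langle\bar Q_t\hat m_t,\hat m_t\rangle-\mathbb E[\langle\bar Q_t\mu_t,\mu_t\rangle]\big)+\tfrac12\big(\langle M_t\hat m_t,\hat m_t\rangle-\mathbb E[\langle M_t\mu_t,\mu_t\rangle]\big)\\ &+\tfrac12\big(\langle G_t\hat m_t,\hat m_t\rangle-\mathbb E[\langle G_t\mu_t,\mu_t\rangle]\big)+\langle N_t\hat m_t,\hat m_t\rangle-\mathbb E[\langle N_t\mu_t,\mu_t\rangle]\\ &+\big\langle L_t-q_t+\big(R_t^{-1}(B_t^\top(\phi_t+\psi_t)+S_t)\big)^\top r_t,\ \mathbb E[\mu_t]-\hat m_t\big\rangle+\langle B_t^\top\phi_t\hat m_t,\Theta^{\hat m}_t\rangle\\ &-\mathbb E[\langle B_t^\top\phi_t\mu_t,R_t^{-1}\delta_t\rangle]-\mathbb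 E[\langle B_t^\top\psi_t\mu_t,R_t^{-1}\delta_t\rangle]+\langle B_t^\top\psi_t\hat m_t,\Theta^{\hat m}_t\rangle\\ &+\tfrac12\big(\langle R_t\Theta^{\hat m}_t,\Theta^{\hat m}_t\rangle-\mathbb E[\langle R_t^{-1}\delta_t,\delta_t\rangle]\big)-\langle r_t,\Theta^{\hat m}_t-R_t^{-1}\mathbb E[\delta_t]\rangle\Big)dt\\ &+\tfrac12\big(\langle\bar H\hat m_T,\hat m_T\rangle-\mathbb E[\langle\bar H\mu_T,\mu_T\rangle]\big)+\tfrac12\big(\langle H\hat m_T,\hat m_T\rangle-\mathbb E[\langle H\mu_T,\mu_T\rangle]\big)\\ &+\langle\tilde H\hat m_T,\hat m_T\rangle-\mathbb E[\langle\tilde H\mu_T,\mu_T\rangle]\ \ge\ 0 . \end{aligned}$$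
   Context: Data. Fix $T>0$, $d,k\in\mathbb N$. $\mathcal S^n$ is the set of real symmetric $n\times n$ matrices, ordered by $\ge$ in the positive semidefinite sense; $I_n$ is the identity. Given: $A,\sigma\in L^\infty([0,T];\mathbb R^{d\times d})$, $B\in L^\infty([0,T];\mathbb R^{d\times k})$, $Q,\bar Q,\tilde Q\in L^\infty([0,T];\mathcal S^d)$, $R\in\mathcal C([0,T];\mathcal S^k)$, $H,\bar H,\tilde H\in\mathcal S^d$, $S\in L^\infty([0,T];\mathbb R^{k\times d})$, $L,q\in L^\infty([0,T];\mathbb R^d)$, $r\in L^\infty([0,T];\mathbb R^k)$, with $H,\bar H,\tilde H\ge0$; $Q_t\ge d_1I_d$ and $R_t\ge d_2I_k$ for all $t$, where $d_1\ge0$, $d_2>0$; $\sup_t|S_t|^2<d_1d_2$ if $d_1>0$, and $S\equiv0$ if $d_1=0$. ODEs with bounded measurable coefficients are understood in the integrated (a.e.) sense. Probability. $(\Omega,\mathcal F,\mathbb F=(\mathcal F_t)_{t\in[0,T]},\mathbb P)$ is a complete filtered probability space satisfying the usual conditions, $W$ a $d$-dimensional $\mathbb F$-Brownian motion, $\xi$ an $\mathbb R^d$-valued $\mathcal F_0$-measurable random variable independent of $W$, with law $\nu$ having finite second moment; $\nu_1=\mathbb E[\xi]$. $\mathcal F_0$ supports a uniform random variable independent of $(\xi,W)$. $\mathbb F^1$ is the filtration generated by $\xi$ and $W$ (satisfying the usual conditions). For a filtration $\mathbb G$, $\mathbb H^2(\mathbb G)$ is the set of $\mathbb G$-progressively measurable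 $\mathbb R^k$-valued processes $\alpha$ with $\mathbb E\int_0^T|\alpha_t|^2dt<\infty$; $\mathbb H^2(\mathcal F_0)$ is this set for the constant filtration $\mathcal F_0$. "Independent of $\xi$ and $W$" means independent of the pair $(\xi,W)$. State and payoff. For $\lambda\in\mathbb H^2(\mathbb F)$, $X=X^\lambda$ solves $dX_t=(A_tX_t+B_t\lambda_t)dt+\sigma_tdW_t$, $X_0=\xi$, and $$\begin{aligned}\mathfrak J(\lambda,\mu)=\mathbb E\Big[&\int_0^T\big(\langle L_t,\mu_t\rangle-\tfrac12\langle\bar Q_t\mu_t,\mu_t\rangle-\tfrac12\langle Q_tX_t,X_t\rangle-\langle\tilde Q_tX_t,\mu_t\rangle-\langle q_t,X_t\rangle-\tfrac12\langle R_t\lambda_t,\lambda_t\rangle-\langle S_tX_t,\lambda_t\rangle-\langle r_t,\lambda_t\rangle\big)dt\\&-\tfrac12\langle\bar H\mu_T,\mu_T\rangle-\tfrac12\langle HX_T,X_T\rangle-\langle\tilde HX_T,\mu_T\rangle\Big].\end{aligned}$$ Correlated flow: a pair $(\lambda,\mu)$ with $\lambda\in\mathbb H^2(\mathbb F)$ and $\mu$ an $\mathcal F_0$-measurable $\mathcal C([0,T];\mathbb R^d)$-valued random variable independent of $\xi$ and $W$. Mean field Nash equilibrium (NE): a pair $(\hat\alpha,\hat m)\in\mathbb H^2(\mathbb F^1)\times\mathcal C([0,T];\mathbb R^d)$ ($\hat m$ deterministic) such that $\mathfrak J(\hat\alpha,\hat m)=\max_{\beta\in\mathbb H^2(\mathbb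 F^1)}\mathfrak J(\beta,\hat m)$ and $\hat m_t=\mathbb E[X^{\hat\alpha}_t]$ for all $t$. It is part of the setting that there is a unique mean field NE, denoted $(\hat\alpha,\hat m)$. ODEs and coefficients. $\phi,\psi$ ($d\times d$-matrix valued) solve $$\dot\phi_t+\phi_tA_t+A_t^\top\phi_t+Q_t-(\phi_tB_t+S_t^\top)R_t^{-1}(B_t^\top\phi_t+S_t)=0,\ \phi_T=H,$$ $$\dot\psi_t+A_t^\top\psi_t+\tilde Q_t-(\phi_tB_t+S_t^\top)R_t^{-1}B_t^\top\psi_t=0,\ \psi_T=\tilde H,$$ and $\Phi_t=R_t^{-1}(B_t^\top\phi_t+S_t)$, $\Psi_t=R_t^{-1}B_t^\top\psi_t$, $M_t=Q_t+\Phi_t^\top R_t\Phi_t-2\Phi_t^\top S_t$, $N_t=\tilde Q_t+\Psi_t^\top R_t\Phi_t-\Psi_t^\top S_t$, $G_t=\Psi_t^\top R_t\Psi_t$. Class $\mathcal G$: all correlated flows $(\lambda,\mu)$ of the form $$\lambda_t=-R_t^{-1}\big((B_t^\top\phi_t+S_t)X_t+B_t^\top\psi_t\mu_t+\delta_t\big),\qquad \dot\mu_t=\big(A_t-B_tR_t^{-1}(B_t^\top\phi_t+S_t+B_t^\top\psi_t)\big)\mu_t-B_tR_t^{-1}\delta_t,\ \ \mu_0=\nu_1,$$ where $X=X^\lambda$ and $\delta\in\mathbb H^2(\mathcal F_0)$ is independent of $\xi$ and $W$. *)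

theory Defs
  imports "HOL-Probability.Probability"
begin

definition sym_mat :: "real^'n^'n \<Rightarrow> bool" where
  "sym_mat M \<longleftrightarrow> transpose M = M"

definition psd :: "real^'n^'n \<Rightarrow> bool" where
  "psd M \<longleftrightarrow> sym_mat M \<and> (\<forall>x. (M *v x) \<bullet> x \<ge> 0)"

definition loewner_le :: "real^'n^'n \<Rightarrow> real^'n^'n \<Rightarrow> bool" where
  "loewner_le M N \<longleftrightarrow> psd (N - M)"

text \<open>
  An element of \<open>L\<^sup>\<infinity>([0,T])\<close> is given by a Borel representative; every class has one.
  Pointwise conditions on such coefficients are accordingly read almost everywhere.
\<close>

definition L_infty :: "real \<Rightarrow> (real \<Rightarrow> 'b::euclidean_space) \<Rightarrow> bool" where
  "L_infty T f \<longleftrightarrow> set_borel_measurable borel {0..T} f \<and>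
     (\<exists>C. AE t in lborel. t \<in> {0..T} \<longrightarrow> norm (f t) \<le> C)"

text \<open>Matrices with \<open>m\<close> rows and \<open>n\<close> columns have type \<open>real^'n^'m\<close>.\<close>

record ('d, 'k, 'w) lq_model =
  horizon :: real
  cA :: "real \<Rightarrow> real^('d::finite)^'d"
  cB :: "real \<Rightarrow> real^('k::finite)^'d"
  cSigma :: "real \<Rightarrow> real^'d^'d"
  cQ :: "real \<Rightarrow> real^'d^'d"
  cQbar :: "real \<Rightarrow> real^'d^'d"
  cQtil :: "real \<Rightarrow> real^'d^'d"
  cR :: "real \<Rightarrow> real^'k^'k"
  cH :: "real^'d^'d"
  cHbar :: "real^'d^'d"
  cHtil :: "real^'d^'d"
  cS :: "real \<Rightarrow> real^'d^'k"
  cL :: "real \<Rightarrow> real^'d"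
  cq :: "real \<Rightarrow> real^'d"
  cr :: "real \<Rightarrow> real^'k"
  prb :: "'w measure"
  filt :: "real \<Rightarrow> 'w measure"
  bm :: "real \<Rightarrow> 'w \<Rightarrow> real^'d"
  xi :: "'w \<Rightarrow> real^'d"

abbreviation Rinv :: "('d::finite, 'k::finite, 'w) lq_model \<Rightarrow> real \<Rightarrow> real^'k^'k" where
  "Rinv D t \<equiv> matrix_inv (cR D t)"

abbreviation expect :: "('d::finite, 'k::finite, 'w) lq_model \<Rightarrow> ('w \<Rightarrow> 'b::{banach, second_countable_topology}) \<Rightarrow> 'b" where
  "expect D f \<equiv> integral\<^sup>L (prb D) f"

text \<open>
  The norm of \<open>S\<^sub>t\<close> is the operator norm. It is dominated by the Frobenius norm, so this is the
  least restrictive reading of the bound on \<open>S\<close>.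
\<close>

definition coefficient_assumptions :: "('d::finite, 'k::finite, 'w) lq_model \<Rightarrow> real \<Rightarrow> real \<Rightarrow> bool" where
  "coefficient_assumptions D d1 d2 \<longleftrightarrow>
     (let T = horizon D in
      T > 0 \<and>
      L_infty T (cA D) \<and> L_infty T (cSigma D) \<and> L_infty T (cB D) \<and>
      L_infty T (cQ D) \<and> L_infty T (cQbar D) \<and> L_infty T (cQtil D) \<and>
      L_infty T (cS D) \<and> L_infty T (cL D) \<and> L_infty T (cq D) \<and> L_infty T (cr D) \<and>
      (AE t in lborel. t \<in> {0..T} \<longrightarrow>
         sym_mat (cQ D t) \<and> sym_mat (cQbar D t) \<and> sym_mat (cQtil D t)) \<and>
      continuous_on {0..T} (cR D) \<and> (\<forall>t\<in>{0..T}. sym_mat (cR D t)) \<and>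
      psd (cH D) \<and> psd (cHbar D) \<and> psd (cHtil D) \<and>
      d1 \<ge> 0 \<and> d2 > 0 \<and>
      (AE t in lborel. t \<in> {0..T} \<longrightarrow> loewner_le (d1 *\<^sub>R mat 1) (cQ D t)) \<and>
      (\<forall>t\<in>{0..T}. loewner_le (d2 *\<^sub>R mat 1) (cR D t)) \<and>
      (d1 > 0 \<longrightarrow> (\<exists>c < d1 * d2. AE t in lborel. t \<in> {0..T} \<longrightarrow> (onorm ((*v) (cS D t)))\<^sup>2 \<le> c)) \<and>
      (d1 = 0 \<longrightarrow> (AE t in lborel. t \<in> {0..T} \<longrightarrow> cS D t = 0)))"

definition path_sigma :: "'w set \<Rightarrow> real set \<Rightarrow> (real \<Rightarrow> 'w \<Rightarrow> 'b::topological_space) \<Rightarrow> 'w set set" where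
  "path_sigma \<Omega> I Z = sigma_sets \<Omega> {Z t -` A \<inter> \<Omega> | t A. t \<in> I \<and> A \<in> sets borel}"

definition rv_sigma :: "'w set \<Rightarrow> ('w \<Rightarrow> 'b::topological_space) \<Rightarrow> 'w set set" where
  "rv_sigma \<Omega> X = {X -` A \<inter> \<Omega> | A. A \<in> sets borel}"

definition noise_sigma :: "('d::finite, 'k::finite, 'w) lq_model \<Rightarrow> 'w set set" where
  "noise_sigma D = sigma_sets (space (prb D))
     (rv_sigma (space (prb D)) (xi D) \<union> path_sigma (space (prb D)) {0..horizon D} (bm D))"

definition usual_filtered_space :: "real \<Rightarrow> 'w measure \<Rightarrow> (real \<Rightarrow> 'w measure) \<Rightarrow> bool" where
  "usual_filtered_space T M F \<longleftrightarrow>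
     prob_space M \<and> complete_measure M \<and>
     (\<forall>t\<in>{0..T}. subalgebra M (F t)) \<and>
     (\<forall>s\<in>{0..T}. \<forall>t\<in>{0..T}. s \<le> t \<longrightarrow> sets (F s) \<subseteq> sets (F t)) \<and>
     null_sets M \<subseteq> sets (F 0) \<and>
     (\<forall>t\<in>{0..<T}. sets (F t) = (\<Inter>s\<in>{t<..T}. sets (F s)))"

definition brownian_motion ::
  "real \<Rightarrow> 'w measure \<Rightarrow> (real \<Rightarrow> 'w measure) \<Rightarrow> (real \<Rightarrow> 'w \<Rightarrow> real^('d::finite)) \<Rightarrow> bool" where
  "brownian_motion T M F W \<longleftrightarrow>
     (\<forall>t\<in>{0..T}. W t \<in> borel_measurable (F t)) \<and>
     (AE \<omega> in M. W 0 \<omega> = 0 \<and> continuous_on {0..T} (\<lambda>t. W t \<omega>)) \<and>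
     (\<forall>s t. 0 \<le> s \<and> s < t \<and> t \<le> T \<longrightarrow>
        distributed M lborel (\<lambda>\<omega>. W t \<omega> - W s \<omega>)
          (\<lambda>x. ennreal (\<Prod>i\<in>UNIV. normal_density 0 (sqrt (t - s)) (x $ i))) \<and>
        prob_space.indep_set M (sets (F s)) (rv_sigma (space M) (\<lambda>\<omega>. W t \<omega> - W s \<omega>)))"

text \<open>
  The filtration generated by \<open>\<xi>\<close> and \<open>W\<close>, made complete and right-continuous on \<open>[0,T]\<close>.
  For \<open>t = T\<close> the index set of the intersection is \<open>{T}\<close>.
\<close>

definition raw_noise_filt :: "('d::finite, 'k::finite, 'w) lq_model \<Rightarrow> real \<Rightarrow> 'w set set" where
  "raw_noise_filt D t = sigma_sets (space (prb D))
     (rv_sigma (space (prb D)) (xi D) \<union> path_sigma (space (prb D)) {0..t} (bm D) \<union> null_sets (prb D))"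

definition filt1 :: "('d::finite, 'k::finite, 'w) lq_model \<Rightarrow> real \<Rightarrow> 'w measure" where
  "filt1 D t = sigma (space (prb D)) (\<Inter>s\<in>{t<..<horizon D} \<union> {horizon D}. raw_noise_filt D s)"

definition stochastic_assumptions :: "('d::finite, 'k::finite, 'w) lq_model \<Rightarrow> bool" where
  "stochastic_assumptions D \<longleftrightarrow>
     usual_filtered_space (horizon D) (prb D) (filt D) \<and>
     brownian_motion (horizon D) (prb D) (filt D) (bm D) \<and>
     xi D \<in> borel_measurable (filt D 0) \<and>
     prob_space.indep_set (prb D) (rv_sigma (space (prb D)) (xi D))
       (path_sigma (space (prb D)) {0..horizon D} (bm D)) \<and>
     integrable (prb D) (\<lambda>\<omega>. (norm (xi D \<omega>))\<^sup>2) \<and>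
     (\<exists>U :: 'w \<Rightarrow> real. U \<in> borel_measurable (filt D 0) \<and>
        distributed (prb D) lborel U (indicator {0..1}) \<and>
        prob_space.indep_set (prb D) (rv_sigma (space (prb D)) U) (noise_sigma D))"

definition prog_measurable ::
  "real \<Rightarrow> (real \<Rightarrow> 'w measure) \<Rightarrow> (real \<Rightarrow> 'w \<Rightarrow> 'b::topological_space) \<Rightarrow> bool" where
  "prog_measurable T G \<alpha> \<longleftrightarrow>
     (\<forall>t\<in>{0..T}. (\<lambda>(s, \<omega>). \<alpha> s \<omega>) \<in> borel_measurable (restrict_space borel {0..t} \<Otimes>\<^sub>M G t))"

definition H2 ::
  "('d::finite, 'k::finite, 'w) lq_model \<Rightarrow> (real \<Rightarrow> 'w measure) \<Rightarrow> (real \<Rightarrow> 'w \<Rightarrow> real^'k) set" where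
  "H2 D G = {\<alpha>. prog_measurable (horizon D) G \<alpha> \<and>
     (\<integral>\<^sup>+\<omega>. (\<integral>\<^sup>+t\<in>{0..horizon D}. ennreal ((norm (\<alpha> t \<omega>))\<^sup>2) \<partial>lborel) \<partial>prb D) < \<infinity>}"

text \<open>
  Since \<open>\<sigma>\<close> is deterministic, \<open>\<integral>\<sigma> dW\<close> only needs the stochastic integral of deterministic
  integrands: the \<open>L\<^sup>2\<close>-limit of the elementary integrals of step functions converging to \<open>\<sigma>\<close> in
  \<open>L\<^sup>2([0,T])\<close>. \<open>step_fun n p c\<close> takes the value \<open>c i\<close> on \<open>(p i, p (i+1)]\<close> for \<open>i < n\<close>.
\<close>

definition step_fun :: "nat \<Rightarrow> (nat \<Rightarrow> real) \<Rightarrow> (nat \<Rightarrow> real^'d^'d) \<Rightarrow> real \<Rightarrow> real^'d^'d" where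
  "step_fun n p c s = (\<Sum>i<n. indicator {p i<..p (Suc i)} s *\<^sub>R c i)"

definition step_integral ::
  "nat \<Rightarrow> (nat \<Rightarrow> real) \<Rightarrow> (nat \<Rightarrow> real^'d^'d) \<Rightarrow> (real \<Rightarrow> 'w \<Rightarrow> real^'d) \<Rightarrow> real \<Rightarrow> 'w \<Rightarrow> real^'d" where
  "step_integral n p c W t \<omega> = (\<Sum>i<n. c i *v (W (min t (p (Suc i))) \<omega> - W (min t (p i)) \<omega>))"

definition is_wiener_integral ::
  "real \<Rightarrow> 'w measure \<Rightarrow> (real \<Rightarrow> 'w \<Rightarrow> real^'d) \<Rightarrow> (real \<Rightarrow> real^'d^'d) \<Rightarrow> (real \<Rightarrow> 'w \<Rightarrow> real^'d) \<Rightarrow> bool" where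
  "is_wiener_integral T M W \<sigma> J \<longleftrightarrow>
     (\<forall>t\<in>{0..T}. J t \<in> borel_measurable M) \<and>
     (\<exists>n p c.
        (\<forall>j. (\<forall>i\<le>n j. p j i \<in> {0..T}) \<and> (\<forall>i<n j. p j i \<le> p j (Suc i))) \<and>
        (\<lambda>j. \<integral>\<^sup>+s\<in>{0..T}. ennreal ((norm (step_fun (n j) (p j) (c j) s - \<sigma> s))\<^sup>2) \<partial>lborel)
          \<longlonglongrightarrow> 0 \<and>
        (\<forall>t\<in>{0..T}.
           (\<lambda>j. \<integral>\<^sup>+\<omega>. ennreal ((norm (step_integral (n j) (p j) (c j) W t \<omega> - J t \<omega>))\<^sup>2) \<partial>M)
             \<longlonglongrightarrow> 0))"

definition is_state ::
  "('d::finite, 'k::finite, 'w) lq_model \<Rightarrow> (real \<Rightarrow> 'w \<Rightarrow> real^'k) \<Rightarrow> (real \<Rightarrow> 'w \<Rightarrow> real^'d) \<Rightarrow> bool" where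
  "is_state D lam X \<longleftrightarrow>
     (\<forall>\<omega>\<in>space (prb D). continuous_on {0..horizon D} (\<lambda>t. X t \<omega>)) \<and>
     (\<forall>t\<in>{0..horizon D}. X t \<in> borel_measurable (filt D t)) \<and>
     (\<exists>J. is_wiener_integral (horizon D) (prb D) (bm D) (cSigma D) J \<and>
        (AE \<omega> in prb D. \<forall>t\<in>{0..horizon D}.
           X t \<omega> = xi D \<omega> + (LBINT s:{0..t}. cA D s *v X s \<omega> + cB D s *v lam s \<omega>) + J t \<omega>))"

text \<open>For \<open>lam\<close> in \<open>H2\<close> a solution exists and is unique up to indistinguishability, so the choice does not matter.\<close>

definition state ::
  "('d::finite, 'k::finite, 'w) lq_model \<Rightarrow> (real \<Rightarrow> 'w \<Rightarrow> real^'k) \<Rightarrow> real \<Rightarrow> 'w \<Rightarrow> real^'d" where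
  "state D lam = (SOME X. is_state D lam X)"

definition payoff ::
  "('d::finite, 'k::finite, 'w) lq_model \<Rightarrow> (real \<Rightarrow> 'w \<Rightarrow> real^'k) \<Rightarrow> (real \<Rightarrow> 'w \<Rightarrow> real^'d) \<Rightarrow> real" where
  "payoff D lam \<mu> =
     (let T = horizon D; X = state D lam in
      expect D (\<lambda>\<omega>.
        (LBINT t:{0..T}.
            cL D t \<bullet> \<mu> t \<omega>
          - 1/2 * ((cQbar D t *v \<mu> t \<omega>) \<bullet> \<mu> t \<omega>)
          - 1/2 * ((cQ D t *v X t \<omega>) \<bullet> X t \<omega>)
          - (cQtil D t *v X t \<omega>) \<bullet> \<mu> t \<omega>
          - cq D t \<bullet> X t \<omega>
          - 1/2 * ((cR D t *v lam t \<omega>) \<bullet> lam t \<omega>)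
          - (cS D t *v X t \<omega>) \<bullet> lam t \<omega>
          - cr D t \<bullet> lam t \<omega>)
        - 1/2 * ((cHbar D *v \<mu> T \<omega>) \<bullet> \<mu> T \<omega>)
        - 1/2 * ((cH D *v X T \<omega>) \<bullet> X T \<omega>)
        - (cHtil D *v X T \<omega>) \<bullet> \<mu> T \<omega>))"

abbreviation payoff_det ::
  "('d::finite, 'k::finite, 'w) lq_model \<Rightarrow> (real \<Rightarrow> 'w \<Rightarrow> real^'k) \<Rightarrow> (real \<Rightarrow> real^'d) \<Rightarrow> real" where
  "payoff_det D lam m \<equiv> payoff D lam (\<lambda>t \<omega>. m t)"

text \<open>
  The Borel sets of \<open>C([0,T];\<real>\<^sup>d)\<close> are generated by the evaluations, so measurability and
  independence of the random path \<open>\<mu>\<close> are expressed through the values \<open>\<mu>\<^sub>t\<close>.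
\<close>

definition correlated_flow ::
  "('d::finite, 'k::finite, 'w) lq_model \<Rightarrow> (real \<Rightarrow> 'w \<Rightarrow> real^'k) \<Rightarrow> (real \<Rightarrow> 'w \<Rightarrow> real^'d) \<Rightarrow> bool" where
  "correlated_flow D lam \<mu> \<longleftrightarrow>
     lam \<in> H2 D (filt D) \<and>
     (\<forall>\<omega>\<in>space (prb D). continuous_on {0..horizon D} (\<lambda>t. \<mu> t \<omega>)) \<and>
     (\<forall>t\<in>{0..horizon D}. \<mu> t \<in> borel_measurable (filt D 0)) \<and>
     prob_space.indep_set (prb D) (path_sigma (space (prb D)) {0..horizon D} \<mu>) (noise_sigma D)"

definition mean_field_NE ::
  "('d::finite, 'k::finite, 'w) lq_model \<Rightarrow> (real \<Rightarrow> 'w \<Rightarrow> real^'k) \<Rightarrow> (real \<Rightarrow> real^'d) \<Rightarrow> bool" where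
  "mean_field_NE D \<alpha> m \<longleftrightarrow>
     \<alpha> \<in> H2 D (filt1 D) \<and> continuous_on {0..horizon D} m \<and>
     (\<forall>\<beta>\<in>H2 D (filt1 D). payoff_det D \<beta> m \<le> payoff_det D \<alpha> m) \<and>
     (\<forall>t\<in>{0..horizon D}. m t = expect D (state D \<alpha> t))"

definition unique_mean_field_NE ::
  "('d::finite, 'k::finite, 'w) lq_model \<Rightarrow> (real \<Rightarrow> 'w \<Rightarrow> real^'k) \<Rightarrow> (real \<Rightarrow> real^'d) \<Rightarrow> bool" where
  "unique_mean_field_NE D \<alpha> m \<longleftrightarrow>
     mean_field_NE D \<alpha> m \<and>
     (\<forall>\<alpha>' m'. mean_field_NE D \<alpha>' m' \<longrightarrow>
        (\<forall>t\<in>{0..horizon D}. m' t = m t) \<and>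
        (AE \<omega> in prb D. AE t in lborel. t \<in> {0..horizon D} \<longrightarrow> \<alpha>' t \<omega> = \<alpha> t \<omega>))"

definition phi_solution :: "('d::finite, 'k::finite, 'w) lq_model \<Rightarrow> (real \<Rightarrow> real^'d^'d) \<Rightarrow> bool" where
  "phi_solution D \<phi> \<longleftrightarrow>
     continuous_on {0..horizon D} \<phi> \<and>
     (\<forall>t\<in>{0..horizon D}. \<phi> t = cH D + (LBINT s:{t..horizon D}.
        \<phi> s ** cA D s + transpose (cA D s) ** \<phi> s + cQ D s
        - (\<phi> s ** cB D s + transpose (cS D s)) ** Rinv D s ** (transpose (cB D s) ** \<phi> s + cS D s)))"

definition psi_solution ::
  "('d::finite, 'k::finite, 'w) lq_model \<Rightarrow> (real \<Rightarrow> real^'d^'d) \<Rightarrow> (real \<Rightarrow> real^'d^'d) \<Rightarrow> bool" where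
  "psi_solution D \<phi> \<psi> \<longleftrightarrow>
     continuous_on {0..horizon D} \<psi> \<and>
     (\<forall>t\<in>{0..horizon D}. \<psi> t = cHtil D + (LBINT s:{t..horizon D}.
        transpose (cA D s) ** \<psi> s + cQtil D s
        - (\<phi> s ** cB D s + transpose (cS D s)) ** Rinv D s ** transpose (cB D s) ** \<psi> s))"

text \<open>\<open>dm\<close> is the almost-everywhere derivative of the absolutely continuous function \<open>m\<close>.\<close>

definition ac_derivative :: "real \<Rightarrow> (real \<Rightarrow> real^'d) \<Rightarrow> (real \<Rightarrow> real^'d) \<Rightarrow> bool" where
  "ac_derivative T m dm \<longleftrightarrow>
     set_integrable lborel {0..T} dm \<and> (\<forall>t\<in>{0..T}. m t = m 0 + (LBINT s:{0..t}. dm s))"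

definition theta_solution ::
  "('d::finite, 'k::finite, 'w) lq_model \<Rightarrow> (real \<Rightarrow> real^'d^'d) \<Rightarrow> (real \<Rightarrow> real^'d^'d)
     \<Rightarrow> (real \<Rightarrow> real^'d) \<Rightarrow> (real \<Rightarrow> real^'d) \<Rightarrow> bool" where
  "theta_solution D \<phi> \<psi> m \<theta> \<longleftrightarrow>
     continuous_on {0..horizon D} \<theta> \<and>
     (\<exists>dm. ac_derivative (horizon D) m dm \<and>
       (\<forall>t\<in>{0..horizon D}. \<theta> t = (LBINT s:{t..horizon D}.
          \<psi> s *v dm s + transpose (cA D s) *v \<theta> s + cq D s
          - ((\<phi> s ** cB D s + transpose (cS D s)) ** Rinv D s) *v (transpose (cB D s) *v \<theta> s + cr D s))))"

definition Phi_coef :: "('d::finite, 'k::finite, 'w) lq_model \<Rightarrow> (real \<Rightarrow> real^'d^'d) \<Rightarrow> real \<Rightarrow> real^'d^'k" where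
  "Phi_coef D \<phi> t = Rinv D t ** (transpose (cB D t) ** \<phi> t + cS D t)"

definition Psi_coef :: "('d::finite, 'k::finite, 'w) lq_model \<Rightarrow> (real \<Rightarrow> real^'d^'d) \<Rightarrow> real \<Rightarrow> real^'d^'k" where
  "Psi_coef D \<psi> t = Rinv D t ** transpose (cB D t) ** \<psi> t"

definition Theta_coef :: "('d::finite, 'k::finite, 'w) lq_model \<Rightarrow> (real \<Rightarrow> real^'d) \<Rightarrow> real \<Rightarrow> real^'k" where
  "Theta_coef D \<theta> t = Rinv D t *v (transpose (cB D t) *v \<theta> t + cr D t)"

definition M_coef :: "('d::finite, 'k::finite, 'w) lq_model \<Rightarrow> (real \<Rightarrow> real^'d^'d) \<Rightarrow> real \<Rightarrow> real^'d^'d" where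
  "M_coef D \<phi> t = cQ D t + transpose (Phi_coef D \<phi> t) ** cR D t ** Phi_coef D \<phi> t
     - 2 *\<^sub>R (transpose (Phi_coef D \<phi> t) ** cS D t)"

definition N_coef ::
  "('d::finite, 'k::finite, 'w) lq_model \<Rightarrow> (real \<Rightarrow> real^'d^'d) \<Rightarrow> (real \<Rightarrow> real^'d^'d) \<Rightarrow> real \<Rightarrow> real^'d^'d" where
  "N_coef D \<phi> \<psi> t = cQtil D t + transpose (Psi_coef D \<psi> t) ** cR D t ** Phi_coef D \<phi> t
     - transpose (Psi_coef D \<psi> t) ** cS D t"

definition G_coef :: "('d::finite, 'k::finite, 'w) lq_model \<Rightarrow> (real \<Rightarrow> real^'d^'d) \<Rightarrow> real \<Rightarrow> real^'d^'d" where
  "G_coef D \<psi> t = transpose (Psi_coef D \<psi> t) ** cR D t ** Psi_coef D \<psi> t"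

definition in_class_G ::
  "('d::finite, 'k::finite, 'w) lq_model \<Rightarrow> (real \<Rightarrow> real^'d^'d) \<Rightarrow> (real \<Rightarrow> real^'d^'d)
     \<Rightarrow> (real \<Rightarrow> 'w \<Rightarrow> real^'k) \<Rightarrow> (real \<Rightarrow> 'w \<Rightarrow> real^'k) \<Rightarrow> (real \<Rightarrow> 'w \<Rightarrow> real^'d) \<Rightarrow> bool" where
  "in_class_G D \<phi> \<psi> \<delta> lam \<mu> \<longleftrightarrow>
     correlated_flow D lam \<mu> \<and>
     \<delta> \<in> H2 D (\<lambda>_. filt D 0) \<and>
     prob_space.indep_set (prb D) (path_sigma (space (prb D)) {0..horizon D} \<delta>) (noise_sigma D) \<and>
     (\<exists>X. is_state D lam X \<and>
        (AE \<omega> in prb D. AE t in lborel. t \<in> {0..horizon D} \<longrightarrow>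
           lam t \<omega> = - (Rinv D t *v
             ((transpose (cB D t) ** \<phi> t + cS D t) *v X t \<omega>
              + (transpose (cB D t) ** \<psi> t) *v \<mu> t \<omega> + \<delta> t \<omega>)))) \<and>
     (AE \<omega> in prb D. \<forall>t\<in>{0..horizon D}.
        \<mu> t \<omega> = expect D (xi D) + (LBINT s:{0..t}.
          (cA D s - cB D s ** Rinv D s **
             (transpose (cB D s) ** \<phi> s + cS D s + transpose (cB D s) ** \<psi> s)) *v \<mu> s \<omega>
          - (cB D s ** Rinv D s) *v \<delta> s \<omega>))"

end

theory Submission
  imports Defs
begin

text \<open>
  The two payoffs differ by exactly the displayed expression.

  Completing the dynamics with the feedback gain \<open>\<Phi>\<close> shows that \<open>Z = X - \<mu>\<close> solves
  \<open>dZ = (A - B \<Phi>) Z dt + \<sigma> dW\<close>, \<open>Z\<^sub>0 = \<xi> - E \<xi>\<close>. The equilibrium control is the feedback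
  \<open>- (\<Phi> X + \<Psi> m + \<Theta>)\<close>, so the equilibrium deviation \<open>X - m\<close> solves the same equation and the two
  deviations coincide. They are centred and measurable with respect to \<open>(\<xi>, W)\<close>, hence orthogonal to
  \<open>\<mu>\<close> and \<open>\<delta>\<close>. Writing \<open>X = Z + \<mu>\<close>, the mixed terms of the payoff vanish in expectation, the terms
  in \<open>Z\<close> cancel, and only the terms in \<open>(\<mu>, \<delta>)\<close> and \<open>(m, \<Theta>)\<close> remain.

  The feedback form is a first-order condition. With \<open>\<epsilon>\<close> the deviation of the equilibrium control from
  the feedback, the control is perturbed by \<open>\<eta> = \<epsilon> - K x\<close>, where \<open>x\<close> is the induced perturbation of the
  state; testing the adjoint process \<open>\<phi> X + \<psi> m + \<theta>\<close> against \<open>x\<close> turns the derivative of the payoff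
  into \<open>- E \<integral> \<langle>R \<epsilon>, \<epsilon>\<rangle>\<close>. Since \<open>x\<close> is absolutely continuous, Ito's formula is not needed: for
  \<open>y = \<integral> y' dt\<close> adapted and the martingale \<open>J = \<integral> \<sigma> dW\<close>, \<open>E \<langle>J\<^sub>T, y\<^sub>T\<rangle> = E \<integral> \<langle>J\<^sub>t, y'\<^sub>t\<rangle> dt\<close>.
\<close>

section \<open>Matrices and bounded coefficients\<close>

text \<open>All Wiener integrals stem from a single source: the class G flow comes with a state,
  hence with one process J, and every other state is that one plus the solution of a linear Volterra
  equation driven by the difference of the controls. As the Wiener integral is unique up to null
  sets, all states carry the same noise path, and this is what makes the two deviations comparable
  path by path. Volterra equations are solved by Picard series, since the partial sums also show
  adaptedness, to \<open>filt D\<close> as well as to the smaller \<open>filt1 D\<close>. The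
  smaller filtration matters twice: the equilibrium is optimal among \<open>filt1 D\<close> controls
  only, so the perturbation has to be adapted to it; and independence of the pair
  (\<open>xi D\<close>, \<open>bm D\<close>) has to be carried over to the completed sigma-algebra
  \<open>filt1 D\<close> at the horizon, where the deviation is measurable. The coefficients are
  merely bounded and measurable, so every derivative is read in integrated form, and the product
  rule comes from Fubini on a square. The payoff is kept as an integral over the product of time and
  probability space, on which almost-everywhere identities of the controls can be inserted.\<close>

lemma bounded_bilinear_mv: "bounded_bilinear (\<lambda>(M::real^'n^'m) v. M *v v)"
  by (subst bilinear_conv_bounded_bilinear[symmetric])
     (auto simp: bilinear_def intro!: linearI simp: matrix_vector_mult_add_rdistrib
        matrix_vector_right_distrib scaleR_matrix_vector_assoc matrix_vector_mult_scaleR)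

lemma matrix_add_rdistrib: "((A::real^'n^'m) + B) ** (C::real^'p^'n) = A ** C + B ** C"
  by (vector matrix_matrix_mult_def sum.distrib[symmetric] field_simps)

lemma bounded_bilinear_mm: "bounded_bilinear (\<lambda>(M::real^'n^'m) (N::real^'p^'n). M ** N)"
  by (subst bilinear_conv_bounded_bilinear[symmetric])
     (auto simp: bilinear_def intro!: linearI simp: matrix_add_ldistrib matrix_add_rdistrib
       scalar_matrix_assoc matrix_scalar_ac)

lemma transpose_add: "transpose (A + B) = transpose A + transpose (B::real^'n^'m)"
  by (simp add: transpose_def vec_eq_iff)

lemma bounded_linear_transpose: "bounded_linear (transpose :: real^'n^'m \<Rightarrow> real^'m^'n)"
  by (rule linear_conv_bounded_linear[THEN iffD1]) (auto intro!: linearI simp: transpose_add transpose_scalar)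

text \<open>Cauchy-Schwarz in each row. The norm of the type \<open>real^'n^'m\<close> is the
  Frobenius norm, which dominates the operator norm.\<close>

lemma norm_matrix_vector_mult_le: "norm ((M::real^'n^'m) *v x) \<le> norm M * norm x"
proof -
  have "(norm (M *v x))\<^sup>2 = (\<Sum>i\<in>UNIV. ((M $ i) \<bullet> x)\<^sup>2)"
    unfolding power2_norm_eq_inner by (simp add: inner_vec_def matrix_vector_mult_def power2_eq_square)
  also have "\<dots> \<le> (\<Sum>i\<in>UNIV. (M $ i) \<bullet> (M $ i) * (x \<bullet> x))"
    by (intro sum_mono) (rule Cauchy_Schwarz_ineq)
  also have "\<dots> = (norm M * norm x)\<^sup>2"
    unfolding power_mult_distrib power2_norm_eq_inner by (simp add: inner_vec_def sum_distrib_right)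
  finally show ?thesis by (rule power2_le_imp_le) simp
qed

lemma matrix_inv_invertible:
  assumes "invertible (A::real^'n^'n)"
  shows "A ** matrix_inv A = mat 1" "matrix_inv A ** A = mat 1"
  using assms someI_ex[of "\<lambda>A'. A ** A' = mat 1 \<and> A' ** A = mat 1"]
  unfolding invertible_def matrix_inv_def by auto

lemma matrix_inv_mult_vec:
  assumes "invertible (A::real^'n^'n)"
  shows "A *v (matrix_inv A *v x) = x" "matrix_inv A *v (A *v x) = x"
  using assms by (auto simp: matrix_vector_mul_assoc matrix_inv_invertible)

text \<open>Coercivity makes the kernel trivial, which for a square matrix is invertibility.\<close>

lemma invertible_if_coercive:
  assumes c: "c > 0" and A: "\<And>x. c * (x \<bullet> x) \<le> (A *v x) \<bullet> (x::real^'n)"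
  shows "invertible A"
proof -
  have "x = 0" if "A *v x = 0" for x
    using A[of x] c that by (auto simp: mult_le_0_iff not_less dest: order_antisym[OF _ inner_ge_zero]) 
  then show ?thesis
    unfolding invertible_left_inverse matrix_left_invertible_ker by auto
qed

text \<open>Coercivity at the preimage x of y gives c |x|^2 \<le> y . x \<le> |y| |x|.\<close>

lemma norm_matrix_inv_vec_le:
  assumes c: "c > 0" and A: "\<And>x. c * (x \<bullet> x) \<le> (A *v x) \<bullet> (x::real^'n)"
  shows "norm (matrix_inv A *v y) \<le> norm y / c"
proof (cases "matrix_inv A *v y = 0")
  case False
  let ?x = "matrix_inv A *v y"
  have "c * (norm ?x)\<^sup>2 \<le> y \<bullet> ?x"
    using A[of ?x] matrix_inv_mult_vec(1)[OF invertible_if_coercive[OF c A], of y]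
    by (simp add: power2_norm_eq_inner)
  also have "\<dots> \<le> norm y * norm ?x" by (rule norm_cauchy_schwarz)
  finally have "c * norm ?x \<le> norm y" using False by (simp add: power2_eq_square)
  then show ?thesis using c by (simp add: field_simps)
qed (use c in simp)

text \<open>The way back from the operator norm to the Frobenius norm: columns are images of unit
  vectors, and the Frobenius norm is at most the sum of the column norms, whence the factor
  \<open>CARD('n)\<close>.\<close>

lemma norm_matrix_le_if_vec_le:
  assumes "\<And>x. norm ((A::real^'n^'m) *v x) \<le> c * norm x"
  shows "norm A \<le> real CARD('n) * c"
proof -
  have "norm A = norm (transpose A)"
    by (simp add: norm_eq_sqrt_inner inner_vec_def transpose_def) (subst sum.swap, rule refl)
  also have "\<dots> \<le> (\<Sum>i\<in>UNIV. norm (transpose A $ i))"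
    unfolding norm_vec_def by (rule L2_set_le_sum) simp
  also have "\<dots> \<le> (\<Sum>(i::'n)\<in>UNIV. c)"
  proof (rule sum_mono)
    fix i :: 'n
    have "transpose A $ i = A *v axis i 1"
      by (simp add: matrix_vector_mult_basis column_def transpose_def vec_eq_iff)
    then show "norm (transpose A $ i) \<le> c" using assms[of "axis i 1"] by simp
  qed
  finally show ?thesis by simp
qed

text \<open>By the resolvent identity, the difference of the inverses at t and s is the product of
  the inverse at t, R(s) - R(t) and the inverse at s. Coercivity bounds both inverses by 1/c, so the
  inverse is Lipschitz in R.\<close>

lemma continuous_on_matrix_inv:
  fixes R :: "real \<Rightarrow> real^'n^'n"
  assumes c: "c > 0" and R: "continuous_on S R"
    and A: "\<And>t x. t \<in> S \<Longrightarrow> c * (x \<bullet> x) \<le> (R t *v x) \<bullet> x"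
  shows "continuous_on S (\<lambda>t. matrix_inv (R t))"
proof -
  let ?I = "\<lambda>t. matrix_inv (R t)"
  let ?N = "real CARD('n)"
  have inv: "invertible (R t)" if "t \<in> S" for t using invertible_if_coercive[OF c A[OF that]] .
  have diff: "?I t - ?I s = ?I t ** (R s - R t) ** ?I s" if "t \<in> S" "s \<in> S" for s t
  proof -
    have "?I t ** (R s - R t) ** ?I s = ?I t ** (R s ** ?I s) - (?I t ** R t) ** ?I s"
      unfolding bounded_bilinear.diff_left[OF bounded_bilinear_mm]
        bounded_bilinear.diff_right[OF bounded_bilinear_mm] matrix_mul_assoc ..
    then show ?thesis
      using matrix_inv_invertible[OF inv[OF that(1)]] matrix_inv_invertible[OF inv[OF that(2)]] by simp
  qed
  have bnd: "norm (?I t - ?I s) \<le> ?N * (1/c * (1/c)) * norm (R t - R s)" if "t \<in> S" "s \<in> S" for s t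
  proof -
    have "norm ((?I t - ?I s) *v x) \<le> 1/c * (norm (R t - R s) * (1/c)) * norm x" for x
    proof -
      have "norm ((?I t - ?I s) *v x) = norm (?I t *v ((R s - R t) *v (?I s *v x)))"
        by (simp only: diff[OF that] matrix_vector_mul_assoc matrix_mul_assoc)
      also have "\<dots> \<le> norm ((R s - R t) *v (?I s *v x)) / c"
        by (rule norm_matrix_inv_vec_le[OF c A[OF that(1)]])
      also have "\<dots> \<le> norm (R s - R t) * norm (?I s *v x) / c"
        using c by (intro divide_right_mono norm_matrix_vector_mult_le) simp
      also have "\<dots> \<le> norm (R s - R t) * (norm x / c) / c"
        using c norm_matrix_inv_vec_le[OF c A[OF that(2)]] by (intro divide_right_mono mult_left_mono) auto
      finally show ?thesis using c by (simp add: norm_minus_commute)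
    qed
    from norm_matrix_le_if_vec_le[OF this] show ?thesis by (simp add: mult_ac)
  qed
  show ?thesis unfolding continuous_on_def
  proof
    fix s assume s: "s \<in> S"
    have "((\<lambda>t. norm (R t - R s)) \<longlongrightarrow> 0) (at s within S)"
      using R s unfolding continuous_on_def by (intro tendsto_norm_zero LIM_zero) auto
    then have "((\<lambda>t. ?N * (1/c * (1/c)) * norm (R t - R s)) \<longlongrightarrow> 0) (at s within S)"
      by (rule tendsto_mult_right_zero)
    moreover have "\<forall>\<^sub>F t in at s within S. norm (?I t - ?I s) \<le> ?N * (1/c * (1/c)) * norm (R t - R s)"
      unfolding eventually_at_filter by (intro always_eventually allI impI bnd s)
    ultimately have "((\<lambda>t. ?I t - ?I s) \<longlongrightarrow> 0) (at s within S)"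
      by (rule Lim_null_comparison[rotated])
    then show "(?I \<longlongrightarrow> ?I s) (at s within S)" by (rule LIM_zero_cancel)
  qed
qed

section \<open>Essentially bounded coefficients and their closure under products\<close>

lemma set_borel_measurable_iff_restrict:
  fixes f :: "real \<Rightarrow> 'b::euclidean_space"
  shows "set_borel_measurable borel {0..T} f \<longleftrightarrow> f \<in> borel_measurable (restrict_space borel {0..T})"
  unfolding set_borel_measurable_def by (subst borel_measurable_restrict_space_iff) auto

lemma set_borel_measurable_continuous:
  fixes f :: "real \<Rightarrow> 'b::euclidean_space"
  shows "continuous_on {0..T} f \<Longrightarrow> set_borel_measurable borel {0..T} f"
  unfolding set_borel_measurable_iff_restrict by (rule borel_measurable_continuous_on_restrict)

lemma L_infty_continuous:
  fixes f :: "real \<Rightarrow> 'b::euclidean_space"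
  assumes "continuous_on {0..T} f" shows "L_infty T f"
proof -
  have "bounded (f ` {0..T})" using assms compact_continuous_image compact_imp_bounded by blast
  then obtain C where "\<forall>t\<in>{0..T}. norm (f t) \<le> C" unfolding bounded_iff by auto
  then show ?thesis unfolding L_infty_def
    using set_borel_measurable_continuous[OF assms] by (auto intro!: exI[of _ C])
qed

text \<open>Serves matrix-vector products, matrix products and scalar multiples at once:
  measurability comes from continuity of \<open>p\<close> on pairs, the bound from the boundedness
  constant of \<open>p\<close>.\<close>

lemma L_infty_bilinear:
  fixes f :: "real \<Rightarrow> 'a::euclidean_space" and g :: "real \<Rightarrow> 'b::euclidean_space"
    and p :: "'a \<Rightarrow> 'b \<Rightarrow> 'c::euclidean_space"
  assumes p: "bounded_bilinear p" and f: "L_infty T f" and g: "L_infty T g"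
  shows "L_infty T (\<lambda>t. p (f t) (g t))"
proof -
  interpret bounded_bilinear p by fact
  obtain C where C: "AE t in lborel. t \<in> {0..T} \<longrightarrow> norm (f t) \<le> C" using f unfolding L_infty_def by auto
  obtain E where E: "AE t in lborel. t \<in> {0..T} \<longrightarrow> norm (g t) \<le> E" using g unfolding L_infty_def by auto
  obtain K where K: "K \<ge> 0" "\<And>a b. norm (p a b) \<le> norm a * norm b * K" using nonneg_bounded by auto
  have fm: "f \<in> borel_measurable (restrict_space borel {0..T})"
   and gm: "g \<in> borel_measurable (restrict_space borel {0..T})"
    using f g unfolding L_infty_def set_borel_measurable_iff_restrict by auto
  have "continuous_on UNIV (\<lambda>z. p (fst z) (snd z))"
    by (auto intro!: continuous_on continuous_intros)
  from borel_measurable_continuous_Pair[OF fm gm this]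
  have "(\<lambda>t. p (f t) (g t)) \<in> borel_measurable (restrict_space borel {0..T})" by simp
  moreover have "AE t in lborel. t \<in> {0..T} \<longrightarrow> norm (p (f t) (g t)) \<le> max 0 C * max 0 E * K"
    using C E
  proof eventually_elim
    case (elim t)
    show ?case
    proof
      assume "t \<in> {0..T}"
      then have "norm (f t) * norm (g t) * K \<le> max 0 C * max 0 E * K"
        using elim K(1) by (intro mult_right_mono mult_mono) auto
      then show "norm (p (f t) (g t)) \<le> max 0 C * max 0 E * K" using K(2) order_trans by blast
    qed
  qed
  ultimately show ?thesis unfolding L_infty_def set_borel_measurable_iff_restrict by blast
qed

text \<open>A linear map is the bilinear map sending x and r to r p(x), taken at the constant r =
  1.\<close>

lemma L_infty_linear:
  fixes f :: "real \<Rightarrow> 'a::euclidean_space" and p :: "'a \<Rightarrow> 'c::euclidean_space"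
  assumes p: "bounded_linear p" and f: "L_infty T f"
  shows "L_infty T (\<lambda>t. p (f t))"
proof -
  have "bounded_bilinear (\<lambda>x (r::real). r *\<^sub>R p x)"
    using bounded_bilinear.comp1[OF bounded_bilinear.flip[OF bounded_bilinear_scaleR] p] .
  from L_infty_bilinear[OF this f L_infty_continuous[OF continuous_on_const[of _ 1]]] show ?thesis by simp
qed

lemma L_infty_add:
  fixes f :: "real \<Rightarrow> 'a::euclidean_space"
  assumes f: "L_infty T f" and g: "L_infty T g"
  shows "L_infty T (\<lambda>t. f t + g t)"
proof -
  obtain C where C: "AE t in lborel. t \<in> {0..T} \<longrightarrow> norm (f t) \<le> C" using f unfolding L_infty_def by auto
  obtain E where E: "AE t in lborel. t \<in> {0..T} \<longrightarrow> norm (g t) \<le> E" using g unfolding L_infty_def by auto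
  have "AE t in lborel. t \<in> {0..T} \<longrightarrow> norm (f t + g t) \<le> C + E"
    using C E by eventually_elim (auto intro: order_trans[OF norm_triangle_ineq] add_mono)
  then show ?thesis using f g unfolding L_infty_def set_borel_measurable_iff_restrict by auto
qed

lemmas L_infty_mv = L_infty_bilinear[OF bounded_bilinear_mv]
lemmas L_infty_mm = L_infty_bilinear[OF bounded_bilinear_mm]
lemmas L_infty_transpose = L_infty_linear[OF bounded_linear_transpose]
lemmas L_infty_minus = L_infty_linear[OF bounded_linear_minus[OF bounded_linear_ident]]
lemmas L_infty_scaleR = L_infty_linear[OF bounded_linear_scaleR_right]

lemma L_infty_diff:
  fixes f :: "real \<Rightarrow> 'a::euclidean_space"
  assumes f: "L_infty T f" and g: "L_infty T g"
  shows "L_infty T (\<lambda>t. f t - g t)"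
  using L_infty_add[OF f L_infty_minus[OF g]] by simp

text \<open>Only one factor is essentially bounded here. The other is merely integrable, as is the
  derivative of the equilibrium mean in the equation of \<theta>.\<close>

lemma set_integrable_L_infty_bilinear:
  fixes f :: "real \<Rightarrow> 'a::euclidean_space" and g :: "real \<Rightarrow> 'b::euclidean_space"
    and p :: "'a \<Rightarrow> 'b \<Rightarrow> 'c::euclidean_space"
  assumes p: "bounded_bilinear p" and f: "L_infty T f" and g: "set_integrable lborel {0..T} g"
  shows "set_integrable lborel {0..T} (\<lambda>t. p (f t) (g t))"
proof -
  interpret bounded_bilinear p by fact
  obtain C where C: "AE t in lborel. t \<in> {0..T} \<longrightarrow> norm (f t) \<le> C" using f unfolding L_infty_def by auto
  obtain K where K: "K \<ge> 0" "\<And>a b. norm (p a b) \<le> norm a * norm b * K" using nonneg_bounded by auto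
  have fm: "f \<in> borel_measurable (restrict_space borel {0..T})"
    using f unfolding L_infty_def set_borel_measurable_iff_restrict by auto
  have gm: "g \<in> borel_measurable (restrict_space borel {0..T})"
    using borel_measurable_integrable[OF g[unfolded set_integrable_def]]
    unfolding set_borel_measurable_iff_restrict[symmetric] set_borel_measurable_def by simp
  have "continuous_on UNIV (\<lambda>z. p (fst z) (snd z))"
    by (auto intro!: continuous_on continuous_intros)
  from borel_measurable_continuous_Pair[OF fm gm this]
  have m: "set_borel_measurable lborel {0..T} (\<lambda>t. p (f t) (g t))"
    unfolding set_borel_measurable_iff_restrict[symmetric] set_borel_measurable_def by simp
  have "set_integrable lborel {0..T} (\<lambda>t. (max 0 C * K) *\<^sub>R g t)" using g by simp
  moreover have "AE t in lborel. t \<in> {0..T} \<longrightarrow> norm (p (f t) (g t)) \<le> norm ((max 0 C * K) *\<^sub>R g t)"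
    using C
  proof eventually_elim
    case (elim t)
    show ?case
    proof
      assume "t \<in> {0..T}"
      then have "norm (f t) * norm (g t) * K \<le> max 0 C * norm (g t) * K"
        using elim K(1) by (intro mult_right_mono mult_mono) auto
      then show "norm (p (f t) (g t)) \<le> norm ((max 0 C * K) *\<^sub>R g t)"
        using K(1) order_trans[OF K(2)] by (simp add: mult_ac)
    qed
  qed
  ultimately show ?thesis using set_integrable_bound[OF _ m] by blast
qed

lemma set_integrable_continuous:
  fixes f :: "real \<Rightarrow> 'a::euclidean_space"
  shows "continuous_on {a..b} f \<Longrightarrow> set_integrable lborel {a..b} f"
  unfolding set_integrable_def using borel_integrable_compact[of "{a..b}" f] 
  by simp

lemma set_integrable_L_infty:
  fixes f :: "real \<Rightarrow> 'a::euclidean_space"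
  assumes "L_infty T f" shows "set_integrable lborel {0..T} f"
  using set_integrable_L_infty_bilinear[OF bounded_bilinear.flip[OF bounded_bilinear_scaleR] assms
      set_integrable_continuous[OF continuous_on_const[of _ "1::real"]]] by simp

lemma continuous_on_set_integral:
  fixes f :: "real \<Rightarrow> 'a::euclidean_space"
  assumes f: "set_integrable lborel {0..T} f"
  shows "continuous_on {0..T} (\<lambda>t. LBINT s:{0..t}. f s)"
proof -
  have "(LBINT s:{0..t}. f s) = integral {0..t} f" if "t \<in> {0..T}" for t
    using set_borel_integral_eq_integral(2)[OF set_integrable_subset[OF f, of "{0..t}"]] that by auto
  then show ?thesis
    using indefinite_integral_continuous_1[OF set_borel_integral_eq_integral(1)[OF f]]
    by (subst continuous_on_cong[OF refl, of _ _ "\<lambda>t. integral {0..t} f"]) auto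
qed

section \<open>Absolutely continuous functions and linear Volterra equations\<close>

text \<open>Absolute continuity in the form in which the equations are given: \<open>a\<close> is a
  derivative almost everywhere, known through its integrals. The type is general, so that the
  matrices \<phi> and \<psi> are covered besides the vectors of
  \<open>ac_derivative\<close>.\<close>

definition ac_deriv :: "real \<Rightarrow> (real \<Rightarrow> 'a::euclidean_space) \<Rightarrow> (real \<Rightarrow> 'a) \<Rightarrow> bool" where
  "ac_deriv T x a \<longleftrightarrow>
     set_integrable lborel {0..T} a \<and> (\<forall>t\<in>{0..T}. x t = x 0 + (LBINT s:{0..t}. a s))"

lemma ac_derivD: "ac_deriv T x a \<Longrightarrow> t \<in> {0..T} \<Longrightarrow> x t = x 0 + (LBINT s:{0..t}. a s)"
  and ac_deriv_integrable: "ac_deriv T x a \<Longrightarrow> set_integrable lborel {0..T} a"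
  unfolding ac_deriv_def by blast+

text \<open>Dominated by a constant times |a(s)| |b(u)|, which is integrable on the plane by Fubini.
  It justifies exchanging the order of integration in the product rule.\<close>

lemma integrable_bilinear_product:
  fixes a :: "real \<Rightarrow> 'a::euclidean_space" and b :: "real \<Rightarrow> 'b::euclidean_space"
    and p :: "'a \<Rightarrow> 'b \<Rightarrow> 'c::euclidean_space"
  assumes p: "bounded_bilinear p" and a: "integrable lborel a" and b: "integrable lborel b"
  shows "integrable (lborel \<Otimes>\<^sub>M lborel) (\<lambda>(s, u). p (a s) (b u))"
proof -
  interpret bounded_bilinear p by fact
  obtain K where K: "K \<ge> 0" "\<And>a b. norm (p a b) \<le> norm a * norm b * K" using nonneg_bounded by auto
  have c: "continuous_on UNIV (\<lambda>z. p (fst z) (snd z))"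
    by (auto intro!: continuous_on continuous_intros)
  have [measurable]: "a \<in> borel_measurable borel" "b \<in> borel_measurable borel" using a b by auto
  have am: "(\<lambda>z::real\<times>real. a (fst z)) \<in> borel_measurable (lborel \<Otimes>\<^sub>M lborel)"
   and bm: "(\<lambda>z::real\<times>real. b (snd z)) \<in> borel_measurable (lborel \<Otimes>\<^sub>M lborel)" by measurable
  have ab: "integrable (lborel \<Otimes>\<^sub>M lborel) (\<lambda>z. (norm (a (fst z)) * norm (b (snd z))) * K)"
  proof (rule lborel_pair.Fubini_integrable)
    show "(\<lambda>z. (norm (a (fst z)) * norm (b (snd z))) * K) \<in> borel_measurable (lborel \<Otimes>\<^sub>M lborel)"
      by (intro borel_measurable_times measurable_compose[OF am borel_measurable_norm] measurable_compose[OF bm borel_measurable_norm] borel_measurable_const)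
    have na: "integrable lborel (\<lambda>x. norm (a x))" and nb: "integrable lborel (\<lambda>x. norm (b x))"
      using a b by auto
    then show "integrable lborel (\<lambda>x. \<integral>y. norm (norm (a (fst (x, y))) * norm (b (snd (x, y))) * K) \<partial>lborel)"
      using K(1) by (simp add: abs_mult)
    show "AE x in lborel. integrable lborel (\<lambda>y. norm (a (fst (x, y))) * norm (b (snd (x, y))) * K)"
      using nb by simp
  qed
  have "integrable (lborel \<Otimes>\<^sub>M lborel) (\<lambda>z. p (a (fst z)) (b (snd z)))"
    by (rule Bochner_Integration.integrable_bound[OF ab borel_measurable_continuous_Pair[OF am bm c]])
       (intro AE_I2, use K in \<open>simp add: abs_mult\<close>)
  then show ?thesis by (simp add: case_prod_beta')
qed

text \<open>The bilinear image of the two increments is the integral of p(a(s), b(u)) over the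
  square. Splitting the square along its diagonal, the part u \<le> s contributes the increment of y
  inside p(a(s), y(s)), the part s \<le> u that of x inside p(x(u), b(u)).\<close>

lemma product_rule_endpoint:
  fixes x a :: "real \<Rightarrow> 'a::euclidean_space" and y b :: "real \<Rightarrow> 'b::euclidean_space"
    and p :: "'a \<Rightarrow> 'b \<Rightarrow> 'c::euclidean_space"
  assumes p: "bounded_bilinear p" and x: "ac_deriv T x a" and y: "ac_deriv T y b" and T: "0 \<le> T"
  shows "set_integrable lborel {0..T} (\<lambda>s. p (a s) (y s) + p (x s) (b s))"
    and "p (x T) (y T) = p (x 0) (y 0) + (LBINT s:{0..T}. p (a s) (y s) + p (x s) (b s))"
proof -
  interpret bounded_bilinear p by fact
  let ?a = "\<lambda>s. indicator {0..T} s *\<^sub>R a s" and ?b = "\<lambda>s. indicator {0..T} s *\<^sub>R b s"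
  have ai: "integrable lborel ?a" and bi: "integrable lborel ?b"
    using ac_deriv_integrable[OF x] ac_deriv_integrable[OF y] unfolding set_integrable_def by auto
  define F where "F = (\<lambda>s u. p (?a s) (?b u))"
  have F: "integrable (lborel \<Otimes>\<^sub>M lborel) (case_prod F)"
    using integrable_bilinear_product[OF p ai bi] unfolding F_def .
  have [measurable]: "case_prod F \<in> borel_measurable (borel \<Otimes>\<^sub>M borel)"
    using borel_measurable_integrable[OF F] by (simp add: lborel_prod borel_prod)
  have F1: "integrable (lborel \<Otimes>\<^sub>M lborel) (\<lambda>(s,u). indicator {..s} u *\<^sub>R F s u)"
    by (rule Bochner_Integration.integrable_bound[OF F])
       (auto simp: indicator_def split: prod.splits)
  have F2: "integrable (lborel \<Otimes>\<^sub>M lborel) (\<lambda>(s,u). indicator {..u} s *\<^sub>R F s u)"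
    by (rule Bochner_Integration.integrable_bound[OF F])
       (auto simp: indicator_def split: prod.splits)
  have Fs: "integrable lborel (F s)" for s unfolding F_def using integrable_bounded_linear[OF bounded_linear_right bi] .
  have xs: "x s = x 0 + (\<integral>u. indicator {..s} u *\<^sub>R ?a u \<partial>lborel)" if "s \<in> {0..T}" for s
  proof -
    have "(\<integral>u. indicator {..s} u *\<^sub>R ?a u \<partial>lborel) = (LBINT u:{0..s}. a u)"
      unfolding set_lebesgue_integral_def
      using that by (intro Bochner_Integration.integral_cong) (auto simp: indicator_def)
    then show ?thesis using ac_derivD[OF x that] by simp
  qed
  have ys: "y s = y 0 + (\<integral>u. indicator {..s} u *\<^sub>R ?b u \<partial>lborel)" if "s \<in> {0..T}" for s
  proof -
    have "(\<integral>u. indicator {..s} u *\<^sub>R ?b u \<partial>lborel) = (LBINT u:{0..s}. b u)"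
      unfolding set_lebesgue_integral_def
      using that by (intro Bochner_Integration.integral_cong) (auto simp: indicator_def)
    then show ?thesis using ac_derivD[OF y that] by simp
  qed
  have ays: "indicator {0..T} s *\<^sub>R p (a s) (y s) = p (?a s) (y 0) + (\<integral>u. indicator {..s} u *\<^sub>R F s u \<partial>lborel)" for s
  proof (cases "s \<in> {0..T}")
    case True
    have "integrable lborel (\<lambda>u. indicator {..s} u *\<^sub>R ?b u)"
      using integrable_mult_indicator[OF _ bi] by simp
    from integral_bounded_linear[OF bounded_linear_right[of "a s"] this]
    have "p (a s) (\<integral>u. indicator {..s} u *\<^sub>R ?b u \<partial>lborel) = (\<integral>u. indicator {..s} u *\<^sub>R F s u \<partial>lborel)"
      using True by (simp add: F_def scaleR_right del: scaleR_scaleR)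
    then show ?thesis using True ys[OF True] by (simp add: add_right)
  qed (simp add: F_def zero_left)
  have bxs: "indicator {0..T} u *\<^sub>R p (x u) (b u) = p (x 0) (?b u) + (\<integral>s. indicator {..u} s *\<^sub>R F s u \<partial>lborel)" for u
  proof (cases "u \<in> {0..T}")
    case True
    have "integrable lborel (\<lambda>s. indicator {..u} s *\<^sub>R ?a s)"
      using integrable_mult_indicator[OF _ ai] by simp
    from integral_bounded_linear[OF bounded_linear_left[of "b u"] this]
    have "p (\<integral>s. indicator {..u} s *\<^sub>R ?a s \<partial>lborel) (b u) = (\<integral>s. indicator {..u} s *\<^sub>R F s u \<partial>lborel)"
      using True by (simp add: F_def scaleR_left del: scaleR_scaleR)
    then show ?thesis using True xs[OF True] by (simp add: add_left)
  qed (simp add: F_def zero_right)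
  have i1: "integrable lborel (\<lambda>s. p (?a s) (y 0))"
    by (rule integrable_bounded_linear[OF bounded_linear_left ai])
  have i2: "integrable lborel (\<lambda>s. p (x 0) (?b s))"
    by (rule integrable_bounded_linear[OF bounded_linear_right bi])
  note i3 = lborel_pair.integrable_fst[OF F1] and i4 = lborel_pair.integrable_snd[OF F2]
  have ind: "indicator {0..T} s *\<^sub>R (p (a s) (y s) + p (x s) (b s)) =
    (p (?a s) (y 0) + (\<integral>u. indicator {..s} u *\<^sub>R F s u \<partial>lborel))
     + (p (x 0) (?b s) + (\<integral>r. indicator {..s} r *\<^sub>R F r s \<partial>lborel))" for s
    by (simp only: scaleR_add_right ays bxs)
  show "set_integrable lborel {0..T} (\<lambda>s. p (a s) (y s) + p (x s) (b s))"
    unfolding set_integrable_def ind by (intro Bochner_Integration.integrable_add i1 i2 i3 i4)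
  have "(LBINT s:{0..T}. p (a s) (y s) + p (x s) (b s)) =
     (\<integral>s. p (?a s) (y 0) \<partial>lborel) + (\<integral>s. (\<integral>u. indicator {..s} u *\<^sub>R F s u \<partial>lborel) \<partial>lborel)
     + ((\<integral>s. p (x 0) (?b s) \<partial>lborel) + (\<integral>s. (\<integral>r. indicator {..s} r *\<^sub>R F r s \<partial>lborel) \<partial>lborel))"
    unfolding set_lebesgue_integral_def ind
    by (simp only: Bochner_Integration.integral_add Bochner_Integration.integrable_add i1 i2 i3 i4)
  \<comment> \<open>Fubini swaps the order in the second triangle, so that both triangles are given
    by their sections at the same \<open>s\<close> and can be added section by section.\<close>
  also have "(\<integral>s. (\<integral>r. indicator {..s} r *\<^sub>R F r s \<partial>lborel) \<partial>lborel) =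
      (\<integral>s. (\<integral>u. indicator {..u} s *\<^sub>R F s u \<partial>lborel) \<partial>lborel)"
    by (rule lborel_pair.Fubini_integral[OF F2])
  finally have e: "(LBINT s:{0..T}. p (a s) (y s) + p (x s) (b s)) =
     (\<integral>s. p (?a s) (y 0) \<partial>lborel) + (\<integral>s. p (x 0) (?b s) \<partial>lborel) +
     ((\<integral>s. (\<integral>u. indicator {..s} u *\<^sub>R F s u \<partial>lborel) \<partial>lborel) + (\<integral>s. (\<integral>u. indicator {..u} s *\<^sub>R F s u \<partial>lborel) \<partial>lborel))"
    by simp
  have "(\<integral>u. indicator {..s} u *\<^sub>R F s u \<partial>lborel) + (\<integral>u. indicator {..u} s *\<^sub>R F s u \<partial>lborel) = (\<integral>u. F s u \<partial>lborel)" for s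
  proof -
    have f1: "integrable lborel (\<lambda>u. indicator {..s} u *\<^sub>R F s u)" by (rule integrable_mult_indicator[OF _ Fs]) simp
    have "(\<lambda>u. indicator {..u} s *\<^sub>R F s u) = (\<lambda>u. indicator {s..} u *\<^sub>R F s u)" by (auto simp: indicator_def)
    then have f2: "integrable lborel (\<lambda>u. indicator {..u} s *\<^sub>R F s u)"
      using integrable_mult_indicator[OF _ Fs, of "{s..}" s] by simp
    have "(\<integral>u. indicator {..s} u *\<^sub>R F s u \<partial>lborel) + (\<integral>u. indicator {..u} s *\<^sub>R F s u \<partial>lborel)
      = (\<integral>u. indicator {..s} u *\<^sub>R F s u + indicator {..u} s *\<^sub>R F s u \<partial>lborel)"
      by (rule Bochner_Integration.integral_add[OF f1 f2, symmetric])
    also have "\<dots> = (\<integral>u. F s u \<partial>lborel)"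
    proof (rule integral_cong_AE)
      \<comment> \<open>The two closed triangles share the diagonal, which meets each section in a
        single point.\<close>
      have "AE u in lborel. u \<noteq> s" by (rule AE_lborel_singleton)
      then show "AE u in lborel. indicator {..s} u *\<^sub>R F s u + indicator {..u} s *\<^sub>R F s u = F s u"
        by eventually_elim (auto simp: indicator_def)
    qed (use borel_measurable_integrable[OF Bochner_Integration.integrable_add[OF f1 f2]]
          borel_measurable_integrable[OF Fs] in auto)
    finally show ?thesis .
  qed
  then have "(\<integral>s. (\<integral>u. indicator {..s} u *\<^sub>R F s u \<partial>lborel) \<partial>lborel) + (\<integral>s. (\<integral>u. indicator {..u} s *\<^sub>R F s u \<partial>lborel) \<partial>lborel)
      = (\<integral>s. (\<integral>u. F s u \<partial>lborel) \<partial>lborel)"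
    using Bochner_Integration.integral_add[OF i3 lborel_pair.integrable_fst[OF F2]] by simp
  also have "\<dots> = p (\<integral>s. ?a s \<partial>lborel) (\<integral>u. ?b u \<partial>lborel)"
    unfolding F_def using integral_bounded_linear[OF bounded_linear_right bi]
      integral_bounded_linear[OF bounded_linear_left ai] by simp
  finally have "(LBINT s:{0..T}. p (a s) (y s) + p (x s) (b s)) =
      p (\<integral>s. ?a s \<partial>lborel) (y 0) + p (x 0) (\<integral>u. ?b u \<partial>lborel) + p (\<integral>s. ?a s \<partial>lborel) (\<integral>u. ?b u \<partial>lborel)"
    using e integral_bounded_linear[OF bounded_linear_right bi]
      integral_bounded_linear[OF bounded_linear_left ai] by simp
  moreover have "x T = x 0 + (\<integral>s. ?a s \<partial>lborel)" "y T = y 0 + (\<integral>s. ?b s \<partial>lborel)"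
    using ac_derivD[OF x, of T] ac_derivD[OF y, of T] T unfolding set_lebesgue_integral_def by auto
  ultimately show "p (x T) (y T) = p (x 0) (y 0) + (LBINT s:{0..T}. p (a s) (y s) + p (x s) (b s))"
    by (simp add: add_left add_right)
qed

lemma ac_deriv_subinterval:
  assumes x: "ac_deriv T x a" and t: "t \<le> T" shows "ac_deriv t x a"
  unfolding ac_deriv_def
proof (intro conjI ballI)
  show "set_integrable lborel {0..t} a"
    by (rule set_integrable_subset[OF ac_deriv_integrable[OF x]]) (use t in auto)
  fix s assume "s \<in> {0..t}"
  then show "x s = x 0 + (LBINT u:{0..s}. a u)" using t by (intro ac_derivD[OF x]) auto
qed

text \<open>The endpoint formula on each subinterval [0, t].\<close>

lemma ac_deriv_bilinear:
  fixes x a :: "real \<Rightarrow> 'a::euclidean_space" and y b :: "real \<Rightarrow> 'b::euclidean_space"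
    and p :: "'a \<Rightarrow> 'b \<Rightarrow> 'c::euclidean_space"
  assumes p: "bounded_bilinear p" and x: "ac_deriv T x a" and y: "ac_deriv T y b" and T: "0 \<le> T"
  shows "ac_deriv T (\<lambda>s. p (x s) (y s)) (\<lambda>s. p (a s) (y s) + p (x s) (b s))"
  unfolding ac_deriv_def
proof (intro conjI ballI)
  show "set_integrable lborel {0..T} (\<lambda>s. p (a s) (y s) + p (x s) (b s))"
    by (rule product_rule_endpoint(1)[OF p x y T])
  fix t assume "t \<in> {0..T}"
  then show "p (x t) (y t) = p (x 0) (y 0) + (LBINT s:{0..t}. p (a s) (y s) + p (x s) (b s))"
    by (intro product_rule_endpoint(2)[OF p] ac_deriv_subinterval[OF x] ac_deriv_subinterval[OF y]) auto
qed

section \<open>Gronwall's inequality and the Picard series of a linear Volterra equation\<close>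

lemma gronwall:
  fixes u g :: "real \<Rightarrow> real"
  assumes u: "continuous_on {0..T} u" and g: "continuous_on {0..T} g" and g0: "\<And>t. t \<in> {0..T} \<Longrightarrow> g t \<ge> 0"
    and K: "K \<ge> 0" and le: "\<And>t. t \<in> {0..T} \<Longrightarrow> u t \<le> g t + K * (LBINT s:{0..t}. u s)"
    and t: "t \<in> {0..T}"
  shows "u t \<le> g t + K * exp (K * T) * (LBINT s:{0..t}. g s)"
proof -
  have eq: "(LBINT s:{0..t}. f s) = integral {0..t} f" if "continuous_on {0..T} f" "t \<in> {0..T}" for t and f :: "real \<Rightarrow> real"
    using set_borel_integral_eq_integral(2)[OF set_integrable_continuous[OF continuous_on_subset[OF that(1)]], of 0 t] that(2) by auto
  define U where "U = (\<lambda>t. integral {0..t} u)"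
  define G where "G = (\<lambda>t. integral {0..t} g)"
  \<comment> \<open>The hypothesis makes the derivative of \<open>w\<close> at most (exp(-K s) - 1)
    g(s) \<le> 0. Hence the integral of u up to t is at most exp(K t) times that of g, and this is
    inserted into the hypothesis once more.\<close>
  define w where "w = (\<lambda>t. exp (- (K * t)) * U t - G t)"
  have wt: "w t \<le> w 0"
  proof (cases "t = 0")
    case False
    then have t0: "0 < t" using t by simp
    have D: "\<exists>d\<le>0. (w has_real_derivative d) (at s)" if s: "0 < s" "s < t" for s
    proof -
      have at: "at s within {0..T} = at s"
        using s t by (intro at_within_interior) (auto simp: interior_atLeastAtMost_real)
      have dU: "(U has_real_derivative u s) (at s)"
        using integral_has_real_derivative[OF u, of s] s t unfolding U_def at by auto
      have dG: "(G has_real_derivative g s) (at s)"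
        using integral_has_real_derivative[OF g, of s] s t unfolding G_def at by auto
      have "(w has_real_derivative exp (- (K * s)) * (u s - K * U s) - g s) (at s)"
        unfolding w_def by (auto intro!: derivative_eq_intros dU dG simp: algebra_simps)
      moreover have "exp (- (K * s)) * (u s - K * U s) \<le> exp (- (K * s)) * g s"
        using le[of s] eq[OF u, of s] s t by (intro mult_left_mono) (auto simp: U_def)
      moreover have "exp (- (K * s)) * g s \<le> 1 * g s"
        using K s t g0[of s] by (intro mult_right_mono) auto
      ultimately show ?thesis
        by (intro exI[of _ "exp (- (K * s)) * (u s - K * U s) - g s"] conjI) linarith+
    qed
    have "continuous_on {0..T} w" unfolding w_def U_def G_def
      by (intro continuous_intros indefinite_integral_continuous_1 integrable_continuous_real u g)
    then have "continuous_on {0..t} w" by (rule continuous_on_subset) (use t in auto)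
    from MVT[OF t0 this] D obtain l z where z: "0 < z" "z < t" "(w has_real_derivative l) (at z)" "w t - w 0 = (t - 0) * l"
      by (metis real_differentiable_def)
    have "l \<le> 0" using D[OF z(1,2)] z(3) DERIV_unique by blast
    then show ?thesis using z(4) t0 mult_nonneg_nonpos[of t l] by auto
  qed simp
  have G0: "G t \<ge> 0" unfolding G_def
    using t g0 by (intro integral_nonneg integrable_continuous_real continuous_on_subset[OF g]) auto
  have "exp (- (K * t)) * U t \<le> G t" using wt by (simp add: w_def U_def G_def)
  then have "U t \<le> exp (K * t) * G t" by (simp add: exp_minus field_simps)
  also have "\<dots> \<le> exp (K * T) * G t" using K t G0 by (intro mult_right_mono) (auto intro: mult_left_mono)
  finally have "K * U t \<le> K * (exp (K * T) * G t)" using K by (rule mult_left_mono)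
  then show ?thesis using le[OF t] eq[OF u t] eq[OF g t] by (simp add: U_def G_def mult.assoc)
qed

definition volterra :: "(real \<Rightarrow> real^'n^'n) \<Rightarrow> (real \<Rightarrow> real^'n) \<Rightarrow> real \<Rightarrow> real^'n" where
  "volterra A x t = (LBINT s:{0..t}. A s *v x s)"

text \<open>The Neumann series of x = f + V x for the Volterra operator V. Being an explicit limit,
  it inherits measurability in the sample point from its partial sums.\<close>

definition picard :: "(real \<Rightarrow> real^'n^'n) \<Rightarrow> (real \<Rightarrow> real^'n) \<Rightarrow> real \<Rightarrow> real^'n" where
  "picard A f t = (\<Sum>n. (volterra A ^^ n) f t)"

lemma set_integrable_mv:
  assumes "L_infty T (A :: real \<Rightarrow> real^'n^'m)" "continuous_on {0..T} x"
  shows "set_integrable lborel {0..T} (\<lambda>s. A s *v x s)"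
  using set_integrable_L_infty_bilinear[OF bounded_bilinear_mv assms(1) set_integrable_continuous[OF assms(2)]] .

lemma continuous_on_volterra:
  assumes "L_infty T A" "continuous_on {0..T} x"
  shows "continuous_on {0..T} (volterra A x)"
  unfolding volterra_def[abs_def] by (rule continuous_on_set_integral[OF set_integrable_mv[OF assms]])

lemma norm_volterra_le:
  assumes A: "L_infty T A" and K: "AE t in lborel. t \<in> {0..T} \<longrightarrow> norm (A t) \<le> K"
    and x: "continuous_on {0..T} x" and t: "t \<in> {0..T}"
  shows "norm (volterra A x t) \<le> K * (LBINT s:{0..t}. norm (x s))"
proof -
  have i: "set_integrable lborel {0..t} (\<lambda>s. A s *v x s)"
    by (rule set_integrable_subset[OF set_integrable_mv[OF A x]]) (use t in auto)
  have j: "set_integrable lborel {0..t} (\<lambda>s. norm (x s))"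
    by (intro set_integrable_continuous continuous_intros continuous_on_subset[OF x]) (use t in auto)
  have "norm (volterra A x t) \<le> (LBINT s:{0..t}. norm (A s *v x s))"
    unfolding volterra_def by (rule set_integral_norm_bound[OF i])
  also have "\<dots> \<le> (LBINT s:{0..t}. K * norm (x s))"
  proof (rule set_integral_mono_AE)
    show "set_integrable lborel {0..t} (\<lambda>s. norm (A s *v x s))" using i by (rule set_integrable_norm)
    show "set_integrable lborel {0..t} (\<lambda>s. K * norm (x s))" using j by simp
    show "AE s\<in>{0..t} in lborel. norm (A s *v x s) \<le> K * norm (x s)"
      using K
    proof eventually_elim
      case (elim s)
      then show ?case using t
        by (auto intro: order_trans[OF norm_matrix_vector_mult_le mult_right_mono])
    qed
  qed
  finally show ?thesis by simp
qed

lemma L_infty_bound: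
  assumes "L_infty T f" obtains K where "K \<ge> 0" "AE t in lborel. t \<in> {0..T} \<longrightarrow> norm (f t) \<le> K"
proof -
  obtain C where "AE t in lborel. t \<in> {0..T} \<longrightarrow> norm (f t) \<le> C" using assms unfolding L_infty_def by auto
  then have "AE t in lborel. t \<in> {0..T} \<longrightarrow> norm (f t) \<le> max 0 C" by eventually_elim auto
  then show ?thesis using that[of "max 0 C"] by simp
qed

lemma continuous_on_volterra_power:
  assumes "L_infty T A" "continuous_on {0..T} f"
  shows "continuous_on {0..T} ((volterra A ^^ n) f)"
  by (induction n) (use assms continuous_on_volterra in auto)

text \<open>Every application of the operator integrates a power of time once more, which produces
  the factorial; the series therefore has an exponential majorant on the whole horizon.\<close>

lemma norm_volterra_power_le:
  assumes A: "L_infty T A" and K: "AE t in lborel. t \<in> {0..T} \<longrightarrow> norm (A t) \<le> K" "K \<ge> 0"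
    and f: "continuous_on {0..T} f" and C: "\<And>t. t \<in> {0..T} \<Longrightarrow> norm (f t) \<le> C" and t: "t \<in> {0..T}"
  shows "norm ((volterra A ^^ n) f t) \<le> C * ((K * t) ^ n / fact n)"
  using t
proof (induction n arbitrary: t)
  case 0 then show ?case using C by simp
next
  case (Suc n)
  let ?x = "(volterra A ^^ n) f"
  have cx: "continuous_on {0..T} ?x" by (rule continuous_on_volterra_power[OF A f])
  have "norm ((volterra A ^^ Suc n) f t) \<le> K * (LBINT s:{0..t}. norm (?x s))"
    using norm_volterra_le[OF A K(1) cx Suc.prems] by simp
  also have "\<dots> \<le> K * (LBINT s:{0..t}. C * K ^ n / fact n * s ^ n)"
  proof (intro mult_left_mono set_integral_mono K(2) set_integrable_continuous continuous_intros)
    show "continuous_on {0..t} ?x" using cx by (rule continuous_on_subset) (use Suc.prems in auto)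
  next
    fix s assume "s \<in> {0..t}"
    then show "norm (?x s) \<le> C * K ^ n / fact n * s ^ n"
      using Suc.IH[of s] Suc.prems by (auto simp: power_mult_distrib)
  qed
  also have "(LBINT s:{0..t}. C * K ^ n / fact n * s ^ n) = C * K ^ n / fact n * (LBINT s:{0..t}. s ^ n)"
    by simp
  also have "(LBINT s:{0..t}. s ^ n) = t ^ Suc n / Suc n"
    using integral_power[of 0 t n] Suc.prems unfolding set_lebesgue_integral_def by (simp add: mult.commute)
  also have "K * (C * K ^ n / fact n * (t ^ Suc n / Suc n)) = C * ((K * t) ^ Suc n / fact (Suc n))"
    by (simp add: power_mult_distrib field_simps)
  finally show ?case .
qed

text \<open>The M-test with the exponential series gives uniform convergence, hence continuity of
  the sum; the equation passes to the limit because V is bounded for the supremum norm. The third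
  part is what measurability arguments use.\<close>

lemma picard_solution:
  assumes A: "L_infty T A" and f: "continuous_on {0..T} f"
  shows "continuous_on {0..T} (picard A f)"
    and "t \<in> {0..T} \<Longrightarrow> picard A f t = f t + (LBINT s:{0..t}. A s *v picard A f s)"
    and "t \<in> {0..T} \<Longrightarrow> (\<lambda>n. \<Sum>i<n. (volterra A ^^ i) f t) \<longlonglongrightarrow> picard A f t"
proof -
  obtain K where K: "K \<ge> 0" "AE t in lborel. t \<in> {0..T} \<longrightarrow> norm (A t) \<le> K" using L_infty_bound[OF A] .
  have "bounded (f ` {0..T})" using f compact_continuous_image compact_imp_bounded by blast
  then obtain C where C: "\<And>t. t \<in> {0..T} \<Longrightarrow> norm (f t) \<le> C" unfolding bounded_iff by blast
  let ?S = "\<lambda>n t. \<Sum>i<n. (volterra A ^^ i) f t"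
  have U: "uniform_limit {0..T} ?S (picard A f) sequentially"
    unfolding picard_def[abs_def]
  proof (rule Weierstrass_m_test)
    show "summable (\<lambda>n. C * ((K * T) ^ n / fact n))"
      using summable_exp_generic[of "K * T"] by (intro summable_mult) (simp add: scaleR_conv_of_real field_simps)
    fix n t assume t: "t \<in> {0..T}"
    then have "0 \<le> C" using C[OF t] norm_ge_zero order_trans by blast
    then show "norm ((volterra A ^^ n) f t) \<le> C * ((K * T) ^ n / fact n)"
      using t K(1) by (intro order_trans[OF norm_volterra_power_le[OF A K(2,1) f C t]] mult_left_mono
          divide_right_mono power_mono) auto
  qed
  have cS: "continuous_on {0..T} (?S n)" for n
    by (intro continuous_intros continuous_on_volterra_power A f)
  show c: "continuous_on {0..T} (picard A f)"
    by (rule uniform_limit_theorem[OF _ U]) (use cS in auto)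
  have l: "(\<lambda>n. ?S n t) \<longlonglongrightarrow> picard A f t" if "t \<in> {0..T}" for t
    using tendsto_uniform_limitI[OF U that] .
  then show "t \<in> {0..T} \<Longrightarrow> (\<lambda>n. ?S n t) \<longlonglongrightarrow> picard A f t" .
  have SS: "?S (Suc n) t = f t + volterra A (?S n) t" if t: "t \<in> {0..T}" for n t
  proof -
    have i: "set_integrable lborel {0..t} (\<lambda>s. A s *v (volterra A ^^ i) f s)" for i
      by (rule set_integrable_subset[OF set_integrable_mv[OF A continuous_on_volterra_power[OF A f]]]) (use t in auto)
    have "volterra A (?S n) t = (\<Sum>i<n. volterra A ((volterra A ^^ i) f) t)"
      unfolding volterra_def[of A _ t] bounded_bilinear.sum_right[OF bounded_bilinear_mv]
      using i unfolding set_lebesgue_integral_def set_integrable_def scaleR_sum_right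
      by (intro Bochner_Integration.integral_sum) auto
    also have "\<dots> = (\<Sum>i<n. (volterra A ^^ Suc i) f t)" by simp
    finally show ?thesis by (subst sum.lessThan_Suc_shift) simp
  qed
  show "picard A f t = f t + (LBINT s:{0..t}. A s *v picard A f s)" if t: "t \<in> {0..T}" 
  proof -
    have V: "(\<lambda>n. volterra A (?S n) t) \<longlonglongrightarrow> volterra A (picard A f) t"
    proof (rule LIMSEQ_I)
      fix r :: real assume r: "r > 0"
      \<comment> \<open>The 1 in the denominator keeps the quotient meaningful for K = 0 and makes
        the final estimate strict.\<close>
      define e where "e = r / (K * T + 1)"
      have KT: "K * T + 1 > 0" using K t by (auto intro!: add_nonneg_pos mult_nonneg_nonneg)
      have e: "e > 0" unfolding e_def using r KT by simp
      obtain N where N: "\<And>n s. n \<ge> N \<Longrightarrow> s \<in> {0..T} \<Longrightarrow> dist (?S n s) (picard A f s) < e"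
        using U e unfolding uniform_limit_sequentially_iff by meson
      have "norm (volterra A (?S n) t - volterra A (picard A f) t) < r" if n: "n \<ge> N" for n
      proof -
        let ?d = "\<lambda>s. ?S n s - picard A f s"
        have cd: "continuous_on {0..T} ?d" by (intro continuous_intros cS c)
        have i: "set_integrable lborel {0..t} (\<lambda>s. A s *v ?S n s)" "set_integrable lborel {0..t} (\<lambda>s. A s *v picard A f s)"
          by (rule set_integrable_subset[OF set_integrable_mv[OF A cS]]; use t in force)
             (rule set_integrable_subset[OF set_integrable_mv[OF A c]]; use t in force)
        have "volterra A (?S n) t - volterra A (picard A f) t = volterra A ?d t"
          unfolding volterra_def matrix_vector_mult_diff_distrib set_integral_diff(2)[OF i] ..
        then have "norm (volterra A (?S n) t - volterra A (picard A f) t) \<le> K * (LBINT s:{0..t}. norm (?d s))"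
          using norm_volterra_le[OF A K(2) cd t] by simp
        also have "\<dots> \<le> K * (LBINT s:{0..t}. e)"
        proof (intro mult_left_mono set_integral_mono K(1))
          show "set_integrable lborel {0..t} (\<lambda>s. norm (?d s))"
            by (intro set_integrable_continuous continuous_on_norm continuous_on_subset[OF cd]) (use t in auto)
          show "set_integrable lborel {0..t} (\<lambda>s. e)"
            by (intro set_integrable_continuous continuous_intros)
        next
          fix s assume "s \<in> {0..t}"
          then show "norm (?d s) \<le> e" using less_imp_le[OF N[OF n, of s]] t unfolding dist_norm by force
        qed
        also have "(LBINT s:{0..t}. e) = t * e"
          using t by (simp add: set_lebesgue_integral_def)
        also have "K * (t * e) \<le> K * (T * e)" using t K e by (intro mult_left_mono mult_right_mono) auto
        also have "\<dots> < (K * T + 1) * e" using e by (simp add: algebra_simps)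
        also have "\<dots> = r" using KT by (simp add: e_def)
        finally show ?thesis .
      qed
      then show "\<exists>no. \<forall>n\<ge>no. norm (volterra A (?S n) t - volterra A (picard A f) t) < r" by blast
    qed
    have "(\<lambda>n. ?S (Suc n) t) \<longlonglongrightarrow> f t + volterra A (picard A f) t"
      unfolding SS[OF t] by (intro tendsto_intros V)
    moreover have "(\<lambda>n. ?S (Suc n) t) \<longlonglongrightarrow> picard A f t" using l[OF t] by (rule LIMSEQ_Suc)
    ultimately have "f t + volterra A (picard A f) t = picard A f t" by (rule LIMSEQ_unique)
    then show ?thesis unfolding volterra_def[of A "picard A f" t] by (rule sym)
  qed
qed

text \<open>Gronwall for |x|. The right-hand side depends on the forcing alone, so that the bound
  can later be squared and averaged over the paths.\<close>

lemma linear_ode_bound: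
  fixes A :: "real \<Rightarrow> real^'n^'n"
  assumes A: "L_infty T A" and K: "AE t in lborel. t \<in> {0..T} \<longrightarrow> norm (A t) \<le> K" "K \<ge> 0"
    and f: "continuous_on {0..T} f" and x: "continuous_on {0..T} x"
    and eq: "\<And>t. t \<in> {0..T} \<Longrightarrow> x t = f t + (LBINT s:{0..t}. A s *v x s)"
    and t: "t \<in> {0..T}"
  shows "norm (x t) \<le> norm (f t) + K * exp (K * T) * (LBINT s:{0..t}. norm (f s))"
proof (rule gronwall[where T=T and u="\<lambda>t. norm (x t)" and g="\<lambda>t. norm (f t)"])
  fix t assume t: "t \<in> {0..T}"
  show "norm (x t) \<le> norm (f t) + K * (LBINT s:{0..t}. norm (x s))"
    using norm_triangle_ineq[of "f t" "volterra A x t"] norm_volterra_le[OF A K(1) x t] eq[OF t]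
    by (simp add: volterra_def)
qed (use assms in \<open>auto intro!: continuous_intros\<close>)

text \<open>The difference solves the equation with forcing 0, for which the bound is 0.\<close>

lemma linear_ode_unique:
  fixes A :: "real \<Rightarrow> real^'n^'n"
  assumes A: "L_infty T A" and x: "continuous_on {0..T} x" and y: "continuous_on {0..T} y"
    and eqx: "\<And>t. t \<in> {0..T} \<Longrightarrow> x t = f t + (LBINT s:{0..t}. A s *v x s)"
    and eqy: "\<And>t. t \<in> {0..T} \<Longrightarrow> y t = f t + (LBINT s:{0..t}. A s *v y s)"
    and t: "t \<in> {0..T}"
  shows "x t = y t"
proof -
  obtain K where K: "K \<ge> 0" "AE t in lborel. t \<in> {0..T} \<longrightarrow> norm (A t) \<le> K" using L_infty_bound[OF A] .
  have "norm (x t - y t) \<le> norm (0::real^'n) + K * exp (K * T) * (LBINT s:{0..t}. norm (0::real^'n))"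
  proof (rule linear_ode_bound[OF A K(2,1) _ _ _ t, where x="\<lambda>t. x t - y t" and f="\<lambda>t. 0"])
    fix t assume t: "t \<in> {0..T}"
    have i: "set_integrable lborel {0..t} (\<lambda>s. A s *v x s)" "set_integrable lborel {0..t} (\<lambda>s. A s *v y s)"
      by (rule set_integrable_subset[OF set_integrable_mv[OF A x]]; use t in force)
         (rule set_integrable_subset[OF set_integrable_mv[OF A y]]; use t in force)
    show "x t - y t = 0 + (LBINT s:{0..t}. A s *v (x s - y s))"
      unfolding matrix_vector_mult_diff_distrib set_integral_diff(2)[OF i]
      by (subst eqx[OF t], subst eqy[OF t]) simp
  qed (use x y in \<open>auto intro!: continuous_intros\<close>)
  then show ?thesis by simp
qed

section \<open>Square-integrable processes\<close>

text \<open>An extended nonnegative value, so that it can be estimated before square integrability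
  is known.\<close>

abbreviation msq :: "'a measure \<Rightarrow> ('a \<Rightarrow> 'b::euclidean_space) \<Rightarrow> ennreal" where
  "msq N f \<equiv> \<integral>\<^sup>+x. ennreal ((norm (f x))\<^sup>2) \<partial>N"

definition L2 :: "'a measure \<Rightarrow> ('a \<Rightarrow> 'b::euclidean_space) \<Rightarrow> bool" where
  "L2 N f \<longleftrightarrow> f \<in> borel_measurable N \<and> integrable N (\<lambda>x. (norm (f x))\<^sup>2)"

lemma L2_measurable: "L2 N f \<Longrightarrow> f \<in> borel_measurable N"
  unfolding L2_def by simp

lemma L2_iff_nn_integral:
  "L2 N f \<longleftrightarrow> f \<in> borel_measurable N \<and> msq N f < \<infinity>"
proof -
  have "f \<in> borel_measurable N \<Longrightarrow> (\<lambda>x. (norm (f x))\<^sup>2) \<in> borel_measurable N" by measurable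
  then show ?thesis unfolding L2_def integrable_iff_bounded by auto
qed

lemma L2_bounded:
  assumes f: "L2 N f" and g: "g \<in> borel_measurable N" and le: "AE x in N. norm (g x) \<le> c * norm (f x)"
  shows "L2 N g"
  unfolding L2_def
proof
  have "integrable N (\<lambda>x. c\<^sup>2 * (norm (f x))\<^sup>2)" using f unfolding L2_def by simp
  then show "integrable N (\<lambda>x. (norm (g x))\<^sup>2)"
  proof (rule Bochner_Integration.integrable_bound)
    show "(\<lambda>x. (norm (g x))\<^sup>2) \<in> borel_measurable N" using g by measurable
    show "AE x in N. norm ((norm (g x))\<^sup>2) \<le> norm (c\<^sup>2 * (norm (f x))\<^sup>2)"
      using le
    proof eventually_elim
      case (elim x)
      then have "(norm (g x))\<^sup>2 \<le> (c * norm (f x))\<^sup>2" by (intro power_mono) auto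
      then show ?case by (simp add: power_mult_distrib)
    qed
  qed
qed (rule g)

lemma L2_inner_integrable:
  assumes f: "L2 N f" and g: "L2 N (g :: _ \<Rightarrow> 'b::euclidean_space)"
  shows "integrable N (\<lambda>x. f x \<bullet> g x)"
proof -
  have i: "integrable N (\<lambda>x. (norm (f x))\<^sup>2 + (norm (g x))\<^sup>2)" using f g unfolding L2_def by auto
  show ?thesis
  proof (rule Bochner_Integration.integrable_bound[OF i])
    show "(\<lambda>x. f x \<bullet> g x) \<in> borel_measurable N"
      using L2_measurable[OF f] L2_measurable[OF g] by measurable
    show "AE x in N. norm (f x \<bullet> g x) \<le> norm ((norm (f x))\<^sup>2 + (norm (g x))\<^sup>2)"
    proof (rule AE_I2)
      fix x
      have "\<bar>f x \<bullet> g x\<bar> \<le> norm (f x) * norm (g x)" by (rule Cauchy_Schwarz_ineq2)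
      also have "\<dots> \<le> (norm (f x))\<^sup>2 + (norm (g x))\<^sup>2"
        using sum_squares_bound[of "norm (f x)" "norm (g x)"] zero_le_power2[of "norm (f x)"] zero_le_power2[of "norm (g x)"]
        by linarith
      finally show "norm (f x \<bullet> g x) \<le> norm ((norm (f x))\<^sup>2 + (norm (g x))\<^sup>2)" by simp
    qed
  qed
qed

lemma L2_add:
  assumes f: "L2 N f" and g: "L2 N (g :: _ \<Rightarrow> 'b::euclidean_space)"
  shows "L2 N (\<lambda>x. f x + g x)"
  unfolding L2_def
proof
  show "(\<lambda>x. f x + g x) \<in> borel_measurable N"
    using L2_measurable[OF f] L2_measurable[OF g] by measurable
  have "(norm (f x + g x))\<^sup>2 = (norm (f x))\<^sup>2 + (norm (g x))\<^sup>2 + 2 * (f x \<bullet> g x)" for x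
    unfolding power2_norm_eq_inner by (simp add: inner_simps inner_commute)
  then show "integrable N (\<lambda>x. (norm (f x + g x))\<^sup>2)"
    using L2_inner_integrable[OF f g] f g unfolding L2_def by simp
qed

lemma L2_scaleR: "L2 N f \<Longrightarrow> L2 N (\<lambda>x. c *\<^sub>R f x)"
  by (rule L2_bounded[where c="\<bar>c\<bar>"]) (auto simp: L2_def)

lemma L2_minus: "L2 N f \<Longrightarrow> L2 N (\<lambda>x. - f x)"
  using L2_scaleR[of N f "-1"] by simp

lemma L2_diff: "L2 N f \<Longrightarrow> L2 N g \<Longrightarrow> L2 N (\<lambda>x. f x - g x)"
  using L2_add[of N f "\<lambda>x. - g x"] L2_minus[of N g] by simp

lemma L2_const: "finite_measure N \<Longrightarrow> L2 N (\<lambda>x. c)"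
  unfolding L2_def by (simp add: finite_measure.integrable_const)

lemma L2_integrable:
  assumes N: "finite_measure N" and f: "L2 N f" shows "integrable N f"
proof -
  have i: "integrable N (\<lambda>x. 1 + (norm (f x))\<^sup>2)"
    using f N unfolding L2_def by (auto intro!: Bochner_Integration.integrable_add finite_measure.integrable_const)
  show ?thesis
  proof (rule Bochner_Integration.integrable_bound[OF i L2_measurable[OF f]], rule AE_I2)
    fix x
    have "0 \<le> (norm (f x) - 1)\<^sup>2 + norm (f x)" by simp
    then have "norm (f x) \<le> 1 + (norm (f x))\<^sup>2" unfolding power2_diff by simp
    then show "norm (f x) \<le> norm (1 + (norm (f x))\<^sup>2)" by simp
  qed
qed

lemma mv_measurable:
  fixes M :: "real^'n^'m"
  shows "f \<in> borel_measurable N \<Longrightarrow> (\<lambda>x. M *v f x) \<in> borel_measurable N"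
  by (rule measurable_compose[OF _ borel_measurable_continuous_onI])
     (auto intro!: linear_continuous_on bounded_bilinear.bounded_linear_right[OF bounded_bilinear_mv])

lemma L2_mv: "L2 N f \<Longrightarrow> L2 N (\<lambda>x. (M::real^'n^'m) *v f x)"
  by (rule L2_bounded[where c="norm M"])
     (auto intro: mv_measurable L2_measurable norm_matrix_vector_mult_le)

section \<open>Processes as functions on the product of the time interval and the probability
  space\<close>

abbreviation "TL T \<equiv> restrict_space lborel {0..T::real}"
abbreviation "TM T M \<equiv> TL T \<Otimes>\<^sub>M M"

lemma finite_measure_TL: "finite_measure (TL T)"
  by (rule finite_measureI) (simp add: space_restrict_space emeasure_restrict_space emeasure_lborel_Icc_eq)

lemma sets_TL: "sets (TL t) = sets (restrict_space borel {0..t})"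
  by (simp add: sets_restrict_space)

text \<open>Progressive measurability is stated over \<open>borel\<close>, integration over
  \<open>lborel\<close>; the sets are the same.\<close>

lemma measurable_TL_cong: "measurable (TL t \<Otimes>\<^sub>M N) K = measurable (restrict_space borel {0..t} \<Otimes>\<^sub>M N) K"
  by (intro measurable_cong_sets sets_pair_measure_cong refl sets_TL)

lemma set_integrable_TL:
  fixes f :: "real \<Rightarrow> 'b::{banach, second_countable_topology}"
  shows "set_integrable lborel {0..T} f \<longleftrightarrow> integrable (TL T) f"
  by (rule set_integrable_eq) simp

lemma LBINT_TL:
  fixes f :: "real \<Rightarrow> 'b::{banach, second_countable_topology}"
  shows "(LBINT t:{0..T}. f t) = (\<integral>t. f t \<partial>TL T)"
  unfolding set_lebesgue_integral_def by (rule integral_restrict_space[symmetric]) simp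

lemma nn_integral_TL: "(\<integral>\<^sup>+t\<in>{0..T}. f t \<partial>lborel) = (\<integral>\<^sup>+t. f t \<partial>TL T)"
  by (rule nn_integral_restrict_space[symmetric]) simp

lemma AE_TL: "(AE t in TL T. P t) \<longleftrightarrow> (AE t in lborel. t \<in> {0..T} \<longrightarrow> P t)"
  by (rule AE_restrict_space_iff) simp

lemma L_infty_measurable_TL:
  fixes c :: "real \<Rightarrow> 'b::euclidean_space"
  shows "L_infty T c \<Longrightarrow> c \<in> borel_measurable (TL T)"
  unfolding L_infty_def set_borel_measurable_iff_restrict measurable_cong_sets[OF sets_TL refl] by blast

lemma bounded_bilinear_measurable:
  fixes p :: "'a::euclidean_space \<Rightarrow> 'b::euclidean_space \<Rightarrow> 'c::euclidean_space"
  assumes p: "bounded_bilinear p" and f: "f \<in> borel_measurable N" and g: "g \<in> borel_measurable N"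
  shows "(\<lambda>x. p (f x) (g x)) \<in> borel_measurable N"
proof -
  have "continuous_on UNIV (\<lambda>z. p (fst z) (snd z))"
    by (auto intro!: bounded_bilinear.continuous_on[OF p] continuous_intros)
  from borel_measurable_continuous_Pair[OF f g this] show ?thesis by simp
qed

text \<open>Rational points approaching t from below. They serve twice: for the joint measurability
  of continuous processes and for extending identities from rational to all times.\<close>

lemma floor_div_tendsto:
  fixes t :: real
  shows "(\<lambda>n. real_of_int \<lfloor>t * real (Suc n)\<rfloor> / real (Suc n)) \<longlonglongrightarrow> t"
proof (rule real_tendsto_sandwich)
  let ?q = "\<lambda>n. real_of_int \<lfloor>t * real (Suc n)\<rfloor> / real (Suc n)"
  show "\<forall>\<^sub>F n in sequentially. t - 1 / real (Suc n) \<le> ?q n"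
  proof (intro always_eventually allI)
    fix n
    have "(t * real (Suc n) - 1) / real (Suc n) \<le> ?q n" by (intro divide_right_mono) linarith+
    then show "t - 1 / real (Suc n) \<le> ?q n" by (simp add: diff_divide_distrib)
  qed
  show "\<forall>\<^sub>F n in sequentially. ?q n \<le> t" by (intro always_eventually allI) (simp add: field_simps)
  show "(\<lambda>n. t - 1 / real (Suc n)) \<longlonglongrightarrow> t"
    using tendsto_diff[OF tendsto_const[of t] LIMSEQ_inverse_real_of_nat] by (simp add: inverse_eq_divide)
qed simp

text \<open>With time rounded down to a grid the process takes countably many measurable forms
  according to the grid index, hence is jointly measurable; refining the grid recovers the process
  by continuity of its paths.\<close>

lemma jointly_measurable_continuous:
  fixes X :: "real \<Rightarrow> 'w \<Rightarrow> 'b::metric_space"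
  assumes t: "0 \<le> t" and c: "\<And>\<omega>. \<omega> \<in> space N \<Longrightarrow> continuous_on {0..t} (\<lambda>s. X s \<omega>)"
    and m: "\<And>s. s \<in> {0..t} \<Longrightarrow> X s \<in> borel_measurable N"
  shows "(\<lambda>z. X (fst z) (snd z)) \<in> borel_measurable (restrict_space borel {0..t} \<Otimes>\<^sub>M N)"
proof (rule borel_measurable_LIMSEQ_metric)
  let ?P = "restrict_space borel {0..t} \<Otimes>\<^sub>M N"
  let ?q = "\<lambda>n s. real_of_int \<lfloor>s * real (Suc n)\<rfloor> / real (Suc n)"
  fix n
  have "(\<lambda>z. \<lfloor>fst z * real (Suc n)\<rfloor>) \<in> measurable ?P (count_space UNIV)"
  proof -
    have "(\<lambda>z. fst z * real (Suc n)) \<in> borel_measurable ?P"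
      by (intro borel_measurable_times borel_measurable_const measurable_compose[OF measurable_fst])
         (simp add: measurable_restrict_space1)
    then show ?thesis by measurable
  qed
  \<comment> \<open>Clamping to [0, t] makes this true for every integer index, including those that
    the rounding never produces.\<close>
  moreover have "(\<lambda>z. X (max 0 (min t (real_of_int i / real (Suc n)))) (snd z)) \<in> borel_measurable ?P" for i :: int
    by (rule measurable_compose[OF measurable_snd m]) (use t in auto)
  ultimately have "(\<lambda>z. X (max 0 (min t (real_of_int \<lfloor>fst z * real (Suc n)\<rfloor> / real (Suc n)))) (snd z)) \<in> borel_measurable ?P"
    by (rule measurable_compose_countable[rotated])
  then show "(\<lambda>z. X (max 0 (min t (?q n (fst z)))) (snd z)) \<in> borel_measurable ?P" .
next
  let ?q = "\<lambda>n s. real_of_int \<lfloor>s * real (Suc n)\<rfloor> / real (Suc n)"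
  fix z assume z: "z \<in> space (restrict_space borel {0..t} \<Otimes>\<^sub>M N)"
  then have s: "fst z \<in> {0..t}" and w: "snd z \<in> space N" by (auto simp: space_pair_measure space_restrict_space)
  have "(\<lambda>n. ?q n (fst z)) \<longlonglongrightarrow> fst z" by (rule floor_div_tendsto)
  then have "(\<lambda>n. max 0 (min t (?q n (fst z)))) \<longlonglongrightarrow> max 0 (min t (fst z))"
    by (intro tendsto_max tendsto_min tendsto_const)
  then have "(\<lambda>n. max 0 (min t (?q n (fst z)))) \<longlonglongrightarrow> fst z" using s by simp
  then show "(\<lambda>n. X (max 0 (min t (?q n (fst z)))) (snd z)) \<longlonglongrightarrow> X (fst z) (snd z)"
    by (rule continuous_on_tendsto_compose[OF c[OF w] _ s]) (use t in auto)
qed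

lemma nn_integral_L2_measurable:
  "f \<in> borel_measurable N \<Longrightarrow> (\<lambda>x. ennreal ((norm (f x))\<^sup>2)) \<in> borel_measurable N"
  by measurable

text \<open>Cauchy-Schwarz against the indicator of [0, t]. It covers a path that is not integrable
  as well, since the Bochner integral then has the value 0.\<close>

lemma integral_square_le:
  fixes v :: "real \<Rightarrow> 'b::euclidean_space"
  assumes t: "t \<in> {0..T}" and v: "v \<in> borel_measurable (TL T)"
  shows "ennreal ((norm (LBINT s:{0..t}. v s))\<^sup>2) \<le> ennreal T * msq (TL T) v"
proof -
  let ?v = "\<lambda>s. indicator {0..T} s *\<^sub>R v s"
  have vm[measurable]: "?v \<in> borel_measurable borel"
    using v unfolding measurable_cong_sets[OF sets_TL refl] by (subst (asm) borel_measurable_restrict_space_iff) auto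
  have "ennreal (norm (LBINT s:{0..t}. v s)) \<le> (\<integral>\<^sup>+s. ennreal (norm (?v s)) * indicator {0..t} s \<partial>lborel)"
  proof -
    have "ennreal (norm (LBINT s:{0..t}. v s)) \<le> (\<integral>\<^sup>+s. ennreal (norm (indicator {0..t} s *\<^sub>R v s)) \<partial>lborel)"
      unfolding set_lebesgue_integral_def
    proof (cases "integrable lborel (\<lambda>s. indicator {0..t} s *\<^sub>R v s)")
      case True then show "ennreal (norm (\<integral>s. indicator {0..t} s *\<^sub>R v s \<partial>lborel)) \<le> (\<integral>\<^sup>+s. ennreal (norm (indicator {0..t} s *\<^sub>R v s)) \<partial>lborel)"
        by (rule integral_norm_bound_ennreal)
    qed (simp add: not_integrable_integral_eq)
    also have "\<dots> = (\<integral>\<^sup>+s. ennreal (norm (?v s)) * indicator {0..t} s \<partial>lborel)"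
      using t by (intro nn_integral_cong) (auto simp: indicator_def)
    finally show ?thesis .
  qed
  then have "(ennreal (norm (LBINT s:{0..t}. v s)))\<^sup>2 \<le> (\<integral>\<^sup>+s. ennreal (norm (?v s)) * indicator {0..t} s \<partial>lborel)\<^sup>2"
    by (intro power_mono) auto
  also have "\<dots> \<le> (\<integral>\<^sup>+s. (ennreal (norm (?v s)))\<^sup>2 \<partial>lborel) * (\<integral>\<^sup>+s. (indicator {0..t} s)\<^sup>2 \<partial>lborel)"
    by (rule Cauchy_Schwarz_nn_integral; measurable)
  also have "(\<integral>\<^sup>+s. (indicator {0..t} s :: ennreal)\<^sup>2 \<partial>lborel) = (\<integral>\<^sup>+s. indicator {0..t} s \<partial>lborel)"
    by (intro nn_integral_cong) (auto simp: indicator_def)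
  also have "\<dots> = ennreal t" using t by simp
  also have "(\<integral>\<^sup>+s. (ennreal (norm (?v s)))\<^sup>2 \<partial>lborel) = msq (TL T) v"
    unfolding nn_integral_TL[symmetric] by (intro nn_integral_cong) (auto simp: indicator_def ennreal_power)
  also have "\<dots> * ennreal t \<le> ennreal T * msq (TL T) v"
    using t by (subst mult.commute) (auto intro!: mult_right_mono ennreal_leI)
  finally show ?thesis by (simp add: ennreal_power)
qed

locale time_space =
  fixes T :: real and M :: "'w measure"
  assumes T_pos: "0 < T" and prob_M: "prob_space M"

sublocale time_space \<subseteq> prob_space M by (rule prob_M)
sublocale time_space \<subseteq> TL: finite_measure "TL T" by (rule finite_measure_TL)
sublocale time_space \<subseteq> P: pair_sigma_finite "TL T" M ..

context time_space
begin

lemma finite_measure_TM: "finite_measure (TM T M)"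
  by (intro finite_measure_pair_measure TL.finite_measure_axioms finite_measure_axioms)

definition meas_proc :: "(real \<Rightarrow> 'w \<Rightarrow> 'b::euclidean_space) \<Rightarrow> bool" where
  "meas_proc X \<longleftrightarrow> (\<lambda>z. X (fst z) (snd z)) \<in> borel_measurable (TM T M)"

definition L2P :: "(real \<Rightarrow> 'w \<Rightarrow> 'b::euclidean_space) \<Rightarrow> bool" where
  "L2P X \<longleftrightarrow> L2 (TM T M) (\<lambda>z. X (fst z) (snd z))"

text \<open>Square integrability on the product says nothing about a fixed time. Second moments
  bounded uniformly in time control every single time, in particular the horizon, where the terminal
  payoff is evaluated.\<close>

definition bddL2 :: "(real \<Rightarrow> 'w \<Rightarrow> 'b::euclidean_space) \<Rightarrow> bool" where
  "bddL2 X \<longleftrightarrow> meas_proc X \<and> (\<forall>t\<in>{0..T}. X t \<in> borel_measurable M) \<and>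
     (\<exists>c. \<forall>t\<in>{0..T}. msq M (X t) \<le> ennreal c)"

lemma L2P_meas: "L2P X \<Longrightarrow> meas_proc X"
  unfolding L2P_def meas_proc_def by (rule L2_measurable)

lemma meas_proc_time: "meas_proc X \<Longrightarrow> t \<in> {0..T} \<Longrightarrow> X t \<in> borel_measurable M"
  unfolding meas_proc_def using measurable_Pair2[of "\<lambda>z. X (fst z) (snd z)" "TL T" M borel t]
  by (simp add: space_restrict_space)

lemma meas_proc_path: "meas_proc X \<Longrightarrow> \<omega> \<in> space M \<Longrightarrow> (\<lambda>t. X t \<omega>) \<in> borel_measurable (TL T)"
  unfolding meas_proc_def using measurable_Pair1[of "\<lambda>z. X (fst z) (snd z)" "TL T" M borel \<omega>] by simp

lemma meas_proc_coef: "L_infty T c \<Longrightarrow> meas_proc (\<lambda>t \<omega>. c t)"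
  unfolding meas_proc_def by (rule measurable_compose[OF measurable_fst]) (rule L_infty_measurable_TL)

lemma meas_proc_bilinear:
  fixes p :: "'a::euclidean_space \<Rightarrow> 'b::euclidean_space \<Rightarrow> 'c::euclidean_space"
  shows "bounded_bilinear p \<Longrightarrow> meas_proc X \<Longrightarrow> meas_proc Y \<Longrightarrow> meas_proc (\<lambda>t \<omega>. p (X t \<omega>) (Y t \<omega>))"
  unfolding meas_proc_def by (rule bounded_bilinear_measurable)

lemma meas_proc_add: "meas_proc X \<Longrightarrow> meas_proc Y \<Longrightarrow> meas_proc (\<lambda>t \<omega>. X t \<omega> + Y t \<omega>)"
  unfolding meas_proc_def by (rule borel_measurable_add)

lemma meas_proc_diff: "meas_proc X \<Longrightarrow> meas_proc Y \<Longrightarrow> meas_proc (\<lambda>t \<omega>. X t \<omega> - Y t \<omega>)"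
  unfolding meas_proc_def by (rule borel_measurable_diff)

lemma meas_proc_mv: "L_infty T A \<Longrightarrow> meas_proc X \<Longrightarrow> meas_proc (\<lambda>t \<omega>. (A t :: real^'n^'m) *v X t \<omega>)"
  by (intro meas_proc_bilinear[OF bounded_bilinear_mv] meas_proc_coef)

text \<open>A null set of times, multiplied by the whole probability space, is null. Essential
  bounds on the coefficients thereby act on processes.\<close>

lemma AE_TM_if_AE_time:
  assumes "AE t in TL T. Q t"
  shows "AE z in TM T M. Q (fst z)"
proof -
  obtain N where N: "N \<in> null_sets (TL T)" "{t \<in> space (TL T). \<not> Q t} \<subseteq> N"
    using assms unfolding eventually_ae_filter by blast
  have "N \<times> space M \<in> null_sets (TM T M)"
    using N(1) by (simp add: null_sets_def emeasure_pair_measure_Times)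
  then show ?thesis
  proof (rule AE_I')
    show "{z \<in> space (TM T M). \<not> Q (fst z)} \<subseteq> N \<times> space M"
      using N(2) unfolding space_pair_measure by (auto simp del: space_restrict_space)
  qed
qed

lemma L2P_mv:
  assumes A: "L_infty T A" and X: "L2P X"
  shows "L2P (\<lambda>t \<omega>. (A t :: real^'n^'m) *v X t \<omega>)"
  unfolding L2P_def
proof -
  obtain K where K: "K \<ge> 0" "AE t in lborel. t \<in> {0..T} \<longrightarrow> norm (A t) \<le> K" using L_infty_bound[OF A] .
  have "AE z in TM T M. norm (A (fst z)) \<le> K"
    using AE_TM_if_AE_time K(2) unfolding AE_TL[symmetric] by blast
  then have "AE z in TM T M. norm (A (fst z) *v X (fst z) (snd z)) \<le> K * norm (X (fst z) (snd z))"
    by eventually_elim (auto intro: order_trans[OF norm_matrix_vector_mult_le mult_right_mono])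
  then show "L2 (TM T M) (\<lambda>z. A (fst z) *v X (fst z) (snd z))"
    by (rule L2_bounded[OF X[unfolded L2P_def] meas_proc_mv[OF A L2P_meas[OF X], unfolded meas_proc_def]])
qed

lemma L2P_add: "L2P X \<Longrightarrow> L2P Y \<Longrightarrow> L2P (\<lambda>t \<omega>. X t \<omega> + Y t \<omega>)"
  unfolding L2P_def by (rule L2_add)

lemma L2P_diff: "L2P X \<Longrightarrow> L2P Y \<Longrightarrow> L2P (\<lambda>t \<omega>. X t \<omega> - Y t \<omega>)"
  unfolding L2P_def by (rule L2_diff)

lemma L2P_minus: "L2P X \<Longrightarrow> L2P (\<lambda>t \<omega>. - X t \<omega>)"
  unfolding L2P_def by (rule L2_minus)

lemma L2P_scaleR: "L2P X \<Longrightarrow> L2P (\<lambda>t \<omega>. c *\<^sub>R X t \<omega>)"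
  unfolding L2P_def by (rule L2_scaleR)

lemma L2P_coef:
  assumes "L_infty T c" shows "L2P (\<lambda>t \<omega>. c t)"
proof -
  obtain K where K: "K \<ge> 0" "AE t in lborel. t \<in> {0..T} \<longrightarrow> norm (c t) \<le> K" using L_infty_bound[OF assms] .
  have "AE z in TM T M. norm (c (fst z)) \<le> K * norm (1::real)"
    using AE_TM_if_AE_time K(2) unfolding AE_TL[symmetric] by simp
  then show ?thesis unfolding L2P_def
    by (rule L2_bounded[OF L2_const[OF finite_measure_TM, where c="1::real"] meas_proc_coef[OF assms, unfolded meas_proc_def]])
qed

lemma L2P_inner_integrable:
  "L2P X \<Longrightarrow> L2P Y \<Longrightarrow> integrable (TM T M) (\<lambda>z. X (fst z) (snd z) \<bullet> Y (fst z) (snd z))"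
  unfolding L2P_def by (rule L2_inner_integrable)

lemma L2P_integrable: "L2P X \<Longrightarrow> integrable (TM T M) (\<lambda>z. X (fst z) (snd z))"
  unfolding L2P_def by (rule L2_integrable[OF finite_measure_TM])

lemma nn_integral_TM_path:
  assumes "meas_proc X"
  shows "msq (TM T M) (\<lambda>z. X (fst z) (snd z))
     = (\<integral>\<^sup>+\<omega>. msq (TL T) (\<lambda>t. X t \<omega>) \<partial>M)"
  using P.nn_integral_snd[OF nn_integral_L2_measurable[OF assms[unfolded meas_proc_def]]] by simp

lemma nn_integral_TM_time:
  assumes "meas_proc X"
  shows "msq (TM T M) (\<lambda>z. X (fst z) (snd z))
     = (\<integral>\<^sup>+t. msq M (X t) \<partial>TL T)"
  using nn_integral_fst[OF nn_integral_L2_measurable[OF assms[unfolded meas_proc_def]]] by simp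

lemma L2P_AE_path:
  assumes "L2P X" shows "AE \<omega> in M. L2 (TL T) (\<lambda>t. X t \<omega>)"
proof -
  have "integrable (TM T M) (\<lambda>(t, \<omega>). (norm (X t \<omega>))\<^sup>2)"
    using assms unfolding L2P_def L2_def by (simp add: case_prod_beta')
  from P.AE_integrable_snd[OF this] show ?thesis using AE_space
    by eventually_elim (auto simp: L2_def meas_proc_path[OF L2P_meas[OF assms]])
qed

lemma L2P_AE_time:
  assumes "L2P X" shows "AE t in TL T. L2 M (X t)"
proof -
  have "integrable (TM T M) (\<lambda>(t, \<omega>). (norm (X t \<omega>))\<^sup>2)"
    using assms unfolding L2P_def L2_def by (simp add: case_prod_beta')
  from P.AE_integrable_fst[OF this] show ?thesis using AE_space
    by eventually_elim (auto simp: L2_def space_restrict_space meas_proc_time[OF L2P_meas[OF assms]])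
qed

lemma L2P_path_integrable:
  assumes "L2P X" shows "AE \<omega> in M. set_integrable lborel {0..T} (\<lambda>t. X t \<omega>)"
  using L2P_AE_path[OF assms] by eventually_elim (auto simp: set_integrable_TL intro: L2_integrable[OF finite_measure_TL])

lemma bddL2_L2:
  assumes "bddL2 X" "t \<in> {0..T}" shows "L2 M (X t)"
  using assms le_less_trans[OF _ ennreal_less_top] unfolding bddL2_def L2_iff_nn_integral by fastforce

lemma bddL2_meas: "bddL2 X \<Longrightarrow> meas_proc X"
  unfolding bddL2_def by simp

lemma bddL2_L2P:
  assumes X: "bddL2 X" shows "L2P X"
proof -
  obtain c where c: "\<And>t. t \<in> {0..T} \<Longrightarrow> msq M (X t) \<le> ennreal c"
    using X unfolding bddL2_def by blast
  have "(\<integral>\<^sup>+t. msq M (X t) \<partial>TL T) \<le> (\<integral>\<^sup>+t. ennreal c \<partial>TL T)"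
    by (intro nn_integral_mono c) (simp add: space_restrict_space)
  also have "\<dots> < \<infinity>" using TL.emeasure_finite[of "{0..T}"] by (simp add: ennreal_mult_eq_top_iff less_top[symmetric])
  finally show ?thesis
    using bddL2_meas[OF X] unfolding L2P_def L2_iff_nn_integral nn_integral_TM_time[OF bddL2_meas[OF X]] meas_proc_def by blast
qed

lemma norm_add_square_le: "(norm (x + y :: 'b::euclidean_space))\<^sup>2 \<le> 2 * (norm x)\<^sup>2 + 2 * (norm y)\<^sup>2"
proof -
  have "(norm (x + y))\<^sup>2 \<le> (norm x + norm y)\<^sup>2" by (intro power_mono norm_triangle_ineq) simp
  also have "\<dots> \<le> 2 * (norm x)\<^sup>2 + 2 * (norm y)\<^sup>2"
    using sum_squares_bound[of "norm x" "norm y"] by (simp add: power2_sum)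
  finally show ?thesis .
qed

lemma nn_integral_add_square_le:
  fixes f g :: "'w \<Rightarrow> 'b::euclidean_space"
  assumes [measurable]: "f \<in> borel_measurable M" "g \<in> borel_measurable M"
  shows "msq M (\<lambda>\<omega>. f \<omega> + g \<omega>)
    \<le> 2 * msq M f + 2 * msq M g"
proof -
  have "msq M (\<lambda>\<omega>. f \<omega> + g \<omega>) \<le> (\<integral>\<^sup>+\<omega>. 2 * ennreal ((norm (f \<omega>))\<^sup>2) + 2 * ennreal ((norm (g \<omega>))\<^sup>2) \<partial>M)"
  proof (rule nn_integral_mono)
    fix \<omega>
    have "ennreal ((norm (f \<omega> + g \<omega>))\<^sup>2) \<le> ennreal (2 * (norm (f \<omega>))\<^sup>2 + 2 * (norm (g \<omega>))\<^sup>2)"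
      by (intro ennreal_leI norm_add_square_le)
    then show "ennreal ((norm (f \<omega> + g \<omega>))\<^sup>2) \<le> 2 * ennreal ((norm (f \<omega>))\<^sup>2) + 2 * ennreal ((norm (g \<omega>))\<^sup>2)"
      by (simp add: ennreal_mult')
  qed
  also have "\<dots> = 2 * msq M f + 2 * msq M g"
    by (subst nn_integral_add) (auto simp: nn_integral_cmult)
  finally show ?thesis .
qed

lemma bddL2_bound:
  assumes "bddL2 X"
  obtains c where "c \<ge> 0" "\<And>t. t \<in> {0..T} \<Longrightarrow> msq M (X t) \<le> ennreal c"
proof -
  obtain c where c: "\<And>t. t \<in> {0..T} \<Longrightarrow> msq M (X t) \<le> ennreal c"
    using assms unfolding bddL2_def by blast
  have "ennreal c \<le> ennreal (max 0 c)" by (rule ennreal_leI) simp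
  then show ?thesis using that[of "max 0 c"] order_trans[OF c] by simp
qed

lemma bddL2_rv: "bddL2 X \<Longrightarrow> t \<in> {0..T} \<Longrightarrow> X t \<in> borel_measurable M"
  unfolding bddL2_def by blast

lemma bddL2I:
  assumes "meas_proc X" "\<And>t. t \<in> {0..T} \<Longrightarrow> msq M (X t) \<le> ennreal c"
  shows "bddL2 X"
  unfolding bddL2_def using assms meas_proc_time[OF assms(1)] by blast

lemma bddL2_add:
  assumes X: "bddL2 X" and Y: "bddL2 Y" shows "bddL2 (\<lambda>t \<omega>. X t \<omega> + Y t \<omega>)"
proof -
  obtain c where c: "c \<ge> 0" "\<And>t. t \<in> {0..T} \<Longrightarrow> msq M (X t) \<le> ennreal c"
    using bddL2_bound[OF X] by blast
  obtain d where d: "d \<ge> 0" "\<And>t. t \<in> {0..T} \<Longrightarrow> msq M (Y t) \<le> ennreal d"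
    using bddL2_bound[OF Y] by blast
  show ?thesis
  proof (rule bddL2I[OF meas_proc_add[OF bddL2_meas[OF X] bddL2_meas[OF Y]]])
    fix t assume t: "t \<in> {0..T}"
    have "msq M (\<lambda>\<omega>. X t \<omega> + Y t \<omega>)
      \<le> 2 * msq M (X t) + 2 * msq M (Y t)"
      by (rule nn_integral_add_square_le[OF bddL2_rv[OF X t] bddL2_rv[OF Y t]])
    also have "\<dots> \<le> ennreal 2 * ennreal c + ennreal 2 * ennreal d"
      by (simp only: ennreal_numeral) (intro add_mono mult_left_mono c(2) d(2) t zero_le)
    also have "\<dots> = ennreal (2 * c + 2 * d)"
      using c(1) d(1) by (simp only: ennreal_plus ennreal_mult mult_nonneg_nonneg zero_le_numeral)
    finally show "msq M (\<lambda>\<omega>. X t \<omega> + Y t \<omega>) \<le> ennreal (2 * c + 2 * d)" .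
  qed
qed

lemma bddL2_const:
  assumes "L2 M f" shows "bddL2 (\<lambda>t. f)"
proof (rule bddL2I)
  show "meas_proc (\<lambda>t. f)" unfolding meas_proc_def
    by (rule measurable_compose[OF measurable_snd L2_measurable[OF assms]])
  fix t
  show "msq M f \<le> ennreal (enn2real (msq M f))"
    using assms unfolding L2_iff_nn_integral by simp
qed

text \<open>The moving endpoint is turned into the indicator of the measurable set s \<le> t under
  an integral over the fixed time interval, to which measurability of parameter integrals
  applies.\<close>

lemma meas_proc_integral:
  fixes v :: "real \<Rightarrow> 'w \<Rightarrow> 'b::euclidean_space"
  assumes v: "meas_proc v"
  shows "meas_proc (\<lambda>t \<omega>. LBINT s:{0..t}. v s \<omega>)"
proof -
  have eq: "(LBINT s:{0..fst z}. v s (snd z)) = (\<integral>s. indicator {..fst z} s *\<^sub>R v s (snd z) \<partial>TL T)"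
    if "z \<in> space (TM T M)" for z
    unfolding set_lebesgue_integral_def
    using that by (subst integral_restrict_space) (auto intro!: Bochner_Integration.integral_cong
       simp: indicator_def space_pair_measure space_restrict_space)
  have vm: "(\<lambda>y. v (snd y) (snd (fst y))) \<in> borel_measurable (TM T M \<Otimes>\<^sub>M TL T)"
    using measurable_compose[OF measurable_Pair[OF measurable_snd measurable_compose[OF measurable_fst measurable_snd]]
        v[unfolded meas_proc_def]] by (simp only: fst_conv snd_conv)
  have id: "(\<lambda>x. x) \<in> borel_measurable (TL T)" by (rule measurable_restrict_space1) simp
  have "(\<lambda>y. snd y) \<in> borel_measurable (TM T M \<Otimes>\<^sub>M TL T)"
    by (rule measurable_compose[OF measurable_snd id])
  moreover have "(\<lambda>y. fst (fst y)) \<in> borel_measurable (TM T M \<Otimes>\<^sub>M TL T)"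
    by (rule measurable_compose[OF measurable_fst measurable_compose[OF measurable_fst id]])
  ultimately have "{y \<in> space (TM T M \<Otimes>\<^sub>M TL T). snd y \<le> fst (fst y)} \<in> sets (TM T M \<Otimes>\<^sub>M TL T)"
    by (rule borel_measurable_le)
  then have "(\<lambda>y. indicator {y \<in> space (TM T M \<Otimes>\<^sub>M TL T). snd y \<le> fst (fst y)} y *\<^sub>R v (snd y) (snd (fst y))) \<in> borel_measurable (TM T M \<Otimes>\<^sub>M TL T)"
    by (intro borel_measurable_scaleR borel_measurable_indicator vm)
  also have "?this \<longleftrightarrow> (\<lambda>y. indicator {..fst (fst y)} (snd y) *\<^sub>R v (snd y) (snd (fst y))) \<in> borel_measurable (TM T M \<Otimes>\<^sub>M TL T)"
    by (rule measurable_cong) (simp add: indicator_def)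
  finally have "(\<lambda>z. \<integral>s. indicator {..fst z} s *\<^sub>R v s (snd z) \<partial>TL T) \<in> borel_measurable (TM T M)"
    by (intro TL.borel_measurable_lebesgue_integral) (simp only: case_prod_beta')
  then show ?thesis unfolding meas_proc_def
    by (rule measurable_cong[THEN iffD2, rotated]) (rule eq)
qed

text \<open>The squared integral is at most T times the energy of the path, whatever the endpoint;
  averaging gives a bound uniform in time.\<close>

lemma bddL2_integral:
  fixes v :: "real \<Rightarrow> 'w \<Rightarrow> 'b::euclidean_space"
  assumes v: "L2P v"
  shows "bddL2 (\<lambda>t \<omega>. LBINT s:{0..t}. v s \<omega>)"
proof -
  have m: "meas_proc (\<lambda>t \<omega>. LBINT s:{0..t}. v s \<omega>)" by (rule meas_proc_integral[OF L2P_meas[OF v]])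
  define c where "c = msq (TM T M) (\<lambda>z. v (fst z) (snd z))"
  have c: "c < \<infinity>" using v unfolding L2P_def L2_iff_nn_integral c_def by blast
  have "msq M (\<lambda>\<omega>. LBINT s:{0..t}. v s \<omega>) \<le> ennreal T * c" if t: "t \<in> {0..T}" for t
  proof -
    have "msq M (\<lambda>\<omega>. LBINT s:{0..t}. v s \<omega>)
      \<le> (\<integral>\<^sup>+\<omega>. ennreal T * msq (TL T) (\<lambda>s. v s \<omega>) \<partial>M)"
      by (intro nn_integral_mono integral_square_le[OF t] meas_proc_path[OF L2P_meas[OF v]])
    also have "\<dots> = ennreal T * c"
      unfolding c_def nn_integral_TM_path[OF L2P_meas[OF v]]
    proof (rule nn_integral_cmult)
      have "(\<lambda>y. ennreal ((norm (v (snd y) (fst y)))\<^sup>2)) \<in> borel_measurable (M \<Otimes>\<^sub>M TL T)"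
        using measurable_compose[OF measurable_Pair[OF measurable_snd measurable_fst]
            nn_integral_L2_measurable[OF L2P_meas[OF v, unfolded meas_proc_def]]] by (simp only: fst_conv snd_conv)
      then show "(\<lambda>\<omega>. \<integral>\<^sup>+s. ennreal ((norm (v s \<omega>))\<^sup>2) \<partial>TL T) \<in> borel_measurable M"
        by (intro TL.borel_measurable_nn_integral) (simp only: case_prod_beta')
    qed
    finally show ?thesis .
  qed
  moreover have "ennreal T * c = ennreal (T * enn2real c)"
    using c T_pos by (simp add: ennreal_mult')
  ultimately show ?thesis by (intro bddL2I[OF m]) simp
qed

end

section \<open>Adaptedness\<close>

lemma prog_measurable_iff:
  "prog_measurable T G \<alpha> \<longleftrightarrow>
    (\<forall>t\<in>{0..T}. (\<lambda>z. \<alpha> (fst z) (snd z)) \<in> borel_measurable (restrict_space borel {0..t} \<Otimes>\<^sub>M G t))"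
  unfolding prog_measurable_def case_prod_beta' ..

lemma prog_bilinear:
  fixes p :: "'a::euclidean_space \<Rightarrow> 'b::euclidean_space \<Rightarrow> 'c::euclidean_space"
  shows "bounded_bilinear p \<Longrightarrow> prog_measurable T G X \<Longrightarrow> prog_measurable T G Y \<Longrightarrow>
    prog_measurable T G (\<lambda>t \<omega>. p (X t \<omega>) (Y t \<omega>))"
  unfolding prog_measurable_iff
  by (intro ballI) (rule bounded_bilinear_measurable[of p], assumption, erule (1) bspec, erule (1) bspec)

lemma prog_add:
  fixes X Y :: "real \<Rightarrow> 'w \<Rightarrow> 'b::euclidean_space"
  shows "prog_measurable T G X \<Longrightarrow> prog_measurable T G Y \<Longrightarrow> prog_measurable T G (\<lambda>t \<omega>. X t \<omega> + Y t \<omega>)"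
  unfolding prog_measurable_iff
  by (intro ballI borel_measurable_add) (erule (1) bspec)+

lemma prog_diff:
  fixes X Y :: "real \<Rightarrow> 'w \<Rightarrow> 'b::euclidean_space"
  shows "prog_measurable T G X \<Longrightarrow> prog_measurable T G Y \<Longrightarrow> prog_measurable T G (\<lambda>t \<omega>. X t \<omega> - Y t \<omega>)"
  unfolding prog_measurable_iff
  by (intro ballI borel_measurable_diff) (erule (1) bspec)+

lemma prog_coef:
  fixes c :: "real \<Rightarrow> 'b::euclidean_space"
  assumes "L_infty T c" shows "prog_measurable T G (\<lambda>t \<omega>. c t)"
  unfolding prog_measurable_iff
proof
  fix t assume t: "t \<in> {0..T}"
  have "c \<in> borel_measurable (restrict_space borel {0..t})"
    by (rule measurable_restrict_mono[of _ _ "{0..T}"])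
       (use assms t in \<open>auto simp: L_infty_def set_borel_measurable_iff_restrict\<close>)
  then show "(\<lambda>z. c (fst z)) \<in> borel_measurable (restrict_space borel {0..t} \<Otimes>\<^sub>M G t)"
    by (rule measurable_compose[OF measurable_fst])
qed

lemma prog_mv:
  "L_infty T A \<Longrightarrow> prog_measurable T G X \<Longrightarrow> prog_measurable T G (\<lambda>t \<omega>. (A t :: real^'n^'m) *v X t \<omega>)"
  by (intro prog_bilinear[OF bounded_bilinear_mv] prog_coef)

lemma prog_scaleR:
  fixes X :: "real \<Rightarrow> 'w \<Rightarrow> 'b::euclidean_space"
  shows "prog_measurable T G X \<Longrightarrow> prog_measurable T G (\<lambda>t \<omega>. c *\<^sub>R X t \<omega>)"
  using prog_bilinear[OF bounded_bilinear_scaleR prog_coef[OF L_infty_continuous[OF continuous_on_const]]] .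

lemma prog_time:
  assumes "prog_measurable T G X" "t \<in> {0..T}" shows "X t \<in> borel_measurable (G t)"
proof -
  have "(\<lambda>z. X (fst z) (snd z)) \<in> borel_measurable (restrict_space borel {0..t} \<Otimes>\<^sub>M G t)"
    using assms unfolding prog_measurable_iff by blast
  from measurable_Pair2[OF this, of t] show ?thesis using assms(2) by (simp add: space_restrict_space)
qed

text \<open>Used for three filtrations: \<open>filt D\<close>, \<open>filt1 D\<close>, and the
  constant one with value \<open>filt D 0\<close>, with respect to which \<mu> and \<delta> are
  adapted.\<close>

locale filt_space = time_space T M for T :: real and M :: "'w measure" +
  fixes G :: "real \<Rightarrow> 'w measure"
  assumes complete_M: "complete_measure M"
    and sub_G: "\<And>t. t \<in> {0..T} \<Longrightarrow> subalgebra M (G t)"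
    and mono_G: "\<And>s t. 0 \<le> s \<Longrightarrow> s \<le> t \<Longrightarrow> t \<le> T \<Longrightarrow> sets (G s) \<subseteq> sets (G t)"
    and null_G: "\<And>t. t \<in> {0..T} \<Longrightarrow> null_sets M \<subseteq> sets (G t)"
begin

lemma space_G: "t \<in> {0..T} \<Longrightarrow> space (G t) = space M"
  using sub_G unfolding subalgebra_def by blast

lemma G_measurable_M: "t \<in> {0..T} \<Longrightarrow> f \<in> measurable (G t) N \<Longrightarrow> f \<in> measurable M N"
  by (rule measurable_from_subalg[OF sub_G])

lemma G_measurable_mono:
  assumes "0 \<le> s" "s \<le> t" "t \<le> T" "f \<in> measurable (G s) N" shows "f \<in> measurable (G t) N"
proof (rule measurable_from_subalg[OF _ assms(4)])
  have "s \<in> {0..T}" "t \<in> {0..T}" using assms(1-3) by auto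
  then show "subalgebra (G t) (G s)"
    unfolding subalgebra_def using mono_G[OF assms(1-3)] by (simp add: space_G)
qed

text \<open>The preimages under the two functions differ only inside a null set N; by completeness
  every subset of N is null, and null sets belong to \<open>G t\<close>.\<close>

lemma adapted_AE:
  assumes t: "t \<in> {0..T}" and f: "f \<in> borel_measurable (G t)" and eq: "AE \<omega> in M. f \<omega> = g \<omega>"
  shows "g \<in> borel_measurable (G t)"
proof (rule measurableI)
  fix S :: "'a set" assume S: "S \<in> sets borel"
  obtain N where N: "N \<in> null_sets M" "{\<omega> \<in> space M. f \<omega> \<noteq> g \<omega>} \<subseteq> N"
    using eq unfolding eventually_ae_filter by blast
  have NG: "N \<in> sets (G t)" using N(1) null_G[OF t] by (rule subsetD[rotated])
  have "g -` S \<inter> N \<in> null_sets M" by (rule complete_measure.complete2[OF complete_M Int_lower2 N(1)])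
  then have "g -` S \<inter> N \<in> sets (G t)" by (rule subsetD[OF null_G[OF t]])
  moreover have "f -` S \<inter> space (G t) \<in> sets (G t)" using f S by (rule measurable_sets)
  ultimately have "(f -` S \<inter> space (G t) - N) \<union> (g -` S \<inter> N) \<in> sets (G t)"
    by (intro sets.Un sets.Diff NG)
  also have "(f -` S \<inter> space (G t) - N) \<union> (g -` S \<inter> N) = g -` S \<inter> space (G t)"
  proof -
    have "N \<subseteq> space M" using sets.sets_into_space[OF NG] space_G[OF t] by simp
    moreover have "f \<omega> = g \<omega>" if "\<omega> \<in> space M" "\<omega> \<notin> N" for \<omega> using N(2) that by blast
    ultimately show ?thesis unfolding space_G[OF t] by auto
  qed
  finally show "g -` S \<inter> space (G t) \<in> sets (G t)" .
qed simp

lemma adapted_lim: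
  fixes f :: "nat \<Rightarrow> 'w \<Rightarrow> 'b::{banach, second_countable_topology}"
  assumes t: "t \<in> {0..T}" and f: "\<And>n. f n \<in> borel_measurable (G t)"
    and lim: "AE \<omega> in M. (\<lambda>n. f n \<omega>) \<longlonglongrightarrow> g \<omega>"
  shows "g \<in> borel_measurable (G t)"
proof (rule adapted_AE[OF t])
  show "(\<lambda>\<omega>. lim (\<lambda>n. f n \<omega>)) \<in> borel_measurable (G t)" by (rule borel_measurable_lim_metric[OF f])
  show "AE \<omega> in M. lim (\<lambda>n. f n \<omega>) = g \<omega>" using lim by eventually_elim (rule limI)
qed

text \<open>The squared distances tend to 0 in L1, so a subsequence tends to 0 almost surely, and
  almost sure limits stay measurable because \<open>G t\<close> contains the null sets.\<close>

lemma adapted_L2_lim: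
  fixes f :: "nat \<Rightarrow> 'w \<Rightarrow> 'b::euclidean_space"
  assumes t: "t \<in> {0..T}" and f: "\<And>n. f n \<in> borel_measurable (G t)" and g: "g \<in> borel_measurable M"
    and lim: "(\<lambda>n. \<integral>\<^sup>+\<omega>. ennreal ((norm (f n \<omega> - g \<omega>))\<^sup>2) \<partial>M) \<longlonglongrightarrow> 0"
  shows "g \<in> borel_measurable (G t)"
proof -
  let ?I = "\<lambda>n. \<integral>\<^sup>+\<omega>. ennreal ((norm (f n \<omega> - g \<omega>))\<^sup>2) \<partial>M"
  have fm: "f n \<in> borel_measurable M" for n by (rule G_measurable_M[OF t f])
  have um: "(\<lambda>\<omega>. (norm (f n \<omega> - g \<omega>))\<^sup>2) \<in> borel_measurable M" for n
    using fm[of n] g by measurable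
  \<comment> \<open>The distances may be infinite for small n; beyond \<open>N\<close> the squared
    distances are integrable.\<close>
  obtain N where N: "\<And>n. n \<ge> N \<Longrightarrow> ?I n < 1"
    using order_tendstoD(2)[OF lim, of 1] unfolding eventually_sequentially by auto
  define u where "u = (\<lambda>n \<omega>. (norm (f (n + N) \<omega> - g \<omega>))\<^sup>2)"
  have nn: "(\<integral>\<^sup>+\<omega>. ennreal (norm (u n \<omega>)) \<partial>M) = ?I (n + N)" for n unfolding u_def by simp
  have ui: "integrable M (u n)" for n
  proof (rule integrableI_bounded)
    show "u n \<in> borel_measurable M" unfolding u_def by (rule um)
    have "?I (n + N) < 1" by (rule N) simp
    also have "(1::ennreal) < \<infinity>" by simp
    finally show "(\<integral>\<^sup>+\<omega>. ennreal (norm (u n \<omega>)) \<partial>M) < \<infinity>" unfolding nn .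
  qed
  have "(\<lambda>n. ennreal (\<integral>\<omega>. norm (u n \<omega>) \<partial>M)) \<longlonglongrightarrow> 0"
  proof -
    have "ennreal (\<integral>\<omega>. norm (u n \<omega>) \<partial>M) = ?I (n + N)" for n
      unfolding nn[symmetric] by (rule nn_integral_eq_integral[symmetric]) (use ui in auto)
    then show ?thesis using LIMSEQ_ignore_initial_segment[OF lim, of N] by simp
  qed
  then have "(\<lambda>n. \<integral>\<omega>. norm (u n \<omega>) \<partial>M) \<longlonglongrightarrow> 0"
    by (intro tendsto_ennrealD[where x=0]) auto
  from tendsto_L1_AE_subseq[OF ui this] obtain r where r: "AE \<omega> in M. (\<lambda>n. u (r n) \<omega>) \<longlonglongrightarrow> 0" by blast
  show ?thesis
  proof (rule adapted_lim[OF t])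
    show "f (r n + N) \<in> borel_measurable (G t)" for n by (rule f)
    show "AE \<omega> in M. (\<lambda>n. f (r n + N) \<omega>) \<longlonglongrightarrow> g \<omega>" using r
    proof eventually_elim
      case (elim \<omega>)
      then have "(\<lambda>n. sqrt (u (r n) \<omega>)) \<longlonglongrightarrow> sqrt 0" by (rule tendsto_real_sqrt)
      then have "(\<lambda>n. norm (f (r n + N) \<omega> - g \<omega>)) \<longlonglongrightarrow> 0" unfolding u_def by simp
      then show ?case using LIM_zero_cancel tendsto_norm_zero_iff by blast
    qed
  qed
qed

lemma prog_continuous:
  fixes X :: "real \<Rightarrow> 'w \<Rightarrow> 'b::euclidean_space"
  assumes c: "\<And>\<omega>. \<omega> \<in> space M \<Longrightarrow> continuous_on {0..T} (\<lambda>t. X t \<omega>)"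
    and m: "\<And>t. t \<in> {0..T} \<Longrightarrow> X t \<in> borel_measurable (G t)"
  shows "prog_measurable T G X"
  unfolding prog_measurable_iff
proof
  fix t assume t: "t \<in> {0..T}"
  show "(\<lambda>z. X (fst z) (snd z)) \<in> borel_measurable (restrict_space borel {0..t} \<Otimes>\<^sub>M G t)"
  proof (rule jointly_measurable_continuous)
    show "0 \<le> t" using t by simp
    show "continuous_on {0..t} (\<lambda>s. X s \<omega>)" if "\<omega> \<in> space (G t)" for \<omega>
      by (rule continuous_on_subset[OF c]) (use that t space_G[OF t] in auto)
    show "X s \<in> borel_measurable (G t)" if "s \<in> {0..t}" for s
      by (rule G_measurable_mono[OF _ _ _ m]) (use that t in auto)
  qed
qed

lemma prog_meas_proc:
  assumes X: "prog_measurable T G X" shows "meas_proc X"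
proof -
  have T: "T \<in> {0..T}" using T_pos by simp
  have "(\<lambda>z. X (fst z) (snd z)) \<in> borel_measurable (restrict_space borel {0..T} \<Otimes>\<^sub>M G T)"
    using X T unfolding prog_measurable_iff by blast
  then have "(\<lambda>z. X (fst z) (snd z)) \<in> borel_measurable (restrict_space borel {0..T} \<Otimes>\<^sub>M M)"
  proof (rule measurable_from_subalg[rotated])
    show "subalgebra (restrict_space borel {0..T} \<Otimes>\<^sub>M M) (restrict_space borel {0..T} \<Otimes>\<^sub>M G T)"
      using sub_G[OF T] unfolding subalgebra_def sets_pair_measure space_pair_measure
      by (auto intro!: sigma_sets_mono')
  qed
  then show ?thesis unfolding meas_proc_def measurable_TL_cong .
qed

lemma prog_integral:
  fixes v :: "real \<Rightarrow> 'w \<Rightarrow> 'b::euclidean_space"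
  assumes v: "prog_measurable T G v" and t: "t \<in> {0..T}"
  shows "(\<lambda>\<omega>. LBINT s:{0..t}. v s \<omega>) \<in> borel_measurable (G t)"
proof -
  interpret t: finite_measure "TL t" by (rule finite_measure_TL)
  have "(\<lambda>z. v (fst z) (snd z)) \<in> borel_measurable (TL t \<Otimes>\<^sub>M G t)"
    using v t unfolding prog_measurable_iff measurable_TL_cong by blast
  from measurable_compose[OF measurable_Pair[OF measurable_snd measurable_fst] this]
  have "(\<lambda>z. v (snd z) (fst z)) \<in> borel_measurable (G t \<Otimes>\<^sub>M TL t)" by (simp only: fst_conv snd_conv)
  then show ?thesis unfolding LBINT_TL
    by (intro t.borel_measurable_lebesgue_integral) (simp only: case_prod_beta')
qed

text \<open>Continuity and adaptedness of one iterate make it progressively measurable, which is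
  what keeps its integral over [0, t] measurable at time t.\<close>

lemma volterra_power_adapted:
  assumes A: "L_infty T A" and c: "\<And>\<omega>. \<omega> \<in> space M \<Longrightarrow> continuous_on {0..T} (\<lambda>t. f t \<omega>)"
    and m: "\<And>t. t \<in> {0..T} \<Longrightarrow> f t \<in> borel_measurable (G t)" and t: "t \<in> {0..T}"
  shows "(\<lambda>\<omega>. (volterra A ^^ n) (\<lambda>s. f s \<omega>) t) \<in> borel_measurable (G t)"
  using t
proof (induction n arbitrary: t)
  case 0 then show ?case using m by simp
next
  case (Suc n)
  have eq: "(volterra A ^^ Suc n) g t = (LBINT s:{0..t}. A s *v (volterra A ^^ n) g s)" for g t
    by (simp only: funpow.simps comp_apply volterra_def[of A "(volterra A ^^ n) g" t])
  have "prog_measurable T G (\<lambda>s \<omega>. (volterra A ^^ n) (\<lambda>s. f s \<omega>) s)"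
    by (rule prog_continuous[OF continuous_on_volterra_power[OF A c] Suc.IH])
  from prog_integral[OF prog_mv[OF A this] Suc.prems]
  show ?case unfolding eq .
qed

lemma picard_adapted:
  assumes A: "L_infty T A" and c: "\<And>\<omega>. \<omega> \<in> space M \<Longrightarrow> continuous_on {0..T} (\<lambda>t. f t \<omega>)"
    and m: "\<And>t. t \<in> {0..T} \<Longrightarrow> f t \<in> borel_measurable (G t)" and t: "t \<in> {0..T}"
  shows "(\<lambda>\<omega>. picard A (\<lambda>s. f s \<omega>) t) \<in> borel_measurable (G t)"
proof (rule borel_measurable_LIMSEQ_metric)
  show "(\<lambda>\<omega>. \<Sum>i<n. (volterra A ^^ i) (\<lambda>s. f s \<omega>) t) \<in> borel_measurable (G t)" for n
    by (intro borel_measurable_sum volterra_power_adapted[OF A c m t])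
  show "(\<lambda>n. \<Sum>i<n. (volterra A ^^ i) (\<lambda>s. f s \<omega>) t) \<longlonglongrightarrow> picard A (\<lambda>s. f s \<omega>) t"
    if "\<omega> \<in> space (G t)" for \<omega>
    using that space_G[OF t] by (intro picard_solution(3)[OF A c t]) simp
qed

text \<open>The exceptional null set is removed from the forcing term so that Picard's series can be used for every path.\<close>

lemma adapted_linear_ode:
  fixes A :: "real \<Rightarrow> real^'n^'n"
  assumes A: "L_infty T A" and c: "AE \<omega> in M. continuous_on {0..T} (\<lambda>t. f t \<omega>)"
    and m: "\<And>t. t \<in> {0..T} \<Longrightarrow> f t \<in> borel_measurable (G t)"
  shows "\<exists>x. (\<forall>\<omega>\<in>space M. continuous_on {0..T} (\<lambda>t. x t \<omega>)) \<and>
    (\<forall>t\<in>{0..T}. x t \<in> borel_measurable (G t)) \<and>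
    (AE \<omega> in M. \<forall>t\<in>{0..T}. x t \<omega> = f t \<omega> + (LBINT s:{0..t}. A s *v x s \<omega>))"
proof -
  obtain N where N: "N \<in> null_sets M" "{\<omega> \<in> space M. \<not> continuous_on {0..T} (\<lambda>t. f t \<omega>)} \<subseteq> N"
    using c unfolding eventually_ae_filter by blast
  define g where "g = (\<lambda>t \<omega>. if \<omega> \<in> N then 0 else f t \<omega>)"
  have AE_N: "AE \<omega> in M. \<omega> \<notin> N" by (rule AE_not_in[OF N(1)])
  have gc: "continuous_on {0..T} (\<lambda>t. g t \<omega>)" if "\<omega> \<in> space M" for \<omega>
    using N(2) that by (cases "\<omega> \<in> N") (auto simp: g_def)
  have gm: "g t \<in> borel_measurable (G t)" if "t \<in> {0..T}" for t
    by (rule adapted_AE[OF that m[OF that]]) (use AE_N in eventually_elim, simp add: g_def)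
  show ?thesis
  proof (intro exI[of _ "\<lambda>t \<omega>. picard A (\<lambda>s. g s \<omega>) t"] conjI ballI)
    show "continuous_on {0..T} (\<lambda>t. picard A (\<lambda>s. g s \<omega>) t)" if "\<omega> \<in> space M" for \<omega>
      using picard_solution(1)[OF A gc[OF that]] by simp
    show "(\<lambda>\<omega>. picard A (\<lambda>s. g s \<omega>) t) \<in> borel_measurable (G t)" if "t \<in> {0..T}" for t
      by (rule picard_adapted[OF A gc gm that])
    show "AE \<omega> in M. \<forall>t\<in>{0..T}. picard A (\<lambda>s. g s \<omega>) t = f t \<omega> + (LBINT s:{0..t}. A s *v picard A (\<lambda>s. g s \<omega>) s)"
      using AE_N AE_space
    proof eventually_elim
      case (elim \<omega>)
      then have "g = (\<lambda>t \<omega>. g t \<omega>)" "\<And>t. g t \<omega> = f t \<omega>" by (auto simp: g_def)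
      then show ?case using picard_solution(2)[OF A gc[OF elim(2)]] by metis
    qed
  qed
qed

end

context time_space
begin

text \<open>The pathwise bound by |f(t)| and the time integral of |f|, squared and averaged; both
  summands have uniformly bounded second moments.\<close>

lemma bddL2_linear_ode:
  fixes A :: "real \<Rightarrow> real^'n^'n"
  assumes A: "L_infty T A" and f: "bddL2 f" and x: "meas_proc x"
    and fc: "AE \<omega> in M. continuous_on {0..T} (\<lambda>t. f t \<omega>)" and xc: "AE \<omega> in M. continuous_on {0..T} (\<lambda>t. x t \<omega>)"
    and eq: "AE \<omega> in M. \<forall>t\<in>{0..T}. x t \<omega> = f t \<omega> + (LBINT s:{0..t}. A s *v x s \<omega>)"
  shows "bddL2 x"
proof -
  obtain K where K: "K \<ge> 0" "AE t in lborel. t \<in> {0..T} \<longrightarrow> norm (A t) \<le> K" using L_infty_bound[OF A] .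
  define C where "C = K * exp (K * T)"
  have C: "C \<ge> 0" unfolding C_def using K(1) by simp
  have "(\<lambda>z. norm (f (fst z) (snd z))) \<in> borel_measurable (TM T M)"
    using bddL2_meas[OF f] unfolding meas_proc_def by (rule measurable_compose[OF _ borel_measurable_norm])
  moreover have "integrable (TM T M) (\<lambda>z. (norm (norm (f (fst z) (snd z))))\<^sup>2)"
    using bddL2_L2P[OF f] unfolding L2P_def L2_def by simp
  ultimately have nf: "L2P (\<lambda>t \<omega>. norm (f t \<omega>))" unfolding L2P_def L2_def by blast
  let ?F = "\<lambda>t \<omega>. LBINT s:{0..t}. norm (f s \<omega>)"
  have F: "bddL2 ?F" by (rule bddL2_integral[OF nf])
  obtain c where c: "c \<ge> 0" "\<And>t. t \<in> {0..T} \<Longrightarrow> msq M (f t) \<le> ennreal c"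
    using bddL2_bound[OF f] by blast
  obtain d where d: "d \<ge> 0" "\<And>t. t \<in> {0..T} \<Longrightarrow> msq M (?F t) \<le> ennreal d"
    using bddL2_bound[OF F] by blast
  show ?thesis
  proof (rule bddL2I[OF x])
    fix t assume t: "t \<in> {0..T}"
    have "AE \<omega> in M. ennreal ((norm (x t \<omega>))\<^sup>2) \<le> ennreal ((norm (norm (f t \<omega>) + C * ?F t \<omega>))\<^sup>2)"
      using fc xc eq
    proof eventually_elim
      case (elim \<omega>)
      have "norm (x t \<omega>) \<le> norm (f t \<omega>) + C * ?F t \<omega>"
        unfolding C_def by (rule linear_ode_bound[OF A K(2,1) elim(1,2) _ t]) (use elim(3) in blast)
      then show ?case by (intro ennreal_leI power_mono) auto
    qed
    then have "msq M (x t) \<le> msq M (\<lambda>\<omega>. norm (f t \<omega>) + C * ?F t \<omega>)"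
      by (rule nn_integral_mono_AE)
    also have "\<dots> \<le> 2 * msq M (\<lambda>\<omega>. norm (f t \<omega>)) + 2 * msq M (\<lambda>\<omega>. C * ?F t \<omega>)"
      by (rule nn_integral_add_square_le)
         (use bddL2_rv[OF f t] bddL2_rv[OF F t] in \<open>auto intro!: borel_measurable_times measurable_compose[OF _ borel_measurable_norm]\<close>)
    also have "msq M (\<lambda>\<omega>. C * ?F t \<omega>) = ennreal (C\<^sup>2) * msq M (?F t)"
    proof -
      have "msq M (\<lambda>\<omega>. C * ?F t \<omega>) = (\<integral>\<^sup>+\<omega>. ennreal (C\<^sup>2) * ennreal ((norm (?F t \<omega>))\<^sup>2) \<partial>M)"
        by (intro nn_integral_cong) (simp add: ennreal_mult power_mult_distrib)
      also have "\<dots> = ennreal (C\<^sup>2) * msq M (?F t)"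
        by (rule nn_integral_cmult[OF nn_integral_L2_measurable[OF bddL2_rv[OF F t]]])
      finally show ?thesis .
    qed
    also have "2 * msq M (\<lambda>\<omega>. norm (f t \<omega>)) + 2 * (ennreal (C\<^sup>2) * msq M (?F t))
       \<le> ennreal 2 * ennreal c + ennreal 2 * (ennreal (C\<^sup>2) * ennreal d)"
      using c(2)[OF t] d(2)[OF t] by (simp only: ennreal_numeral real_norm_def abs_norm_cancel) (intro add_mono mult_left_mono zero_le)
    also have "\<dots> = ennreal (2 * c + 2 * (C\<^sup>2 * d))"
      using c(1) d(1) by (simp only: ennreal_plus ennreal_mult mult_nonneg_nonneg zero_le_numeral zero_le_power2)
    finally show "msq M (x t) \<le> ennreal (2 * c + 2 * (C\<^sup>2 * d))" .
  qed
qed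

end

section \<open>Gaussian moments\<close>

text \<open>Preimages of Borel sets already form a sigma-algebra, so independence of two families
  containing them is independence of the random variables.\<close>

lemma (in prob_space) indep_expectation_mult:
  fixes f g :: "'a \<Rightarrow> real"
  assumes ind: "indep_set \<A> \<B>" and f: "integrable M f" and g: "integrable M g"
    and fA: "\<And>S. S \<in> sets borel \<Longrightarrow> f -` S \<inter> space M \<in> \<A>"
    and gB: "\<And>S. S \<in> sets borel \<Longrightarrow> g -` S \<inter> space M \<in> \<B>"
  shows "integrable M (\<lambda>\<omega>. f \<omega> * g \<omega>)"
    and "expectation (\<lambda>\<omega>. f \<omega> * g \<omega>) = expectation f * expectation g"
proof -
  have sub: "sigma_sets (space M) {h -` S \<inter> space M | S. S \<in> sets borel} = {h -` S \<inter> space M | S. S \<in> sets borel}"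
    for h :: "'a \<Rightarrow> real"
  proof -
    have B: "sigma_sets UNIV (sets (borel :: real measure)) = sets borel"
      using sets.sigma_sets_eq[of "borel :: real measure"] by (simp only: space_borel)
    have "h \<in> space M \<rightarrow> UNIV" by simp
    from sigma_sets_vimage_commute[OF this, of "sets borel"] show ?thesis unfolding B by (rule sym)
  qed
  have "indep_var borel f borel g"
    unfolding indep_var_eq sub indep_sets2_eq
    using borel_measurable_integrable[OF f] borel_measurable_integrable[OF g] ind[unfolded indep_sets2_eq] fA gB
    by (auto intro!: measurable_sets)
  from indep_var_integrable[OF this f g] indep_var_lebesgue_integral[OF this f g]
  show "integrable M (\<lambda>\<omega>. f \<omega> * g \<omega>)" "expectation (\<lambda>\<omega>. f \<omega> * g \<omega>) = expectation f * expectation g" .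
qed

text \<open>\<open>lborel\<close> is the image of the product measure under the coordinate
  representation, and Fubini holds for products of functions of one coordinate each.\<close>

lemma lborel_prod_integral:
  fixes f :: "'a::euclidean_space \<Rightarrow> real \<Rightarrow> real"
  assumes f: "\<And>b. b \<in> Basis \<Longrightarrow> integrable lborel (f b)"
  shows "(\<integral>x. (\<Prod>b\<in>Basis. f b (x \<bullet> b)) \<partial>lborel) = (\<Prod>b\<in>Basis. (\<integral>x. f b x \<partial>lborel))"
    and "integrable lborel (\<lambda>x. \<Prod>b\<in>Basis. f b (x \<bullet> b))"
proof -
  interpret product_sigma_finite "\<lambda>_::'a. lborel :: real measure" ..
  have [measurable]: "f b \<in> borel_measurable borel" if "b \<in> Basis" for b
    using borel_measurable_integrable[OF f[OF that]] by simp
  have m: "(\<lambda>x::'a. \<Prod>b\<in>Basis. f b (x \<bullet> b)) \<in> borel_measurable borel" by measurable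
  have g: "(\<lambda>f. \<Sum>b\<in>Basis. f b *\<^sub>R b) \<in> measurable (\<Pi>\<^sub>M b\<in>Basis. lborel :: real measure) (borel :: 'a measure)" by measurable
  have e: "(\<Prod>b\<in>Basis. f b ((\<Sum>c\<in>Basis. y c *\<^sub>R c) \<bullet> b)) = (\<Prod>b\<in>Basis. f b (y b))" for y :: "'a \<Rightarrow> real"
    by (intro prod.cong refl) simp
  show "(\<integral>x. (\<Prod>b\<in>Basis. f b (x \<bullet> b)) \<partial>lborel) = (\<Prod>b\<in>Basis. (\<integral>x. f b x \<partial>lborel))"
    unfolding lborel_eq[where 'a='a] integral_distr[OF g m] e
    by (rule product_integral_prod) (use f in auto)
  show "integrable lborel (\<lambda>x. \<Prod>b\<in>Basis. f b (x \<bullet> b))"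
    unfolding lborel_eq[where 'a='a] integrable_distr_eq[OF g m] e
    by (rule product_integrable_prod) (use f in auto)
qed

lemma prod_Basis_vec: "(\<Prod>b\<in>(Basis::(real^'d) set). g b) = (\<Prod>i\<in>UNIV. g (axis i 1))"
proof -
  have B: "(Basis::(real^'d) set) = (\<lambda>i. axis i 1) ` UNIV" by (auto simp: Basis_vec_def)
  have "inj (\<lambda>i::'d. axis i (1::real))" by (auto simp: inj_on_def axis_eq_axis)
  then show ?thesis unfolding B by (subst prod.reindex) auto
qed

lemma gaussian_moments:
  fixes i j :: "'d::finite" and \<sigma> :: real
  assumes \<sigma>: "\<sigma> > 0"
  defines "p \<equiv> \<lambda>x::real^'d. \<Prod>i\<in>UNIV. normal_density 0 \<sigma> (x $ i)"
  shows "integrable lborel (\<lambda>x. p x * x $ i)" "(\<integral>x. p x * x $ i \<partial>lborel) = 0"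
    and "integrable lborel (\<lambda>x. p x * (x $ i * x $ j))"
    and "(\<integral>x. p x * (x $ i * x $ j) \<partial>lborel) = (if i = j then \<sigma>\<^sup>2 else 0)"
proof -
  let ?n = "normal_density 0 \<sigma>"
  have n0: "integrable lborel ?n" "(\<integral>x. ?n x \<partial>lborel) = 1"
    using integrable_normal_density[OF \<sigma>] integral_normal_density[OF \<sigma>] by auto
  have n1: "integrable lborel (\<lambda>x. ?n x * x)" "(\<integral>x. ?n x * x \<partial>lborel) = 0"
    using integrable_normal_moment_nz_1[OF \<sigma>, of 0] integral_normal_moment_nz_1[OF \<sigma>, of 0] by auto
  have n2: "integrable lborel (\<lambda>x. ?n x * (x * x))" "(\<integral>x. ?n x * (x * x) \<partial>lborel) = \<sigma>\<^sup>2"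
    using integrable_normal_moment[OF \<sigma>, of 0 2] integral_normal_moment_even[OF \<sigma>, of 0 1]
    by (auto simp: power2_eq_square)
  \<comment> \<open>Each monomial is absorbed into the density of its own coordinate, the other
    factors integrate to 1. For i = j both monomials meet in one factor, giving the variance;
    otherwise a factor of mean 0 appears.\<close>
  define f where "f = (\<lambda>(b::real^'d) u. ?n u * (if b = axis i 1 then u else 1))"
  define g where "g = (\<lambda>(b::real^'d) u. ?n u * ((if b = axis i 1 then u else 1) * (if b = axis j 1 then u else 1)))"
  have fi: "integrable lborel (f b)" for b using n0 n1 unfolding f_def by (cases "b = axis i 1") simp_all
  have gi: "integrable lborel (g b)" for b
    using n0 n1 n2 unfolding g_def by (cases "b = axis i 1"; cases "b = axis j 1") simp_all
  have one: "(\<Prod>k\<in>UNIV. if k = l then h k else 1) = h l" for h :: "'d \<Rightarrow> real" and l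
    by (subst prod.delta) auto
  have ax: "(axis k (1::real) = (axis l 1 :: real^'d)) = (k = l)" for k l by (auto simp: axis_eq_axis)
  have pf: "p x * x $ i = (\<Prod>b\<in>Basis. f b (x \<bullet> b))" for x
    unfolding prod_Basis_vec p_def f_def ax prod.distrib
    using one[of i "\<lambda>k. x $ k"] by (simp add: inner_axis)
  have pg: "p x * (x $ i * x $ j) = (\<Prod>b\<in>Basis. g b (x \<bullet> b))" for x
    unfolding prod_Basis_vec p_def g_def ax prod.distrib
    using one[of i "\<lambda>k. x $ k"] one[of j "\<lambda>k. x $ k"] by (simp add: inner_axis)
  show "integrable lborel (\<lambda>x. p x * x $ i)" "integrable lborel (\<lambda>x. p x * (x $ i * x $ j))"
    unfolding pf pg by (intro lborel_prod_integral(2) fi gi)+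
  have F: "(\<integral>x. (\<Prod>b\<in>Basis. f b (x \<bullet> b)) \<partial>lborel) = (\<Prod>k\<in>UNIV. \<integral>u. f (axis k 1) u \<partial>lborel)"
    by (subst lborel_prod_integral(1)[OF fi]) (rule prod_Basis_vec)
  have G: "(\<integral>x. (\<Prod>b\<in>Basis. g b (x \<bullet> b)) \<partial>lborel) = (\<Prod>k\<in>UNIV. \<integral>u. g (axis k 1) u \<partial>lborel)"
    by (subst lborel_prod_integral(1)[OF gi]) (rule prod_Basis_vec)
  have "(\<integral>u. f (axis i 1) u \<partial>lborel) = 0" unfolding f_def using n1 by simp
  then show "(\<integral>x. p x * x $ i \<partial>lborel) = 0"
    unfolding pf F by (intro prod_zero) auto
  have gk: "(\<integral>u. g (axis k 1) u \<partial>lborel) = (if i = j then (if k = i then \<sigma>\<^sup>2 else 1) else (if k = i \<or> k = j then 0 else 1))" for k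
    unfolding g_def ax using n0 n1 n2 by auto
  show "(\<integral>x. p x * (x $ i * x $ j) \<partial>lborel) = (if i = j then \<sigma>\<^sup>2 else 0)"
    unfolding pg G gk
    using one[of i "\<lambda>k. \<sigma>\<^sup>2"] by auto
qed

lemma L2_component: "L2 N (f :: _ \<Rightarrow> real^'n) \<Longrightarrow> L2 N (\<lambda>x. f x $ i)"
  by (rule L2_bounded[where c=1])
     (auto simp: L2_def component_le_norm_cart intro: measurable_compose[OF _ borel_measurable_nth])

lemma L2_vecI:
  assumes "\<And>i. L2 N (\<lambda>x. f x $ i)" shows "L2 N (f :: _ \<Rightarrow> real^'n)"
proof -
  have fm: "f \<in> borel_measurable N"
    using assms L2_measurable unfolding borel_measurable_euclidean_space[of f]
    by (auto simp: Basis_vec_def inner_axis)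
  have "(norm (f x))\<^sup>2 = (\<Sum>i\<in>UNIV. (norm (f x $ i))\<^sup>2)" for x
    unfolding power2_norm_eq_inner by (simp add: inner_vec_def)
  then have "integrable N (\<lambda>x. (norm (f x))\<^sup>2)"
    using assms unfolding L2_def by (simp add: Bochner_Integration.integrable_sum)
  then show ?thesis using fm unfolding L2_def by blast
qed

lemma L2_mult_integrable:
  fixes f g :: "_ \<Rightarrow> real"
  shows "L2 N f \<Longrightarrow> L2 N g \<Longrightarrow> integrable N (\<lambda>x. f x * g x)"
  using L2_inner_integrable[of N f g] by simp

section \<open>The Wiener integral\<close>

text \<open>The length of the intersection is written as the combination of minima that arises when
  the covariance of two Brownian increments is expanded bilinearly.\<close>

lemma overlap_integral:
  fixes a b a' b' :: real
  assumes "a \<le> b" "a' \<le> b'"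
  shows "(\<integral>s. indicator {a<..b} s * indicator {a'<..b'} s \<partial>lborel) = min b b' - min b a' - min a b' + min a a'"
    and "integrable lborel (\<lambda>s. indicator {a<..b} s * indicator {a'<..b'} s :: real)"
proof -
  have e: "indicator {a<..b} s * indicator {a'<..b'} s = (indicator {max a a'<..min b b'} s :: real)" for s
    by (auto simp: indicator_def)
  have "emeasure lborel {max a a'<..min b b'} \<le> emeasure lborel {a..b}" by (rule emeasure_mono) auto
  then have fin: "emeasure lborel {max a a'<..min b b'} < \<infinity>" using assms(1) le_less_trans by fastforce
  have h: "measure lborel {u<..v} = max 0 (v - u)" for u v :: real by (cases "u \<le> v") auto
  show "integrable lborel (\<lambda>s. indicator {a<..b} s * indicator {a'<..b'} s :: real)"
    unfolding e using fin by simp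
  have "(\<integral>s. indicator {a<..b} s * indicator {a'<..b'} s \<partial>lborel) = measure lborel {max a a'<..min b b'}"
    unfolding e by simp
  also have "\<dots> = max 0 (min b b' - max a a')" by (rule h)
  also have "\<dots> = min b b' - min b a' - min a b' + min a a'"
    using assms by (simp add: min_def max_def)
  finally show "(\<integral>s. indicator {a<..b} s * indicator {a'<..b'} s \<partial>lborel) = min b b' - min b a' - min a b' + min a a'" .
qed

locale wiener_space = filt_space T M F for T M F +
  fixes W :: "real \<Rightarrow> 'a \<Rightarrow> real^'d"
  assumes bm: "brownian_motion T M F W"
begin

lemma W_adapted: "t \<in> {0..T} \<Longrightarrow> W t \<in> borel_measurable (F t)"
  using bm unfolding brownian_motion_def by blast

lemma W_measurable: "t \<in> {0..T} \<Longrightarrow> W t \<in> borel_measurable M"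
  by (rule G_measurable_M[OF _ W_adapted])

text \<open>The Gaussian law is prescribed for s < t; the degenerate increment s = t is treated
  apart.\<close>

lemma increment_moments:
  assumes st: "0 \<le> s" "s \<le> t" "t \<le> T"
  shows "L2 M (\<lambda>\<omega>. W t \<omega> - W s \<omega>)" "expectation (\<lambda>\<omega>. (W t \<omega> - W s \<omega>) $ i) = 0"
    and "expectation (\<lambda>\<omega>. (W t \<omega> - W s \<omega>) $ i * (W t \<omega> - W s \<omega>) $ j) = (if i = j then t - s else 0)"
proof -
  have "L2 M (\<lambda>\<omega>. W t \<omega> - W s \<omega>) \<and> expectation (\<lambda>\<omega>. (W t \<omega> - W s \<omega>) $ i) = 0 \<and>
     expectation (\<lambda>\<omega>. (W t \<omega> - W s \<omega>) $ i * (W t \<omega> - W s \<omega>) $ j) = (if i = j then t - s else 0)"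
  proof (cases "s = t")
    case True
    then show ?thesis using L2_const[OF finite_measure_axioms, of "0 :: real^'d"] by simp
  next
    case False
    then have lt: "s < t" using st by simp
    define p where "p = (\<lambda>x::real^'d. \<Prod>i\<in>UNIV. normal_density 0 (sqrt (t - s)) (x $ i))"
    have D: "distributed M lborel (\<lambda>\<omega>. W t \<omega> - W s \<omega>) (\<lambda>x. ennreal (p x))"
      using bm st lt unfolding brownian_motion_def p_def by blast
    have p0: "0 \<le> p x" for x unfolding p_def by (intro prod_nonneg) simp
    have sq: "sqrt (t - s) > 0" "(sqrt (t - s))\<^sup>2 = t - s" using lt by auto
    have pd: "(\<Prod>i\<in>UNIV. normal_density 0 (sqrt (t - s)) (x $ i)) = p x" for x :: "real^'d" by (simp add: p_def)
    note gm = gaussian_moments[where 'd='d, OF sq(1), unfolded sq(2) pd]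
    have m1: "(\<lambda>x::real^'d. x $ i) \<in> borel_measurable lborel" for i by simp
    have m2: "(\<lambda>x::real^'d. x $ i * x $ j) \<in> borel_measurable lborel" for i j by simp
    have "L2 M (\<lambda>\<omega>. W t \<omega> - W s \<omega>)"
    proof (rule L2_vecI)
      fix k
      have "(\<lambda>\<omega>. (W t \<omega> - W s \<omega>) $ k) \<in> borel_measurable M"
        by (rule measurable_compose[OF borel_measurable_diff[OF W_measurable W_measurable] borel_measurable_nth])
           (use st in auto)
      moreover have "integrable M (\<lambda>\<omega>. (W t \<omega> - W s \<omega>) $ k * (W t \<omega> - W s \<omega>) $ k)"
        using distributed_integrable[OF D m2[of k k]] p0 gm(3) by blast
      ultimately show "L2 M (\<lambda>\<omega>. (W t \<omega> - W s \<omega>) $ k)" unfolding L2_def by (simp add: power2_eq_square)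
    qed
    then show ?thesis
      using distributed_integral[OF D m1[of i]] distributed_integral[OF D m2[of i j]] p0 gm(2,4) by simp
  qed
  then show "L2 M (\<lambda>\<omega>. W t \<omega> - W s \<omega>)" "expectation (\<lambda>\<omega>. (W t \<omega> - W s \<omega>) $ i) = 0"
    "expectation (\<lambda>\<omega>. (W t \<omega> - W s \<omega>) $ i * (W t \<omega> - W s \<omega>) $ j) = (if i = j then t - s else 0)" by blast+
qed

text \<open>\<open>Y\<close> is measurable at time s, hence independent of the increment, whose mean
  is 0.\<close>

lemma increment_orthogonal:
  fixes Y :: "'a \<Rightarrow> real"
  assumes st: "0 \<le> s" "s \<le> t" "t \<le> T" and Y: "L2 M Y" "Y \<in> borel_measurable (F s)"
  shows "expectation (\<lambda>\<omega>. Y \<omega> * (W t \<omega> - W s \<omega>) $ j) = 0"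
proof (cases "s = t")
  case False
  then have lt: "s < t" using st by simp
  have ind: "indep_set (sets (F s)) (rv_sigma (space M) (\<lambda>\<omega>. W t \<omega> - W s \<omega>))"
    using bm st lt unfolding brownian_motion_def by blast
  have "expectation (\<lambda>\<omega>. Y \<omega> * (W t \<omega> - W s \<omega>) $ j) = expectation Y * expectation (\<lambda>\<omega>. (W t \<omega> - W s \<omega>) $ j)"
  proof (rule indep_expectation_mult(2)[OF ind])
    show "integrable M Y" by (rule L2_integrable[OF finite_measure_axioms Y(1)])
    show "integrable M (\<lambda>\<omega>. (W t \<omega> - W s \<omega>) $ j)"
      by (rule L2_integrable[OF finite_measure_axioms L2_component[OF increment_moments(1)[OF st]]])
    fix S :: "real set" assume S: "S \<in> sets borel"
    show "Y -` S \<inter> space M \<in> sets (F s)"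
      using measurable_sets[OF Y(2) S] space_G[of s] st by simp
    have "(\<lambda>x::real^'d. x $ j) -` S \<in> sets borel"
      by (rule measurable_sets_borel[OF borel_measurable_nth S])
    then show "(\<lambda>\<omega>. (W t \<omega> - W s \<omega>) $ j) -` S \<inter> space M \<in> rv_sigma (space M) (\<lambda>\<omega>. W t \<omega> - W s \<omega>)"
      unfolding rv_sigma_def by (auto intro!: exI[of _ "(\<lambda>x::real^'d. x $ j) -` S"])
  qed
  then show ?thesis using increment_moments(2)[OF st] by simp
qed simp

lemma increment_L2_adapted:
  assumes "0 \<le> s" "s \<le> t" "t \<le> u" "u \<le> T"
  shows "(\<lambda>\<omega>. (W t \<omega> - W s \<omega>) $ i) \<in> borel_measurable (F u)" "L2 M (\<lambda>\<omega>. (W t \<omega> - W s \<omega>) $ i)"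
proof -
  have "W t \<in> borel_measurable (F u)" "W s \<in> borel_measurable (F u)"
    by (rule G_measurable_mono[OF _ _ _ W_adapted]; use assms in simp)+
  then have "(\<lambda>\<omega>. W t \<omega> - W s \<omega>) \<in> borel_measurable (F u)" by (rule borel_measurable_diff)
  then show "(\<lambda>\<omega>. (W t \<omega> - W s \<omega>) $ i) \<in> borel_measurable (F u)"
    by (rule measurable_compose[OF _ borel_measurable_nth])
  show "L2 M (\<lambda>\<omega>. (W t \<omega> - W s \<omega>) $ i)"
    by (rule L2_component[OF increment_moments(1)]) (use assms in auto)
qed

text \<open>The later increment splits into the earlier one and an increment orthogonal to it.
  \<open>W 0\<close> is subtracted because it vanishes only almost surely.\<close>

lemma covariance_from_0:
  assumes s: "s \<in> {0..T}" and t: "t \<in> {0..T}"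
  shows "expectation (\<lambda>\<omega>. (W s \<omega> - W 0 \<omega>) $ i * (W t \<omega> - W 0 \<omega>) $ j) = (if i = j then min s t else 0)"
proof -
  have le: "expectation (\<lambda>\<omega>. (W s \<omega> - W 0 \<omega>) $ i * (W t \<omega> - W 0 \<omega>) $ j) = (if i = j then s else 0)"
    if "0 \<le> s" "s \<le> t" "t \<le> T" for s t i j
  proof -
    note l2 = increment_L2_adapted(2)
    have "expectation (\<lambda>\<omega>. (W s \<omega> - W 0 \<omega>) $ i * (W t \<omega> - W 0 \<omega>) $ j)
       = expectation (\<lambda>\<omega>. (W s \<omega> - W 0 \<omega>) $ i * (W s \<omega> - W 0 \<omega>) $ j + (W s \<omega> - W 0 \<omega>) $ i * (W t \<omega> - W s \<omega>) $ j)"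
      by (intro Bochner_Integration.integral_cong refl) (simp add: algebra_simps)
    also have "\<dots> = expectation (\<lambda>\<omega>. (W s \<omega> - W 0 \<omega>) $ i * (W s \<omega> - W 0 \<omega>) $ j) +
        expectation (\<lambda>\<omega>. (W s \<omega> - W 0 \<omega>) $ i * (W t \<omega> - W s \<omega>) $ j)"
      by (intro Bochner_Integration.integral_add L2_mult_integrable l2[of _ _ s] l2[of _ _ t]) (use that in auto)
    also have "expectation (\<lambda>\<omega>. (W s \<omega> - W 0 \<omega>) $ i * (W t \<omega> - W s \<omega>) $ j) = 0"
      by (intro increment_orthogonal increment_L2_adapted increment_L2_adapted(2)[of _ _ s]) (use that in auto)
    finally show ?thesis using increment_moments(3)[of 0 s i j] that by simp
  qed
  show ?thesis
  proof (cases "s \<le> t")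
    case True then show ?thesis using le[of s t i j] s t by simp
  next
    case False then show ?thesis using le[of t s j i] s t by (simp add: mult.commute)
  qed
qed

lemma covariance_increments:
  assumes a: "0 \<le> a" "a \<le> b" "b \<le> T" and a': "0 \<le> a'" "a' \<le> b'" "b' \<le> T"
  shows "expectation (\<lambda>\<omega>. (W b \<omega> - W a \<omega>) $ i * (W b' \<omega> - W a' \<omega>) $ j)
    = (if i = j then (\<integral>s. indicator {a<..b} s * indicator {a'<..b'} s \<partial>lborel) else 0)"
proof -
  define B where "B = (\<lambda>t \<omega>. W t \<omega> - W 0 \<omega>)"
  have i: "integrable M (\<lambda>\<omega>. B s \<omega> $ i * B t \<omega> $ j)" if "s \<in> {0..T}" "t \<in> {0..T}" for s t
    unfolding B_def by (intro L2_mult_integrable increment_L2_adapted(2)[of _ _ T]) (use that in auto)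
  have "expectation (\<lambda>\<omega>. (W b \<omega> - W a \<omega>) $ i * (W b' \<omega> - W a' \<omega>) $ j)
    = expectation (\<lambda>\<omega>. B b \<omega> $ i * B b' \<omega> $ j - B b \<omega> $ i * B a' \<omega> $ j - (B a \<omega> $ i * B b' \<omega> $ j - B a \<omega> $ i * B a' \<omega> $ j))"
    unfolding B_def by (intro Bochner_Integration.integral_cong refl) (simp add: algebra_simps)
  also have "\<dots> = expectation (\<lambda>\<omega>. B b \<omega> $ i * B b' \<omega> $ j) - expectation (\<lambda>\<omega>. B b \<omega> $ i * B a' \<omega> $ j)
     - (expectation (\<lambda>\<omega>. B a \<omega> $ i * B b' \<omega> $ j) - expectation (\<lambda>\<omega>. B a \<omega> $ i * B a' \<omega> $ j))"
    using a a' by (simp add: i)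
  also have "\<dots> = (if i = j then min b b' - min b a' - min a b' + min a a' else 0)"
  proof -
    have mem: "a \<in> {0..T}" "b \<in> {0..T}" "a' \<in> {0..T}" "b' \<in> {0..T}" using a a' by auto
    show ?thesis unfolding B_def by (cases "i = j") (simp_all only: covariance_from_0 mem, auto)
  qed
  finally show ?thesis unfolding overlap_integral[OF a(2) a'(2)] .
qed

text \<open>Distinct coordinates are uncorrelated and all have the same variance, so the double sum
  over coordinates collapses to the Frobenius inner product of \<open>c\<close> and
  \<open>c'\<close>.\<close>

lemma covariance_matrix_increments:
  fixes c c' :: "real^'d^'m"
  assumes a: "0 \<le> a" "a \<le> b" "b \<le> T" and a': "0 \<le> a'" "a' \<le> b'" "b' \<le> T"
  shows "expectation (\<lambda>\<omega>. (c *v (W b \<omega> - W a \<omega>)) \<bullet> (c' *v (W b' \<omega> - W a' \<omega>)))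
    = (c \<bullet> c') * (\<integral>s. indicator {a<..b} s * indicator {a'<..b'} s \<partial>lborel)"
proof -
  let ?u = "\<lambda>\<omega>. W b \<omega> - W a \<omega>" and ?v = "\<lambda>\<omega>. W b' \<omega> - W a' \<omega>"
  let ?k = "\<integral>s. indicator {a<..b} s * indicator {a'<..b'} s \<partial>lborel :: real"
  have i: "integrable M (\<lambda>\<omega>. ?u \<omega> $ k * ?v \<omega> $ l)" for k l
    by (intro L2_mult_integrable increment_L2_adapted(2)[of _ _ T]) (use a a' in auto)
  have "(c *v x) \<bullet> (c' *v y) = (\<Sum>i\<in>UNIV. \<Sum>k\<in>UNIV. \<Sum>l\<in>UNIV. c $ i $ k * c' $ i $ l * (x $ k * y $ l))" for x y
    unfolding inner_vec_def matrix_vector_mult_def inner_real_def vec_lambda_beta sum_product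
    by (intro sum.cong refl) (simp add: mult_ac)
  then have "expectation (\<lambda>\<omega>. (c *v ?u \<omega>) \<bullet> (c' *v ?v \<omega>)) =
    (\<Sum>i\<in>UNIV. \<Sum>k\<in>UNIV. \<Sum>l\<in>UNIV. c $ i $ k * c' $ i $ l * expectation (\<lambda>\<omega>. ?u \<omega> $ k * ?v \<omega> $ l))"
    by (simp only:) (subst Bochner_Integration.integral_sum | intro Bochner_Integration.integrable_sum integrable_mult_right i sum.cong refl
       | simp only: integral_mult_right_zero)+
  also have "\<dots> = (\<Sum>i\<in>UNIV. \<Sum>k\<in>UNIV. c $ i $ k * c' $ i $ k * ?k)"
    unfolding covariance_increments[OF a a'] by (intro sum.cong refl) (simp add: if_distrib sum.delta cong: if_cong)
  also have "\<dots> = (c \<bullet> c') * ?k" by (simp add: inner_vec_def sum_distrib_right)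
  finally show ?thesis .
qed

text \<open>The Ito isometry for a finite family of intervals that may overlap. Allowing overlaps
  turns the difference of two step integrals on different partitions into an instance of the same
  formula.\<close>

lemma wiener_isometry:
  fixes c :: "'k \<Rightarrow> real^'d^'m"
  assumes K: "finite K" and ab: "\<And>k. k \<in> K \<Longrightarrow> 0 \<le> a k \<and> a k \<le> b k \<and> b k \<le> T"
  shows "L2 M (\<lambda>\<omega>. \<Sum>k\<in>K. c k *v (W (b k) \<omega> - W (a k) \<omega>))"
    and "expectation (\<lambda>\<omega>. (norm (\<Sum>k\<in>K. c k *v (W (b k) \<omega> - W (a k) \<omega>)))\<^sup>2)
      = (\<integral>s. (norm (\<Sum>k\<in>K. indicator {a k<..b k} s *\<^sub>R c k))\<^sup>2 \<partial>lborel)"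
    and "integrable lborel (\<lambda>s. (norm (\<Sum>k\<in>K. indicator {a k<..b k} s *\<^sub>R c k))\<^sup>2)"
proof -
  let ?X = "\<lambda>k \<omega>. c k *v (W (b k) \<omega> - W (a k) \<omega>)"
  let ?I = "\<lambda>k s. indicator {a k<..b k} s :: real"
  have X: "L2 M (?X k)" if "k \<in> K" for k
    by (intro L2_mv increment_moments(1)) (use ab[OF that] in auto)
  show "L2 M (\<lambda>\<omega>. \<Sum>k\<in>K. ?X k \<omega>)"
    using K X by (induction K rule: finite_induct) (auto intro: L2_add L2_const finite_measure_axioms)
  have II: "integrable lborel (\<lambda>s. ?I k s * ?I l s)" if "k \<in> K" "l \<in> K" for k l
    by (rule overlap_integral(2)) (use ab that in auto)
  have n1: "(norm (\<Sum>k\<in>K. ?X k \<omega>))\<^sup>2 = (\<Sum>k\<in>K. \<Sum>l\<in>K. ?X k \<omega> \<bullet> ?X l \<omega>)" for \<omega>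
    unfolding power2_norm_eq_inner inner_sum_left inner_sum_right by (rule sum.swap)
  have n2: "(norm (\<Sum>k\<in>K. ?I k s *\<^sub>R c k))\<^sup>2 = (\<Sum>k\<in>K. \<Sum>l\<in>K. (c k \<bullet> c l) * (?I k s * ?I l s))" for s
    unfolding power2_norm_eq_inner inner_sum_left inner_sum_right by (subst sum.swap) (simp add: mult_ac)
  show "integrable lborel (\<lambda>s. (norm (\<Sum>k\<in>K. ?I k s *\<^sub>R c k))\<^sup>2)"
    unfolding n2 by (intro Bochner_Integration.integrable_sum integrable_mult_right II)
  have "expectation (\<lambda>\<omega>. (norm (\<Sum>k\<in>K. ?X k \<omega>))\<^sup>2) = (\<Sum>k\<in>K. expectation (\<lambda>\<omega>. \<Sum>l\<in>K. ?X k \<omega> \<bullet> ?X l \<omega>))"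
    unfolding n1 by (intro Bochner_Integration.integral_sum Bochner_Integration.integrable_sum L2_inner_integrable X)
  also have "\<dots> = (\<Sum>k\<in>K. \<Sum>l\<in>K. expectation (\<lambda>\<omega>. ?X k \<omega> \<bullet> ?X l \<omega>))"
    by (intro sum.cong refl Bochner_Integration.integral_sum L2_inner_integrable X)
  also have "\<dots> = (\<Sum>k\<in>K. \<Sum>l\<in>K. (c k \<bullet> c l) * (\<integral>s. ?I k s * ?I l s \<partial>lborel))"
    using ab by (intro sum.cong refl covariance_matrix_increments) auto
  also have "\<dots> = (\<Sum>k\<in>K. \<Sum>l\<in>K. (\<integral>s. (c k \<bullet> c l) * (?I k s * ?I l s) \<partial>lborel))" by simp
  also have "\<dots> = (\<Sum>k\<in>K. (\<integral>s. (\<Sum>l\<in>K. (c k \<bullet> c l) * (?I k s * ?I l s)) \<partial>lborel))"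
    by (intro sum.cong refl Bochner_Integration.integral_sum[symmetric] integrable_mult_right II)
  also have "\<dots> = (\<integral>s. (norm (\<Sum>k\<in>K. ?I k s *\<^sub>R c k))\<^sup>2 \<partial>lborel)"
    unfolding n2 by (intro Bochner_Integration.integral_sum[symmetric] Bochner_Integration.integrable_sum integrable_mult_right II)
  finally show "expectation (\<lambda>\<omega>. (norm (\<Sum>k\<in>K. ?X k \<omega>))\<^sup>2) = (\<integral>s. (norm (\<Sum>k\<in>K. ?I k s *\<^sub>R c k))\<^sup>2 \<partial>lborel)" .
qed

lemma wiener_isometry_nn:
  fixes c :: "'k \<Rightarrow> real^'d^'m"
  assumes K: "finite K" and ab: "\<And>k. k \<in> K \<Longrightarrow> 0 \<le> a k \<and> a k \<le> b k \<and> b k \<le> T"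
  shows "msq M (\<lambda>\<omega>. \<Sum>k\<in>K. c k *v (W (b k) \<omega> - W (a k) \<omega>))
      = msq lborel (\<lambda>s. \<Sum>k\<in>K. indicator {a k<..b k} s *\<^sub>R c k)"
proof -
  have "integrable M (\<lambda>\<omega>. (norm (\<Sum>k\<in>K. c k *v (W (b k) \<omega> - W (a k) \<omega>)))\<^sup>2)"
    using wiener_isometry(1)[where a=a and b=b and K=K and c=c, OF assms] unfolding L2_def by blast
  then have "msq M (\<lambda>\<omega>. \<Sum>k\<in>K. c k *v (W (b k) \<omega> - W (a k) \<omega>))
     = ennreal (\<integral>s. (norm (\<Sum>k\<in>K. indicator {a k<..b k} s *\<^sub>R c k))\<^sup>2 \<partial>lborel)"
    by (subst nn_integral_eq_integral) (auto simp: wiener_isometry(2)[where a=a and b=b and K=K and c=c, OF assms])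
  also have "\<dots> = msq lborel (\<lambda>s. \<Sum>k\<in>K. indicator {a k<..b k} s *\<^sub>R c k)"
    by (subst nn_integral_eq_integral) (auto intro: wiener_isometry(3)[where a=a and b=b and K=K and c=c, OF assms])
  finally show ?thesis .
qed

lemma step_integral_L2:
  assumes p: "\<And>i. i \<le> n \<Longrightarrow> p i \<in> {0..T}" "\<And>i. i < n \<Longrightarrow> p i \<le> p (Suc i)" and t: "t \<in> {0..T}"
  shows "L2 M (step_integral n p c W t)"
  unfolding step_integral_def[abs_def]
proof (rule wiener_isometry(1))
  fix i assume "i \<in> {..<n}"
  then have "p i \<in> {0..T}" "p (Suc i) \<in> {0..T}" "p i \<le> p (Suc i)" using p[of i] p(1)[of "Suc i"] by auto
  then show "0 \<le> min t (p i) \<and> min t (p i) \<le> min t (p (Suc i)) \<and> min t (p (Suc i)) \<le> T" using t by auto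
qed simp

lemma step_integral_adapted:
  assumes p: "\<And>i. i \<le> n \<Longrightarrow> p i \<in> {0..T}" and t: "t \<in> {0..T}"
    and W: "\<And>s. s \<in> {0..t} \<Longrightarrow> W s \<in> borel_measurable N"
  shows "step_integral n p c W t \<in> borel_measurable N"
  unfolding step_integral_def[abs_def]
proof (intro borel_measurable_sum mv_measurable borel_measurable_diff W)
  fix i assume "i \<in> {..<n}"
  then show "min t (p (Suc i)) \<in> {0..t}" "min t (p i) \<in> {0..t}" using p[of i] p[of "Suc i"] t by auto
qed

text \<open>The two partitions are put side by side on the disjoint union of their index sets, the
  second with negated coefficients, and the isometry for overlapping intervals is applied to the
  combined sum.\<close>

lemma step_integral_dist:
  assumes p: "\<And>i. i \<le> n \<Longrightarrow> p i \<in> {0..T}" "\<And>i. i < n \<Longrightarrow> p i \<le> p (Suc i)"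
    and p': "\<And>i. i \<le> n' \<Longrightarrow> p' i \<in> {0..T}" "\<And>i. i < n' \<Longrightarrow> p' i \<le> p' (Suc i)" and t: "t \<in> {0..T}"
  shows "msq M (\<lambda>\<omega>. step_integral n p c W t \<omega> - step_integral n' p' c' W t \<omega>)
    \<le> msq (TL T) (\<lambda>s. step_fun n p c s - step_fun n' p' c' s)"
proof -
  define K where "K = Inl ` {..<n} \<union> Inr ` {..<n'}"
  define A where "A = case_sum p p'"
  define B where "B = case_sum (\<lambda>i. p (Suc i)) (\<lambda>i. p' (Suc i))"
  define C where "C = case_sum c (\<lambda>i. - c' i)"
  have sumK: "(\<Sum>k\<in>K. h k) = (\<Sum>i<n. h (Inl i)) + (\<Sum>i<n'. h (Inr i))" for h :: "nat + nat \<Rightarrow> 'x::comm_monoid_add"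
    unfolding K_def by (subst sum.union_disjoint) (auto simp: sum.reindex)
  have K: "finite K" unfolding K_def by simp
  have AB: "A k \<in> {0..T} \<and> B k \<in> {0..T} \<and> A k \<le> B k" if "k \<in> K" for k
    using that p p' unfolding K_def A_def B_def by (auto simp: Suc_le_eq)
  have ab: "0 \<le> min t (A k) \<and> min t (A k) \<le> min t (B k) \<and> min t (B k) \<le> T" if "k \<in> K" for k
    using AB[OF that] t by auto
  have neg: "(- c' i) *v x = - (c' i *v x)" for i x
    by (rule bounded_bilinear.minus_left[OF bounded_bilinear_mv])
  have e1: "step_integral n p c W t \<omega> - step_integral n' p' c' W t \<omega> = (\<Sum>k\<in>K. C k *v (W (min t (B k)) \<omega> - W (min t (A k)) \<omega>))" for \<omega>
    unfolding sumK step_integral_def A_def B_def C_def by (simp add: neg sum_negf)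
  \<comment> \<open>Stopping both endpoints of an interval at t restricts the integrand to
    [0, t].\<close>
  have e2: "(\<Sum>k\<in>K. indicator {min t (A k)<..min t (B k)} s *\<^sub>R C k) = indicator {0..t} s *\<^sub>R (step_fun n p c s - step_fun n' p' c' s)" for s
  proof -
    have ind: "indicator {min t (A k)<..min t (B k)} s = indicator {0..t} s * (indicator {A k<..B k} s :: real)" if "k \<in> K" for k
      using AB[OF that] t by (auto simp: indicator_def)
    have "(\<Sum>k\<in>K. indicator {min t (A k)<..min t (B k)} s *\<^sub>R C k) = indicator {0..t} s *\<^sub>R (\<Sum>k\<in>K. indicator {A k<..B k} s *\<^sub>R C k)"
      unfolding scaleR_sum_right by (intro sum.cong refl) (simp add: ind)
    also have "(\<Sum>k\<in>K. indicator {A k<..B k} s *\<^sub>R C k) = step_fun n p c s - step_fun n' p' c' s"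
      unfolding sumK step_fun_def A_def B_def C_def by (simp add: sum_negf)
    finally show ?thesis .
  qed
  have iso: "msq M (\<lambda>\<omega>. \<Sum>k\<in>K. C k *v (W (min t (B k)) \<omega> - W (min t (A k)) \<omega>))
    = msq lborel (\<lambda>s. \<Sum>k\<in>K. indicator {min t (A k)<..min t (B k)} s *\<^sub>R C k)"
    by (rule wiener_isometry_nn[OF K ab])
  have "msq M (\<lambda>\<omega>. step_integral n p c W t \<omega> - step_integral n' p' c' W t \<omega>)
    = msq lborel (\<lambda>s. indicator {0..t} s *\<^sub>R (step_fun n p c s - step_fun n' p' c' s))"
    using iso unfolding e1 e2 .
  also have "\<dots> \<le> (\<integral>\<^sup>+s. ennreal ((norm (step_fun n p c s - step_fun n' p' c' s))\<^sup>2) * indicator {0..T} s \<partial>lborel)"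
    using t by (intro nn_integral_mono) (auto simp: indicator_def)
  finally show ?thesis unfolding nn_integral_TL .
qed

section \<open>Mean-square limits of step integrals\<close>

lemma L2_limit:
  fixes f :: "nat \<Rightarrow> 'a \<Rightarrow> 'b::euclidean_space"
  assumes f: "\<And>n. L2 M (f n)" and g: "g \<in> borel_measurable M"
    and lim: "(\<lambda>n. \<integral>\<^sup>+\<omega>. ennreal ((norm (f n \<omega> - g \<omega>))\<^sup>2) \<partial>M) \<longlonglongrightarrow> 0"
  shows "L2 M g" "(\<lambda>n. expectation (\<lambda>\<omega>. (norm (f n \<omega> - g \<omega>))\<^sup>2)) \<longlonglongrightarrow> 0"
proof -
  let ?I = "\<lambda>n. \<integral>\<^sup>+\<omega>. ennreal ((norm (f n \<omega> - g \<omega>))\<^sup>2) \<partial>M"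
  obtain N where N: "?I N < 1"
    using order_tendstoD(2)[OF lim, of 1] unfolding eventually_sequentially by auto
  have "?I N < \<infinity>" using N by (rule order_less_trans) simp
  then have "L2 M (\<lambda>\<omega>. f N \<omega> - g \<omega>)"
    unfolding L2_iff_nn_integral using borel_measurable_diff[OF L2_measurable[OF f] g] by blast
  from L2_diff[OF f[of N] this] show g2: "L2 M g" by simp
  have "ennreal (expectation (\<lambda>\<omega>. (norm (f n \<omega> - g \<omega>))\<^sup>2)) = ?I n" for n
    using L2_diff[OF f g2] unfolding L2_def by (intro nn_integral_eq_integral[symmetric]) auto
  then have "(\<lambda>n. ennreal (expectation (\<lambda>\<omega>. (norm (f n \<omega> - g \<omega>))\<^sup>2))) \<longlonglongrightarrow> ennreal 0" using lim by simp
  then show "(\<lambda>n. expectation (\<lambda>\<omega>. (norm (f n \<omega> - g \<omega>))\<^sup>2)) \<longlonglongrightarrow> 0"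
    by (intro tendsto_ennrealD[where x=0]) auto
qed

text \<open>The second moment of x f - g is a nonnegative quadratic polynomial in x; it is evaluated
  at its minimiser.\<close>

lemma L2_cauchy_schwarz:
  fixes f g :: "'a \<Rightarrow> 'b::euclidean_space"
  assumes f: "L2 M f" and g: "L2 M g"
  shows "(expectation (\<lambda>\<omega>. f \<omega> \<bullet> g \<omega>))\<^sup>2 \<le> expectation (\<lambda>\<omega>. (norm (f \<omega>))\<^sup>2) * expectation (\<lambda>\<omega>. (norm (g \<omega>))\<^sup>2)"
proof -
  let ?a = "expectation (\<lambda>\<omega>. (norm (f \<omega>))\<^sup>2)" and ?b = "expectation (\<lambda>\<omega>. (norm (g \<omega>))\<^sup>2)"
    and ?c = "expectation (\<lambda>\<omega>. f \<omega> \<bullet> g \<omega>)"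
  have i: "integrable M (\<lambda>\<omega>. (norm (f \<omega>))\<^sup>2)" "integrable M (\<lambda>\<omega>. (norm (g \<omega>))\<^sup>2)"
    using f g unfolding L2_def by auto
  note ic = L2_inner_integrable[OF f g]
  have q: "0 \<le> ?a * x\<^sup>2 - 2 * ?c * x + ?b" for x
  proof -
    have "0 \<le> expectation (\<lambda>\<omega>. (norm (x *\<^sub>R f \<omega> - g \<omega>))\<^sup>2)" by simp
    also have "(\<lambda>\<omega>. (norm (x *\<^sub>R f \<omega> - g \<omega>))\<^sup>2) = (\<lambda>\<omega>. x\<^sup>2 * (norm (f \<omega>))\<^sup>2 - 2 * x * (f \<omega> \<bullet> g \<omega>) + (norm (g \<omega>))\<^sup>2)"
      unfolding power2_norm_eq_inner by (auto simp: inner_simps inner_commute power2_eq_square)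
    also have "expectation \<dots> = x\<^sup>2 * ?a - 2 * x * ?c + ?b" using i ic by simp
    finally show ?thesis by (simp add: mult_ac)
  qed
  show ?thesis
  proof (cases "?a = 0")
    case True
    have "?c = 0"
    proof (rule ccontr)
      assume c: "?c \<noteq> 0"
      \<comment> \<open>With vanishing leading coefficient the polynomial is affine, and this
        argument would give it the value -1.\<close>
      have "0 \<le> - 2 * ?c * ((?b + 1) / (2 * ?c)) + ?b" using q[of "(?b + 1) / (2 * ?c)"] True by simp
      then show False using c by (simp add: field_simps)
    qed
    then show ?thesis using True by simp
  next
    case False
    then have a: "?a > 0" by (simp add: order_less_le)
    have "0 \<le> ?a * (?c / ?a)\<^sup>2 - 2 * ?c * (?c / ?a) + ?b" by (rule q)
    also have "\<dots> = ?b - ?c\<^sup>2 / ?a" using a by (simp add: power2_eq_square field_simps)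
    finally show ?thesis using a by (simp add: field_simps)
  qed
qed

lemma wiener_integral_approx:
  assumes "is_wiener_integral T M W \<sigma> J"
  obtains n p c where "\<And>j i. i \<le> n j \<Longrightarrow> p j i \<in> {0..T}" "\<And>j i. i < n j \<Longrightarrow> p j i \<le> p j (Suc i)"
    "(\<lambda>j. \<integral>\<^sup>+s. ennreal ((norm (step_fun (n j) (p j) (c j) s - \<sigma> s))\<^sup>2) \<partial>TL T) \<longlonglongrightarrow> 0"
    "\<And>t. t \<in> {0..T} \<Longrightarrow> (\<lambda>j. \<integral>\<^sup>+\<omega>. ennreal ((norm (step_integral (n j) (p j) (c j) W t \<omega> - J t \<omega>))\<^sup>2) \<partial>M) \<longlonglongrightarrow> 0"
    "\<And>t. t \<in> {0..T} \<Longrightarrow> J t \<in> borel_measurable M"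
  using assms unfolding is_wiener_integral_def nn_integral_TL by blast

lemma wiener_integral_L2:
  assumes J: "is_wiener_integral T M W \<sigma> J" and t: "t \<in> {0..T}" shows "L2 M (J t)"
proof -
  obtain n p c where I: "\<And>j i. i \<le> n j \<Longrightarrow> p j i \<in> {0..T}" "\<And>j i. i < n j \<Longrightarrow> p j i \<le> p j (Suc i)"
    "(\<lambda>j. \<integral>\<^sup>+\<omega>. ennreal ((norm (step_integral (n j) (p j) (c j) W t \<omega> - J t \<omega>))\<^sup>2) \<partial>M) \<longlonglongrightarrow> 0"
    "J t \<in> borel_measurable M"
    by (rule wiener_integral_approx[OF J]) (use t in blast)
  have "L2 M (step_integral (n j) (p j) (c j) W t)" for j
    by (rule step_integral_L2) (intro I(1,2) t; assumption)+
  from L2_limit(1)[OF this I(4,3)] show ?thesis .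
qed

lemma step_fun_measurable: "step_fun n p c \<in> borel_measurable (TL T)"
proof -
  have "step_fun n p c \<in> borel_measurable borel" unfolding step_fun_def[abs_def] by measurable
  then show ?thesis by (intro measurable_restrict_space1) simp
qed

text \<open>Each integral comes with its own approximating sequence. Both sequences approach
  \<sigma>, so by the isometry their step integrals approach each other, and so do the
  limits.\<close>

lemma wiener_integral_unique:
  assumes J: "is_wiener_integral T M W \<sigma> J" and J': "is_wiener_integral T M W \<sigma> J'"
    and \<sigma>: "L_infty T \<sigma>" and t: "t \<in> {0..T}"
  shows "AE \<omega> in M. J t \<omega> = J' t \<omega>"
proof -
  obtain n p c where I: "\<And>j i. i \<le> n j \<Longrightarrow> p j i \<in> {0..T}" "\<And>j i. i < n j \<Longrightarrow> p j i \<le> p j (Suc i)"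
    "(\<lambda>j. \<integral>\<^sup>+s. ennreal ((norm (step_fun (n j) (p j) (c j) s - \<sigma> s))\<^sup>2) \<partial>TL T) \<longlonglongrightarrow> 0"
    "\<And>t. t \<in> {0..T} \<Longrightarrow> (\<lambda>j. \<integral>\<^sup>+\<omega>. ennreal ((norm (step_integral (n j) (p j) (c j) W t \<omega> - J t \<omega>))\<^sup>2) \<partial>M) \<longlonglongrightarrow> 0"
    "\<And>t. t \<in> {0..T} \<Longrightarrow> J t \<in> borel_measurable M"
    by (rule wiener_integral_approx[OF J]) blast
  obtain n' p' c' where I': "\<And>j i. i \<le> n' j \<Longrightarrow> p' j i \<in> {0..T}" "\<And>j i. i < n' j \<Longrightarrow> p' j i \<le> p' j (Suc i)"
    "(\<lambda>j. \<integral>\<^sup>+s. ennreal ((norm (step_fun (n' j) (p' j) (c' j) s - \<sigma> s))\<^sup>2) \<partial>TL T) \<longlonglongrightarrow> 0"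
    "\<And>t. t \<in> {0..T} \<Longrightarrow> (\<lambda>j. \<integral>\<^sup>+\<omega>. ennreal ((norm (step_integral (n' j) (p' j) (c' j) W t \<omega> - J' t \<omega>))\<^sup>2) \<partial>M) \<longlonglongrightarrow> 0"
    "\<And>t. t \<in> {0..T} \<Longrightarrow> J' t \<in> borel_measurable M"
    by (rule wiener_integral_approx[OF J']) blast
  let ?f = "\<lambda>j. step_fun (n j) (p j) (c j)" and ?f' = "\<lambda>j. step_fun (n' j) (p' j) (c' j)"
  let ?I = "\<lambda>j. step_integral (n j) (p j) (c j) W t" and ?I' = "\<lambda>j. step_integral (n' j) (p' j) (c' j) W t"
  have Im: "?I j \<in> borel_measurable M" and Im': "?I' j \<in> borel_measurable M" for j
    by (rule step_integral_adapted, rule I(1), assumption, rule t, rule W_measurable, use t in simp)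
       (rule step_integral_adapted, rule I'(1), assumption, rule t, rule W_measurable, use t in simp)
  \<comment> \<open>The constants 4, 4, 2 result from applying |x + y|^2 \<le> 2 |x|^2 + 2 |y|^2
    twice.\<close>
  have sq: "(norm (x + y + z))\<^sup>2 \<le> 4 * (norm x)\<^sup>2 + 4 * (norm y)\<^sup>2 + 2 * (norm z)\<^sup>2" for x y z :: "real^'d"
    using norm_add_square_le[of "x + y" z] norm_add_square_le[of x y] by simp
  have tri: "(norm (J t \<omega> - J' t \<omega>))\<^sup>2 \<le> 4 * (norm (?I j \<omega> - J t \<omega>))\<^sup>2 + 4 * (norm (?I j \<omega> - ?I' j \<omega>))\<^sup>2 + 2 * (norm (?I' j \<omega> - J' t \<omega>))\<^sup>2" for j \<omega>
    using sq[of "J t \<omega> - ?I j \<omega>" "?I j \<omega> - ?I' j \<omega>" "?I' j \<omega> - J' t \<omega>"] by (simp add: norm_minus_commute)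
  have enn: "ennreal (4 * x + 4 * y + 2 * z) = 4 * ennreal x + 4 * ennreal y + 2 * ennreal z" if "0 \<le> x" "0 \<le> y" "0 \<le> z" for x y z
    using that by (simp add: ennreal_mult')
  let ?D = "\<integral>\<^sup>+\<omega>. ennreal ((norm (J t \<omega> - J' t \<omega>))\<^sup>2) \<partial>M"
  let ?a = "\<lambda>j. \<integral>\<^sup>+\<omega>. ennreal ((norm (?I j \<omega> - J t \<omega>))\<^sup>2) \<partial>M"
    and ?b = "\<lambda>j. \<integral>\<^sup>+\<omega>. ennreal ((norm (?I j \<omega> - ?I' j \<omega>))\<^sup>2) \<partial>M"
    and ?d = "\<lambda>j. \<integral>\<^sup>+\<omega>. ennreal ((norm (?I' j \<omega> - J' t \<omega>))\<^sup>2) \<partial>M"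
    and ?e = "\<lambda>j. \<integral>\<^sup>+s. ennreal ((norm (?f j s - \<sigma> s))\<^sup>2) \<partial>TL T"
    and ?e' = "\<lambda>j. \<integral>\<^sup>+s. ennreal ((norm (?f' j s - \<sigma> s))\<^sup>2) \<partial>TL T"
  have D: "?D \<le> 4 * ?a j + 4 * (2 * ?e j + 2 * ?e' j) + 2 * ?d j" for j
  proof -
    have m1: "(\<lambda>\<omega>. ennreal ((norm (?I j \<omega> - J t \<omega>))\<^sup>2)) \<in> borel_measurable M"
      and m2: "(\<lambda>\<omega>. ennreal ((norm (?I j \<omega> - ?I' j \<omega>))\<^sup>2)) \<in> borel_measurable M"
      and m3: "(\<lambda>\<omega>. ennreal ((norm (?I' j \<omega> - J' t \<omega>))\<^sup>2)) \<in> borel_measurable M"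
      by (intro nn_integral_L2_measurable borel_measurable_diff Im Im' I(5) I'(5) t)+
    have "?D \<le> (\<integral>\<^sup>+\<omega>. 4 * ennreal ((norm (?I j \<omega> - J t \<omega>))\<^sup>2) + 4 * ennreal ((norm (?I j \<omega> - ?I' j \<omega>))\<^sup>2) + 2 * ennreal ((norm (?I' j \<omega> - J' t \<omega>))\<^sup>2) \<partial>M)"
      by (intro nn_integral_mono) (subst enn[symmetric]; intro ennreal_leI tri zero_le_power2)
    also have "\<dots> = 4 * ?a j + 4 * ?b j + 2 * ?d j"
      using m1 m2 m3 by (simp add: nn_integral_add nn_integral_cmult)
    also have "?b j \<le> msq (TL T) (\<lambda>s. ?f j s - ?f' j s)"
      by (rule step_integral_dist) (intro I(1,2) I'(1,2) t; assumption)+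
    also have "\<dots> \<le> 2 * ?e j + 2 * ?e' j"
    proof -
      have m: "?f j \<in> borel_measurable (TL T)" "?f' j \<in> borel_measurable (TL T)" "\<sigma> \<in> borel_measurable (TL T)"
        by (intro step_fun_measurable L_infty_measurable_TL[OF \<sigma>])+
      have m1: "(\<lambda>s. ennreal ((norm (?f j s - \<sigma> s))\<^sup>2)) \<in> borel_measurable (TL T)"
        and m2: "(\<lambda>s. ennreal ((norm (?f' j s - \<sigma> s))\<^sup>2)) \<in> borel_measurable (TL T)"
        by (intro nn_integral_L2_measurable borel_measurable_diff m)+
      have "msq (TL T) (\<lambda>s. ?f j s - ?f' j s)
        \<le> (\<integral>\<^sup>+s. 2 * ennreal ((norm (?f j s - \<sigma> s))\<^sup>2) + 2 * ennreal ((norm (?f' j s - \<sigma> s))\<^sup>2) \<partial>TL T)"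
      proof (rule nn_integral_mono)
        fix s
        have "(norm (?f j s - ?f' j s))\<^sup>2 \<le> 2 * (norm (?f j s - \<sigma> s))\<^sup>2 + 2 * (norm (?f' j s - \<sigma> s))\<^sup>2"
          using norm_add_square_le[of "?f j s - \<sigma> s" "\<sigma> s - ?f' j s"] by (simp add: norm_minus_commute)
        then have "ennreal ((norm (?f j s - ?f' j s))\<^sup>2) \<le> ennreal (2 * (norm (?f j s - \<sigma> s))\<^sup>2 + 2 * (norm (?f' j s - \<sigma> s))\<^sup>2)"
          by (rule ennreal_leI)
        then show "ennreal ((norm (?f j s - ?f' j s))\<^sup>2) \<le> 2 * ennreal ((norm (?f j s - \<sigma> s))\<^sup>2) + 2 * ennreal ((norm (?f' j s - \<sigma> s))\<^sup>2)"
          by (simp add: ennreal_mult')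
      qed
      also have "\<dots> = 2 * ?e j + 2 * ?e' j"
        using m1 m2 by (simp add: nn_integral_add nn_integral_cmult)
      finally show ?thesis .
    qed
    finally show ?thesis by (simp add: add_mono mult_left_mono)
  qed
  have "(\<lambda>j. 4 * ?a j + 4 * (2 * ?e j + 2 * ?e' j) + 2 * ?d j) \<longlonglongrightarrow> 4 * 0 + 4 * (2 * 0 + 2 * 0) + 2 * 0"
    by (intro tendsto_add ennreal_tendsto_cmult I(3) I'(3) I(4)[OF t] I'(4)[OF t]) auto
  from tendsto_lowerbound[OF this always_eventually[OF allI[OF D]]]
  have "?D = 0" by simp
  then have "AE \<omega> in M. ennreal ((norm (J t \<omega> - J' t \<omega>))\<^sup>2) = 0"
    by (subst (asm) nn_integral_0_iff_AE) (intro nn_integral_L2_measurable borel_measurable_diff I(5) I'(5) t)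
  then show ?thesis by eventually_elim simp
qed

text \<open>The martingale property in weak form. It is an exact identity for step integrals, and
  Cauchy-Schwarz carries it to the mean-square limit.\<close>

lemma wiener_integral_orthogonal:
  assumes J: "is_wiener_integral T M W \<sigma> J" and st: "0 \<le> s" "s \<le> t" "t \<le> T"
    and Y: "L2 M Y" "Y \<in> borel_measurable (F s)"
  shows "expectation (\<lambda>\<omega>. Y \<omega> \<bullet> (J t \<omega> - J s \<omega>)) = 0"
proof -
  obtain n p c where I: "\<And>j i. i \<le> n j \<Longrightarrow> p j i \<in> {0..T}" "\<And>j i. i < n j \<Longrightarrow> p j i \<le> p j (Suc i)"
    "\<And>t. t \<in> {0..T} \<Longrightarrow> (\<lambda>j. \<integral>\<^sup>+\<omega>. ennreal ((norm (step_integral (n j) (p j) (c j) W t \<omega> - J t \<omega>))\<^sup>2) \<partial>M) \<longlonglongrightarrow> 0"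
    "\<And>t. t \<in> {0..T} \<Longrightarrow> J t \<in> borel_measurable M"
    by (rule wiener_integral_approx[OF J]) blast
  let ?I = "\<lambda>j t. step_integral (n j) (p j) (c j) W t"
  have mem: "s \<in> {0..T}" "t \<in> {0..T}" using st by auto
  have I2: "L2 M (?I j u)" if "u \<in> {0..T}" for j u
    by (rule step_integral_L2) (intro I(1,2) that; assumption)+
  have J2: "L2 M (J u)" if "u \<in> {0..T}" for u by (rule wiener_integral_L2[OF J that])
  have zero: "expectation (\<lambda>\<omega>. Y \<omega> \<bullet> (?I j t \<omega> - ?I j s \<omega>)) = 0" for j
  proof -
    \<comment> \<open>The part of the path before s cancels: partition points are moved into [s, t],
      after which every increment starts at s and is orthogonal to \<open>Y\<close>.\<close>
    have incr: "W (min t u) \<omega> - W (min s u) \<omega> = W (max s (min t u)) \<omega> - W s \<omega>" if "u \<in> {0..T}" for u \<omega>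
      using st that by (auto simp: min_def max_def)
    define u where "u = (\<lambda>i. max s (min t (p j (Suc i))))"
    define v where "v = (\<lambda>i. max s (min t (p j i)))"
    have uv: "s \<le> u i" "u i \<le> T" "s \<le> v i" "v i \<le> T" for i using st unfolding u_def v_def by auto
    have "?I j t \<omega> - ?I j s \<omega> = (\<Sum>i<n j. c j i *v ((W (u i) \<omega> - W s \<omega>) - (W (v i) \<omega> - W s \<omega>)))" for \<omega>
      unfolding step_integral_def sum_subtractf[symmetric] matrix_vector_mult_diff_distrib[symmetric]
    proof (intro sum.cong refl arg_cong2[where f="(*v)"])
      fix i assume "i \<in> {..<n j}"
      then have "p j (Suc i) \<in> {0..T}" "p j i \<in> {0..T}" using I(1)[of "Suc i" j] I(1)[of i j] by auto
      note inc = incr[OF this(1), of \<omega>] incr[OF this(2), of \<omega>]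
      have "W (min t (p j (Suc i))) \<omega> - W (min t (p j i)) \<omega> - (W (min s (p j (Suc i))) \<omega> - W (min s (p j i)) \<omega>) =
        (W (min t (p j (Suc i))) \<omega> - W (min s (p j (Suc i))) \<omega>) - (W (min t (p j i)) \<omega> - W (min s (p j i)) \<omega>)"
        by (simp add: algebra_simps)
      then show "W (min t (p j (Suc i))) \<omega> - W (min t (p j i)) \<omega> - (W (min s (p j (Suc i))) \<omega> - W (min s (p j i)) \<omega>) =
        W (u i) \<omega> - W s \<omega> - (W (v i) \<omega> - W s \<omega>)" unfolding u_def v_def inc .
    qed
    then have e: "Y \<omega> \<bullet> (?I j t \<omega> - ?I j s \<omega>) = (\<Sum>i<n j. Y \<omega> \<bullet> (c j i *v (W (u i) \<omega> - W s \<omega>)) - Y \<omega> \<bullet> (c j i *v (W (v i) \<omega> - W s \<omega>)))" for \<omega>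
      by (simp add: inner_sum_right matrix_vector_mult_diff_distrib inner_diff_right)
    have z: "expectation (\<lambda>\<omega>. Y \<omega> \<bullet> (C *v (W x \<omega> - W s \<omega>))) = 0" if x: "s \<le> x" "x \<le> T" for x and C :: "real^'d^'d"
    proof -
      have "Y \<omega> \<bullet> (C *v w) = (\<Sum>k\<in>UNIV. (transpose C *v Y \<omega>) $ k * w $ k)" for w \<omega>
        unfolding dot_lmul_matrix[symmetric] by (simp add: inner_vec_def)
      then have "expectation (\<lambda>\<omega>. Y \<omega> \<bullet> (C *v (W x \<omega> - W s \<omega>)))
        = expectation (\<lambda>\<omega>. \<Sum>k\<in>UNIV. (transpose C *v Y \<omega>) $ k * (W x \<omega> - W s \<omega>) $ k)" by (simp only:)
      also have "\<dots> = (\<Sum>k\<in>UNIV. expectation (\<lambda>\<omega>. (transpose C *v Y \<omega>) $ k * (W x \<omega> - W s \<omega>) $ k))"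
        by (intro Bochner_Integration.integral_sum L2_mult_integrable L2_component L2_mv Y(1) increment_moments(1) st(1) x)
      also have "\<dots> = 0"
        by (intro sum.neutral ballI increment_orthogonal L2_component L2_mv Y(1) st(1) x
            measurable_compose[OF mv_measurable[OF Y(2)] borel_measurable_nth])
      finally show ?thesis .
    qed
    have int: "integrable M (\<lambda>\<omega>. Y \<omega> \<bullet> (C *v (W x \<omega> - W s \<omega>)))" if x: "s \<le> x" "x \<le> T" for x and C :: "real^'d^'d"
      by (intro L2_inner_integrable Y(1) L2_mv increment_moments(1) st(1) x)
    have "expectation (\<lambda>\<omega>. Y \<omega> \<bullet> (?I j t \<omega> - ?I j s \<omega>)) = (\<Sum>i<n j. expectation (\<lambda>\<omega>. Y \<omega> \<bullet> (c j i *v (W (u i) \<omega> - W s \<omega>)) - Y \<omega> \<bullet> (c j i *v (W (v i) \<omega> - W s \<omega>))))"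
      unfolding e by (intro Bochner_Integration.integral_sum Bochner_Integration.integrable_diff int uv)
    also have "\<dots> = 0"
    proof (rule sum.neutral, rule ballI)
      fix i
      show "expectation (\<lambda>\<omega>. Y \<omega> \<bullet> (c j i *v (W (u i) \<omega> - W s \<omega>)) - Y \<omega> \<bullet> (c j i *v (W (v i) \<omega> - W s \<omega>))) = 0"
        by (subst Bochner_Integration.integral_diff) (simp_all only: int uv z diff_self)
    qed
    finally show ?thesis .
  qed
  let ?e = "\<lambda>j u. expectation (\<lambda>\<omega>. (norm (?I j u \<omega> - J u \<omega>))\<^sup>2)"
  let ?y = "expectation (\<lambda>\<omega>. (norm (Y \<omega>))\<^sup>2)"
  have lim: "(\<lambda>j. ?e j u) \<longlonglongrightarrow> 0" if "u \<in> {0..T}" for u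
    by (rule L2_limit(2)[OF I2[OF that] I(4)[OF that] I(3)[OF that]])
  have "(expectation (\<lambda>\<omega>. Y \<omega> \<bullet> (J t \<omega> - J s \<omega>)))\<^sup>2 \<le> ?y * (2 * ?e j t + 2 * ?e j s)" for j
  proof -
    let ?d = "\<lambda>\<omega>. (?I j t \<omega> - J t \<omega>) - (?I j s \<omega> - J s \<omega>)"
    have d2: "L2 M ?d" by (intro L2_diff I2 J2 mem)
    have "expectation (\<lambda>\<omega>. Y \<omega> \<bullet> ?d \<omega>) = expectation (\<lambda>\<omega>. Y \<omega> \<bullet> (?I j t \<omega> - ?I j s \<omega>) - Y \<omega> \<bullet> (J t \<omega> - J s \<omega>))"
      by (intro Bochner_Integration.integral_cong refl) (simp add: inner_diff_right)
    also have "\<dots> = expectation (\<lambda>\<omega>. Y \<omega> \<bullet> (?I j t \<omega> - ?I j s \<omega>)) - expectation (\<lambda>\<omega>. Y \<omega> \<bullet> (J t \<omega> - J s \<omega>))"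
      by (intro Bochner_Integration.integral_diff L2_inner_integrable Y(1) L2_diff I2 J2 mem)
    finally have "(expectation (\<lambda>\<omega>. Y \<omega> \<bullet> (J t \<omega> - J s \<omega>)))\<^sup>2 = (expectation (\<lambda>\<omega>. Y \<omega> \<bullet> ?d \<omega>))\<^sup>2"
      unfolding zero by simp
    also have "\<dots> \<le> ?y * expectation (\<lambda>\<omega>. (norm (?d \<omega>))\<^sup>2)" by (rule L2_cauchy_schwarz[OF Y(1) d2])
    also have "\<dots> \<le> ?y * (2 * ?e j t + 2 * ?e j s)"
    proof (rule mult_left_mono)
      have i: "integrable M (\<lambda>\<omega>. (norm (?I j u \<omega> - J u \<omega>))\<^sup>2)" if "u \<in> {0..T}" for u
        using L2_diff[OF I2[OF that] J2[OF that]] unfolding L2_def by blast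
      have "expectation (\<lambda>\<omega>. (norm (?d \<omega>))\<^sup>2) \<le> expectation (\<lambda>\<omega>. 2 * (norm (?I j t \<omega> - J t \<omega>))\<^sup>2 + 2 * (norm (?I j s \<omega> - J s \<omega>))\<^sup>2)"
      proof (rule integral_mono)
        show "integrable M (\<lambda>\<omega>. (norm (?d \<omega>))\<^sup>2)" using d2 unfolding L2_def by blast
        show "integrable M (\<lambda>\<omega>. 2 * (norm (?I j t \<omega> - J t \<omega>))\<^sup>2 + 2 * (norm (?I j s \<omega> - J s \<omega>))\<^sup>2)"
          by (intro Bochner_Integration.integrable_add integrable_mult_right i mem)
        show "(norm (?d \<omega>))\<^sup>2 \<le> 2 * (norm (?I j t \<omega> - J t \<omega>))\<^sup>2 + 2 * (norm (?I j s \<omega> - J s \<omega>))\<^sup>2" for \<omega>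
          using norm_add_square_le[of "?I j t \<omega> - J t \<omega>" "- (?I j s \<omega> - J s \<omega>)"] by (simp only: norm_minus_cancel diff_conv_add_uminus)
      qed
      also have "\<dots> = 2 * ?e j t + 2 * ?e j s" using i[OF mem(1)] i[OF mem(2)] by simp
      finally show "expectation (\<lambda>\<omega>. (norm (?d \<omega>))\<^sup>2) \<le> 2 * ?e j t + 2 * ?e j s" .
    qed simp
    finally show ?thesis .
  qed
  moreover have "(\<lambda>j. ?y * (2 * ?e j t + 2 * ?e j s)) \<longlonglongrightarrow> ?y * (2 * 0 + 2 * 0)"
    by (intro tendsto_intros lim mem)
  ultimately have "(expectation (\<lambda>\<omega>. Y \<omega> \<bullet> (J t \<omega> - J s \<omega>)))\<^sup>2 \<le> ?y * (2 * 0 + 2 * 0)"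
    by (intro tendsto_lowerbound[OF _ always_eventually]) auto
  then show ?thesis by simp
qed

text \<open>Step integrals up to t involve W on [0, t] only, and mean-square limits remain
  measurable. The second filtration \<open>G\<close> allows the result to be used for
  \<open>filt1 D\<close> as well as for \<open>filt D\<close>.\<close>

lemma wiener_integral_adapted:
  assumes J: "is_wiener_integral T M W \<sigma> J" and G: "filt_space T M G" and t: "t \<in> {0..T}"
    and W: "\<And>s. s \<in> {0..t} \<Longrightarrow> W s \<in> borel_measurable (G t)"
  shows "J t \<in> borel_measurable (G t)"
proof -
  obtain n p c where I: "\<And>j i. i \<le> n j \<Longrightarrow> p j i \<in> {0..T}"
    "(\<lambda>j. \<integral>\<^sup>+\<omega>. ennreal ((norm (step_integral (n j) (p j) (c j) W t \<omega> - J t \<omega>))\<^sup>2) \<partial>M) \<longlonglongrightarrow> 0"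
    "J t \<in> borel_measurable M"
    by (rule wiener_integral_approx[OF J]) (use t in blast)
  show ?thesis
    by (rule filt_space.adapted_L2_lim[OF G t _ I(3,2)], rule step_integral_adapted[OF _ t W])
       (intro I(1); assumption)+
qed

text \<open>Pythagoras: the increment over [t, T] is orthogonal to \<open>J t\<close>, so the second
  moment is largest at the horizon.\<close>

lemma wiener_integral_bound:
  assumes J: "is_wiener_integral T M W \<sigma> J" and t: "t \<in> {0..T}"
  shows "expectation (\<lambda>\<omega>. (norm (J t \<omega>))\<^sup>2) \<le> expectation (\<lambda>\<omega>. (norm (J T \<omega>))\<^sup>2)"
proof -
  have T: "T \<in> {0..T}" using t by simp
  note J2 = wiener_integral_L2[OF J]
  have ad: "J t \<in> borel_measurable (F t)"
    by (rule wiener_integral_adapted[OF J filt_space_axioms t]) (rule G_measurable_mono[OF _ _ _ W_adapted]; use t in simp)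
  have o: "expectation (\<lambda>\<omega>. J t \<omega> \<bullet> (J T \<omega> - J t \<omega>)) = 0"
    by (rule wiener_integral_orthogonal[OF J _ _ _ J2[OF t] ad]) (use t in auto)
  have i: "integrable M (\<lambda>\<omega>. (norm (J t \<omega>))\<^sup>2)" "integrable M (\<lambda>\<omega>. (norm (J T \<omega> - J t \<omega>))\<^sup>2)"
    "integrable M (\<lambda>\<omega>. J t \<omega> \<bullet> (J T \<omega> - J t \<omega>))"
    using J2[OF t] L2_diff[OF J2[OF T] J2[OF t]] L2_inner_integrable[OF J2[OF t] L2_diff[OF J2[OF T] J2[OF t]]] unfolding L2_def by auto
  have "(norm (J T \<omega>))\<^sup>2 = (norm (J t \<omega>))\<^sup>2 + 2 * (J t \<omega> \<bullet> (J T \<omega> - J t \<omega>)) + (norm (J T \<omega> - J t \<omega>))\<^sup>2" for \<omega>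
    unfolding power2_norm_eq_inner by (simp add: inner_simps inner_commute)
  then have "expectation (\<lambda>\<omega>. (norm (J T \<omega>))\<^sup>2) = expectation (\<lambda>\<omega>. (norm (J t \<omega>))\<^sup>2) + expectation (\<lambda>\<omega>. (norm (J T \<omega> - J t \<omega>))\<^sup>2)"
    using i o by simp
  then show ?thesis by simp
qed

end

section \<open>The linear-quadratic model\<close>

lemma prog_measurable_mono:
  assumes X: "prog_measurable T G X" and sub: "\<And>t. t \<in> {0..T} \<Longrightarrow> space (G t) = space (G' t) \<and> sets (G t) \<subseteq> sets (G' t)"
  shows "prog_measurable T G' X"
  unfolding prog_measurable_iff
proof
  fix t assume t: "t \<in> {0..T}"
  have "(\<lambda>z. X (fst z) (snd z)) \<in> borel_measurable (restrict_space borel {0..t} \<Otimes>\<^sub>M G t)"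
    using X t unfolding prog_measurable_iff by blast
  then show "(\<lambda>z. X (fst z) (snd z)) \<in> borel_measurable (restrict_space borel {0..t} \<Otimes>\<^sub>M G' t)"
  proof (rule measurable_from_subalg[rotated])
    show "subalgebra (restrict_space borel {0..t} \<Otimes>\<^sub>M G' t) (restrict_space borel {0..t} \<Otimes>\<^sub>M G t)"
      using sub[OF t] unfolding subalgebra_def sets_pair_measure space_pair_measure
      by (auto intro!: sigma_sets_mono')
  qed
qed

text \<open>One null set serves all rational times, and continuity does the rest. The rational
  approximations come from below and so stay in the interval.\<close>

lemma (in time_space) AE_eq_paths:
  fixes K K' :: "real \<Rightarrow> 'w \<Rightarrow> 'b::euclidean_space"
  assumes c: "AE \<omega> in M. continuous_on {0..T} (\<lambda>t. K t \<omega>)" "AE \<omega> in M. continuous_on {0..T} (\<lambda>t. K' t \<omega>)"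
    and eq: "\<And>t. t \<in> {0..T} \<Longrightarrow> AE \<omega> in M. K t \<omega> = K' t \<omega>"
  shows "AE \<omega> in M. \<forall>t\<in>{0..T}. K t \<omega> = K' t \<omega>"
proof -
  have "AE \<omega> in M. \<forall>q\<in>\<rat> \<inter> {0..T}. K q \<omega> = K' q \<omega>"
    by (subst AE_ball_countable) (auto intro: eq countable_subset[OF _ countable_rat])
  then show ?thesis using c
  proof eventually_elim
    case (elim \<omega>)
    show ?case
    proof
      fix t assume t: "t \<in> {0..T}"
      let ?q = "\<lambda>n. real_of_int \<lfloor>t * real (Suc n)\<rfloor> / real (Suc n)"
      have q: "?q n \<in> \<rat> \<inter> {0..T}" for n
      proof -
        have "?q n \<le> t" by (simp add: field_simps)
        moreover have "0 \<le> ?q n" using t by simp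
        moreover have "?q n \<in> \<rat>" by (intro Rats_divide Rats_of_int Rats_of_nat)
        ultimately show ?thesis using t by auto
      qed
      have lim: "?q \<longlonglongrightarrow> t" by (rule floor_div_tendsto)
      have "(\<lambda>n. K (?q n) \<omega>) \<longlonglongrightarrow> K t \<omega>" "(\<lambda>n. K' (?q n) \<omega>) \<longlonglongrightarrow> K' t \<omega>"
        using q by (intro continuous_on_tendsto_compose[OF elim(2) lim t] continuous_on_tendsto_compose[OF elim(3) lim t] always_eventually; blast)+
      moreover have "K (?q n) \<omega> = K' (?q n) \<omega>" for n using elim(1) q by blast
      ultimately show "K t \<omega> = K' t \<omega>" using LIMSEQ_unique by simp
    qed
  qed
qed

locale lq =
  fixes D :: "('d::finite, 'k::finite, 'w) lq_model" and d1 d2 :: real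
  assumes coefs: "coefficient_assumptions D d1 d2" and stoch: "stochastic_assumptions D"

context lq
begin

abbreviation T where "T \<equiv> horizon D"
abbreviation M where "M \<equiv> prb D"
abbreviation A where "A \<equiv> cA D"
abbreviation B where "B \<equiv> cB D"
abbreviation R where "R \<equiv> cR D"
abbreviation S where "S \<equiv> cS D"
abbreviation Q where "Q \<equiv> cQ D"
abbreviation Qt where "Qt \<equiv> cQtil D"
abbreviation Ri where "Ri \<equiv> Rinv D"
abbreviation F where "F \<equiv> filt D"
abbreviation W where "W \<equiv> bm D"
abbreviation F1 where "F1 \<equiv> filt1 D"

lemma T_pos: "0 < T"
  and bddA: "L_infty T A" and bddSigma: "L_infty T (cSigma D)" and bddB: "L_infty T B"
  and bddQ: "L_infty T Q" and bddQbar: "L_infty T (cQbar D)" and bddQt: "L_infty T Qt" and bddS: "L_infty T S"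
  and bddL: "L_infty T (cL D)" and bddq: "L_infty T (cq D)" and bddr: "L_infty T (cr D)"
  and contR: "continuous_on {0..T} R" and d2_pos: "d2 > 0"
  and symR: "t \<in> {0..T} \<Longrightarrow> sym_mat (R t)"
  using coefs unfolding coefficient_assumptions_def Let_def by simp_all

lemma symH: "transpose (cH D) = cH D" and symHt: "transpose (cHtil D) = cHtil D"
  using coefs unfolding coefficient_assumptions_def Let_def psd_def sym_mat_def by simp_all

lemma symQ: "AE t in TL T. transpose (Q t) = Q t" and symQt: "AE t in TL T. transpose (Qt t) = Qt t"
proof -
  have "AE t in lborel. t \<in> {0..T} \<longrightarrow> sym_mat (Q t) \<and> sym_mat (cQbar D t) \<and> sym_mat (Qt t)"
    using coefs unfolding coefficient_assumptions_def Let_def by blast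
  then show "AE t in TL T. transpose (Q t) = Q t" "AE t in TL T. transpose (Qt t) = Qt t"
    unfolding AE_TL sym_mat_def by (eventually_elim, simp)+
qed

lemma R_coercive:
  assumes t: "t \<in> {0..T}" shows "d2 * (x \<bullet> x) \<le> (R t *v x) \<bullet> x"
proof -
  have "loewner_le (d2 *\<^sub>R mat 1) (R t)" using coefs t unfolding coefficient_assumptions_def Let_def by blast
  then have "0 \<le> ((R t - d2 *\<^sub>R mat 1) *v x) \<bullet> x" unfolding loewner_le_def psd_def by blast
  also have "(R t - d2 *\<^sub>R mat 1) *v x = R t *v x - d2 *\<^sub>R x"
    by (simp add: matrix_vector_mult_diff_rdistrib scaleR_matrix_vector_assoc[symmetric])
  finally show ?thesis by (simp add: inner_diff_left)
qed

lemma R_invertible: "t \<in> {0..T} \<Longrightarrow> invertible (R t)"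
  by (rule invertible_if_coercive[OF d2_pos R_coercive])

lemma R_Ri: "t \<in> {0..T} \<Longrightarrow> R t *v (Ri t *v x) = x"
  using matrix_inv_mult_vec(1)[OF R_invertible] .

lemma bddR: "L_infty T R" by (rule L_infty_continuous[OF contR])

lemma bddRi: "L_infty T Ri"
  by (rule L_infty_continuous, rule continuous_on_matrix_inv[OF d2_pos contR R_coercive])

sublocale wiener_space T M F W
proof -
  have u: "usual_filtered_space T M F" and b: "brownian_motion T M F W"
    using stoch unfolding stochastic_assumptions_def by blast+
  note u = u[unfolded usual_filtered_space_def]
  note p = u[THEN conjunct1] and c = u[THEN conjunct2, THEN conjunct1]
    and s = u[THEN conjunct2, THEN conjunct2, THEN conjunct1, THEN bspec]
    and m = u[THEN conjunct2, THEN conjunct2, THEN conjunct2, THEN conjunct1, THEN bspec, THEN bspec, THEN mp]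
    and n = u[THEN conjunct2, THEN conjunct2, THEN conjunct2, THEN conjunct2, THEN conjunct1]
  show "wiener_space T M F W"
  proof (intro wiener_space.intro filt_space.intro time_space.intro filt_space_axioms.intro wiener_space_axioms.intro)
    show "0 < T" by (rule T_pos)
    show "prob_space M" by (rule p)
    show "complete_measure M" by (rule c)
    show "subalgebra M (F t)" if "t \<in> {0..T}" for t by (rule s[OF that])
    show "sets (F s) \<subseteq> sets (F t)" if "0 \<le> s" "s \<le> t" "t \<le> T" for s t by (rule m) (use that in auto)
    show "null_sets M \<subseteq> sets (F t)" if "t \<in> {0..T}" for t
      by (rule order_trans[OF n m]) (use that in auto)
    show "brownian_motion T M F W" by (rule b)
  qed
qed

lemma filt_right_continuous: "t \<in> {0..<T} \<Longrightarrow> sets (F t) = (\<Inter>s\<in>{t<..T}. sets (F s))"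
  using stoch unfolding stochastic_assumptions_def usual_filtered_space_def by blast

lemma xi_adapted: "t \<in> {0..T} \<Longrightarrow> xi D \<in> borel_measurable (F t)"
proof -
  have "xi D \<in> borel_measurable (F 0)" using stoch unfolding stochastic_assumptions_def by blast
  then show "t \<in> {0..T} \<Longrightarrow> xi D \<in> borel_measurable (F t)" by (intro G_measurable_mono[of 0 t]) auto
qed

lemma xi_L2: "L2 M (xi D)"
proof -
  have "integrable M (\<lambda>\<omega>. (norm (xi D \<omega>))\<^sup>2)" using stoch unfolding stochastic_assumptions_def by blast
  moreover have m: "0 \<in> {0..T}" using T_pos by simp
  ultimately show ?thesis unfolding L2_def using G_measurable_M[OF m xi_adapted[OF m]] by blast
qed

section \<open>The filtration generated by the initial value and the Brownian motion\<close>

lemma raw_subset_Pow: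
  "rv_sigma (space M) (xi D) \<union> path_sigma (space M) {0..s} W \<union> null_sets M \<subseteq> Pow (space M)"
proof -
  have "path_sigma (space M) {0..s} W \<subseteq> Pow (space M)"
    unfolding path_sigma_def
    using sigma_sets_into_sp[of "{Z t -` A \<inter> space M |t A Z. Z = W \<and> t \<in> {0..s} \<and> A \<in> sets borel}" "space M"] by auto
  then show ?thesis unfolding rv_sigma_def using sets.sets_into_space null_setsD2 by blast
qed

lemma raw_sigma_algebra: "sigma_algebra (space M) (raw_noise_filt D s)"
  unfolding raw_noise_filt_def by (rule sigma_algebra_sigma_sets[OF raw_subset_Pow])

lemma raw_Pow: "raw_noise_filt D s \<subseteq> Pow (space M)"
  unfolding raw_noise_filt_def using sigma_sets_into_sp[OF raw_subset_Pow] by blast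

lemma raw_subset_F:
  assumes s: "s \<in> {0..T}" shows "raw_noise_filt D s \<subseteq> sets (F s)"
proof -
  have "rv_sigma (space M) (xi D) \<subseteq> sets (F s)"
    unfolding rv_sigma_def using measurable_sets[OF xi_adapted[OF s]] space_G[OF s] by auto
  moreover have "path_sigma (space M) {0..s} W \<subseteq> sets (F s)"
    unfolding path_sigma_def space_G[OF s, symmetric]
  proof (rule sets.sigma_sets_subset, safe)
    fix u and E :: "(real^'d) set" assume u: "u \<in> {0..s}" and E: "E \<in> sets borel"
    have "W u \<in> borel_measurable (F s)" by (rule G_measurable_mono[OF _ _ _ W_adapted]) (use u s in auto)
    from measurable_sets[OF this E] show "W u -` E \<inter> space (F s) \<in> sets (F s)" .
  qed
  ultimately show ?thesis
    unfolding raw_noise_filt_def using null_G[OF s] space_G[OF s]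
    by (subst space_G[OF s, symmetric]) (intro sets.sigma_sets_subset, simp)
qed

lemma raw_mono: "s \<le> t \<Longrightarrow> raw_noise_filt D s \<subseteq> raw_noise_filt D t"
proof -
  assume st: "s \<le> t"
  have "path_sigma (space M) {0..s} W \<subseteq> path_sigma (space M) {0..t} W"
    unfolding path_sigma_def by (rule sigma_sets_mono') (use st in force)
  then show ?thesis unfolding raw_noise_filt_def by (intro sigma_sets_mono') blast
qed

text \<open>An intersection of sigma-algebras is a sigma-algebra, hence equal to what it
  generates.\<close>

lemma sets_F1: "sets (F1 t) = (\<Inter>s\<in>{t<..<T} \<union> {T}. raw_noise_filt D s)"
proof -
  let ?X = "\<Inter>s\<in>{t<..<T} \<union> {T}. raw_noise_filt D s"
  have P: "?X \<subseteq> Pow (space M)"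
    using raw_Pow by blast
  have "sigma_sets (space M) ?X \<subseteq> ?X"
  proof (rule INT_greatest)
    fix s assume "s \<in> {t<..<T} \<union> {T}"
    then show "sigma_sets (space M) ?X \<subseteq> raw_noise_filt D s"
      by (intro sigma_algebra.sigma_sets_subset[OF raw_sigma_algebra]) blast
  qed
  moreover have "?X \<subseteq> sigma_sets (space M) ?X" by (rule sigma_sets_superset_generator)
  ultimately show ?thesis unfolding filt1_def by (subst sets_measure_of[OF P]) blast
qed

lemma space_F1: "space (F1 t) = space M"
proof -
  have "(\<Inter>s\<in>{t<..<T} \<union> {T}. raw_noise_filt D s) \<subseteq> Pow (space M)"
    using raw_Pow by blast
  then show ?thesis unfolding filt1_def by (rule space_measure_of)
qed

lemma raw_subset_F1: "t \<in> {0..T} \<Longrightarrow> raw_noise_filt D t \<subseteq> sets (F1 t)"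
  unfolding sets_F1 by (intro INT_greatest raw_mono) auto

text \<open>Before the horizon \<open>filt1 D\<close> looks infinitesimally into the future of the
  raw filtration; right-continuity of \<open>filt D\<close> absorbs this. At the horizon the raw
  filtration itself is compared.\<close>

lemma F1_subset_F:
  assumes t: "t \<in> {0..T}" shows "sets (F1 t) \<subseteq> sets (F t)"
proof (cases "t = T")
  case True
  then show ?thesis unfolding sets_F1 using raw_subset_F[of T] t by auto
next
  case False
  have "(\<Inter>s\<in>{t<..<T} \<union> {T}. raw_noise_filt D s) \<subseteq> (\<Inter>s\<in>{t<..T}. sets (F s))"
  proof (rule INT_greatest)
    fix s assume s: "s \<in> {t<..T}"
    then have "raw_noise_filt D s \<subseteq> sets (F s)" using t by (intro raw_subset_F) auto
    moreover have "s \<in> {t<..<T} \<union> {T}" using s by auto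
    ultimately show "(\<Inter>s\<in>{t<..<T} \<union> {T}. raw_noise_filt D s) \<subseteq> sets (F s)" by blast
  qed
  then show ?thesis unfolding sets_F1 using filt_right_continuous[of t] t False by simp
qed

sublocale F1: filt_space T M F1
proof (intro filt_space.intro filt_space_axioms.intro)
  show "time_space T M" by (rule time_space_axioms)
  show "complete_measure M" by (rule complete_M)
  show "subalgebra M (F1 t)" if "t \<in> {0..T}" for t
    using F1_subset_F[OF that] sub_G[OF that] space_F1[of t] unfolding subalgebra_def by blast
  show "sets (F1 s) \<subseteq> sets (F1 t)" if "0 \<le> s" "s \<le> t" "t \<le> T" for s t
    unfolding sets_F1 using that by (intro INT_anti_mono) auto
  show "null_sets M \<subseteq> sets (F1 t)" if t: "t \<in> {0..T}" for t
  proof -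
    have "null_sets M \<subseteq> raw_noise_filt D t" unfolding raw_noise_filt_def by (auto intro: sigma_sets.Basic)
    then show ?thesis using raw_subset_F1[OF t] by blast
  qed
qed

lemma xi_F1: "t \<in> {0..T} \<Longrightarrow> xi D \<in> borel_measurable (F1 t)"
proof (rule measurableI)
  fix E :: "(real^'d) set" assume t: "t \<in> {0..T}" and E: "E \<in> sets borel"
  have "xi D -` E \<inter> space M \<in> raw_noise_filt D t"
    unfolding raw_noise_filt_def rv_sigma_def using E by (intro sigma_sets.Basic) blast
  then show "xi D -` E \<inter> space (F1 t) \<in> sets (F1 t)" unfolding space_F1 using raw_subset_F1[OF t] by blast
qed simp

lemma W_F1: "t \<in> {0..T} \<Longrightarrow> s \<in> {0..t} \<Longrightarrow> W s \<in> borel_measurable (F1 t)"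
proof (rule measurableI)
  fix E :: "(real^'d) set" assume t: "t \<in> {0..T}" and s: "s \<in> {0..t}" and E: "E \<in> sets borel"
  have "W s -` E \<inter> space M \<in> path_sigma (space M) {0..t} W"
    unfolding path_sigma_def using E s by (intro sigma_sets.Basic) blast
  then have "W s -` E \<inter> space M \<in> raw_noise_filt D t"
    unfolding raw_noise_filt_def by (intro sigma_sets.Basic) blast
  then show "W s -` E \<inter> space (F1 t) \<in> sets (F1 t)" unfolding space_F1 using raw_subset_F1[OF t] by blast
qed simp

text \<open>Independence is assumed for \<open>noise_sigma D\<close>, which is not completed.
  Induction along the generation of the sigma-algebra shows that adjoining the null sets alters each
  event by a null set only.\<close>

lemma raw_T_noise:
  assumes "E \<in> raw_noise_filt D T"
  shows "\<exists>E'\<in>noise_sigma D. AE \<omega> in M. \<omega> \<in> E \<longleftrightarrow> \<omega> \<in> E'"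
  using assms unfolding raw_noise_filt_def
proof (induction rule: sigma_sets.induct)
  case (Basic a)
  show ?case
  proof (cases "a \<in> null_sets M")
    case True
    then have "AE \<omega> in M. \<omega> \<in> a \<longleftrightarrow> \<omega> \<in> {}" using AE_not_in by fastforce
    then show ?thesis unfolding noise_sigma_def using sigma_sets.Empty by blast
  next
    case False
    then have "a \<in> noise_sigma D" using Basic unfolding noise_sigma_def by (intro sigma_sets.Basic) blast
    then show ?thesis by (intro bexI[of _ a]) auto
  qed
next
  case Empty
  show ?case unfolding noise_sigma_def by (intro bexI[of _ "{}"] sigma_sets.Empty) auto
next
  case (Compl a)
  then obtain E' where E': "E' \<in> noise_sigma D" "AE \<omega> in M. \<omega> \<in> a \<longleftrightarrow> \<omega> \<in> E'" by blast
  have "space M - E' \<in> noise_sigma D" using E'(1) unfolding noise_sigma_def by (rule sigma_sets.Compl)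
  moreover have "AE \<omega> in M. \<omega> \<in> space M - a \<longleftrightarrow> \<omega> \<in> space M - E'" using E'(2) by eventually_elim auto
  ultimately show ?case by blast
next
  case (Union a)
  then obtain E' where E': "\<And>i. E' i \<in> noise_sigma D" "\<And>i. AE \<omega> in M. \<omega> \<in> a i \<longleftrightarrow> \<omega> \<in> E' i" by metis
  have "(\<Union>i::nat. E' i) \<in> noise_sigma D" using E'(1) unfolding noise_sigma_def by (rule sigma_sets.Union)
  moreover have "AE \<omega> in M. \<forall>i. \<omega> \<in> a i \<longleftrightarrow> \<omega> \<in> E' i" using E'(2) by (simp add: AE_all_countable)
  then have "AE \<omega> in M. \<omega> \<in> (\<Union>i. a i) \<longleftrightarrow> \<omega> \<in> (\<Union>i. E' i)" by eventually_elim auto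
  ultimately show ?case by blast
qed

text \<open>At the horizon \<open>filt1 D\<close> is the completed raw filtration, and probabilities
  do not see modifications by null sets.\<close>

lemma indep_raw:
  assumes "indep_set \<A> (noise_sigma D)"
  shows "indep_set \<A> (sets (F1 T))"
  unfolding indep_sets2_eq
proof (intro conjI ballI)
  show "\<A> \<subseteq> events" using assms unfolding indep_sets2_eq by blast
  have T: "T \<in> {0..T}" using T_pos by simp
  show F1e: "sets (F1 T) \<subseteq> events" using F1.sub_G[OF T] unfolding subalgebra_def by blast
  fix a b assume a: "a \<in> \<A>" and b: "b \<in> sets (F1 T)"
  have "b \<in> raw_noise_filt D T" using b unfolding sets_F1 by simp
  then obtain b' where b': "b' \<in> noise_sigma D" "AE \<omega> in M. \<omega> \<in> b \<longleftrightarrow> \<omega> \<in> b'" using raw_T_noise by blast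
  have ev: "a \<in> events" "b' \<in> events" "b \<in> events" and eq: "prob (a \<inter> b') = prob a * prob b'"
    using assms a b'(1) b F1e unfolding indep_sets2_eq by blast+
  have "prob (a \<inter> b) = prob (a \<inter> b')"
    by (rule finite_measure_eq_AE) (use b'(2) ev in \<open>auto elim: eventually_mono\<close>)
  moreover have "prob b = prob b'"
    by (rule finite_measure_eq_AE) (use b'(2) ev in auto)
  ultimately show "prob (a \<inter> b) = prob a * prob b" using eq by simp
qed

lemma H2_prog: "\<alpha> \<in> H2 D G \<Longrightarrow> prog_measurable T G \<alpha>"
  unfolding H2_def by blast

lemma H2_L2P:
  assumes "filt_space T M G" "\<alpha> \<in> H2 D G" shows "L2P \<alpha>"
proof -
  have m: "meas_proc \<alpha>" by (rule filt_space.prog_meas_proc[OF assms(1) H2_prog[OF assms(2)]])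
  show ?thesis using assms(2) m unfolding H2_def L2P_def L2_iff_nn_integral nn_integral_TM_path[OF m] nn_integral_TL
    by (simp add: meas_proc_def)
qed

lemma H2I:
  assumes "prog_measurable T G \<alpha>" "L2P \<alpha>" shows "\<alpha> \<in> H2 D G"
  using assms unfolding H2_def nn_integral_TL L2P_def L2_iff_nn_integral
  by (simp add: nn_integral_TM_path[OF L2P_meas[OF assms(2)], symmetric])

lemma H2_F1_F: "\<alpha> \<in> H2 D F1 \<Longrightarrow> \<alpha> \<in> H2 D F"
  by (rule H2I[OF prog_measurable_mono[OF H2_prog] H2_L2P[OF F1.filt_space_axioms]])
     (use F1_subset_F space_F1 space_G in auto)

end

section \<open>State processes\<close>

context lq
begin

lemma filt_space_F: "filt_space T M F" by (rule filt_space_axioms)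
lemma filt_space_F1: "filt_space T M F1" by (rule F1.filt_space_axioms)

lemma filt_space_F0: "filt_space T M (\<lambda>_. F 0)"
proof (intro filt_space.intro filt_space_axioms.intro)
  have 0: "0 \<in> {0..T}" using T_pos by simp
  show "time_space T M" by (rule time_space_axioms)
  show "complete_measure M" by (rule complete_M)
  show "subalgebra M (F 0)" by (rule sub_G[OF 0])
  show "null_sets M \<subseteq> sets (F 0)" by (rule null_G[OF 0])
qed simp

lemma is_state_continuous: "is_state D lam X \<Longrightarrow> \<omega> \<in> space M \<Longrightarrow> continuous_on {0..T} (\<lambda>t. X t \<omega>)"
  and is_state_adapted: "is_state D lam X \<Longrightarrow> t \<in> {0..T} \<Longrightarrow> X t \<in> borel_measurable (F t)"
  unfolding is_state_def by blast+

lemma is_state_meas_proc: "is_state D lam X \<Longrightarrow> meas_proc X"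
  by (rule prog_meas_proc[OF prog_continuous[OF is_state_continuous is_state_adapted]])

text \<open>The Wiener integral recovered from the state. The process J in \<open>is_state\<close>
  satisfies the equation almost surely, whereas this one satisfies it on every path by construction
  and is jointly measurable.\<close>

definition noise :: "(real \<Rightarrow> 'w \<Rightarrow> real^'k) \<Rightarrow> (real \<Rightarrow> 'w \<Rightarrow> real^'d) \<Rightarrow> real \<Rightarrow> 'w \<Rightarrow> real^'d" where
  "noise lam X t \<omega> = X t \<omega> - xi D \<omega> - (LBINT s:{0..t}. A s *v X s \<omega>) - (LBINT s:{0..t}. B s *v lam s \<omega>)"

lemma state_eq: "X t \<omega> = (xi D \<omega> + (LBINT s:{0..t}. B s *v lam s \<omega>) + noise lam X t \<omega>) + (LBINT s:{0..t}. A s *v X s \<omega>)"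
  unfolding noise_def by simp

lemma path_integrable_control:
  assumes "L2P lam"
  shows "AE \<omega> in M. set_integrable lborel {0..T} (\<lambda>s. B s *v lam s \<omega>)"
  by (rule L2P_path_integrable[OF L2P_mv[OF bddB assms]])

lemma set_integral_add_sub:
  fixes f g :: "real \<Rightarrow> 'b::euclidean_space"
  assumes "set_integrable lborel {0..T} f" "set_integrable lborel {0..T} g" "t \<in> {0..T}"
  shows "(LBINT s:{0..t}. f s + g s) = (LBINT s:{0..t}. f s) + (LBINT s:{0..t}. g s)"
  by (rule set_integral_add(2); rule set_integrable_subset[where A="{0..T}"]) (use assms in auto)

lemma set_integral_diff_sub:
  fixes f g :: "real \<Rightarrow> 'b::euclidean_space"
  assumes "set_integrable lborel {0..T} f" "set_integrable lborel {0..T} g" "t \<in> {0..T}"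
  shows "(LBINT s:{0..t}. f s - g s) = (LBINT s:{0..t}. f s) - (LBINT s:{0..t}. g s)"
  by (rule set_integral_diff(2); rule set_integrable_subset[where A="{0..T}"]) (use assms in auto)

lemma is_state_wiener:
  assumes X: "is_state D lam X" and lam: "L2P lam"
  obtains J where "is_wiener_integral T M W (cSigma D) J" "AE \<omega> in M. \<forall>t\<in>{0..T}. noise lam X t \<omega> = J t \<omega>"
proof -
  obtain J where J: "is_wiener_integral T M W (cSigma D) J"
    "AE \<omega> in M. \<forall>t\<in>{0..T}. X t \<omega> = xi D \<omega> + (LBINT s:{0..t}. A s *v X s \<omega> + B s *v lam s \<omega>) + J t \<omega>"
    using X unfolding is_state_def by blast
  have "AE \<omega> in M. \<forall>t\<in>{0..T}. noise lam X t \<omega> = J t \<omega>"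
    using J(2) path_integrable_control[OF lam] AE_space
  proof eventually_elim
    case (elim \<omega>)
    show ?case
    proof
      fix t assume t: "t \<in> {0..T}"
      have "X t \<omega> = xi D \<omega> + ((LBINT s:{0..t}. A s *v X s \<omega>) + (LBINT s:{0..t}. B s *v lam s \<omega>)) + J t \<omega>"
        unfolding set_integral_add_sub[OF set_integrable_mv[OF bddA is_state_continuous[OF X elim(3)]] elim(2) t, symmetric] using elim(1) t by blast
      then show "noise lam X t \<omega> = J t \<omega>" unfolding noise_def by simp
    qed
  qed
  with J(1) that show ?thesis by blast
qed

lemma noise_meas_proc:
  assumes X: "is_state D lam X" and lam: "L2P lam" shows "meas_proc (noise lam X)"
  unfolding noise_def[abs_def]
  by (intro meas_proc_diff is_state_meas_proc[OF X] meas_proc_integral meas_proc_mv bddA bddB L2P_meas[OF lam]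
      bddL2_meas[OF bddL2_const[OF xi_L2]])

lemma noise_wiener:
  assumes X: "is_state D lam X" and lam: "L2P lam"
  shows "is_wiener_integral T M W (cSigma D) (noise lam X)"
proof -
  obtain J where J: "is_wiener_integral T M W (cSigma D) J" "AE \<omega> in M. \<forall>t\<in>{0..T}. noise lam X t \<omega> = J t \<omega>"
    by (rule is_state_wiener[OF X lam])
  have m: "noise lam X t \<in> borel_measurable M" if "t \<in> {0..T}" for t
    by (rule meas_proc_time[OF noise_meas_proc[OF X lam] that])
  have eq: "msq M (\<lambda>\<omega>. Y \<omega> - J t \<omega>) = msq M (\<lambda>\<omega>. Y \<omega> - noise lam X t \<omega>)"
    if "t \<in> {0..T}" for t Y
    using J(2) that by (intro nn_integral_cong_AE) (auto elim: eventually_mono)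
  show ?thesis
    using J(1) m unfolding is_wiener_integral_def by (simp only: eq cong: ball_cong) blast
qed

lemma noise_bddL2:
  assumes X: "is_state D lam X" and lam: "L2P lam" shows "bddL2 (noise lam X)"
proof (rule bddL2I[OF noise_meas_proc[OF X lam]])
  fix t assume t: "t \<in> {0..T}"
  have "integrable M (\<lambda>\<omega>. (norm (noise lam X t \<omega>))\<^sup>2)"
    using wiener_integral_L2[OF noise_wiener[OF X lam] t] unfolding L2_def by blast
  then have "msq M (noise lam X t) = ennreal (expectation (\<lambda>\<omega>. (norm (noise lam X t \<omega>))\<^sup>2))"
    by (rule nn_integral_eq_integral) simp
  also have "\<dots> \<le> ennreal (expectation (\<lambda>\<omega>. (norm (noise lam X T \<omega>))\<^sup>2))"
    by (rule ennreal_leI[OF wiener_integral_bound[OF noise_wiener[OF X lam] t]])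
  finally show "msq M (noise lam X t) \<le> ennreal (expectation (\<lambda>\<omega>. (norm (noise lam X T \<omega>))\<^sup>2))" .
qed

lemma forcing_bddL2:
  assumes X: "is_state D lam X" and lam: "L2P lam"
  shows "bddL2 (\<lambda>t \<omega>. xi D \<omega> + (LBINT s:{0..t}. B s *v lam s \<omega>) + noise lam X t \<omega>)"
  by (intro bddL2_add bddL2_const xi_L2 bddL2_integral L2P_mv bddB lam noise_bddL2[OF X lam])

text \<open>The forcing equals the state minus the integral of A X, so it is continuous on every
  path, although the control integral and the noise are separately known to be continuous only
  almost surely.\<close>

lemma forcing_continuous:
  assumes X: "is_state D lam X" and w: "\<omega> \<in> space M"
  shows "continuous_on {0..T} (\<lambda>t. xi D \<omega> + (LBINT s:{0..t}. B s *v lam s \<omega>) + noise lam X t \<omega>)"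
proof -
  have "(\<lambda>t. xi D \<omega> + (LBINT s:{0..t}. B s *v lam s \<omega>) + noise lam X t \<omega>) = (\<lambda>t. X t \<omega> - (LBINT s:{0..t}. A s *v X s \<omega>))"
    unfolding noise_def by (rule ext) simp
  then show ?thesis
    using is_state_continuous[OF X w] continuous_on_set_integral[OF set_integrable_mv[OF bddA is_state_continuous[OF X w]]]
    by (simp only:) (rule continuous_on_diff)
qed

lemma state_bddL2:
  assumes X: "is_state D lam X" and lam: "L2P lam" shows "bddL2 X"
proof (rule bddL2_linear_ode[OF bddA forcing_bddL2[OF X lam] is_state_meas_proc[OF X]])
  show "AE \<omega> in M. continuous_on {0..T} (\<lambda>t. xi D \<omega> + (LBINT s:{0..t}. B s *v lam s \<omega>) + noise lam X t \<omega>)"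
    by (rule AE_I2[OF forcing_continuous[OF X]])
  show "AE \<omega> in M. continuous_on {0..T} (\<lambda>t. X t \<omega>)" by (rule AE_I2[OF is_state_continuous[OF X]])
  show "AE \<omega> in M. \<forall>t\<in>{0..T}. X t \<omega> = xi D \<omega> + (LBINT s:{0..t}. B s *v lam s \<omega>) + noise lam X t \<omega> + (LBINT s:{0..t}. A s *v X s \<omega>)"
    by (intro AE_I2 ballI state_eq)
qed

lemma noise_continuous:
  assumes X: "is_state D lam X" and lam: "L2P lam"
  shows "AE \<omega> in M. continuous_on {0..T} (\<lambda>t. noise lam X t \<omega>)"
  using path_integrable_control[OF lam] AE_space
proof eventually_elim
  case (elim \<omega>)
  show ?case unfolding noise_def
    by (intro continuous_on_diff continuous_on_const is_state_continuous[OF X elim(2)] continuous_on_set_integral elim(1)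
        set_integrable_mv[OF bddA is_state_continuous[OF X elim(2)]])
qed

text \<open>By uniqueness of the Wiener integral the two agree almost surely at each time, and both
  have continuous paths. The controls may differ, which is what comparing the deviations of the flow
  and of the equilibrium requires.\<close>

lemma noise_unique:
  assumes X: "is_state D lam X" and lam: "L2P lam" and X': "is_state D lam' X'" and lam': "L2P lam'"
  shows "AE \<omega> in M. \<forall>t\<in>{0..T}. noise lam X t \<omega> = noise lam' X' t \<omega>"
  by (rule AE_eq_paths[OF noise_continuous[OF X lam] noise_continuous[OF X' lam']])
     (rule wiener_integral_unique[OF noise_wiener[OF X lam] noise_wiener[OF X' lam'] bddSigma])

lemma state_unique:
  assumes X: "is_state D lam X" and X': "is_state D lam X'" and lam: "L2P lam"
  shows "AE \<omega> in M. \<forall>t\<in>{0..T}. X t \<omega> = X' t \<omega>"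
  using noise_unique[OF X lam X' lam] AE_space
proof eventually_elim
  case (elim \<omega>)
  show ?case
  proof
    fix t assume t: "t \<in> {0..T}"
    show "X t \<omega> = X' t \<omega>"
    proof (rule linear_ode_unique[OF bddA is_state_continuous[OF X elim(2)] is_state_continuous[OF X' elim(2)] _ _ t])
      fix t assume "t \<in> {0..T}"
      then show "X' t \<omega> = (xi D \<omega> + (LBINT s:{0..t}. B s *v lam s \<omega>) + noise lam X t \<omega>) + (LBINT s:{0..t}. A s *v X' s \<omega>)"
        using state_eq[of X' t \<omega> lam] elim(1) by simp
    qed (rule state_eq)
  qed
qed

text \<open>By linearity a change of the control adds an absolutely continuous response to the state
  and leaves the noise as it is.\<close>

lemma state_perturb:
  assumes X: "is_state D lam X" and lam: "L2P lam" and eta: "L2P eta"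
    and xc: "\<And>\<omega>. \<omega> \<in> space M \<Longrightarrow> continuous_on {0..T} (\<lambda>t. x t \<omega>)"
    and xm: "\<And>t. t \<in> {0..T} \<Longrightarrow> x t \<in> borel_measurable (F t)"
    and eq: "AE \<omega> in M. \<forall>t\<in>{0..T}. x t \<omega> = (LBINT s:{0..t}. B s *v eta s \<omega>) + (LBINT s:{0..t}. A s *v x s \<omega>)"
  shows "is_state D (\<lambda>t \<omega>. lam t \<omega> + eta t \<omega>) (\<lambda>t \<omega>. X t \<omega> + x t \<omega>)"
  unfolding is_state_def
proof (intro conjI ballI exI)
  show "continuous_on {0..T} (\<lambda>t. X t \<omega> + x t \<omega>)" if "\<omega> \<in> space M" for \<omega>
    by (intro continuous_on_add is_state_continuous[OF X that] xc that)
  show "(\<lambda>\<omega>. X t \<omega> + x t \<omega>) \<in> borel_measurable (F t)" if "t \<in> {0..T}" for t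
    by (intro borel_measurable_add is_state_adapted[OF X that] xm that)
  show "is_wiener_integral T M W (cSigma D) (noise lam X)" by (rule noise_wiener[OF X lam])
  show "AE \<omega> in M. \<forall>t\<in>{0..T}. X t \<omega> + x t \<omega> = xi D \<omega> +
      (LBINT s:{0..t}. A s *v (X s \<omega> + x s \<omega>) + B s *v (lam s \<omega> + eta s \<omega>)) + noise lam X t \<omega>"
    using eq path_integrable_control[OF lam] path_integrable_control[OF eta] AE_space
  proof eventually_elim
    case (elim \<omega>)
    note iX = set_integrable_mv[OF bddA is_state_continuous[OF X elim(4)]]
      and ix = set_integrable_mv[OF bddA xc[OF elim(4)]]
    show ?case
    proof
      fix t assume t: "t \<in> {0..T}"
      have "(LBINT s:{0..t}. A s *v (X s \<omega> + x s \<omega>) + B s *v (lam s \<omega> + eta s \<omega>)) =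
         ((LBINT s:{0..t}. A s *v X s \<omega>) + (LBINT s:{0..t}. A s *v x s \<omega>)) + ((LBINT s:{0..t}. B s *v lam s \<omega>) + (LBINT s:{0..t}. B s *v eta s \<omega>))"
        unfolding matrix_vector_right_distrib
        by (simp only: set_integral_add_sub[OF _ _ t] iX ix elim(2,3) set_integral_add(1))
      moreover have "x t \<omega> = (LBINT s:{0..t}. B s *v eta s \<omega>) + (LBINT s:{0..t}. A s *v x s \<omega>)" using elim(1) t by blast
      ultimately show "X t \<omega> + x t \<omega> = xi D \<omega> +
        (LBINT s:{0..t}. A s *v (X s \<omega> + x s \<omega>) + B s *v (lam s \<omega> + eta s \<omega>)) + noise lam X t \<omega>"
        using state_eq[of X t \<omega> lam] by simp
    qed
  qed
qed

lemma control_integral_adapted: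
  assumes G: "filt_space T M G" and eta: "prog_measurable T G eta" and t: "t \<in> {0..T}"
  shows "(\<lambda>\<omega>. LBINT s:{0..t}. B s *v eta s \<omega>) \<in> borel_measurable (G t)"
  by (rule filt_space.prog_integral[OF G prog_mv[OF bddB eta] t])

lemma control_integral_continuous:
  assumes "L2P eta" shows "AE \<omega> in M. continuous_on {0..T} (\<lambda>t. LBINT s:{0..t}. B s *v eta s \<omega>)"
  using path_integrable_control[OF assms] by eventually_elim (rule continuous_on_set_integral)

text \<open>The response to the difference of the two controls is added to the given state
  \<open>X\<close>. In this way the choice in \<open>state\<close> denotes a genuine
  solution.\<close>

lemma state_exists:
  assumes X: "is_state D lam X" and lam: "lam \<in> H2 D F" and bet: "bet \<in> H2 D F"
  shows "\<exists>X'. is_state D bet X'"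
proof -
  define eta where "eta = (\<lambda>t \<omega>. bet t \<omega> - lam t \<omega>)"
  have lamL: "L2P lam" by (rule H2_L2P[OF filt_space_F lam])
  have betL: "L2P bet" by (rule H2_L2P[OF filt_space_F bet])
  have eta: "L2P eta" unfolding eta_def by (rule L2P_diff[OF betL lamL])
  have etap: "prog_measurable T F eta" unfolding eta_def by (rule prog_diff[OF H2_prog[OF bet] H2_prog[OF lam]])
  obtain x where x: "\<And>\<omega>. \<omega> \<in> space M \<Longrightarrow> continuous_on {0..T} (\<lambda>t. x t \<omega>)"
    "\<And>t. t \<in> {0..T} \<Longrightarrow> x t \<in> borel_measurable (F t)"
    "AE \<omega> in M. \<forall>t\<in>{0..T}. x t \<omega> = (LBINT s:{0..t}. B s *v eta s \<omega>) + (LBINT s:{0..t}. A s *v x s \<omega>)"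
    using adapted_linear_ode[OF bddA control_integral_continuous[OF eta] control_integral_adapted[OF filt_space_F etap]]
    by blast
  have "is_state D (\<lambda>t \<omega>. lam t \<omega> + eta t \<omega>) (\<lambda>t \<omega>. X t \<omega> + x t \<omega>)"
    by (rule state_perturb[OF X lamL eta x])
  moreover have "(\<lambda>t \<omega>. lam t \<omega> + eta t \<omega>) = bet" unfolding eta_def by simp
  ultimately show ?thesis by auto
qed

lemma state_is_state:
  assumes X: "is_state D lam X" and lam: "lam \<in> H2 D F" and bet: "bet \<in> H2 D F"
  shows "is_state D bet (state D bet)"
  unfolding state_def by (rule someI_ex[OF state_exists[OF assms]])

text \<open>\<open>is_state\<close> provides adaptedness to \<open>filt D\<close>. The forcing is
  adapted to \<open>filt1 D\<close>, so its Picard series is as well, and by uniqueness the series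
  is the state.\<close>

lemma state_F1_adapted:
  assumes al: "al \<in> H2 D F1" and X: "is_state D al X" and t: "t \<in> {0..T}"
  shows "X t \<in> borel_measurable (F1 t)"
proof -
  have alL: "L2P al" by (rule H2_L2P[OF filt_space_F1 al])
  let ?f = "\<lambda>t \<omega>. xi D \<omega> + (LBINT s:{0..t}. B s *v al s \<omega>) + noise al X t \<omega>"
  have fm: "?f t \<in> borel_measurable (F1 t)" if t: "t \<in> {0..T}" for t
    by (intro borel_measurable_add xi_F1 t control_integral_adapted[OF filt_space_F1 H2_prog[OF al] t]
        wiener_integral_adapted[OF noise_wiener[OF X alL] filt_space_F1 t] W_F1; assumption)
  have P: "(\<lambda>\<omega>. picard A (\<lambda>s. ?f s \<omega>) t) \<in> borel_measurable (F1 t)"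
    by (rule F1.picard_adapted[OF bddA forcing_continuous[OF X] fm t])
  have "picard A (\<lambda>s. ?f s \<omega>) t = X t \<omega>" if w: "\<omega> \<in> space M" for \<omega>
    by (rule linear_ode_unique[OF bddA picard_solution(1)[OF bddA forcing_continuous[OF X w]] is_state_continuous[OF X w]
          picard_solution(2)[OF bddA forcing_continuous[OF X w]] state_eq t])
  then show ?thesis by (rule measurable_cong[THEN iffD1, OF _ P, unfolded space_F1])
qed

end

section \<open>The payoff and its first-order condition\<close>

lemma inner_transpose_left: "(transpose (C::real^'n^'m) *v u) \<bullet> v = u \<bullet> (C *v v)"
  by (simp add: dot_lmul_matrix[symmetric])

lemma inner_transpose_right: "u \<bullet> (transpose (C::real^'n^'m) *v v) = (C *v u) \<bullet> v"
  by (subst inner_commute, subst inner_transpose_left, rule inner_commute)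

lemma mv_add: "(C + D) *v x = C *v x + (D *v x :: real^'m)"
  by (rule bounded_bilinear.add_left[OF bounded_bilinear_mv])

lemma mv_diff: "(C - D) *v x = C *v x - (D *v x :: real^'m)"
  by (rule bounded_bilinear.diff_left[OF bounded_bilinear_mv])

lemma mv_minus_left: "(- C) *v x = - (C *v x :: real^'m)"
  by (rule bounded_bilinear.minus_left[OF bounded_bilinear_mv])

lemma mv_mm: "(C ** E) *v x = C *v (E *v (x :: real^'n))"
  by (simp add: matrix_vector_mul_assoc)

lemma mv_minus_right: "C *v (- x) = - (C *v (x::real^'n))"
  by (rule bounded_bilinear.minus_right[OF bounded_bilinear_mv])

lemmas mv_simps = mv_add mv_diff mv_minus_left mv_mm mv_minus_right matrix_vector_right_distrib
  matrix_vector_mult_diff_distrib matrix_vector_mult_scaleR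

text \<open>
  The derivative of the inner product of the adjoint process with the perturbation of the state,
  compared with the directional derivative of the running payoff.
\<close>

lemma first_order_identity:
  fixes A Q Qt \<phi> \<psi> :: "real^'d^'d" and B :: "real^'k^'d" and S :: "real^'d^'k" and R Ri :: "real^'k^'k"
    and X m \<theta> x q :: "real^'d" and a r :: "real^'k"
  assumes RRi: "\<And>v. R *v (Ri *v v) = v"
    and Q: "transpose Q = Q" and Qt: "transpose Qt = Qt" and R: "transpose R = R"
  defines "g \<equiv> \<phi> ** A + transpose A ** \<phi> + Q - (\<phi> ** B + transpose S) ** Ri ** (transpose B ** \<phi> + S)"
    and "g2 \<equiv> transpose A ** \<psi> + Qt - (\<phi> ** B + transpose S) ** Ri ** transpose B ** \<psi>"
    and "th \<equiv> transpose A *v \<theta> + q - ((\<phi> ** B + transpose S) ** Ri) *v (transpose B *v \<theta> + r)"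
    and "eps \<equiv> a + (Ri ** (transpose B ** \<phi> + S)) *v X + (Ri ** transpose B ** \<psi>) *v m + Ri *v (transpose B *v \<theta> + r)"
  defines "eta \<equiv> eps - (Ri ** (transpose B ** transpose \<phi> + S)) *v x"
  defines "x' \<equiv> A *v x + B *v eta"
  shows "- 1/2 * ((Q *v X) \<bullet> x + (Q *v x) \<bullet> X) - (Qt *v x) \<bullet> m - q \<bullet> x
      - 1/2 * ((R *v a) \<bullet> eta + (R *v eta) \<bullet> a) - (S *v X) \<bullet> eta - (S *v x) \<bullet> a - r \<bullet> eta
    = ((A *v X + B *v a) \<bullet> (transpose \<phi> *v x) + X \<bullet> (transpose (- g) *v x + transpose \<phi> *v x')
       + (m \<bullet> (transpose (- g2) *v x + transpose \<psi> *v x') + ((- th) \<bullet> x + \<theta> \<bullet> x'))) - eps \<bullet> (R *v eps)"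
proof -
  \<comment> \<open>The feedback control is the negative of the sum of these three parts, belonging
    to the state, the mean and the inhomogeneity.\<close>
  define u1 where "u1 = Ri *v (transpose B *v (\<phi> *v X) + S *v X)"
  define u2 where "u2 = Ri *v (transpose B *v (\<psi> *v m))"
  define u3 where "u3 = Ri *v (transpose B *v \<theta> + r)"
  have eps: "eps = a + u1 + u2 + u3" unfolding eps_def u1_def u2_def u3_def by (simp only: mv_simps)
  have symR: "(R *v v) \<bullet> w = (R *v w) \<bullet> v" for v w
    using inner_transpose_left[of R v w] R by (simp add: inner_commute)
  have symQ: "(Q *v v) \<bullet> w = (Q *v w) \<bullet> v" for v w
    using inner_transpose_left[of Q v w] Q by (simp add: inner_commute)
  have symQt: "(Qt *v v) \<bullet> w = (Qt *v w) \<bullet> v" for v w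
    using inner_transpose_left[of Qt v w] Qt by (simp add: inner_commute)
  have t1: "(A *v X + B *v a) \<bullet> (transpose \<phi> *v x) = (\<phi> *v (A *v X)) \<bullet> x + (\<phi> *v (B *v a)) \<bullet> x"
    unfolding inner_transpose_right by (simp only: mv_simps inner_add_left)
  have gX: "g *v X = \<phi> *v (A *v X) + transpose A *v (\<phi> *v X) + Q *v X - (\<phi> *v (B *v u1) + transpose S *v u1)"
    unfolding g_def u1_def by (simp only: mv_simps add_ac)
  have t2: "X \<bullet> (transpose (- g) *v x) = - ((\<phi> *v (A *v X)) \<bullet> x) - (\<phi> *v X) \<bullet> (A *v x) - (Q *v X) \<bullet> x + (\<phi> *v (B *v u1)) \<bullet> x + u1 \<bullet> (S *v x)"
    unfolding inner_transpose_right mv_minus_left gX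
    by (simp add: inner_add_left inner_diff_left inner_transpose_left del: transpose_matrix_vector)
  have t3: "X \<bullet> (transpose \<phi> *v x') = (\<phi> *v X) \<bullet> (A *v x) + (\<phi> *v X) \<bullet> (B *v eta)"
    unfolding inner_transpose_right x'_def by (rule inner_add_right)
  have g2m: "g2 *v m = transpose A *v (\<psi> *v m) + Qt *v m - (\<phi> *v (B *v u2) + transpose S *v u2)"
    unfolding g2_def u2_def by (simp only: mv_simps)
  have t4: "m \<bullet> (transpose (- g2) *v x) = - ((\<psi> *v m) \<bullet> (A *v x)) - (Qt *v m) \<bullet> x + (\<phi> *v (B *v u2)) \<bullet> x + u2 \<bullet> (S *v x)"
    unfolding inner_transpose_right mv_minus_left g2m
    by (simp add: inner_add_left inner_diff_left inner_transpose_left del: transpose_matrix_vector)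
  have t5: "m \<bullet> (transpose \<psi> *v x') = (\<psi> *v m) \<bullet> (A *v x) + (\<psi> *v m) \<bullet> (B *v eta)"
    unfolding inner_transpose_right x'_def by (rule inner_add_right)
  have th: "th = transpose A *v \<theta> + q - (\<phi> *v (B *v u3) + transpose S *v u3)"
    unfolding th_def u3_def by (simp only: mv_simps add_ac)
  have t6: "(- th) \<bullet> x = - (\<theta> \<bullet> (A *v x)) - q \<bullet> x + (\<phi> *v (B *v u3)) \<bullet> x + u3 \<bullet> (S *v x)"
    unfolding th by (simp add: inner_add_left inner_diff_left inner_transpose_left del: transpose_matrix_vector)
  have t7: "\<theta> \<bullet> x' = \<theta> \<bullet> (A *v x) + \<theta> \<bullet> (B *v eta)"
    unfolding x'_def by (rule inner_add_right)
  have t8: "(R *v (u1 + u2 + u3)) \<bullet> eta = (\<phi> *v X) \<bullet> (B *v eta) + (S *v X) \<bullet> eta + (\<psi> *v m) \<bullet> (B *v eta) + \<theta> \<bullet> (B *v eta) + r \<bullet> eta"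
    unfolding u1_def u2_def u3_def
    by (simp add: matrix_vector_right_distrib RRi inner_add_left inner_transpose_left del: transpose_matrix_vector)
  \<comment> \<open>The gain subtracted in \<open>eta\<close> is made for this formula: its two
    terms cancel the products of \<open>x\<close> with \<open>\<phi> *v (B *v eps)\<close> and of
    \<open>eps\<close> with \<open>S *v x\<close> that the adjoint equations leave over.\<close>
  have Reta: "R *v eta = R *v eps - (transpose B *v (transpose \<phi> *v x) + S *v x)"
    unfolding eta_def by (simp only: mv_simps RRi)
  have t9: "(R *v eta) \<bullet> eps = (R *v eps) \<bullet> eps - (\<phi> *v (B *v eps)) \<bullet> x - eps \<bullet> (S *v x)"
    unfolding Reta
    unfolding inner_diff_left inner_add_left inner_transpose_left inner_commute[of "transpose \<phi> *v x"]
      inner_transpose_right inner_commute[of "S *v x" eps] inner_commute[of x "\<phi> *v (B *v eps)"] by simp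
  have t10: "(R *v eta) \<bullet> eps = (R *v a) \<bullet> eta + (R *v (u1 + u2 + u3)) \<bullet> eta"
    unfolding symR[of eta eps] unfolding eps by (simp add: matrix_vector_right_distrib inner_add_left)
  have t11: "(\<phi> *v (B *v eps)) \<bullet> x = (\<phi> *v (B *v a)) \<bullet> x + (\<phi> *v (B *v u1)) \<bullet> x + (\<phi> *v (B *v u2)) \<bullet> x + (\<phi> *v (B *v u3)) \<bullet> x"
    unfolding eps by (simp add: matrix_vector_right_distrib inner_add_left)
  have t12: "eps \<bullet> (S *v x) = (S *v x) \<bullet> a + u1 \<bullet> (S *v x) + u2 \<bullet> (S *v x) + u3 \<bullet> (S *v x)"
    unfolding eps inner_add_left by (simp add: inner_commute[of a])
  have e: "eps \<bullet> (R *v eps) = (R *v eps) \<bullet> eps" by (rule inner_commute)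
  have s1: "(\<phi> *v X) \<bullet> (B *v eta) + (\<psi> *v m) \<bullet> (B *v eta) + \<theta> \<bullet> (B *v eta)
      = (R *v eps) \<bullet> eps - (\<phi> *v (B *v eps)) \<bullet> x - eps \<bullet> (S *v x) - (R *v a) \<bullet> eta - (S *v X) \<bullet> eta - r \<bullet> eta"
    using t8 t9 t10 by linarith
  have s2: "(\<phi> *v (B *v a)) \<bullet> x + (\<phi> *v (B *v u1)) \<bullet> x + (\<phi> *v (B *v u2)) \<bullet> x + (\<phi> *v (B *v u3)) \<bullet> x
      + u1 \<bullet> (S *v x) + u2 \<bullet> (S *v x) + u3 \<bullet> (S *v x) = (\<phi> *v (B *v eps)) \<bullet> x + eps \<bullet> (S *v x) - (S *v x) \<bullet> a"
    using t11 t12 by linarith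
  show ?thesis
    unfolding inner_add_right[of X] inner_add_right[of m] t1 t2 t3 t4 t5 t6 t7 e
      symQ[of x X] symQt[of x m] symR[of eta a]
    using s1 s2 by argo
qed

text \<open>The equations of \<phi>, \<psi> and \<theta> integrate from t to the horizon. Splitting
  the whole interval at t, a null overlap, yields the forward form that the product rule
  expects.\<close>

lemma ac_deriv_backward:
  fixes f g :: "real \<Rightarrow> 'b::euclidean_space"
  assumes f: "\<And>t. t \<in> {0..T} \<Longrightarrow> f t = c + (LBINT s:{t..T}. g s)" and g: "set_integrable lborel {0..T} g" and T: "0 \<le> T"
  shows "ac_deriv T f (\<lambda>s. - g s)"
  unfolding ac_deriv_def
proof (intro conjI ballI)
  show "set_integrable lborel {0..T} (\<lambda>s. - g s)" using g unfolding set_integrable_def by simp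
  fix t assume t: "t \<in> {0..T}"
  have i: "set_integrable lborel {0..t} g" "set_integrable lborel {t..T} g"
    by (rule set_integrable_subset[OF g]; use t in force)+
  have AE: "AE s in lborel. s \<noteq> t" by (rule AE_lborel_singleton)
  have m: "(\<lambda>s. indicator {0..T} s *\<^sub>R g s) \<in> borel_measurable lborel"
    "(\<lambda>s. indicator {0..t} s *\<^sub>R g s + indicator {t..T} s *\<^sub>R g s) \<in> borel_measurable lborel"
    using g i unfolding set_integrable_def by auto
  have "(LBINT s:{0..T}. g s) = (\<integral>s. indicator {0..t} s *\<^sub>R g s + indicator {t..T} s *\<^sub>R g s \<partial>lborel)"
    unfolding set_lebesgue_integral_def
  proof (rule integral_cong_AE[OF m])
    show "AE s in lborel. indicator {0..T} s *\<^sub>R g s = indicator {0..t} s *\<^sub>R g s + indicator {t..T} s *\<^sub>R g s"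
      using AE by eventually_elim (use t in \<open>auto simp: indicator_def\<close>)
  qed
  also have "\<dots> = (LBINT s:{0..t}. g s) + (LBINT s:{t..T}. g s)"
    using i unfolding set_lebesgue_integral_def set_integrable_def by (rule Bochner_Integration.integral_add)
  finally have e: "(LBINT s:{t..T}. g s) = (LBINT s:{0..T}. g s) - (LBINT s:{0..t}. g s)" by simp
  have n: "(LBINT s:{0..t}. - g s) = - (LBINT s:{0..t}. g s)" unfolding set_lebesgue_integral_def by simp
  show "f t = f 0 + (LBINT s:{0..t}. - g s)"
    using f[OF t] f[of 0] T unfolding e n by simp
qed

lemma bounded_bilinear_transpose_mv: "bounded_bilinear (\<lambda>(C::real^'n^'m) v. transpose C *v v)"
  by (rule bounded_bilinear.comp[OF bounded_bilinear_mv bounded_linear_transpose bounded_linear_ident])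

section \<open>The payoff as an integral over the product space\<close>

context lq
begin

definition run :: "real \<Rightarrow> real^'d \<Rightarrow> real^'k \<Rightarrow> real^'d \<Rightarrow> real" where
  "run t x l m = cL D t \<bullet> m - 1/2 * ((cQbar D t *v m) \<bullet> m) - 1/2 * ((Q t *v x) \<bullet> x) - (Qt t *v x) \<bullet> m - cq D t \<bullet> x
     - 1/2 * ((R t *v l) \<bullet> l) - (S t *v x) \<bullet> l - cr D t \<bullet> l"

definition ter :: "real^'d \<Rightarrow> real^'d \<Rightarrow> real" where
  "ter x m = - 1/2 * ((cHbar D *v m) \<bullet> m) - 1/2 * ((cH D *v x) \<bullet> x) - (cHtil D *v x) \<bullet> m"

lemma run_integrable:
  assumes "L2P X" "L2P lam" "L2P mu"
  shows "integrable (TM T M) (\<lambda>z. run (fst z) (X (fst z) (snd z)) (lam (fst z) (snd z)) (mu (fst z) (snd z)))"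
  unfolding run_def
  by (intro Bochner_Integration.integrable_diff integrable_mult_right L2P_inner_integrable[of "\<lambda>t \<omega>. _ t", simplified]
      L2P_inner_integrable L2P_mv L2P_coef assms bddL bddQbar bddQ bddQt bddq bddR bddS bddr)

lemma ter_integrable: "L2 M x \<Longrightarrow> L2 M m \<Longrightarrow> integrable M (\<lambda>\<omega>. ter (x \<omega>) (m \<omega>))"
  unfolding ter_def
  by (intro Bochner_Integration.integrable_diff integrable_mult_right L2_inner_integrable L2_mv)

lemma TM_path_integral:
  fixes f :: "real \<Rightarrow> 'w \<Rightarrow> real"
  assumes "integrable (TM T M) (\<lambda>z. f (fst z) (snd z))"
  shows "integrable M (\<lambda>\<omega>. LBINT t:{0..T}. f t \<omega>)"
    and "expectation (\<lambda>\<omega>. LBINT t:{0..T}. f t \<omega>) = (\<integral>z. f (fst z) (snd z) \<partial>TM T M)"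
  using P.integrable_snd[of f] P.integral_snd[of f] assms unfolding LBINT_TL by (simp_all add: case_prod_beta')

lemma TM_time_integral:
  fixes f :: "real \<Rightarrow> 'w \<Rightarrow> real"
  assumes "integrable (TM T M) (\<lambda>z. f (fst z) (snd z))"
  shows "set_integrable lborel {0..T} (\<lambda>t. expectation (f t))"
    and "(LBINT t:{0..T}. expectation (f t)) = (\<integral>z. f (fst z) (snd z) \<partial>TM T M)"
  using P.integrable_fst[of f] P.integral_fst[of f] assms unfolding LBINT_TL set_integrable_TL by (simp_all add: case_prod_beta')

lemma T_mem: "T \<in> {0..T}" and zero_mem: "0 \<in> {0..T}" using T_pos by auto

text \<open>\<open>payoff\<close> refers to the chosen solution \<open>state D lam\<close>. Any
  other state is indistinguishable from it and may replace it, and Fubini turns the expected time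
  integral into one over the product.\<close>

lemma payoff_eq:
  assumes lam: "lam \<in> H2 D F" and X: "is_state D lam X" and mu: "bddL2 mu"
  shows "payoff D lam mu = (\<integral>z. run (fst z) (X (fst z) (snd z)) (lam (fst z) (snd z)) (mu (fst z) (snd z)) \<partial>TM T M)
    + expectation (\<lambda>\<omega>. ter (X T \<omega>) (mu T \<omega>))"
proof -
  have lamL: "L2P lam" by (rule H2_L2P[OF filt_space_F lam])
  have st: "is_state D lam (state D lam)" by (rule state_is_state[OF X lam lam])
  have int: "integrable M (\<lambda>\<omega>. LBINT t:{0..T}. run t (Y t \<omega>) (lam t \<omega>) (mu t \<omega>))"
    "integrable M (\<lambda>\<omega>. ter (Y T \<omega>) (mu T \<omega>))"
    "expectation (\<lambda>\<omega>. LBINT t:{0..T}. run t (Y t \<omega>) (lam t \<omega>) (mu t \<omega>)) = (\<integral>z. run (fst z) (Y (fst z) (snd z)) (lam (fst z) (snd z)) (mu (fst z) (snd z)) \<partial>TM T M)"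
    if Y: "is_state D lam Y" for Y
  proof -
    have b: "bddL2 Y" by (rule state_bddL2[OF Y lamL])
    note ri = run_integrable[OF bddL2_L2P[OF b] lamL bddL2_L2P[OF mu]]
    show "integrable M (\<lambda>\<omega>. LBINT t:{0..T}. run t (Y t \<omega>) (lam t \<omega>) (mu t \<omega>))"
      "expectation (\<lambda>\<omega>. LBINT t:{0..T}. run t (Y t \<omega>) (lam t \<omega>) (mu t \<omega>)) = (\<integral>z. run (fst z) (Y (fst z) (snd z)) (lam (fst z) (snd z)) (mu (fst z) (snd z)) \<partial>TM T M)"
      by (rule TM_path_integral[OF ri])+
    show "integrable M (\<lambda>\<omega>. ter (Y T \<omega>) (mu T \<omega>))"
      by (rule ter_integrable[OF bddL2_L2[OF b T_mem] bddL2_L2[OF mu T_mem]])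
  qed
  let ?h = "\<lambda>Y \<omega>. (LBINT t:{0..T}. run t (Y t \<omega>) (lam t \<omega>) (mu t \<omega>)) + ter (Y T \<omega>) (mu T \<omega>)"
  have hi: "integrable M (?h Y)" if "is_state D lam Y" for Y
    by (intro Bochner_Integration.integrable_add int that)
  have "payoff D lam mu = expectation (?h (state D lam))"
    unfolding payoff_def Let_def run_def ter_def by (intro Bochner_Integration.integral_cong refl) simp
  also have "\<dots> = expectation (?h X)"
  proof (rule integral_cong_AE[OF borel_measurable_integrable[OF hi[OF st]] borel_measurable_integrable[OF hi[OF X]]])
    show "AE \<omega> in M. ?h (state D lam) \<omega> = ?h X \<omega>"
      using state_unique[OF st X lamL]
    proof eventually_elim
      case (elim \<omega>)
      have "(LBINT t:{0..T}. run t (state D lam t \<omega>) (lam t \<omega>) (mu t \<omega>)) = (LBINT t:{0..T}. run t (X t \<omega>) (lam t \<omega>) (mu t \<omega>))"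
        using elim by (intro set_lebesgue_integral_cong) auto
      moreover have "state D lam T \<omega> = X T \<omega>" using elim T_mem by blast
      ultimately show ?case by simp
    qed
  qed
  also have "\<dots> = (\<integral>z. run (fst z) (X (fst z) (snd z)) (lam (fst z) (snd z)) (mu (fst z) (snd z)) \<partial>TM T M)
    + expectation (\<lambda>\<omega>. ter (X T \<omega>) (mu T \<omega>))"
    using Bochner_Integration.integral_add[OF int(1,2)[OF X]] int(3)[OF X] by simp
  finally show ?thesis .
qed

end

lemma set_integral_at_point: "(LBINT s:{t..t::real}. f s) = (0 :: 'b::euclidean_space)"
proof -
  have "AE s in lborel. s \<noteq> t" by (rule AE_lborel_singleton)
  then have "AE s in lborel. indicator {t..t} s *\<^sub>R f s = (0 :: 'b)" by eventually_elim simp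
  then show ?thesis unfolding set_lebesgue_integral_def by (rule integral_eq_zero_AE)
qed

lemma ac_deriv_integral:
  fixes v :: "real \<Rightarrow> 'b::euclidean_space"
  assumes "set_integrable lborel {0..T} v" shows "ac_deriv T (\<lambda>t. c + (LBINT s:{0..t}. v s)) v"
  unfolding ac_deriv_def using assms set_integral_at_point[of 0 v] by simp

lemma linear_zero_if_quadratic_nonpos:
  fixes l q :: real
  assumes le: "\<And>c. c * l + c\<^sup>2 * q \<le> 0" shows "l = 0"
proof (rule ccontr)
  assume n: "l \<noteq> 0"
  \<comment> \<open>It has the sign of l, and c l = 2 (|q| + 1) c^2 exceeds the quadratic term in
    absolute value.\<close>
  define c where "c = l / (2 * (\<bar>q\<bar> + 1))"
  have p: "2 * (\<bar>q\<bar> + 1) > 0" by (simp add: add_nonneg_pos)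
  have l: "l = c * (2 * (\<bar>q\<bar> + 1))" unfolding c_def using p by simp
  have c0: "c\<^sup>2 > 0" using n l by auto
  have "c * l + c\<^sup>2 * q = c\<^sup>2 * (2 * (\<bar>q\<bar> + 1) + q)" by (subst l) (simp add: power2_eq_square algebra_simps)
  also have "\<dots> > 0"
  proof (rule mult_pos_pos[OF c0])
    show "0 < 2 * (\<bar>q\<bar> + 1) + q" using abs_ge_minus_self[of q] abs_ge_zero[of q] by (simp add: algebra_simps)
  qed
  finally show False using le[of c] by simp
qed

section \<open>Variation of the payoff\<close>

context lq
begin

lemma bddL2_det:
  fixes m :: "real \<Rightarrow> 'b::euclidean_space"
  assumes m: "continuous_on {0..T} m" shows "bddL2 (\<lambda>t \<omega>. m t)"
proof -
  have "bounded (m ` {0..T})" using m compact_continuous_image compact_imp_bounded by blast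
  then obtain C where C: "\<And>t. t \<in> {0..T} \<Longrightarrow> norm (m t) \<le> C" unfolding bounded_iff by blast
  show ?thesis
  proof (rule bddL2I)
    show "meas_proc (\<lambda>t \<omega>. m t)" by (rule meas_proc_coef[OF L_infty_continuous[OF m]])
    fix t assume t: "t \<in> {0..T}"
    show "msq M (\<lambda>\<omega>. m t) \<le> ennreal (C\<^sup>2)"
      using C[OF t] by (simp add: emeasure_space_1 power_mono)
  qed
qed

text \<open>After Fubini, at almost every time t the noise increment over [t, T] is orthogonal to
  the adapted \<open>y t\<close>, so the terminal value of the noise may be replaced by its value at
  t.\<close>

lemma noise_by_parts:
  assumes X: "is_state D lam X" and lam: "L2P lam" and y: "L2P y" "prog_measurable T F y"
  shows "expectation (\<lambda>\<omega>. noise lam X T \<omega> \<bullet> (LBINT s:{0..T}. y s \<omega>))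
     = (\<integral>z. noise lam X (fst z) (snd z) \<bullet> y (fst z) (snd z) \<partial>TM T M)"
    and "integrable M (\<lambda>\<omega>. noise lam X T \<omega> \<bullet> (LBINT s:{0..T}. y s \<omega>))"
proof -
  let ?K = "noise lam X"
  have K: "bddL2 ?K" by (rule noise_bddL2[OF X lam])
  have KT: "L2P (\<lambda>t. ?K T)" by (rule bddL2_L2P[OF bddL2_const[OF bddL2_L2[OF K T_mem]]])
  have i1: "integrable (TM T M) (\<lambda>z. ?K T (snd z) \<bullet> y (fst z) (snd z))" by (rule L2P_inner_integrable[OF KT y(1)])
  have i2: "integrable (TM T M) (\<lambda>z. ?K (fst z) (snd z) \<bullet> y (fst z) (snd z))" by (rule L2P_inner_integrable[OF bddL2_L2P[OF K] y(1)])
  show int: "integrable M (\<lambda>\<omega>. ?K T \<omega> \<bullet> (LBINT s:{0..T}. y s \<omega>))"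
    by (rule L2_inner_integrable[OF bddL2_L2[OF K T_mem] bddL2_L2[OF bddL2_integral[OF y(1)] T_mem]])
  have "expectation (\<lambda>\<omega>. ?K T \<omega> \<bullet> (LBINT s:{0..T}. y s \<omega>)) = expectation (\<lambda>\<omega>. LBINT s:{0..T}. ?K T \<omega> \<bullet> y s \<omega>)"
  proof (rule integral_cong_AE[OF borel_measurable_integrable[OF int] borel_measurable_integrable[OF TM_path_integral(1)[OF i1]]])
    show "AE \<omega> in M. ?K T \<omega> \<bullet> (LBINT s:{0..T}. y s \<omega>) = (LBINT s:{0..T}. ?K T \<omega> \<bullet> y s \<omega>)"
      using L2P_path_integrable[OF y(1)]
      by eventually_elim (simp add: LBINT_TL set_integrable_TL)
  qed
  also have "\<dots> = (LBINT t:{0..T}. expectation (\<lambda>\<omega>. ?K T \<omega> \<bullet> y t \<omega>))"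
    using TM_path_integral(2)[OF i1] TM_time_integral(2)[OF i1] by simp
  also have "\<dots> = (LBINT t:{0..T}. expectation (\<lambda>\<omega>. ?K t \<omega> \<bullet> y t \<omega>))"
    unfolding LBINT_TL
  proof (rule integral_cong_AE)
    show "(\<lambda>t. expectation (\<lambda>\<omega>. ?K T \<omega> \<bullet> y t \<omega>)) \<in> borel_measurable (TL T)"
      "(\<lambda>t. expectation (\<lambda>\<omega>. ?K t \<omega> \<bullet> y t \<omega>)) \<in> borel_measurable (TL T)"
      using TM_time_integral(1)[OF i1] TM_time_integral(1)[OF i2] unfolding set_integrable_TL by (blast dest: borel_measurable_integrable)+
    show "AE t in TL T. expectation (\<lambda>\<omega>. ?K T \<omega> \<bullet> y t \<omega>) = expectation (\<lambda>\<omega>. ?K t \<omega> \<bullet> y t \<omega>)"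
      using L2P_AE_time[OF y(1)] AE_space
    proof eventually_elim
      case (elim t)
      then have t: "t \<in> {0..T}" by (simp add: space_restrict_space)
      have "expectation (\<lambda>\<omega>. y t \<omega> \<bullet> (?K T \<omega> - ?K t \<omega>)) = 0"
        by (rule wiener_integral_orthogonal[OF noise_wiener[OF X lam] _ _ _ elim(1) prog_time[OF y(2) t]]) (use t in auto)
      moreover have "expectation (\<lambda>\<omega>. y t \<omega> \<bullet> (?K T \<omega> - ?K t \<omega>)) = expectation (\<lambda>\<omega>. ?K T \<omega> \<bullet> y t \<omega>) - expectation (\<lambda>\<omega>. ?K t \<omega> \<bullet> y t \<omega>)"
        unfolding inner_diff_right inner_commute[of "y t _"]
        by (rule Bochner_Integration.integral_diff) (intro L2_inner_integrable elim(1) bddL2_L2[OF K] T_mem t)+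
      ultimately show ?case by simp
    qed
  qed
  also have "\<dots> = (\<integral>z. ?K (fst z) (snd z) \<bullet> y (fst z) (snd z) \<partial>TM T M)" by (rule TM_time_integral(2)[OF i2])
  finally show "expectation (\<lambda>\<omega>. ?K T \<omega> \<bullet> (LBINT s:{0..T}. y s \<omega>)) = (\<integral>z. ?K (fst z) (snd z) \<bullet> y (fst z) (snd z) \<partial>TM T M)" .
qed

text \<open>The derivative of \<open>run\<close> at state X and control a in the direction (x, e).
  Since \<open>run\<close> is quadratic, it and \<open>qrun\<close> give the exact expansion; both
  orders of the Q and R pairings appear, as the expansion is purely bilinear. \<open>dter\<close>
  and \<open>qter\<close> do the same for \<open>ter\<close>.\<close>

definition drun :: "real \<Rightarrow> real^'d \<Rightarrow> real^'k \<Rightarrow> real^'d \<Rightarrow> real^'k \<Rightarrow> real^'d \<Rightarrow> real" where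
  "drun t X a x e m = - 1/2 * ((Q t *v X) \<bullet> x + (Q t *v x) \<bullet> X) - (Qt t *v x) \<bullet> m - cq D t \<bullet> x
      - 1/2 * ((R t *v a) \<bullet> e + (R t *v e) \<bullet> a) - (S t *v X) \<bullet> e - (S t *v x) \<bullet> a - cr D t \<bullet> e"

definition qrun :: "real \<Rightarrow> real^'d \<Rightarrow> real^'k \<Rightarrow> real" where
  "qrun t x e = - 1/2 * ((Q t *v x) \<bullet> x) - 1/2 * ((R t *v e) \<bullet> e) - (S t *v x) \<bullet> e"

definition dter :: "real^'d \<Rightarrow> real^'d \<Rightarrow> real^'d \<Rightarrow> real" where
  "dter X x m = - 1/2 * ((cH D *v X) \<bullet> x + (cH D *v x) \<bullet> X) - (cHtil D *v x) \<bullet> m"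

definition qter :: "real^'d \<Rightarrow> real" where
  "qter x = - 1/2 * ((cH D *v x) \<bullet> x)"

lemma run_perturb: "run t (X + c *\<^sub>R x) (a + c *\<^sub>R e) m = run t X a m + (c * drun t X a x e m + c\<^sup>2 * qrun t x e)"
  unfolding run_def drun_def qrun_def
  by (simp add: matrix_vector_right_distrib matrix_vector_mult_scaleR inner_simps power2_eq_square algebra_simps)

lemma ter_perturb: "ter (X + c *\<^sub>R x) m = ter X m + (c * dter X x m + c\<^sup>2 * qter x)"
  unfolding ter_def dter_def qter_def
  by (simp add: matrix_vector_right_distrib matrix_vector_mult_scaleR inner_simps power2_eq_square algebra_simps)

lemma drun_integrable:
  assumes "L2P X" "L2P a" "L2P x" "L2P e" "L2P m"
  shows "integrable (TM T M) (\<lambda>z. drun (fst z) (X (fst z) (snd z)) (a (fst z) (snd z)) (x (fst z) (snd z)) (e (fst z) (snd z)) (m (fst z) (snd z)))"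
  unfolding drun_def
  by (intro Bochner_Integration.integrable_diff Bochner_Integration.integrable_add integrable_mult_right L2P_inner_integrable[of "\<lambda>t \<omega>. _ t", simplified]
      L2P_inner_integrable L2P_mv L2P_coef assms bddQ bddQt bddq bddR bddS bddr)

lemma qrun_integrable:
  assumes "L2P x" "L2P e"
  shows "integrable (TM T M) (\<lambda>z. qrun (fst z) (x (fst z) (snd z)) (e (fst z) (snd z)))"
  unfolding qrun_def
  by (intro Bochner_Integration.integrable_diff integrable_mult_right L2P_inner_integrable L2P_mv assms bddQ bddR bddS)

lemma dter_integrable: "L2 M X \<Longrightarrow> L2 M x \<Longrightarrow> L2 M m \<Longrightarrow> integrable M (\<lambda>\<omega>. dter (X \<omega>) (x \<omega>) (m \<omega>))"
  unfolding dter_def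
  by (intro Bochner_Integration.integrable_diff Bochner_Integration.integrable_add integrable_mult_right L2_inner_integrable L2_mv)

lemma qter_integrable: "L2 M x \<Longrightarrow> integrable M (\<lambda>\<omega>. qter (x \<omega>))"
  unfolding qter_def by (intro integrable_mult_right L2_inner_integrable L2_mv)

text \<open>Along the line of perturbations the payoff is exactly a quadratic polynomial in c. Being
  maximal at c = 0 among all real c, of either sign, it has vanishing linear coefficient.\<close>

lemma first_order_condition:
  assumes lam: "lam \<in> H2 D F" and X: "is_state D lam X" and eta: "eta \<in> H2 D F"
    and xc: "\<And>\<omega>. \<omega> \<in> space M \<Longrightarrow> continuous_on {0..T} (\<lambda>t. x t \<omega>)"
    and xm: "\<And>t. t \<in> {0..T} \<Longrightarrow> x t \<in> borel_measurable (F t)"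
    and eq: "AE \<omega> in M. \<forall>t\<in>{0..T}. x t \<omega> = (LBINT s:{0..t}. B s *v eta s \<omega>) + (LBINT s:{0..t}. A s *v x s \<omega>)"
    and x: "bddL2 x" and mu: "bddL2 mu"
    and opt: "\<And>c. payoff D (\<lambda>t \<omega>. lam t \<omega> + c *\<^sub>R eta t \<omega>) mu \<le> payoff D lam mu"
  shows "(\<integral>z. drun (fst z) (X (fst z) (snd z)) (lam (fst z) (snd z)) (x (fst z) (snd z)) (eta (fst z) (snd z)) (mu (fst z) (snd z)) \<partial>TM T M)
     + expectation (\<lambda>\<omega>. dter (X T \<omega>) (x T \<omega>) (mu T \<omega>)) = 0" (is "?L = 0")
proof -
  have lamL: "L2P lam" and etaL: "L2P eta" by (rule H2_L2P[OF filt_space_F], fact)+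
  have Xb: "bddL2 X" by (rule state_bddL2[OF X lamL])
  note L = bddL2_L2P[OF Xb] lamL bddL2_L2P[OF x] etaL bddL2_L2P[OF mu]
  note LT = bddL2_L2[OF Xb T_mem] bddL2_L2[OF x T_mem] bddL2_L2[OF mu T_mem]
  let ?q = "(\<integral>z. qrun (fst z) (x (fst z) (snd z)) (eta (fst z) (snd z)) \<partial>TM T M) + expectation (\<lambda>\<omega>. qter (x T \<omega>))"
  have pay: "payoff D (\<lambda>t \<omega>. lam t \<omega> + c *\<^sub>R eta t \<omega>) mu = payoff D lam mu + c * ?L + c\<^sup>2 * ?q" for c
  proof -
    have e2: "L2P (\<lambda>t \<omega>. c *\<^sub>R eta t \<omega>)" by (rule L2P_scaleR[OF etaL])
    have h: "(\<lambda>t \<omega>. lam t \<omega> + c *\<^sub>R eta t \<omega>) \<in> H2 D F"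
      by (intro H2I prog_add prog_scaleR H2_prog[OF lam] H2_prog[OF eta] L2P_add lamL e2)
    have st: "is_state D (\<lambda>t \<omega>. lam t \<omega> + c *\<^sub>R eta t \<omega>) (\<lambda>t \<omega>. X t \<omega> + c *\<^sub>R x t \<omega>)"
    proof (rule state_perturb[OF X lamL e2])
      show "continuous_on {0..T} (\<lambda>t. c *\<^sub>R x t \<omega>)" if "\<omega> \<in> space M" for \<omega>
        by (intro continuous_on_scaleR continuous_on_const xc that)
      show "(\<lambda>\<omega>. c *\<^sub>R x t \<omega>) \<in> borel_measurable (F t)" if "t \<in> {0..T}" for t
        by (intro borel_measurable_scaleR borel_measurable_const xm that)
      show "AE \<omega> in M. \<forall>t\<in>{0..T}. c *\<^sub>R x t \<omega> = (LBINT s:{0..t}. B s *v (c *\<^sub>R eta s \<omega>)) + (LBINT s:{0..t}. A s *v (c *\<^sub>R x s \<omega>))"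
        unfolding matrix_vector_mult_scaleR set_integral_scaleR_right scaleR_add_right[symmetric]
        using eq by eventually_elim simp
    qed
    have "payoff D (\<lambda>t \<omega>. lam t \<omega> + c *\<^sub>R eta t \<omega>) mu =
      (\<integral>z. run (fst z) (X (fst z) (snd z)) (lam (fst z) (snd z)) (mu (fst z) (snd z))
        + (c * drun (fst z) (X (fst z) (snd z)) (lam (fst z) (snd z)) (x (fst z) (snd z)) (eta (fst z) (snd z)) (mu (fst z) (snd z))
        + c\<^sup>2 * qrun (fst z) (x (fst z) (snd z)) (eta (fst z) (snd z))) \<partial>TM T M)
      + expectation (\<lambda>\<omega>. ter (X T \<omega>) (mu T \<omega>) + (c * dter (X T \<omega>) (x T \<omega>) (mu T \<omega>) + c\<^sup>2 * qter (x T \<omega>)))"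
      unfolding payoff_eq[OF h st mu] run_perturb ter_perturb ..
    also have "\<dots> = payoff D lam mu + c * ?L + c\<^sup>2 * ?q"
      unfolding payoff_eq[OF lam X mu]
      using run_integrable[OF L(1,2,5)] drun_integrable[OF L(1-5)] qrun_integrable[OF L(3,4)]
        ter_integrable[OF LT(1,3)] dter_integrable[OF LT] qter_integrable[OF LT(2)]
      by (simp add: algebra_simps)
    finally show ?thesis .
  qed
  have le: "c * ?L + c\<^sup>2 * ?q \<le> 0" for c using opt[of c] unfolding pay by simp
  show "?L = 0" by (rule linear_zero_if_quadratic_nonpos) (rule le)
qed

end

section \<open>The equilibrium control\<close>

locale lq_riccati = lq D d1 d2 for D :: "('d::finite, 'k::finite, 'w) lq_model" and d1 d2 :: real +
  fixes \<phi> \<psi> :: "real \<Rightarrow> real^'d^'d"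
  assumes phi: "phi_solution D \<phi>" and psi: "psi_solution D \<phi> \<psi>"
begin

text \<open>The derivative of \<phi> is the negative of this matrix, and likewise for \<psi> and
  \<open>gpsi\<close>.\<close>

definition gphi :: "real \<Rightarrow> real^'d^'d" where
  "gphi s = \<phi> s ** A s + transpose (A s) ** \<phi> s + Q s
        - (\<phi> s ** B s + transpose (S s)) ** Ri s ** (transpose (B s) ** \<phi> s + S s)"

definition gpsi :: "real \<Rightarrow> real^'d^'d" where
  "gpsi s = transpose (A s) ** \<psi> s + Qt s
        - (\<phi> s ** B s + transpose (S s)) ** Ri s ** transpose (B s) ** \<psi> s"

lemma bdd_phi: "L_infty T \<phi>" and bdd_psi: "L_infty T \<psi>"
  using phi psi unfolding phi_solution_def psi_solution_def by (auto intro: L_infty_continuous)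

lemmas L_infty_closure = L_infty_mv L_infty_mm L_infty_transpose L_infty_minus L_infty_scaleR L_infty_add L_infty_diff

lemmas bdd_coefs = bddA bddB bddQ bddQt bddS bddRi bddR bdd_phi bdd_psi bddq bddr

lemma bdd_gphi: "L_infty T gphi" and bdd_gpsi: "L_infty T gpsi"
  unfolding gphi_def[abs_def] gpsi_def[abs_def] by (intro L_infty_closure bdd_coefs)+

lemma bdd_Phi: "L_infty T (Phi_coef D \<phi>)" and bdd_Psi: "L_infty T (Psi_coef D \<psi>)"
  unfolding Phi_coef_def[abs_def] Psi_coef_def[abs_def] by (intro L_infty_closure bdd_coefs)+

lemma phi_ac: "ac_deriv T \<phi> (\<lambda>s. - gphi s)" and phi_T: "\<phi> T = cH D"
proof -
  have e: "\<And>t. t \<in> {0..T} \<Longrightarrow> \<phi> t = cH D + (LBINT s:{t..T}. gphi s)"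
    using phi unfolding phi_solution_def gphi_def by blast
  show "ac_deriv T \<phi> (\<lambda>s. - gphi s)"
    by (rule ac_deriv_backward[OF e set_integrable_L_infty[OF bdd_gphi]]) (use T_pos in auto)
  show "\<phi> T = cH D" using e[OF T_mem] set_integral_at_point[of T gphi] by simp
qed

lemma psi_ac: "ac_deriv T \<psi> (\<lambda>s. - gpsi s)" and psi_T: "\<psi> T = cHtil D"
proof -
  have e: "\<And>t. t \<in> {0..T} \<Longrightarrow> \<psi> t = cHtil D + (LBINT s:{t..T}. gpsi s)"
    using psi unfolding psi_solution_def gpsi_def by blast
  show "ac_deriv T \<psi> (\<lambda>s. - gpsi s)"
    by (rule ac_deriv_backward[OF e set_integrable_L_infty[OF bdd_gpsi]]) (use T_pos in auto)
  show "\<psi> T = cHtil D" using e[OF T_mem] set_integral_at_point[of T gpsi] by simp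
qed

end

text \<open>The pair \<open>lam0\<close>, \<open>X0\<close> is one control with an existing state,
  from which the state of \<open>ah\<close> is obtained. The class G flow takes this role
  later.\<close>

locale lq_equilibrium = lq_riccati D d1 d2 \<phi> \<psi>
  for D :: "('d::finite, 'k::finite, 'w) lq_model" and d1 d2 :: real and \<phi> \<psi> :: "real \<Rightarrow> real^'d^'d" +
  fixes \<theta> mh :: "real \<Rightarrow> real^'d" and ah lam0 :: "real \<Rightarrow> 'w \<Rightarrow> real^'k" and X0 :: "real \<Rightarrow> 'w \<Rightarrow> real^'d"
  assumes NE: "mean_field_NE D ah mh" and theta: "theta_solution D \<phi> \<psi> mh \<theta>"
    and lam0: "lam0 \<in> H2 D F" and X0: "is_state D lam0 X0"
begin

abbreviation Xh where "Xh \<equiv> state D ah"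

lemma ah_F1: "ah \<in> H2 D F1" and mh_cont: "continuous_on {0..T} mh"
  and ah_opt: "bet \<in> H2 D F1 \<Longrightarrow> payoff_det D bet mh \<le> payoff_det D ah mh"
  and mh_eq: "t \<in> {0..T} \<Longrightarrow> mh t = expectation (Xh t)"
  using NE unfolding mean_field_NE_def by blast+

lemma ah_F: "ah \<in> H2 D F" by (rule H2_F1_F[OF ah_F1])
lemma ah_L2P: "L2P ah" by (rule H2_L2P[OF filt_space_F ah_F])
lemma Xh_state: "is_state D ah Xh" by (rule state_is_state[OF X0 lam0 ah_F])
lemma Xh_bddL2: "bddL2 Xh" by (rule state_bddL2[OF Xh_state ah_L2P])
lemma Xh_prog: "prog_measurable T F1 Xh"
  by (rule F1.prog_continuous[OF is_state_continuous[OF Xh_state] state_F1_adapted[OF ah_F1 Xh_state]])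
lemma mh_bdd: "L_infty T mh" by (rule L_infty_continuous[OF mh_cont])
lemma theta_cont: "continuous_on {0..T} \<theta>" using theta unfolding theta_solution_def by blast
lemma theta_bdd: "L_infty T \<theta>" by (rule L_infty_continuous[OF theta_cont])

lemma bdd_Theta: "L_infty T (Theta_coef D \<theta>)"
  unfolding Theta_coef_def[abs_def] by (intro L_infty_closure bdd_coefs theta_bdd)

text \<open>The part of the backward drift of \<theta> that is essentially bounded; the remaining
  term contains the derivative of \<open>mh\<close>, which is known only to be integrable.\<close>

definition gtheta :: "real \<Rightarrow> real^'d" where
  "gtheta s = transpose (A s) *v \<theta> s + cq D s
     - ((\<phi> s ** B s + transpose (S s)) ** Ri s) *v (transpose (B s) *v \<theta> s + cr D s)"

lemma bdd_gtheta: "L_infty T gtheta"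
  unfolding gtheta_def[abs_def] by (intro L_infty_closure bdd_coefs theta_bdd)

lemma theta_ac:
  obtains dm where "ac_deriv T mh dm" "ac_deriv T \<theta> (\<lambda>s. - (\<psi> s *v dm s + gtheta s))" "\<theta> T = 0"
proof -
  obtain dm where dm: "ac_derivative T mh dm"
    "\<forall>t\<in>{0..T}. \<theta> t = (LBINT s:{t..T}. \<psi> s *v dm s + transpose (A s) *v \<theta> s + cq D s
          - ((\<phi> s ** B s + transpose (S s)) ** Ri s) *v (transpose (B s) *v \<theta> s + cr D s))"
    using theta unfolding theta_solution_def by blast
  have a: "ac_deriv T mh dm" using dm(1) unfolding ac_derivative_def ac_deriv_def .
  have e: "\<theta> t = 0 + (LBINT s:{t..T}. \<psi> s *v dm s + gtheta s)" if "t \<in> {0..T}" for t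
    using dm(2) that unfolding gtheta_def by (simp add: add_diff_eq add.assoc)
  have i: "set_integrable lborel {0..T} (\<lambda>s. \<psi> s *v dm s + gtheta s)"
    by (intro set_integral_add(1) set_integrable_L_infty_bilinear[OF bounded_bilinear_mv bdd_psi ac_deriv_integrable[OF a]]
        set_integrable_L_infty[OF bdd_gtheta])
  show ?thesis
  proof (rule that[OF a])
    show "ac_deriv T \<theta> (\<lambda>s. - (\<psi> s *v dm s + gtheta s))"
      by (rule ac_deriv_backward[OF e i]) (use T_pos in auto)
    show "\<theta> T = 0" using e[OF T_mem] set_integral_at_point[of T "\<lambda>s. \<psi> s *v dm s + gtheta s"] by simp
  qed
qed

definition eps :: "real \<Rightarrow> 'w \<Rightarrow> real^'k" where
  "eps t \<omega> = ah t \<omega> + Phi_coef D \<phi> t *v Xh t \<omega> + Psi_coef D \<psi> t *v mh t + Theta_coef D \<theta> t"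

lemma eps_L2P: "L2P eps"
  unfolding eps_def[abs_def]
  by (intro L2P_add L2P_mv L2P_coef L_infty_mv ah_L2P bdd_Phi bdd_Psi bdd_Theta bddL2_L2P[OF Xh_bddL2] mh_bdd)

lemma eps_prog: "prog_measurable T F1 eps"
  unfolding eps_def[abs_def]
  by (intro prog_add prog_mv prog_coef L_infty_mv H2_prog[OF ah_F1] bdd_Phi bdd_Psi bdd_Theta Xh_prog mh_bdd)

definition Kp :: "real \<Rightarrow> real^'d^'k" where
  "Kp t = Ri t ** (transpose (B t) ** transpose (\<phi> t) + S t)"

lemma bdd_Kp: "L_infty T Kp"
  unfolding Kp_def[abs_def] by (intro L_infty_closure bdd_coefs)

text \<open>
  The perturbation is chosen such that the first-order condition reads
  \<open>E \<integral> \<langle>R \<epsilon>, \<epsilon>\<rangle> = 0\<close>; pairing with the adjoint process puts the transpose of \<open>\<phi>\<close> into \<open>Kp\<close>.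
\<close>

lemma perturbation_exists:
  obtains x where "\<And>\<omega>. \<omega> \<in> space M \<Longrightarrow> continuous_on {0..T} (\<lambda>t. x t \<omega>)"
    "\<And>t. t \<in> {0..T} \<Longrightarrow> x t \<in> borel_measurable (F1 t)" "bddL2 x"
    "(\<lambda>t \<omega>. eps t \<omega> - Kp t *v x t \<omega>) \<in> H2 D F1"
    "AE \<omega> in M. \<forall>t\<in>{0..T}. x t \<omega> = (LBINT s:{0..t}. B s *v (eps s \<omega> - Kp s *v x s \<omega>)) + (LBINT s:{0..t}. A s *v x s \<omega>)"
proof -
  \<comment> \<open>The perturbation of the control depends on the perturbed state. So
    \<open>x\<close> is found from the closed-loop equation with matrix A - B \<open>Kp\<close> and
    forcing from \<open>eps\<close>, and the control is read off from it.\<close>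
  have Acl: "L_infty T (\<lambda>s. A s - B s ** Kp s)" by (intro L_infty_closure bdd_coefs bdd_Kp)
  have BK: "L_infty T (\<lambda>s. B s ** Kp s)" by (intro L_infty_closure bdd_coefs bdd_Kp)
  obtain x where x: "\<And>\<omega>. \<omega> \<in> space M \<Longrightarrow> continuous_on {0..T} (\<lambda>t. x t \<omega>)"
    "\<And>t. t \<in> {0..T} \<Longrightarrow> x t \<in> borel_measurable (F1 t)"
    "AE \<omega> in M. \<forall>t\<in>{0..T}. x t \<omega> = (LBINT s:{0..t}. B s *v eps s \<omega>) + (LBINT s:{0..t}. (A s - B s ** Kp s) *v x s \<omega>)"
    using F1.adapted_linear_ode[OF Acl control_integral_continuous[OF eps_L2P] control_integral_adapted[OF filt_space_F1 eps_prog]]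
    by blast
  have xp: "prog_measurable T F1 x" by (rule F1.prog_continuous[OF x(1,2)])
  have xb: "bddL2 x"
    by (rule bddL2_linear_ode[OF Acl bddL2_integral[OF L2P_mv[OF bddB eps_L2P]] F1.prog_meas_proc[OF xp]
          control_integral_continuous[OF eps_L2P] AE_I2[OF x(1)] x(3)])
  have eta: "(\<lambda>t \<omega>. eps t \<omega> - Kp t *v x t \<omega>) \<in> H2 D F1"
    by (intro H2I prog_diff prog_mv L2P_diff L2P_mv eps_prog eps_L2P bdd_Kp xp bddL2_L2P[OF xb])
  have "AE \<omega> in M. \<forall>t\<in>{0..T}. x t \<omega> = (LBINT s:{0..t}. B s *v (eps s \<omega> - Kp s *v x s \<omega>)) + (LBINT s:{0..t}. A s *v x s \<omega>)"
    using x(3) path_integrable_control[OF eps_L2P] AE_space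
  proof eventually_elim
    case (elim \<omega>)
    note iA = set_integrable_mv[OF bddA x(1)[OF elim(3)]] and iK = set_integrable_mv[OF BK x(1)[OF elim(3)]]
    show ?case
    proof
      fix t assume t: "t \<in> {0..T}"
      have "x t \<omega> = (LBINT s:{0..t}. B s *v eps s \<omega>) + (LBINT s:{0..t}. (A s - B s ** Kp s) *v x s \<omega>)"
        using elim(1) t by blast
      also have "\<dots> = ((LBINT s:{0..t}. B s *v eps s \<omega>) - (LBINT s:{0..t}. (B s ** Kp s) *v x s \<omega>)) + (LBINT s:{0..t}. A s *v x s \<omega>)"
        unfolding mv_diff set_integral_diff_sub[OF iA iK t] by simp
      also have "(LBINT s:{0..t}. B s *v eps s \<omega>) - (LBINT s:{0..t}. (B s ** Kp s) *v x s \<omega>) = (LBINT s:{0..t}. B s *v (eps s \<omega> - Kp s *v x s \<omega>))"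
        using set_integral_diff_sub[OF elim(2) iK t] by (simp only: matrix_vector_mult_diff_distrib mv_mm)
      finally show "x t \<omega> = (LBINT s:{0..t}. B s *v (eps s \<omega> - Kp s *v x s \<omega>)) + (LBINT s:{0..t}. A s *v x s \<omega>)" .
    qed
  qed
  with that[OF x(1,2) xb eta] show ?thesis by blast
qed

lemma bdd_transpose_gphi: "L_infty T (\<lambda>s. transpose (- gphi s))" and bdd_transpose_gpsi: "L_infty T (\<lambda>s. transpose (- gpsi s))"
  and bdd_transpose_phi: "L_infty T (\<lambda>s. transpose (\<phi> s))" and bdd_transpose_psi: "L_infty T (\<lambda>s. transpose (\<psi> s))"
  by (intro L_infty_closure bdd_gphi bdd_gpsi bdd_phi bdd_psi)+

lemma NE_eps_zero: "AE z in TM T M. eps (fst z) (snd z) = 0"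
proof -
  obtain x where x: "\<And>\<omega>. \<omega> \<in> space M \<Longrightarrow> continuous_on {0..T} (\<lambda>t. x t \<omega>)"
    "\<And>t. t \<in> {0..T} \<Longrightarrow> x t \<in> borel_measurable (F1 t)" "bddL2 x"
    "(\<lambda>t \<omega>. eps t \<omega> - Kp t *v x t \<omega>) \<in> H2 D F1"
    "AE \<omega> in M. \<forall>t\<in>{0..T}. x t \<omega> = (LBINT s:{0..t}. B s *v (eps s \<omega> - Kp s *v x s \<omega>)) + (LBINT s:{0..t}. A s *v x s \<omega>)"
    using perturbation_exists by blast
  define eta where "eta = (\<lambda>t \<omega>. eps t \<omega> - Kp t *v x t \<omega>)"
  have etaF1: "eta \<in> H2 D F1" and eq: "AE \<omega> in M. \<forall>t\<in>{0..T}. x t \<omega> = (LBINT s:{0..t}. B s *v eta s \<omega>) + (LBINT s:{0..t}. A s *v x s \<omega>)"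
    using x(4,5) unfolding eta_def by blast+
  have etaF: "eta \<in> H2 D F" by (rule H2_F1_F[OF etaF1])
  have etaL: "L2P eta" by (rule H2_L2P[OF filt_space_F etaF])
  have xm: "x t \<in> borel_measurable (F t)" if t: "t \<in> {0..T}" for t
  proof (rule measurable_from_subalg[OF _ x(2)[OF t]])
    show "subalgebra (F t) (F1 t)" unfolding subalgebra_def using F1_subset_F[OF t] space_F1 space_G[OF t] by simp
  qed
  have xL: "L2P x" by (rule bddL2_L2P[OF x(3)])
  have xp: "prog_measurable T F x" by (rule prog_continuous[OF x(1) xm])
  have mb: "bddL2 (\<lambda>t \<omega>. mh t)" by (rule bddL2_det[OF mh_cont])
  have XL: "L2P Xh" by (rule bddL2_L2P[OF Xh_bddL2])
  let ?Ldr = "\<integral>z. drun (fst z) (Xh (fst z) (snd z)) (ah (fst z) (snd z)) (x (fst z) (snd z)) (eta (fst z) (snd z)) (mh (fst z)) \<partial>TM T M"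
  have foc: "?Ldr + expectation (\<lambda>\<omega>. dter (Xh T \<omega>) (x T \<omega>) (mh T)) = 0"
  proof (rule first_order_condition[OF ah_F Xh_state etaF x(1) xm eq x(3) mb])
    fix c
    have "(\<lambda>t \<omega>. ah t \<omega> + c *\<^sub>R eta t \<omega>) \<in> H2 D F1"
      by (intro H2I prog_add prog_scaleR L2P_add L2P_scaleR H2_prog[OF ah_F1] H2_prog[OF etaF1] ah_L2P etaL)
    then show "payoff D (\<lambda>t \<omega>. ah t \<omega> + c *\<^sub>R eta t \<omega>) (\<lambda>t \<omega>. mh t) \<le> payoff D ah (\<lambda>t \<omega>. mh t)" by (rule ah_opt)
  qed
  \<comment> \<open>\<open>x'\<close> and \<open>v\<close> are the drifts of \<open>x\<close> and of
    the equilibrium state; \<open>y'\<close> is the derivative of \<open>y\<close>, which is paired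
    with the state at the horizon; \<open>w'\<close> is that of the transpose of \<psi> applied to
    \<open>x\<close>, paired with the mean.\<close>
  define x' where "x' = (\<lambda>t \<omega>. A t *v x t \<omega> + B t *v eta t \<omega>)"
  define v where "v = (\<lambda>t \<omega>. A t *v Xh t \<omega> + B t *v ah t \<omega>)"
  define y where "y = (\<lambda>t \<omega>. transpose (\<phi> t) *v x t \<omega>)"
  define y' where "y' = (\<lambda>t \<omega>. transpose (- gphi t) *v x t \<omega> + transpose (\<phi> t) *v x' t \<omega>)"
  define w' where "w' = (\<lambda>t \<omega>. transpose (- gpsi t) *v x t \<omega> + transpose (\<psi> t) *v x' t \<omega>)"
  have x'L: "L2P x'" unfolding x'_def by (intro L2P_add L2P_mv bddA bddB xL etaL)
  have vL: "L2P v" unfolding v_def by (intro L2P_add L2P_mv bddA bddB XL ah_L2P)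
  have yL: "L2P y" unfolding y_def by (intro L2P_mv bdd_transpose_phi xL)
  have y'L: "L2P y'" unfolding y'_def by (intro L2P_add L2P_mv bdd_transpose_phi bdd_transpose_gphi xL x'L)
  have w'L: "L2P w'" unfolding w'_def by (intro L2P_add L2P_mv bdd_transpose_psi bdd_transpose_gpsi xL x'L)
  have y'p: "prog_measurable T F y'" unfolding y'_def x'_def
    by (intro prog_add prog_mv bdd_transpose_phi bdd_transpose_gphi bddA bddB xp H2_prog[OF etaF])
  have x0: "AE \<omega> in M. ac_deriv T (\<lambda>t. x t \<omega>) (\<lambda>t. x' t \<omega>) \<and> x 0 \<omega> = 0"
    using eq path_integrable_control[OF etaL] AE_space
  proof eventually_elim
    case (elim \<omega>)
    note iA = set_integrable_mv[OF bddA x(1)[OF elim(3)]]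
    have xt: "x t \<omega> = 0 + (LBINT s:{0..t}. x' s \<omega>)" if t: "t \<in> {0..T}" for t
      unfolding x'_def set_integral_add_sub[OF iA elim(2) t] using elim(1) t by (simp add: add.commute)
    have x0: "x 0 \<omega> = 0" using xt[OF zero_mem] set_integral_at_point[of 0 "\<lambda>s. x' s \<omega>"] by simp
    have "set_integrable lborel {0..T} (\<lambda>t. x' t \<omega>)" unfolding x'_def by (rule set_integral_add(1)[OF iA elim(2)])
    then show ?case unfolding ac_deriv_def using xt x0 by simp
  qed
  obtain dm where dm: "ac_deriv T mh dm" "ac_deriv T \<theta> (\<lambda>s. - (\<psi> s *v dm s + gtheta s))" "\<theta> T = 0"
    by (rule theta_ac)
  have T0: "0 \<le> T" using T_pos by simp
  have path_y: "AE \<omega> in M. y T \<omega> = (LBINT s:{0..T}. y' s \<omega>) \<and> ac_deriv T (\<lambda>t. y t \<omega>) (\<lambda>t. y' t \<omega>) \<and> y 0 \<omega> = 0"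
    using x0
  proof eventually_elim
    case (elim \<omega>)
    then have a: "ac_deriv T (\<lambda>t. x t \<omega>) (\<lambda>t. x' t \<omega>)" and z: "x 0 \<omega> = 0" by blast+
    have ya: "ac_deriv T (\<lambda>t. y t \<omega>) (\<lambda>t. y' t \<omega>)"
      unfolding y_def y'_def by (rule ac_deriv_bilinear[OF bounded_bilinear_transpose_mv phi_ac a T0])
    moreover have y0: "y 0 \<omega> = 0" unfolding y_def z by simp
    ultimately show ?case using ac_derivD[OF ya T_mem] by simp
  qed
  \<comment> \<open>Both products contain the derivative \<open>dm\<close>, with opposite signs:
    once from \<open>mh\<close>, once through the term with \<psi> in the equation of \<theta>.
    Their cancellation leaves square-integrable quantities only.\<close>
  have path_m: "AE \<omega> in M. mh T \<bullet> (cHtil D *v x T \<omega>) = (LBINT t:{0..T}. mh t \<bullet> w' t \<omega> + ((- gtheta t) \<bullet> x t \<omega> + \<theta> t \<bullet> x' t \<omega>))"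
    using x0
  proof eventually_elim
    case (elim \<omega>)
    then have a: "ac_deriv T (\<lambda>t. x t \<omega>) (\<lambda>t. x' t \<omega>)" and z: "x 0 \<omega> = 0" by blast+
    have wa: "ac_deriv T (\<lambda>t. transpose (\<psi> t) *v x t \<omega>) (\<lambda>t. w' t \<omega>)"
      unfolding w'_def by (rule ac_deriv_bilinear[OF bounded_bilinear_transpose_mv psi_ac a T0])
    note p1 = product_rule_endpoint[OF bounded_bilinear_inner dm(1) wa T0]
    note p2 = product_rule_endpoint[OF bounded_bilinear_inner dm(2) a T0]
    have "mh T \<bullet> (cHtil D *v x T \<omega>) = mh T \<bullet> (transpose (\<psi> T) *v x T \<omega>) + \<theta> T \<bullet> x T \<omega>"
      unfolding psi_T symHt dm(3) by simp
    also have "\<dots> = (LBINT s:{0..T}. dm s \<bullet> (transpose (\<psi> s) *v x s \<omega>) + mh s \<bullet> w' s \<omega>)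
       + (LBINT s:{0..T}. - (\<psi> s *v dm s + gtheta s) \<bullet> x s \<omega> + \<theta> s \<bullet> x' s \<omega>)"
      unfolding p1(2) p2(2) z by simp
    also have "\<dots> = (LBINT s:{0..T}. (dm s \<bullet> (transpose (\<psi> s) *v x s \<omega>) + mh s \<bullet> w' s \<omega>) + (- (\<psi> s *v dm s + gtheta s) \<bullet> x s \<omega> + \<theta> s \<bullet> x' s \<omega>))"
      by (rule set_integral_add(2)[OF p1(1) p2(1), symmetric])
    also have "\<dots> = (LBINT t:{0..T}. mh t \<bullet> w' t \<omega> + ((- gtheta t) \<bullet> x t \<omega> + \<theta> t \<bullet> x' t \<omega>))"
      by (rule arg_cong[where f="set_lebesgue_integral lborel {0..T}"], rule ext)
         (simp only: inner_transpose_right, simp add: inner_add_left inner_diff_left)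
    finally show ?case .
  qed
  have i_m: "integrable (TM T M) (\<lambda>z. mh (fst z) \<bullet> w' (fst z) (snd z) + ((- gtheta (fst z)) \<bullet> x (fst z) (snd z) + \<theta> (fst z) \<bullet> x' (fst z) (snd z)))"
    by (intro Bochner_Integration.integrable_add L2P_inner_integrable[OF L2P_coef[OF mh_bdd] w'L]
        L2P_inner_integrable[OF L2P_coef[OF L_infty_minus[OF bdd_gtheta]] xL] L2P_inner_integrable[OF L2P_coef[OF theta_bdd] x'L])
  have xT: "L2 M (x T)" and XT: "L2 M (Xh T)" by (intro bddL2_L2[OF _ T_mem] x(3) Xh_bddL2)+
  have cT: "L2 M (\<lambda>\<omega>. mh T)" by (rule L2_const[OF finite_measure_axioms])
  have E_m: "expectation (\<lambda>\<omega>. mh T \<bullet> (cHtil D *v x T \<omega>)) =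
      (\<integral>z. mh (fst z) \<bullet> w' (fst z) (snd z) + ((- gtheta (fst z)) \<bullet> x (fst z) (snd z) + \<theta> (fst z) \<bullet> x' (fst z) (snd z)) \<partial>TM T M)"
    unfolding TM_path_integral(2)[OF i_m, symmetric]
    by (rule integral_cong_AE[OF borel_measurable_integrable[OF L2_inner_integrable[OF cT L2_mv[OF xT]]]
          borel_measurable_integrable[OF TM_path_integral(1)[OF i_m]] path_m])
  let ?K = "noise ah Xh"
  \<comment> \<open>The state minus its noise is absolutely continuous on almost every path, so the
    product rule applies to it; the noise is split off and treated in expectation.\<close>
  have path_X: "AE \<omega> in M. Xh T \<omega> \<bullet> (cH D *v x T \<omega>) = (LBINT t:{0..T}. v t \<omega> \<bullet> y t \<omega> + (Xh t \<omega> - ?K t \<omega>) \<bullet> y' t \<omega>) + ?K T \<omega> \<bullet> (LBINT t:{0..T}. y' t \<omega>)"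
    using path_y L2P_path_integrable[OF vL] path_integrable_control[OF ah_L2P] AE_space
  proof eventually_elim
    case (elim \<omega>)
    then have yT: "y T \<omega> = (LBINT s:{0..T}. y' s \<omega>)" and ya: "ac_deriv T (\<lambda>t. y t \<omega>) (\<lambda>t. y' t \<omega>)" and y0: "y 0 \<omega> = 0" by blast+
    note iA = set_integrable_mv[OF bddA is_state_continuous[OF Xh_state elim(4)]]
    let ?V = "\<lambda>t. xi D \<omega> + (LBINT s:{0..t}. v s \<omega>)"
    have va: "ac_deriv T ?V (\<lambda>t. v t \<omega>)" by (rule ac_deriv_integral[OF elim(2)])
    have Ve: "?V t = Xh t \<omega> - ?K t \<omega>" if t: "t \<in> {0..T}" for t
      unfolding v_def set_integral_add_sub[OF iA elim(3) t] noise_def by simp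
    have "Xh T \<omega> \<bullet> (cH D *v x T \<omega>) = ?V T \<bullet> y T \<omega> + ?K T \<omega> \<bullet> y T \<omega>"
      unfolding Ve[OF T_mem] y_def phi_T symH by (simp add: inner_diff_left)
    also have "?V T \<bullet> y T \<omega> = (LBINT t:{0..T}. v t \<omega> \<bullet> y t \<omega> + ?V t \<bullet> y' t \<omega>)"
      unfolding product_rule_endpoint(2)[OF bounded_bilinear_inner va ya T0] y0 by simp
    also have "\<dots> = (LBINT t:{0..T}. v t \<omega> \<bullet> y t \<omega> + (Xh t \<omega> - ?K t \<omega>) \<bullet> y' t \<omega>)"
      by (intro set_lebesgue_integral_cong allI impI) (simp_all only: Ve, simp)
    finally show ?case unfolding yT .
  qed
  have KL: "L2P ?K" by (rule bddL2_L2P[OF noise_bddL2[OF Xh_state ah_L2P]])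
  have i1: "integrable (TM T M) (\<lambda>z. v (fst z) (snd z) \<bullet> y (fst z) (snd z) + (Xh (fst z) (snd z) - ?K (fst z) (snd z)) \<bullet> y' (fst z) (snd z))"
    by (intro Bochner_Integration.integrable_add L2P_inner_integrable vL yL L2P_diff XL KL y'L)
  have i2: "integrable (TM T M) (\<lambda>z. ?K (fst z) (snd z) \<bullet> y' (fst z) (snd z))" by (rule L2P_inner_integrable[OF KL y'L])
  note nb = noise_by_parts[OF Xh_state ah_L2P y'L y'p]
  have E_X: "expectation (\<lambda>\<omega>. Xh T \<omega> \<bullet> (cH D *v x T \<omega>)) =
     (\<integral>z. v (fst z) (snd z) \<bullet> y (fst z) (snd z) + Xh (fst z) (snd z) \<bullet> y' (fst z) (snd z) \<partial>TM T M)"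
  proof -
    have "expectation (\<lambda>\<omega>. Xh T \<omega> \<bullet> (cH D *v x T \<omega>)) =
      expectation (\<lambda>\<omega>. (LBINT t:{0..T}. v t \<omega> \<bullet> y t \<omega> + (Xh t \<omega> - ?K t \<omega>) \<bullet> y' t \<omega>) + ?K T \<omega> \<bullet> (LBINT t:{0..T}. y' t \<omega>))"
      by (rule integral_cong_AE[OF borel_measurable_integrable[OF L2_inner_integrable[OF XT L2_mv[OF xT]]]
          borel_measurable_integrable[OF Bochner_Integration.integrable_add[OF TM_path_integral(1)[OF i1] nb(2)]] path_X])
    also have "\<dots> = (\<integral>z. v (fst z) (snd z) \<bullet> y (fst z) (snd z) + (Xh (fst z) (snd z) - ?K (fst z) (snd z)) \<bullet> y' (fst z) (snd z) \<partial>TM T M)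
       + (\<integral>z. ?K (fst z) (snd z) \<bullet> y' (fst z) (snd z) \<partial>TM T M)"
      unfolding Bochner_Integration.integral_add[OF TM_path_integral(1)[OF i1] nb(2)] TM_path_integral(2)[OF i1] nb(1) ..
    also have "\<dots> = (\<integral>z. (v (fst z) (snd z) \<bullet> y (fst z) (snd z) + (Xh (fst z) (snd z) - ?K (fst z) (snd z)) \<bullet> y' (fst z) (snd z)) + ?K (fst z) (snd z) \<bullet> y' (fst z) (snd z) \<partial>TM T M)"
      by (rule Bochner_Integration.integral_add[OF i1 i2, symmetric])
    also have "\<dots> = (\<integral>z. v (fst z) (snd z) \<bullet> y (fst z) (snd z) + Xh (fst z) (snd z) \<bullet> y' (fst z) (snd z) \<partial>TM T M)"
      by (intro Bochner_Integration.integral_cong refl) (simp add: inner_diff_left)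
    finally show ?thesis .
  qed
  \<comment> \<open>The terminal values of \<phi>, \<psi> and \<theta> are such that the derivative
    of the terminal payoff is minus the pairing of the adjoint process with \<open>x\<close> at the
    horizon.\<close>
  have dterT: "dter (Xh T \<omega>) (x T \<omega>) (mh T) = - (Xh T \<omega> \<bullet> (cH D *v x T \<omega>)) - mh T \<bullet> (cHtil D *v x T \<omega>)" for \<omega>
    unfolding dter_def using inner_transpose_left[of "cH D" "Xh T \<omega>" "x T \<omega>"] symH
    by (simp add: inner_commute del: transpose_matrix_vector)
  have E_d: "expectation (\<lambda>\<omega>. dter (Xh T \<omega>) (x T \<omega>) (mh T)) =
     - expectation (\<lambda>\<omega>. Xh T \<omega> \<bullet> (cH D *v x T \<omega>)) - expectation (\<lambda>\<omega>. mh T \<bullet> (cHtil D *v x T \<omega>))"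
    unfolding dterT using L2_inner_integrable[OF XT L2_mv[OF xT]] L2_inner_integrable[OF cT L2_mv[OF xT]] by simp
  let ?s1 = "\<lambda>z. v (fst z) (snd z) \<bullet> y (fst z) (snd z) + Xh (fst z) (snd z) \<bullet> y' (fst z) (snd z)"
  let ?s2 = "\<lambda>z. mh (fst z) \<bullet> w' (fst z) (snd z) + ((- gtheta (fst z)) \<bullet> x (fst z) (snd z) + \<theta> (fst z) \<bullet> x' (fst z) (snd z))"
  let ?d = "\<lambda>z. drun (fst z) (Xh (fst z) (snd z)) (ah (fst z) (snd z)) (x (fst z) (snd z)) (eta (fst z) (snd z)) (mh (fst z))"
  let ?e = "\<lambda>z. eps (fst z) (snd z) \<bullet> (R (fst z) *v eps (fst z) (snd z))"
  have i_s1: "integrable (TM T M) ?s1"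
    by (intro Bochner_Integration.integrable_add L2P_inner_integrable vL yL XL y'L)
  have i_d: "integrable (TM T M) ?d"
    using drun_integrable[OF XL ah_L2P xL etaL L2P_coef[OF mh_bdd]] .
  have i_e: "integrable (TM T M) ?e" by (intro L2P_inner_integrable eps_L2P L2P_mv bddR)
  have pt: "AE z in TM T M. ?d z = (?s1 z + ?s2 z) - ?e z"
  proof -
    have s: "AE t in TL T. t \<in> {0..T} \<and> transpose (Q t) = Q t \<and> transpose (Qt t) = Qt t"
      using symQ symQt AE_space by eventually_elim (simp add: space_restrict_space)
    have "AE z in TM T M. fst z \<in> {0..T} \<and> transpose (Q (fst z)) = Q (fst z) \<and> transpose (Qt (fst z)) = Qt (fst z)"
      by (rule AE_TM_if_AE_time[OF s])
    then show ?thesis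
    proof eventually_elim
      case (elim z)
      let ?t = "fst z" and ?w = "snd z"
      have t: "?t \<in> {0..T}" and sQ: "transpose (Q ?t) = Q ?t" and sQt: "transpose (Qt ?t) = Qt ?t" using elim by blast+
      have sR: "transpose (R ?t) = R ?t" using symR[OF t] unfolding sym_mat_def .
      note I = first_order_identity[OF R_Ri[OF t] sQ sQt sR, where A="A ?t" and B="B ?t" and \<phi>="\<phi> ?t" and \<psi>="\<psi> ?t" and S="S ?t"
          and X="Xh ?t ?w" and a="ah ?t ?w" and x="x ?t ?w" and m="mh ?t" and \<theta>="\<theta> ?t" and q="cq D ?t" and r="cr D ?t"]
      have ee: "eps ?t ?w = ah ?t ?w + (Ri ?t ** (transpose (B ?t) ** \<phi> ?t + S ?t)) *v Xh ?t ?w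
          + (Ri ?t ** transpose (B ?t) ** \<psi> ?t) *v mh ?t + Ri ?t *v (transpose (B ?t) *v \<theta> ?t + cr D ?t)"
        unfolding eps_def Phi_coef_def Psi_coef_def Theta_coef_def ..
      show ?case
        using I unfolding ee[symmetric] gphi_def[symmetric] gpsi_def[symmetric] gtheta_def[symmetric] Kp_def[symmetric]
        unfolding drun_def v_def y_def y'_def w'_def x'_def eta_def by simp
    qed
  qed
  have "?Ldr = (\<integral>z. (?s1 z + ?s2 z) - ?e z \<partial>TM T M)"
    by (rule integral_cong_AE[OF borel_measurable_integrable[OF i_d] borel_measurable_integrable pt])
       (intro Bochner_Integration.integrable_diff Bochner_Integration.integrable_add[OF i_s1 i_m] i_e)
  also have "\<dots> = (\<integral>z. ?s1 z \<partial>TM T M) + (\<integral>z. ?s2 z \<partial>TM T M) - (\<integral>z. ?e z \<partial>TM T M)"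
    unfolding Bochner_Integration.integral_diff[OF Bochner_Integration.integrable_add[OF i_s1 i_m] i_e]
      Bochner_Integration.integral_add[OF i_s1 i_m] ..
  \<comment> \<open>The terminal terms and the adjoint terms have cancelled, leaving the R-energy of
    \<open>eps\<close>; coercivity of R then forces \<open>eps\<close> to vanish.\<close>
  finally have zero: "(\<integral>z. ?e z \<partial>TM T M) = 0" using foc unfolding E_d E_X E_m by linarith
  have co: "AE z in TM T M. d2 * (eps (fst z) (snd z) \<bullet> eps (fst z) (snd z)) \<le> ?e z"
  proof -
    have "AE z in TM T M. fst z \<in> {0..T}" using AE_TM_if_AE_time[of "\<lambda>t. t \<in> {0..T}"] AE_space[of "TL T"] by (simp add: space_restrict_space)
    then show ?thesis
    proof eventually_elim
      case (elim z)
      show ?case using R_coercive[OF elim, of "eps (fst z) (snd z)"]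
        by (simp only: inner_commute[of "R (fst z) *v eps (fst z) (snd z)"])
    qed
  qed
  have "AE z in TM T M. 0 \<le> ?e z" using co
    by eventually_elim (use d2_pos in \<open>meson inner_ge_zero mult_nonneg_nonneg order_less_imp_le order_trans\<close>)
  from integral_nonneg_eq_0_iff_AE[OF i_e this] zero have "AE z in TM T M. ?e z = 0" by blast
  then show ?thesis using co
  proof eventually_elim
    case (elim z)
    then have "d2 * (eps (fst z) (snd z) \<bullet> eps (fst z) (snd z)) \<le> 0" by simp
    then have "eps (fst z) (snd z) \<bullet> eps (fst z) (snd z) \<le> 0" using d2_pos by (simp add: mult_le_0_iff)
    then show ?case using inner_ge_zero[of "eps (fst z) (snd z)"] by (simp add: order_antisym)
  qed
qed

end

section \<open>Orthogonality to the noise\<close>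

lemma set_integral_cong_TL:
  fixes f g :: "real \<Rightarrow> 'b::euclidean_space"
  assumes f: "set_integrable lborel {0..T} f" and g: "set_integrable lborel {0..T} g"
    and eq: "AE s in TL T. f s = g s" and t: "t \<in> {0..T}"
  shows "(LBINT s:{0..t}. f s) = (LBINT s:{0..t}. g s)"
  unfolding set_lebesgue_integral_def
proof (rule integral_cong_AE)
  have "set_integrable lborel {0..t} f" "set_integrable lborel {0..t} g"
    by (rule set_integrable_subset[OF f], use t in simp, use t in force)
       (rule set_integrable_subset[OF g], use t in simp, use t in force)
  then show "(\<lambda>s. indicator {0..t} s *\<^sub>R f s) \<in> borel_measurable lborel" "(\<lambda>s. indicator {0..t} s *\<^sub>R g s) \<in> borel_measurable lborel"
    unfolding set_integrable_def by (blast dest: borel_measurable_integrable)+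
  show "AE s in lborel. indicator {0..t} s *\<^sub>R f s = indicator {0..t} s *\<^sub>R g s"
    using eq unfolding AE_TL by eventually_elim (use t in \<open>auto simp: indicator_def\<close>)
qed

context time_space
begin

lemma meas_proc_eq_sets:
  assumes "meas_proc f" "meas_proc g"
  shows "{z \<in> space (TM T M). f (fst z) (snd z) = g (fst z) (snd z)} \<in> sets (TM T M)"
proof -
  have "(\<lambda>z. f (fst z) (snd z) - g (fst z) (snd z)) \<in> borel_measurable (TM T M)"
    using meas_proc_diff[OF assms] unfolding meas_proc_def .
  from measurable_sets[OF this, of "{0}"]
  have "(\<lambda>z. f (fst z) (snd z) - g (fst z) (snd z)) -` {0} \<inter> space (TM T M) \<in> sets (TM T M)" by simp
  moreover have "(\<lambda>z. f (fst z) (snd z) - g (fst z) (snd z)) -` {0} \<inter> space (TM T M) = {z \<in> space (TM T M). f (fst z) (snd z) = g (fst z) (snd z)}"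
    by auto
  ultimately show ?thesis by simp
qed

lemma AE_TM_eq_iff_time:
  assumes "meas_proc f" "meas_proc g"
  shows "(AE z in TM T M. f (fst z) (snd z) = g (fst z) (snd z)) \<longleftrightarrow> (AE t in TL T. AE \<omega> in M. f t \<omega> = g t \<omega>)"
  using P.AE_pair_iff[OF meas_proc_eq_sets[OF assms]] by blast

lemma AE_TM_eq_iff_path:
  assumes "meas_proc f" "meas_proc g"
  shows "(AE z in TM T M. f (fst z) (snd z) = g (fst z) (snd z)) \<longleftrightarrow> (AE \<omega> in M. AE t in TL T. f t \<omega> = g t \<omega>)"
  unfolding AE_TM_eq_iff_time[OF assms] by (rule P.AE_commute[OF meas_proc_eq_sets[OF assms]])

text \<open>Uncorrelatedness for all pairs of coordinates, integrability included. It is stable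
  under matrices, so that it kills every cross term of a quadratic functional.\<close>

definition orth :: "('w \<Rightarrow> real^'m) \<Rightarrow> ('w \<Rightarrow> real^'n) \<Rightarrow> bool" where
  "orth z y \<longleftrightarrow> (\<forall>i j. integrable M (\<lambda>\<omega>. z \<omega> $ i * y \<omega> $ j) \<and> expectation (\<lambda>\<omega>. z \<omega> $ i * y \<omega> $ j) = 0)"

lemma orth_mv_right:
  assumes "orth z y" shows "orth z (\<lambda>\<omega>. C *v y \<omega>)"
proof -
  have e: "z \<omega> $ i * (C *v y \<omega>) $ j = (\<Sum>l\<in>UNIV. C $ j $ l * (z \<omega> $ i * y \<omega> $ l))" for \<omega> i j
    unfolding matrix_vector_mult_def vec_lambda_beta sum_distrib_left by (intro sum.cong refl) (simp add: mult_ac)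
  have i: "integrable M (\<lambda>\<omega>. C $ j $ l * (z \<omega> $ i * y \<omega> $ l))" for i j l
    using assms unfolding orth_def by (intro integrable_mult_right) blast
  have "expectation (\<lambda>\<omega>. \<Sum>l\<in>UNIV. C $ j $ l * (z \<omega> $ i * y \<omega> $ l)) = (\<Sum>l\<in>UNIV. expectation (\<lambda>\<omega>. C $ j $ l * (z \<omega> $ i * y \<omega> $ l)))" for i j
    by (rule Bochner_Integration.integral_sum[OF i])
  then have E: "expectation (\<lambda>\<omega>. \<Sum>l\<in>UNIV. C $ j $ l * (z \<omega> $ i * y \<omega> $ l)) = 0" for i j
    using assms unfolding orth_def by simp
  show ?thesis unfolding orth_def e by (intro allI conjI Bochner_Integration.integrable_sum i E)
qed

lemma orth_add:
  assumes "orth z y" "orth z y'" shows "orth z (\<lambda>\<omega>. y \<omega> + y' \<omega>)"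
  using assms unfolding orth_def by (simp add: distrib_left)

lemma orth_minus:
  assumes "orth z y" shows "orth z (\<lambda>\<omega>. - y \<omega>)"
  using assms unfolding orth_def by simp

lemma orth_const:
  assumes z: "L2 M z" and "expectation z = 0" shows "orth z (\<lambda>\<omega>. c)"
proof -
  have zi: "integrable M z" by (rule L2_integrable[OF finite_measure_axioms z])
  have "expectation (\<lambda>\<omega>. z \<omega> $ i) = expectation z $ i" for i
    using integral_bounded_linear[OF bounded_linear_vec_nth zi] .
  moreover have "integrable M (\<lambda>\<omega>. z \<omega> $ i)" for i
    using integrable_bounded_linear[OF bounded_linear_vec_nth zi] .
  ultimately show ?thesis using assms unfolding orth_def by simp
qed

lemma orth_inner:
  assumes "orth z y"
  shows "integrable M (\<lambda>\<omega>. (C *v z \<omega>) \<bullet> y \<omega>)" "expectation (\<lambda>\<omega>. (C *v z \<omega>) \<bullet> y \<omega>) = 0"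
proof -
  have o: "orth z (\<lambda>\<omega>. transpose C *v y \<omega>)" by (rule orth_mv_right[OF assms])
  have e: "(C *v z \<omega>) \<bullet> y \<omega> = (\<Sum>i\<in>UNIV. z \<omega> $ i * (transpose C *v y \<omega>) $ i)" for \<omega>
    unfolding inner_transpose_right[symmetric] by (simp only: inner_vec_def inner_real_def)
  show "integrable M (\<lambda>\<omega>. (C *v z \<omega>) \<bullet> y \<omega>)"
    unfolding e using o unfolding orth_def by (intro Bochner_Integration.integrable_sum) blast
  have "expectation (\<lambda>\<omega>. (C *v z \<omega>) \<bullet> y \<omega>) = (\<Sum>i\<in>UNIV. expectation (\<lambda>\<omega>. z \<omega> $ i * (transpose C *v y \<omega>) $ i))"
    unfolding e using o unfolding orth_def by (intro Bochner_Integration.integral_sum) blast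
  also have "\<dots> = 0" using o unfolding orth_def by (intro sum.neutral) blast
  finally show "expectation (\<lambda>\<omega>. (C *v z \<omega>) \<bullet> y \<omega>) = 0" .
qed

lemma orth_if_indep:
  assumes ind: "indep_set \<A> \<B>" and z: "L2 M z" "expectation z = 0" and y: "L2 M y"
    and yA: "\<And>E. E \<in> sets borel \<Longrightarrow> y -` E \<inter> space M \<in> \<A>"
    and zB: "\<And>E. E \<in> sets borel \<Longrightarrow> z -` E \<inter> space M \<in> \<B>"
  shows "orth (z :: 'w \<Rightarrow> real^'m) (y :: 'w \<Rightarrow> real^'n)"
  unfolding orth_def
proof (intro allI)
  fix i j
  have zi: "integrable M z" by (rule L2_integrable[OF finite_measure_axioms z(1)])
  have Ez: "expectation (\<lambda>\<omega>. z \<omega> $ i) = 0"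
    using integral_bounded_linear[OF bounded_linear_vec_nth zi, of i] z(2) by simp
  have iz: "integrable M (\<lambda>\<omega>. z \<omega> $ i)" by (rule L2_integrable[OF finite_measure_axioms L2_component[OF z(1)]])
  have iy: "integrable M (\<lambda>\<omega>. y \<omega> $ j)" by (rule L2_integrable[OF finite_measure_axioms L2_component[OF y]])
  have A: "(\<lambda>\<omega>. y \<omega> $ j) -` E \<inter> space M \<in> \<A>" if E: "E \<in> sets borel" for E
  proof -
    have "y -` ((\<lambda>x. x $ j) -` E) \<inter> space M \<in> \<A>"
      by (rule yA, rule measurable_sets_borel[OF borel_measurable_nth E])
    then show ?thesis unfolding vimage_def by simp
  qed
  have B: "(\<lambda>\<omega>. z \<omega> $ i) -` E \<inter> space M \<in> \<B>" if E: "E \<in> sets borel" for E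
  proof -
    have "z -` ((\<lambda>x. x $ i) -` E) \<inter> space M \<in> \<B>"
      by (rule zB, rule measurable_sets_borel[OF borel_measurable_nth E])
    then show ?thesis unfolding vimage_def by simp
  qed
  have c: "(\<lambda>\<omega>. z \<omega> $ i * y \<omega> $ j) = (\<lambda>\<omega>. y \<omega> $ j * z \<omega> $ i)" by (rule ext) (rule mult.commute)
  note m = indep_expectation_mult[OF ind iy iz A B]
  show "integrable M (\<lambda>\<omega>. z \<omega> $ i * y \<omega> $ j) \<and> expectation (\<lambda>\<omega>. z \<omega> $ i * y \<omega> $ j) = 0"
    unfolding c using m(1) by (simp only: m(2) Ez mult_zero_right simp_thms)
qed

end

context wiener_space
begin

lemma wiener_integral_0:
  assumes J: "is_wiener_integral T M W \<sigma> J" shows "AE \<omega> in M. J 0 \<omega> = 0"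
proof -
  have 0: "0 \<in> {0..T}" using T_pos by simp
  obtain n p c where I: "\<And>j i. i \<le> n j \<Longrightarrow> p j i \<in> {0..T}"
    "(\<lambda>j. \<integral>\<^sup>+\<omega>. ennreal ((norm (step_integral (n j) (p j) (c j) W 0 \<omega> - J 0 \<omega>))\<^sup>2) \<partial>M) \<longlonglongrightarrow> 0"
    "J 0 \<in> borel_measurable M"
    by (rule wiener_integral_approx[OF J]) (use 0 in blast)
  have z: "step_integral (n j) (p j) (c j) W 0 \<omega> = 0" for j \<omega>
    unfolding step_integral_def
  proof (intro sum.neutral ballI)
    fix i assume "i \<in> {..<n j}"
    then have "p j i \<ge> 0" "p j (Suc i) \<ge> 0" using I(1)[of i j] I(1)[of "Suc i" j] by auto
    then show "c j i *v (W (min 0 (p j (Suc i))) \<omega> - W (min 0 (p j i)) \<omega>) = 0" by simp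
  qed
  have "msq M (J 0) = 0"
    using I(2) unfolding z by (simp add: LIMSEQ_const_iff)
  then have "AE \<omega> in M. ennreal ((norm (J 0 \<omega>))\<^sup>2) = 0"
    by (subst (asm) nn_integral_0_iff_AE) (intro nn_integral_L2_measurable I(3))
  then show ?thesis by eventually_elim simp
qed

text \<open>Increments are orthogonal to constants, so the mean is orthogonal to every vector and
  thus to itself.\<close>

lemma wiener_integral_mean:
  assumes J: "is_wiener_integral T M W \<sigma> J" and t: "t \<in> {0..T}" shows "expectation (J t) = 0"
proof -
  have 0: "0 \<in> {0..T}" using T_pos by simp
  note J2 = wiener_integral_L2[OF J]
  have i: "integrable M (J t)" "integrable M (J 0)"
    by (rule L2_integrable[OF finite_measure_axioms J2[OF t]], rule L2_integrable[OF finite_measure_axioms J2[OF 0]])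
  have "expectation (J 0) = 0" by (rule integral_eq_zero_AE[OF wiener_integral_0[OF J]])
  moreover have "c \<bullet> (expectation (J t) - expectation (J 0)) = 0" for c
  proof -
    have "expectation (\<lambda>\<omega>. c \<bullet> (J t \<omega> - J 0 \<omega>)) = 0"
      by (rule wiener_integral_orthogonal[OF J _ _ _ L2_const[OF finite_measure_axioms]]) (use t in auto)
    moreover have "expectation (\<lambda>\<omega>. c \<bullet> (J t \<omega> - J 0 \<omega>)) = c \<bullet> expectation (\<lambda>\<omega>. J t \<omega> - J 0 \<omega>)"
      by (rule integral_inner_right) (rule Bochner_Integration.integrable_diff[OF i])
    ultimately show ?thesis unfolding Bochner_Integration.integral_diff[OF i] by simp
  qed
  ultimately have "expectation (J t) \<bullet> expectation (J t) = 0" by (metis diff_zero)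
  then show ?thesis by simp
qed

end

context time_space
begin

lemma L2P_indicator:
  assumes v: "L2P v" shows "L2P (\<lambda>s \<omega>. indicator {0..t} s *\<^sub>R v s \<omega>)"
  unfolding L2P_def
proof (rule L2_bounded[OF v[unfolded L2P_def], where c=1])
  have id: "(\<lambda>x. x) \<in> borel_measurable (TL T)" by (rule measurable_restrict_space1) simp
  have "(\<lambda>x. indicator {0..t} x :: real) \<in> borel_measurable (TL T)"
    by (rule measurable_compose[OF id borel_measurable_indicator]) simp
  from measurable_compose[OF measurable_fst this] L2P_meas[OF v]
  show "(\<lambda>z. indicator {0..t} (fst z) *\<^sub>R v (fst z) (snd z)) \<in> borel_measurable (TM T M)"
    unfolding meas_proc_def by (intro borel_measurable_scaleR)
  show "AE z in TM T M. norm (indicator {0..t} (fst z) *\<^sub>R v (fst z) (snd z)) \<le> 1 * norm (v (fst z) (snd z))"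
    by (rule AE_I2) (simp add: indicator_def)
qed

lemma LBINT_indicator:
  fixes f :: "real \<Rightarrow> 'b::euclidean_space"
  assumes "t \<in> {0..T}" shows "(LBINT s:{0..t}. f s) = (\<integral>s. indicator {0..t} s *\<^sub>R f s \<partial>TL T)"
  unfolding set_lebesgue_integral_def
  using assms by (subst integral_restrict_space) (auto intro!: Bochner_Integration.integral_cong simp: indicator_def)

lemma expectation_integral:
  fixes v :: "real \<Rightarrow> 'w \<Rightarrow> 'b::euclidean_space"
  assumes v: "L2P v" and t: "t \<in> {0..T}"
  shows "expectation (\<lambda>\<omega>. LBINT s:{0..t}. v s \<omega>) = (LBINT s:{0..t}. expectation (v s))"
proof -
  have i: "integrable (TM T M) (\<lambda>(s, \<omega>). indicator {0..t} s *\<^sub>R v s \<omega>)"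
    using L2P_integrable[OF L2P_indicator[OF v, of t]] by (simp only: case_prod_beta')
  have "expectation (\<lambda>\<omega>. LBINT s:{0..t}. v s \<omega>) = (\<integral>s. expectation (\<lambda>\<omega>. indicator {0..t} s *\<^sub>R v s \<omega>) \<partial>TL T)"
    unfolding LBINT_indicator[OF t] by (rule P.Fubini_integral[OF i])
  also have "\<dots> = (\<integral>s. indicator {0..t} s *\<^sub>R expectation (v s) \<partial>TL T)" by simp
  finally show ?thesis unfolding LBINT_indicator[OF t] .
qed

lemma expectation_set_integrable:
  fixes v :: "real \<Rightarrow> 'w \<Rightarrow> 'b::euclidean_space"
  assumes v: "L2P v" shows "set_integrable lborel {0..T} (\<lambda>t. expectation (v t))"
  unfolding set_integrable_TL using P.integrable_fst[of v] L2P_integrable[OF v] by (simp only: case_prod_beta')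

end

section \<open>Separating the deviation from the mean part of the payoff\<close>

context lq_riccati
begin

lemma bdd_closed_loop: "L_infty T (\<lambda>s. A s - B s ** Phi_coef D \<phi> s)"
  by (intro L_infty_closure bdd_coefs bdd_Phi)

text \<open>Here \<open>u\<close> is the feedback form of the control and \<open>e\<close> the drift
  of the mean \<open>n\<close>. Once the two drifts are subtracted, all terms other than those in
  \<open>Y\<close> - \<open>n\<close> cancel, as \<open>alg\<close> records. Applied to the flow
  with \<mu> and to the equilibrium with \<open>mh\<close>.\<close>

lemma deviation_eq:
  assumes Y: "is_state D l Y" and l: "L2P l" and u: "L2P u" and lu: "AE z in TM T M. l (fst z) (snd z) = u (fst z) (snd z)"
    and e: "AE \<omega> in M. set_integrable lborel {0..T} (\<lambda>t. e t \<omega>)"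
    and n: "AE \<omega> in M. \<forall>t\<in>{0..T}. n t \<omega> = expectation (xi D) + (LBINT s:{0..t}. e s \<omega>)"
    and alg: "\<And>t \<omega>. A t *v Y t \<omega> + B t *v u t \<omega> - e t \<omega> = (A t - B t ** Phi_coef D \<phi> t) *v (Y t \<omega> - n t \<omega>)"
  shows "AE \<omega> in M. \<forall>t\<in>{0..T}. Y t \<omega> - n t \<omega> = (xi D \<omega> - expectation (xi D) + noise l Y t \<omega>)
      + (LBINT s:{0..t}. (A s - B s ** Phi_coef D \<phi> s) *v (Y s \<omega> - n s \<omega>))"
proof -
  have "AE \<omega> in M. AE t in TL T. l t \<omega> = u t \<omega>"
    using lu AE_TM_eq_iff_path[OF L2P_meas[OF l] L2P_meas[OF u]] by blast
  then show ?thesis using path_integrable_control[OF l] path_integrable_control[OF u] e n AE_space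
  proof eventually_elim
    case (elim \<omega>)
    note iA = set_integrable_mv[OF bddA is_state_continuous[OF Y elim(6)]]
    show ?case
    proof
      fix t assume t: "t \<in> {0..T}"
      have "AE s in TL T. B s *v l s \<omega> = B s *v u s \<omega>" using elim(1) by eventually_elim simp
      from set_integral_cong_TL[OF elim(2,3) this t]
      have "Y t \<omega> = (xi D \<omega> + noise l Y t \<omega>) + ((LBINT s:{0..t}. A s *v Y s \<omega>) + (LBINT s:{0..t}. B s *v u s \<omega>))"
        using state_eq[of Y t \<omega> l] by simp
      also have "(LBINT s:{0..t}. A s *v Y s \<omega>) + (LBINT s:{0..t}. B s *v u s \<omega>) = (LBINT s:{0..t}. A s *v Y s \<omega> + B s *v u s \<omega>)"
        by (rule set_integral_add_sub[OF iA elim(3) t, symmetric])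
      finally have "Y t \<omega> - n t \<omega> = (xi D \<omega> - expectation (xi D) + noise l Y t \<omega>)
         + ((LBINT s:{0..t}. A s *v Y s \<omega> + B s *v u s \<omega>) - (LBINT s:{0..t}. e s \<omega>))"
        using elim(5) t by simp
      also have "(LBINT s:{0..t}. A s *v Y s \<omega> + B s *v u s \<omega>) - (LBINT s:{0..t}. e s \<omega>)
         = (LBINT s:{0..t}. (A s - B s ** Phi_coef D \<phi> s) *v (Y s \<omega> - n s \<omega>))"
        unfolding set_integral_diff_sub[OF set_integral_add(1)[OF iA elim(3)] elim(4) t, symmetric] alg ..
      finally show "Y t \<omega> - n t \<omega> = (xi D \<omega> - expectation (xi D) + noise l Y t \<omega>)
        + (LBINT s:{0..t}. (A s - B s ** Phi_coef D \<phi> s) *v (Y s \<omega> - n s \<omega>))" .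
    qed
  qed
qed

text \<open>The cross terms pair the deviations z, l with the mean parts m, a; transposition puts
  the matrix next to z or l, the form which \<open>orth_inner\<close> evaluates. The mean argument 0
  drops the terms containing the mean from the part in z.\<close>

lemma run_split: "run t (z + m) (l + a) m = run t m a m + run t z l 0
   + (- 1/2 * ((Q t *v z) \<bullet> m + m \<bullet> (transpose (Q t) *v z)) - (Qt t *v z) \<bullet> m
      - 1/2 * ((R t *v l) \<bullet> a + a \<bullet> (transpose (R t) *v l)) - (S t *v z) \<bullet> a - m \<bullet> (transpose (S t) *v l))"
  unfolding run_def inner_transpose_right
  by (simp add: matrix_vector_right_distrib inner_simps algebra_simps)

lemma ter_split: "ter (z + m) m = ter m m + ter z 0
   + (- 1/2 * ((cH D *v z) \<bullet> m + m \<bullet> (transpose (cH D) *v z)) - (cHtil D *v z) \<bullet> m)"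
  unfolding ter_def inner_transpose_right
  by (simp add: matrix_vector_right_distrib inner_simps algebra_simps)

text \<open>The part in \<open>z\<close> keeps its linear terms and is left as it stands, since it
  enters both payoffs in the same way.\<close>

lemma payoff_split:
  assumes l: "l \<in> H2 D F" and Y: "is_state D l Y" and n: "bddL2 n" and a: "L2P a" and z: "bddL2 z"
    and Yz: "AE \<omega> in M. \<forall>t\<in>{0..T}. Y t \<omega> = z t \<omega> + n t \<omega>"
    and la: "AE x in TM T M. l (fst x) (snd x) = - (Phi_coef D \<phi> (fst x) *v z (fst x) (snd x)) + a (fst x) (snd x)"
    and on: "\<And>t. t \<in> {0..T} \<Longrightarrow> orth (z t) (n t)" and oa: "AE t in TL T. orth (z t) (a t)"
  shows "payoff D l n = (\<integral>x. run (fst x) (n (fst x) (snd x)) (a (fst x) (snd x)) (n (fst x) (snd x)) \<partial>TM T M)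
      + (\<integral>x. run (fst x) (z (fst x) (snd x)) (- (Phi_coef D \<phi> (fst x) *v z (fst x) (snd x))) 0 \<partial>TM T M)
      + expectation (\<lambda>\<omega>. ter (n T \<omega>) (n T \<omega>)) + expectation (\<lambda>\<omega>. ter (z T \<omega>) 0)"
proof -
  have lL: "L2P l" by (rule H2_L2P[OF filt_space_F l])
  have Yb: "bddL2 Y" by (rule state_bddL2[OF Y lL])
  define L where "L = (\<lambda>t \<omega>. - (Phi_coef D \<phi> t *v z t \<omega>))"
  have zL: "L2P z" and nL: "L2P n" and YL: "L2P Y" by (rule bddL2_L2P, fact)+
  have LL: "L2P L" unfolding L_def by (intro L2P_minus L2P_mv bdd_Phi zL)
  have zeroL: "L2P (\<lambda>t \<omega>. 0 :: real^'d)" by (rule L2P_coef[OF L_infty_continuous[OF continuous_on_const]])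
  let ?cr = "\<lambda>t \<omega>. - 1/2 * ((Q t *v z t \<omega>) \<bullet> n t \<omega> + n t \<omega> \<bullet> (transpose (Q t) *v z t \<omega>)) - (Qt t *v z t \<omega>) \<bullet> n t \<omega>
      - 1/2 * ((R t *v L t \<omega>) \<bullet> a t \<omega> + a t \<omega> \<bullet> (transpose (R t) *v L t \<omega>)) - (S t *v z t \<omega>) \<bullet> a t \<omega> - n t \<omega> \<bullet> (transpose (S t) *v L t \<omega>)"
  have i_cr: "integrable (TM T M) (\<lambda>x. ?cr (fst x) (snd x))"
    by (intro Bochner_Integration.integrable_diff Bochner_Integration.integrable_add integrable_mult_right
        L2P_inner_integrable L2P_mv zL nL a LL L_infty_transpose bddQ bddQt bddR bddS)
  have i_n: "integrable (TM T M) (\<lambda>x. run (fst x) (n (fst x) (snd x)) (a (fst x) (snd x)) (n (fst x) (snd x)))"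
    by (rule run_integrable[OF nL a nL])
  have i_z: "integrable (TM T M) (\<lambda>x. run (fst x) (z (fst x) (snd x)) (L (fst x) (snd x)) 0)"
    by (rule run_integrable[OF zL LL zeroL])
  have cr0: "(\<integral>x. ?cr (fst x) (snd x) \<partial>TM T M) = 0"
    unfolding TM_time_integral(2)[OF i_cr, symmetric] LBINT_TL
  proof (rule integral_eq_zero_AE)
    show "AE t in TL T. expectation (?cr t) = 0"
      using oa AE_space
    proof eventually_elim
      case (elim t)
      then have t: "t \<in> {0..T}" by (simp add: space_restrict_space)
      have o1: "orth (z t) (n t)" by (rule on[OF t])
      have comm: "n t \<omega> \<bullet> w = w \<bullet> n t \<omega>" "a t \<omega> \<bullet> w' = w' \<bullet> a t \<omega>" for \<omega> w w' by (rule inner_commute)+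
      \<comment> \<open>The control part L is a matrix applied to \<open>z\<close>, so the cross
        terms containing L are pairings of \<open>z\<close> as well.\<close>
      have LC: "C *v L t \<omega> = (C ** (- Phi_coef D \<phi> t)) *v z t \<omega>" for C :: "real^'k^'m" and \<omega>
        unfolding L_def by (simp only: mv_simps)
      note n = orth_inner[OF o1] and aa = orth_inner[OF elim(1)]
      show ?case unfolding comm LC
        by (simp add: n(1) aa(1) n(2) aa(2) del: transpose_matrix_vector)
    qed
  qed
  have "(\<integral>x. run (fst x) (Y (fst x) (snd x)) (l (fst x) (snd x)) (n (fst x) (snd x)) \<partial>TM T M)
     = (\<integral>x. (run (fst x) (n (fst x) (snd x)) (a (fst x) (snd x)) (n (fst x) (snd x)) + run (fst x) (z (fst x) (snd x)) (L (fst x) (snd x)) 0)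
         + ?cr (fst x) (snd x) \<partial>TM T M)"
  proof (rule integral_cong_AE[OF borel_measurable_integrable[OF run_integrable[OF YL lL nL]]
        borel_measurable_integrable[OF Bochner_Integration.integrable_add[OF Bochner_Integration.integrable_add[OF i_n i_z] i_cr]]])
    have m: "meas_proc (\<lambda>t \<omega>. z t \<omega> + n t \<omega>)" by (rule meas_proc_add[OF bddL2_meas[OF z] bddL2_meas[OF n]])
    have "AE x in TM T M. Y (fst x) (snd x) = z (fst x) (snd x) + n (fst x) (snd x)"
      unfolding AE_TM_eq_iff_path[OF bddL2_meas[OF Yb] m]
    proof -
      show "AE \<omega> in M. AE t in TL T. Y t \<omega> = z t \<omega> + n t \<omega>"
        using Yz by eventually_elim (rule AE_I2, simp add: space_restrict_space)
    qed
    then show "AE x in TM T M. run (fst x) (Y (fst x) (snd x)) (l (fst x) (snd x)) (n (fst x) (snd x))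
      = (run (fst x) (n (fst x) (snd x)) (a (fst x) (snd x)) (n (fst x) (snd x)) + run (fst x) (z (fst x) (snd x)) (L (fst x) (snd x)) 0)
         + ?cr (fst x) (snd x)"
      using la
    proof eventually_elim
      case (elim x)
      show ?case unfolding elim L_def by (rule run_split)
    qed
  qed
  also have "\<dots> = (\<integral>x. run (fst x) (n (fst x) (snd x)) (a (fst x) (snd x)) (n (fst x) (snd x)) \<partial>TM T M)
     + (\<integral>x. run (fst x) (z (fst x) (snd x)) (L (fst x) (snd x)) 0 \<partial>TM T M)"
    unfolding Bochner_Integration.integral_add[OF Bochner_Integration.integrable_add[OF i_n i_z] i_cr]
      Bochner_Integration.integral_add[OF i_n i_z] cr0 by simp
  finally have r: "(\<integral>x. run (fst x) (Y (fst x) (snd x)) (l (fst x) (snd x)) (n (fst x) (snd x)) \<partial>TM T M)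
    = (\<integral>x. run (fst x) (n (fst x) (snd x)) (a (fst x) (snd x)) (n (fst x) (snd x)) \<partial>TM T M)
     + (\<integral>x. run (fst x) (z (fst x) (snd x)) (L (fst x) (snd x)) 0 \<partial>TM T M)" .
  have nT: "L2 M (n T)" and zT: "L2 M (z T)" and YT: "L2 M (Y T)" by (intro bddL2_L2[OF _ T_mem]; fact)+
  have z0: "L2 M (\<lambda>\<omega>. 0 :: real^'d)" by (rule L2_const[OF finite_measure_axioms])
  let ?ct = "\<lambda>\<omega>. - 1/2 * ((cH D *v z T \<omega>) \<bullet> n T \<omega> + n T \<omega> \<bullet> (transpose (cH D) *v z T \<omega>)) - (cHtil D *v z T \<omega>) \<bullet> n T \<omega>"
  note oT = orth_inner[OF on[OF T_mem]]
  have i_ct: "integrable M ?ct" and ct0: "expectation ?ct = 0"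
    unfolding inner_commute[of "n T _"] by (simp_all add: oT del: transpose_matrix_vector)
  note i_tn = ter_integrable[OF nT nT] and i_tz = ter_integrable[OF zT z0]
  have "expectation (\<lambda>\<omega>. ter (Y T \<omega>) (n T \<omega>)) = expectation (\<lambda>\<omega>. (ter (n T \<omega>) (n T \<omega>) + ter (z T \<omega>) 0) + ?ct \<omega>)"
  proof (rule integral_cong_AE[OF borel_measurable_integrable[OF ter_integrable[OF YT nT]]
        borel_measurable_integrable[OF Bochner_Integration.integrable_add[OF Bochner_Integration.integrable_add[OF i_tn i_tz] i_ct]]])
    show "AE \<omega> in M. ter (Y T \<omega>) (n T \<omega>) = (ter (n T \<omega>) (n T \<omega>) + ter (z T \<omega>) 0) + ?ct \<omega>"
      using Yz
    proof eventually_elim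
      case (elim \<omega>)
      then have "Y T \<omega> = z T \<omega> + n T \<omega>" using T_mem by blast
      then show ?case by (simp only: ter_split)
    qed
  qed
  also have "\<dots> = expectation (\<lambda>\<omega>. ter (n T \<omega>) (n T \<omega>)) + expectation (\<lambda>\<omega>. ter (z T \<omega>) 0)"
    unfolding Bochner_Integration.integral_add[OF Bochner_Integration.integrable_add[OF i_tn i_tz] i_ct]
      Bochner_Integration.integral_add[OF i_tn i_tz] ct0 by simp
  finally show ?thesis unfolding payoff_eq[OF l Y n] r L_def by simp
qed

end

section \<open>Comparison of the payoffs\<close>

context lq_riccati
begin

text \<open>R times \<open>Phi_coef\<close> is transpose(B) \<phi> + S and R times
  \<open>Psi_coef\<close> is transpose(B) \<psi>. Hence the S terms cancel in the cross terms with
  \<open>u\<close>, and the quadratic terms in m collect into \<open>M_coef\<close>,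
  \<open>N_coef\<close> and \<open>G_coef\<close>. Used with \<open>u\<close> equal to
  \<open>Ri t *v \<delta> t\<close> for the flow and to \<open>Theta_coef\<close> for the
  equilibrium.\<close>

lemma run_identity:
  fixes m :: "real^'d" and u :: "real^'k"
  assumes t: "t \<in> {0..T}"
  shows "run t m (- ((Phi_coef D \<phi> t *v m + Psi_coef D \<psi> t *v m) + u)) m =
     - 1/2 * ((cQbar D t *v m) \<bullet> m) - 1/2 * ((M_coef D \<phi> t *v m) \<bullet> m) - 1/2 * ((G_coef D \<psi> t *v m) \<bullet> m)
     - (N_coef D \<phi> \<psi> t *v m) \<bullet> m
     + (cL D t - cq D t + transpose (Ri t ** (transpose (B t) ** (\<phi> t + \<psi> t) + S t)) *v cr D t) \<bullet> m
     - ((transpose (B t) ** \<phi> t) *v m) \<bullet> u - ((transpose (B t) ** \<psi> t) *v m) \<bullet> u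
     - 1/2 * ((R t *v u) \<bullet> u) + cr D t \<bullet> u"
proof -
  let ?p = "Phi_coef D \<phi> t *v m" and ?s = "Psi_coef D \<psi> t *v m"
  have sR: "(R t *v v) \<bullet> w = (R t *v w) \<bullet> v" for v w
    using inner_transpose_left[of "R t" v w] symR[OF t] unfolding sym_mat_def by (simp add: inner_commute)
  have Rp: "R t *v ?p = (transpose (B t) ** \<phi> t) *v m + S t *v m"
    unfolding Phi_coef_def mv_mm R_Ri[OF t] by (simp only: mv_simps)
  have Rs: "R t *v ?s = (transpose (B t) ** \<psi> t) *v m"
    unfolding Psi_coef_def mv_mm R_Ri[OF t] ..
  have M: "(M_coef D \<phi> t *v m) \<bullet> m = (Q t *v m) \<bullet> m + (R t *v ?p) \<bullet> ?p - 2 * ((S t *v m) \<bullet> ?p)"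
    unfolding M_coef_def mv_add mv_diff scaleR_matrix_vector_assoc[symmetric] mv_mm
    by (simp add: inner_add_left inner_diff_left inner_transpose_left del: transpose_matrix_vector)
  have G: "(G_coef D \<psi> t *v m) \<bullet> m = (R t *v ?s) \<bullet> ?s"
    unfolding G_coef_def mv_mm by (rule inner_transpose_left)
  have N: "(N_coef D \<phi> \<psi> t *v m) \<bullet> m = (Qt t *v m) \<bullet> m + (R t *v ?p) \<bullet> ?s - (S t *v m) \<bullet> ?s"
    unfolding N_coef_def mv_add mv_diff mv_mm
    by (simp add: inner_add_left inner_diff_left inner_transpose_left del: transpose_matrix_vector)
  have C: "(Ri t ** (transpose (B t) ** (\<phi> t + \<psi> t) + S t)) *v m = ?p + ?s"
    unfolding Phi_coef_def Psi_coef_def by (simp only: mv_simps add_ac)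
  have r: "(cL D t - cq D t + transpose (Ri t ** (transpose (B t) ** (\<phi> t + \<psi> t) + S t)) *v cr D t) \<bullet> m
     = cL D t \<bullet> m - cq D t \<bullet> m + (cr D t \<bullet> ?p + cr D t \<bullet> ?s)"
    unfolding inner_add_left inner_diff_left inner_transpose_left C inner_add_right by simp
  have Ra: "(R t *v (- ((?p + ?s) + u))) \<bullet> (- ((?p + ?s) + u))
     = (R t *v ?p) \<bullet> ?p + (R t *v ?s) \<bullet> ?s + (R t *v u) \<bullet> u + 2 * ((R t *v ?p) \<bullet> ?s) + 2 * ((R t *v ?p) \<bullet> u) + 2 * ((R t *v ?s) \<bullet> u)"
    using sR[of ?s ?p] sR[of u ?p] sR[of u ?s]
    by (simp only: mv_minus_right matrix_vector_right_distrib inner_minus_left inner_minus_right minus_minus inner_add_left inner_add_right)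
  have Bp: "((transpose (B t) ** \<phi> t) *v m) \<bullet> u = (R t *v ?p) \<bullet> u - (S t *v m) \<bullet> u"
    unfolding Rp by (simp add: inner_add_left)
  have Bs: "((transpose (B t) ** \<psi> t) *v m) \<bullet> u = (R t *v ?s) \<bullet> u" unfolding Rs ..
  have Sa: "(S t *v m) \<bullet> (- ((?p + ?s) + u)) = - ((S t *v m) \<bullet> ?p) - (S t *v m) \<bullet> ?s - (S t *v m) \<bullet> u"
    by (simp only: inner_minus_right inner_add_right)
  have ra: "cr D t \<bullet> (- ((?p + ?s) + u)) = - (cr D t \<bullet> ?p) - cr D t \<bullet> ?s - cr D t \<bullet> u"
    by (simp only: inner_minus_right inner_add_right)
  show ?thesis unfolding run_def M G N r Ra Bp Bs Sa ra by argo
qed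

lemma bdd_M_coef: "L_infty T (M_coef D \<phi>)" and bdd_G_coef: "L_infty T (G_coef D \<psi>)" and bdd_N_coef: "L_infty T (N_coef D \<phi> \<psi>)"
  unfolding M_coef_def[abs_def] G_coef_def[abs_def] N_coef_def[abs_def]
  by (intro L_infty_closure bdd_coefs bdd_Phi bdd_Psi)+

lemma E_inner_measurable:
  fixes f g :: "real \<Rightarrow> 'w \<Rightarrow> 'b::euclidean_space"
  assumes f: "L2P f" and g: "L2P g"
  shows "(\<lambda>t. expectation (\<lambda>\<omega>. f t \<omega> \<bullet> g t \<omega>)) \<in> borel_measurable (TL T)"
  using TM_time_integral(1)[OF L2P_inner_integrable[OF f g]] unfolding set_integrable_TL
  by (rule borel_measurable_integrable)

lemma E_vec_measurable:
  fixes f :: "real \<Rightarrow> 'w \<Rightarrow> 'b::euclidean_space"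
  shows "L2P f \<Longrightarrow> (\<lambda>t. expectation (f t)) \<in> borel_measurable (TL T)"
  using expectation_set_integrable[of f] unfolding set_integrable_TL by (blast dest: borel_measurable_integrable)

end

section \<open>A flow of the class G compared with the equilibrium\<close>

locale lq_class_G = lq_equilibrium D d1 d2 \<phi> \<psi> \<theta> mh ah lam X
  for D :: "('d::finite, 'k::finite, 'w) lq_model" and d1 d2 :: real and \<phi> \<psi> :: "real \<Rightarrow> real^'d^'d"
    and \<theta> mh :: "real \<Rightarrow> real^'d" and ah lam :: "real \<Rightarrow> 'w \<Rightarrow> real^'k" and X :: "real \<Rightarrow> 'w \<Rightarrow> real^'d" +
  fixes \<delta> :: "real \<Rightarrow> 'w \<Rightarrow> real^'k" and \<mu> :: "real \<Rightarrow> 'w \<Rightarrow> real^'d"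
  assumes mu_cont: "\<And>\<omega>. \<omega> \<in> space M \<Longrightarrow> continuous_on {0..T} (\<lambda>t. \<mu> t \<omega>)"
    and mu_meas: "\<And>t. t \<in> {0..T} \<Longrightarrow> \<mu> t \<in> borel_measurable (F 0)"
    and mu_indep: "indep_set (path_sigma (space M) {0..T} \<mu>) (noise_sigma D)"
    and delta_H2: "\<delta> \<in> H2 D (\<lambda>_. F 0)"
    and delta_indep: "indep_set (path_sigma (space M) {0..T} \<delta>) (noise_sigma D)"
    and lam_eq: "AE \<omega> in M. AE t in lborel. t \<in> {0..T} \<longrightarrow>
           lam t \<omega> = - (Ri t *v ((transpose (B t) ** \<phi> t + S t) *v X t \<omega>
              + (transpose (B t) ** \<psi> t) *v \<mu> t \<omega> + \<delta> t \<omega>))"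
    and mu_eq: "AE \<omega> in M. \<forall>t\<in>{0..T}. \<mu> t \<omega> = expectation (xi D) + (LBINT s:{0..t}.
          (A s - B s ** Ri s ** (transpose (B s) ** \<phi> s + S s + transpose (B s) ** \<psi> s)) *v \<mu> s \<omega>
          - (B s ** Ri s) *v \<delta> s \<omega>)"
begin

lemma lam_L2P: "L2P lam" by (rule H2_L2P[OF filt_space_F lam0])
lemma X_bddL2: "bddL2 X" by (rule state_bddL2[OF X0 lam_L2P])
lemma delta_L2P: "L2P \<delta>" by (rule H2_L2P[OF filt_space_F0 delta_H2])

lemma mu_meas_proc: "meas_proc \<mu>"
  by (rule filt_space.prog_meas_proc[OF filt_space_F0 filt_space.prog_continuous[OF filt_space_F0 mu_cont mu_meas]])

abbreviation Amu where
  "Amu s \<equiv> A s - B s ** Ri s ** (transpose (B s) ** \<phi> s + S s + transpose (B s) ** \<psi> s)"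

lemma bdd_Amu: "L_infty T (\<lambda>s. Amu s)" and bdd_BRi: "L_infty T (\<lambda>s. B s ** Ri s)"
  by (intro L_infty_closure bdd_coefs)+

text \<open>The integrated equation for \<mu> is linear with a forcing by \<delta> that is square
  integrable on the product, so the moment bound for linear equations applies.\<close>

lemma mu_bddL2: "bddL2 \<mu>"
proof (rule bddL2_linear_ode[OF bdd_Amu _ mu_meas_proc _ AE_I2[OF mu_cont]])
  let ?g = "\<lambda>s \<omega>. - ((B s ** Ri s) *v \<delta> s \<omega>)"
  have gL: "L2P ?g" by (intro L2P_minus L2P_mv bdd_BRi delta_L2P)
  show "bddL2 (\<lambda>t \<omega>. expectation (xi D) + (LBINT s:{0..t}. ?g s \<omega>))"
    by (intro bddL2_add bddL2_const L2_const finite_measure_axioms bddL2_integral gL)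
  show "AE \<omega> in M. continuous_on {0..T} (\<lambda>t. expectation (xi D) + (LBINT s:{0..t}. ?g s \<omega>))"
    using L2P_path_integrable[OF gL]
    by eventually_elim (intro continuous_on_add continuous_on_const continuous_on_set_integral)
  show "AE \<omega> in M. \<forall>t\<in>{0..T}. \<mu> t \<omega> = expectation (xi D) + (LBINT s:{0..t}. ?g s \<omega>) + (LBINT s:{0..t}. Amu s *v \<mu> s \<omega>)"
    using mu_eq L2P_path_integrable[OF gL] AE_space
  proof eventually_elim
    case (elim \<omega>)
    show ?case
    proof
      fix t assume t: "t \<in> {0..T}"
      have "\<mu> t \<omega> = expectation (xi D) + (LBINT s:{0..t}. Amu s *v \<mu> s \<omega> - (B s ** Ri s) *v \<delta> s \<omega>)" using elim(1) t by blast
      also have "(LBINT s:{0..t}. Amu s *v \<mu> s \<omega> - (B s ** Ri s) *v \<delta> s \<omega>) = (LBINT s:{0..t}. Amu s *v \<mu> s \<omega>) + (LBINT s:{0..t}. ?g s \<omega>)"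
        unfolding set_integral_add_sub[OF set_integrable_mv[OF bdd_Amu mu_cont[OF elim(3)]] elim(2) t, symmetric] by simp
      finally show "\<mu> t \<omega> = expectation (xi D) + (LBINT s:{0..t}. ?g s \<omega>) + (LBINT s:{0..t}. Amu s *v \<mu> s \<omega>)"
        by (simp only: add_ac)
    qed
  qed
qed

lemma mu_L2P: "L2P \<mu>" by (rule bddL2_L2P[OF mu_bddL2])
lemma mh_L2P: "L2P (\<lambda>t \<omega>. mh t)" by (rule L2P_coef[OF mh_bdd])

lemma lam_feedback: "AE z in TM T M. lam (fst z) (snd z) =
   - (Ri (fst z) *v ((transpose (B (fst z)) ** \<phi> (fst z) + S (fst z)) *v X (fst z) (snd z)
              + (transpose (B (fst z)) ** \<psi> (fst z)) *v \<mu> (fst z) (snd z) + \<delta> (fst z) (snd z)))"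
  and lam_feedback_L2P: "L2P (\<lambda>t \<omega>. - (Ri t *v ((transpose (B t) ** \<phi> t + S t) *v X t \<omega>
              + (transpose (B t) ** \<psi> t) *v \<mu> t \<omega> + \<delta> t \<omega>)))" (is "L2P ?u")
proof -
  show L: "L2P ?u"
    by (intro L2P_minus L2P_mv L2P_add L_infty_closure bdd_coefs delta_L2P mu_L2P bddL2_L2P[OF X_bddL2])
  show "AE z in TM T M. lam (fst z) (snd z) = ?u (fst z) (snd z)"
    unfolding AE_TM_eq_iff_path[OF L2P_meas[OF lam_L2P] L2P_meas[OF L]] AE_TL by (rule lam_eq)
qed

lemma ah_feedback: "AE z in TM T M. ah (fst z) (snd z) =
    - ((Phi_coef D \<phi> (fst z) *v Xh (fst z) (snd z) + Psi_coef D \<psi> (fst z) *v mh (fst z)) + Theta_coef D \<theta> (fst z))"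
  using NE_eps_zero unfolding eps_def 
proof eventually_elim
  case (elim z)
  then have "ah (fst z) (snd z) + ((Phi_coef D \<phi> (fst z) *v Xh (fst z) (snd z) + Psi_coef D \<psi> (fst z) *v mh (fst z)) + Theta_coef D \<theta> (fst z)) = 0"
    by (simp only: add.assoc)
  then show ?case by (rule eq_neg_iff_add_eq_0[THEN iffD2])
qed

lemma ah_feedback_L2P: "L2P (\<lambda>t \<omega>. - ((Phi_coef D \<phi> t *v Xh t \<omega> + Psi_coef D \<psi> t *v mh t) + Theta_coef D \<theta> t))"
  by (intro L2P_minus L2P_add L2P_mv L2P_coef bdd_Phi bdd_Psi bdd_Theta bddL2_L2P[OF Xh_bddL2] mh_L2P)

definition eh :: "real \<Rightarrow> real^'d" where
  "eh s = A s *v mh s - B s *v ((Phi_coef D \<phi> s *v mh s + Psi_coef D \<psi> s *v mh s) + Theta_coef D \<theta> s)"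

lemma bdd_eh: "L_infty T eh"
  unfolding eh_def[abs_def] by (intro L_infty_closure bdd_coefs bdd_Phi bdd_Psi bdd_Theta mh_bdd)

text \<open>Expectation of the state equation: the noise has mean 0, and the consistency condition
  together with the feedback form of the control closes the equation in \<open>mh\<close>.\<close>

lemma mh_integral: "t \<in> {0..T} \<Longrightarrow> mh t = expectation (xi D) + (LBINT s:{0..t}. eh s)"
proof -
  assume t: "t \<in> {0..T}"
  define v where "v = (\<lambda>t \<omega>. A t *v Xh t \<omega> + B t *v ah t \<omega>)"
  have vL: "L2P v" unfolding v_def by (intro L2P_add L2P_mv bddA bddB bddL2_L2P[OF Xh_bddL2] ah_L2P)
  let ?K = "noise ah Xh"
  have K: "L2 M (?K t)" by (rule bddL2_L2[OF noise_bddL2[OF Xh_state ah_L2P] t])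
  have V: "L2 M (\<lambda>\<omega>. LBINT s:{0..t}. v s \<omega>)" by (rule bddL2_L2[OF bddL2_integral[OF vL] t])
  note i = L2_integrable[OF finite_measure_axioms xi_L2] L2_integrable[OF finite_measure_axioms V] L2_integrable[OF finite_measure_axioms K]
  have iX: "integrable M (Xh t)" by (rule L2_integrable[OF finite_measure_axioms bddL2_L2[OF Xh_bddL2 t]])
  have "AE \<omega> in M. Xh t \<omega> = (xi D \<omega> + (LBINT s:{0..t}. v s \<omega>)) + ?K t \<omega>"
    using path_integrable_control[OF ah_L2P] AE_space
  proof eventually_elim
    case (elim \<omega>)
    show ?case unfolding v_def set_integral_add_sub[OF set_integrable_mv[OF bddA is_state_continuous[OF Xh_state elim(2)]] elim(1) t] noise_def by simp
  qed
  then have "expectation (Xh t) = expectation (\<lambda>\<omega>. (xi D \<omega> + (LBINT s:{0..t}. v s \<omega>)) + ?K t \<omega>)"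
    by (rule integral_cong_AE[OF borel_measurable_integrable[OF iX] borel_measurable_integrable[OF Bochner_Integration.integrable_add[OF Bochner_Integration.integrable_add[OF i(1,2)] i(3)]]])
  also have "\<dots> = expectation (xi D) + expectation (\<lambda>\<omega>. LBINT s:{0..t}. v s \<omega>)"
    unfolding Bochner_Integration.integral_add[OF Bochner_Integration.integrable_add[OF i(1,2)] i(3)] Bochner_Integration.integral_add[OF i(1,2)]
      wiener_integral_mean[OF noise_wiener[OF Xh_state ah_L2P] t] by simp
  also have "expectation (\<lambda>\<omega>. LBINT s:{0..t}. v s \<omega>) = (LBINT s:{0..t}. expectation (v s))"
    by (rule expectation_integral[OF vL t])
  also have "\<dots> = (LBINT s:{0..t}. eh s)"
  proof (rule set_integral_cong_TL[OF expectation_set_integrable[OF vL] set_integrable_L_infty[OF bdd_eh] _ t])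
    have "AE s in TL T. AE \<omega> in M. ah s \<omega> = - ((Phi_coef D \<phi> s *v Xh s \<omega> + Psi_coef D \<psi> s *v mh s) + Theta_coef D \<theta> s)"
      using ah_feedback AE_TM_eq_iff_time[OF L2P_meas[OF ah_L2P] L2P_meas[OF ah_feedback_L2P]] by blast
    then show "AE s in TL T. expectation (v s) = eh s"
      using AE_space L2P_AE_time[OF vL]
    proof eventually_elim
      case (elim s)
      then have s: "s \<in> {0..T}" by (simp add: space_restrict_space)
      have Xs: "integrable M (Xh s)" by (rule L2_integrable[OF finite_measure_axioms bddL2_L2[OF Xh_bddL2 s]])
      \<comment> \<open>With the feedback inserted the drift is affine in the state, so its
        expectation involves the state only through its mean.\<close>
      define C where "C = A s - B s ** Phi_coef D \<phi> s"
      define c where "c = - (B s *v (Psi_coef D \<psi> s *v mh s + Theta_coef D \<theta> s))"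
      have CX: "integrable M (\<lambda>\<omega>. C *v Xh s \<omega>)"
        by (rule integrable_bounded_linear[OF bounded_bilinear.bounded_linear_right[OF bounded_bilinear_mv] Xs])
      have "AE \<omega> in M. v s \<omega> = C *v Xh s \<omega> + c"
        using elim(1)
      proof eventually_elim
        case (elim \<omega>)
        show ?case unfolding v_def elim C_def c_def by (simp add: mv_simps)
      qed
      then have "expectation (v s) = expectation (\<lambda>\<omega>. C *v Xh s \<omega> + c)"
        by (rule integral_cong_AE[OF L2_measurable[OF elim(3)] borel_measurable_integrable[OF Bochner_Integration.integrable_add[OF CX finite_measure.integrable_const[OF finite_measure_axioms]]]])
      also have "\<dots> = C *v expectation (Xh s) + c"
        unfolding Bochner_Integration.integral_add[OF CX finite_measure.integrable_const[OF finite_measure_axioms]]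
          integral_bounded_linear[OF bounded_bilinear.bounded_linear_right[OF bounded_bilinear_mv] Xs] by (simp add: prob_space)
      also have "\<dots> = eh s" unfolding mh_eq[OF s, symmetric] eh_def C_def c_def by (simp add: mv_simps)
      finally show ?case .
    qed
  qed
  finally show ?thesis unfolding mh_eq[OF t] .
qed

text \<open>Taken from the equilibrium rather than from the flow, because this version is measurable
  with respect to \<open>filt1 D\<close>; the deviation of the flow agrees with it almost
  surely.\<close>

definition Z :: "real \<Rightarrow> 'w \<Rightarrow> real^'d" where "Z t \<omega> = Xh t \<omega> - mh t"

text \<open>Both deviations satisfy the closed-loop equation with matrix A - B
  \<open>Phi_coef\<close> and, off one null set, the same noise path; uniqueness is then applied to
  each path.\<close>

lemma X_eq_Z: "AE \<omega> in M. \<forall>t\<in>{0..T}. X t \<omega> = Z t \<omega> + \<mu> t \<omega>"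
proof -
  have iL: "L2P (\<lambda>s \<omega>. Amu s *v \<mu> s \<omega> - (B s ** Ri s) *v \<delta> s \<omega>)"
    by (intro L2P_diff L2P_mv bdd_Amu bdd_BRi mu_L2P delta_L2P)
  have 1: "AE \<omega> in M. \<forall>t\<in>{0..T}. X t \<omega> - \<mu> t \<omega> = (xi D \<omega> - expectation (xi D) + noise lam X t \<omega>)
      + (LBINT s:{0..t}. (A s - B s ** Phi_coef D \<phi> s) *v (X s \<omega> - \<mu> s \<omega>))"
    by (rule deviation_eq[OF X0 lam_L2P lam_feedback_L2P lam_feedback L2P_path_integrable[OF iL] mu_eq])
       (simp add: mv_simps Phi_coef_def)
  have 2: "AE \<omega> in M. \<forall>t\<in>{0..T}. Xh t \<omega> - mh t = (xi D \<omega> - expectation (xi D) + noise ah Xh t \<omega>)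
      + (LBINT s:{0..t}. (A s - B s ** Phi_coef D \<phi> s) *v (Xh s \<omega> - mh s))"
  proof (rule deviation_eq[OF Xh_state ah_L2P ah_feedback_L2P ah_feedback, where e="\<lambda>t \<omega>. eh t" and n="\<lambda>t \<omega>. mh t"])
    show "AE \<omega> in M. set_integrable lborel {0..T} (\<lambda>t. eh t)" by (rule AE_I2[OF set_integrable_L_infty[OF bdd_eh]])
    show "AE \<omega> in M. \<forall>t\<in>{0..T}. mh t = expectation (xi D) + (LBINT s:{0..t}. eh s)" by (intro AE_I2 ballI mh_integral)
  qed (simp add: eh_def mv_simps)
  show ?thesis using 1 2 noise_unique[OF X0 lam_L2P Xh_state ah_L2P] AE_space
  proof eventually_elim
    case (elim \<omega>)
    show ?case
    proof
      fix t assume t: "t \<in> {0..T}"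
      have "X t \<omega> - \<mu> t \<omega> = Xh t \<omega> - mh t"
      proof (rule linear_ode_unique[OF bdd_closed_loop _ _ _ _ t])
        show "continuous_on {0..T} (\<lambda>t. X t \<omega> - \<mu> t \<omega>)"
          by (intro continuous_on_diff is_state_continuous[OF X0 elim(4)] mu_cont[OF elim(4)])
        show "continuous_on {0..T} (\<lambda>t. Xh t \<omega> - mh t)"
          by (intro continuous_on_diff is_state_continuous[OF Xh_state elim(4)] mh_cont)
        show "X t \<omega> - \<mu> t \<omega> = (xi D \<omega> - expectation (xi D) + noise ah Xh t \<omega>)
          + (LBINT s:{0..t}. (A s - B s ** Phi_coef D \<phi> s) *v (X s \<omega> - \<mu> s \<omega>))" if "t \<in> {0..T}" for t
          using bspec[OF elim(1) that] bspec[OF elim(3) that] by simp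
        show "Xh t \<omega> - mh t = (xi D \<omega> - expectation (xi D) + noise ah Xh t \<omega>)
          + (LBINT s:{0..t}. (A s - B s ** Phi_coef D \<phi> s) *v (Xh s \<omega> - mh s))" if "t \<in> {0..T}" for t
          using bspec[OF elim(2) that] .
      qed
      then show "X t \<omega> = Z t \<omega> + \<mu> t \<omega>" unfolding Z_def by (metis diff_add_cancel)
    qed
  qed
qed

lemma Z_bddL2: "bddL2 Z"
  using bddL2_add[OF Xh_bddL2 bddL2_det[OF continuous_on_minus[OF mh_cont]]] unfolding Z_def[abs_def] by simp

lemma Z_L2: "t \<in> {0..T} \<Longrightarrow> L2 M (Z t)" by (rule bddL2_L2[OF Z_bddL2])

lemma Z_mean:
  assumes t: "t \<in> {0..T}" shows "expectation (Z t) = 0"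
proof -
  have "integrable M (Xh t)" by (rule L2_integrable[OF finite_measure_axioms bddL2_L2[OF Xh_bddL2 t]])
  then show ?thesis unfolding Z_def[abs_def] using mh_eq[OF t] by (simp add: prob_space)
qed

lemma Z_F1:
  assumes t: "t \<in> {0..T}" and E: "E \<in> sets borel" shows "Z t -` E \<inter> space M \<in> sets (F1 T)"
proof -
  have "Xh t \<in> borel_measurable (F1 T)"
    by (rule F1.G_measurable_mono[OF _ _ _ state_F1_adapted[OF ah_F1 Xh_state t]]) (use t in auto)
  then have "Z t \<in> borel_measurable (F1 T)" unfolding Z_def[abs_def] by (intro borel_measurable_diff borel_measurable_const)
  from measurable_sets[OF this E] show ?thesis unfolding space_F1 .
qed

lemma orth_mu:
  assumes t: "t \<in> {0..T}" shows "orth (Z t) (\<mu> t)"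
proof (rule orth_if_indep[OF indep_raw[OF mu_indep] Z_L2[OF t] Z_mean[OF t] bddL2_L2[OF mu_bddL2 t] _ Z_F1[OF t]])
  fix E :: "(real^'d) set" assume "E \<in> sets borel"
  then show "\<mu> t -` E \<inter> space M \<in> path_sigma (space M) {0..T} \<mu>"
    unfolding path_sigma_def using t by (intro sigma_sets.Basic) blast
qed

lemma orth_delta:
  assumes t: "t \<in> {0..T}" and L: "L2 M (\<delta> t)" shows "orth (Z t) (\<delta> t)"
proof (rule orth_if_indep[OF indep_raw[OF delta_indep] Z_L2[OF t] Z_mean[OF t] L _ Z_F1[OF t]])
  fix E :: "(real^'k) set" assume "E \<in> sets borel"
  then show "\<delta> t -` E \<inter> space M \<in> path_sigma (space M) {0..T} \<delta>"
    unfolding path_sigma_def using t by (intro sigma_sets.Basic) blast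
qed

text \<open>The feedback control with the state replaced by \<mu>; the rest of \<open>lam\<close> is
  \<open>Z\<close> multiplied by minus \<open>Phi_coef\<close>. \<open>amh\<close> is the
  equilibrium counterpart.\<close>

definition am :: "real \<Rightarrow> 'w \<Rightarrow> real^'k" where
  "am t \<omega> = - ((Phi_coef D \<phi> t *v \<mu> t \<omega> + Psi_coef D \<psi> t *v \<mu> t \<omega>) + Ri t *v \<delta> t \<omega>)"

definition amh :: "real \<Rightarrow> real^'k" where
  "amh t = - ((Phi_coef D \<phi> t *v mh t + Psi_coef D \<psi> t *v mh t) + Theta_coef D \<theta> t)"

lemma am_L2P: "L2P am"
  unfolding am_def[abs_def] by (intro L2P_minus L2P_add L2P_mv bdd_Phi bdd_Psi bddRi mu_L2P delta_L2P)

lemma bdd_amh: "L_infty T amh"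
  unfolding amh_def[abs_def] by (intro L_infty_closure bdd_Phi bdd_Psi bdd_Theta mh_bdd)

lemma amh_L2P: "L2P (\<lambda>t \<omega>. amh t)" by (rule L2P_coef[OF bdd_amh])

abbreviation Cst where
  "Cst \<equiv> (\<integral>x. run (fst x) (Z (fst x) (snd x)) (- (Phi_coef D \<phi> (fst x) *v Z (fst x) (snd x))) 0 \<partial>TM T M)
      + expectation (\<lambda>\<omega>. ter (Z T \<omega>) 0)"

lemma payoff_flow: "payoff D lam \<mu> = (\<integral>x. run (fst x) (\<mu> (fst x) (snd x)) (am (fst x) (snd x)) (\<mu> (fst x) (snd x)) \<partial>TM T M)
      + expectation (\<lambda>\<omega>. ter (\<mu> T \<omega>) (\<mu> T \<omega>)) + Cst"
proof -
  have m: "meas_proc (\<lambda>t \<omega>. Z t \<omega> + \<mu> t \<omega>)" by (rule meas_proc_add[OF bddL2_meas[OF Z_bddL2] mu_meas_proc])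
  have "AE \<omega> in M. AE t in TL T. X t \<omega> = Z t \<omega> + \<mu> t \<omega>"
    using X_eq_Z by eventually_elim (rule AE_I2, simp add: space_restrict_space)
  then have XZ: "AE z in TM T M. X (fst z) (snd z) = Z (fst z) (snd z) + \<mu> (fst z) (snd z)"
    using AE_TM_eq_iff_path[OF bddL2_meas[OF X_bddL2] m] by blast
  have la: "AE x in TM T M. lam (fst x) (snd x) = - (Phi_coef D \<phi> (fst x) *v Z (fst x) (snd x)) + am (fst x) (snd x)"
    using lam_feedback XZ
  proof eventually_elim
    case (elim x)
    show ?case unfolding elim am_def Phi_coef_def Psi_coef_def by (simp add: mv_simps)
  qed
  have oa: "AE t in TL T. orth (Z t) (am t)"
    using L2P_AE_time[OF delta_L2P] AE_space
  proof eventually_elim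
    case (elim t)
    then have t: "t \<in> {0..T}" by (simp add: space_restrict_space)
    show ?case unfolding am_def[abs_def]
      by (intro orth_minus orth_add orth_mv_right orth_mu[OF t] orth_delta[OF t elim(1)])
  qed
  show ?thesis
    using payoff_split[OF lam0 X0 mu_bddL2 am_L2P Z_bddL2 X_eq_Z la orth_mu oa] by simp
qed

lemma payoff_equilibrium: "payoff_det D ah mh = (\<integral>x. run (fst x) (mh (fst x)) (amh (fst x)) (mh (fst x)) \<partial>TM T M)
      + ter (mh T) (mh T) + Cst"
proof -
  have XZ: "AE \<omega> in M. \<forall>t\<in>{0..T}. Xh t \<omega> = Z t \<omega> + mh t" unfolding Z_def by simp
  have la: "AE x in TM T M. ah (fst x) (snd x) = - (Phi_coef D \<phi> (fst x) *v Z (fst x) (snd x)) + amh (fst x)"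
    using ah_feedback
  proof eventually_elim
    case (elim x)
    show ?case unfolding elim amh_def Z_def by (simp add: mv_simps)
  qed
  have o: "orth (Z t) (\<lambda>\<omega>. c)" if "t \<in> {0..T}" for t and c :: "real^'n"
    by (rule orth_const[OF Z_L2[OF that] Z_mean[OF that]])
  have oa: "AE t in TL T. orth (Z t) (\<lambda>\<omega>. amh t)"
    by (rule AE_I2) (simp add: o space_restrict_space)
  show ?thesis
    using payoff_split[OF ah_F Xh_state bddL2_det[OF mh_cont] amh_L2P Z_bddL2 XZ la o oa] by (simp add: prob_space)
qed

text \<open>Kept in the shape of the integrand of the criterion, so that unfolding it at the end
  matches the claim.\<close>

definition gap :: "real \<Rightarrow> real" where
  "gap t =
        1/2 * ((cQbar D t *v mh t) \<bullet> mh t - expect D (\<lambda>\<omega>. (cQbar D t *v \<mu> t \<omega>) \<bullet> \<mu> t \<omega>))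
      + 1/2 * ((M_coef D \<phi> t *v mh t) \<bullet> mh t - expect D (\<lambda>\<omega>. (M_coef D \<phi> t *v \<mu> t \<omega>) \<bullet> \<mu> t \<omega>))
      + 1/2 * ((G_coef D \<psi> t *v mh t) \<bullet> mh t - expect D (\<lambda>\<omega>. (G_coef D \<psi> t *v \<mu> t \<omega>) \<bullet> \<mu> t \<omega>))
      + (N_coef D \<phi> \<psi> t *v mh t) \<bullet> mh t - expect D (\<lambda>\<omega>. (N_coef D \<phi> \<psi> t *v \<mu> t \<omega>) \<bullet> \<mu> t \<omega>)
      + (cL D t - cq D t
          + transpose (Rinv D t ** (transpose (cB D t) ** (\<phi> t + \<psi> t) + cS D t)) *v cr D t)
        \<bullet> (expect D (\<mu> t) - mh t)
      + ((transpose (cB D t) ** \<phi> t) *v mh t) \<bullet> Theta_coef D \<theta> t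
      - expect D (\<lambda>\<omega>. ((transpose (cB D t) ** \<phi> t) *v \<mu> t \<omega>) \<bullet> (Rinv D t *v \<delta> t \<omega>))
      - expect D (\<lambda>\<omega>. ((transpose (cB D t) ** \<psi> t) *v \<mu> t \<omega>) \<bullet> (Rinv D t *v \<delta> t \<omega>))
      + ((transpose (cB D t) ** \<psi> t) *v mh t) \<bullet> Theta_coef D \<theta> t
      + 1/2 * ((cR D t *v Theta_coef D \<theta> t) \<bullet> Theta_coef D \<theta> t
               - expect D (\<lambda>\<omega>. (Rinv D t *v \<delta> t \<omega>) \<bullet> \<delta> t \<omega>))
      - cr D t \<bullet> (Theta_coef D \<theta> t - Rinv D t *v expect D (\<delta> t))"

text \<open>The identification of \<open>gap\<close> holds for almost every time, and transferring
  it to the integrals requires measurability of both sides.\<close>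

lemma gap_measurable: "gap \<in> borel_measurable (TL T)"
  unfolding gap_def[abs_def]
  by (intro borel_measurable_add borel_measurable_diff borel_measurable_times borel_measurable_const borel_measurable_inner
      E_inner_measurable E_vec_measurable bounded_bilinear_measurable[OF bounded_bilinear_mv]
      L2P_mv mu_L2P delta_L2P L_infty_measurable_TL L_infty_closure bdd_coefs bddQbar bdd_M_coef bdd_G_coef bdd_N_coef bddL mh_bdd bdd_Theta)

text \<open>Restricted to almost every time since \<delta>, an element of \<open>H2\<close>, is
  square integrable at almost every time only. Apart from that, it is the expectation of the
  pointwise identity for the flow minus the same identity for the equilibrium.\<close>

lemma gap_eq: "AE t in TL T. gap t = expectation (\<lambda>\<omega>. run t (\<mu> t \<omega>) (am t \<omega>) (\<mu> t \<omega>)) - run t (mh t) (amh t) (mh t)"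
  using L2P_AE_time[OF delta_L2P] AE_space
proof eventually_elim
  case (elim t)
  then have t: "t \<in> {0..T}" by (simp add: space_restrict_space)
  have m: "L2 M (\<mu> t)" by (rule bddL2_L2[OF mu_bddL2 t])
  note d = elim(1)
  let ?c = "cL D t - cq D t + transpose (Ri t ** (transpose (B t) ** (\<phi> t + \<psi> t) + S t)) *v cr D t"
  have RR: "(R t *v (Ri t *v \<delta> t \<omega>)) \<bullet> (Ri t *v \<delta> t \<omega>) = (Ri t *v \<delta> t \<omega>) \<bullet> \<delta> t \<omega>" for \<omega>
    unfolding R_Ri[OF t] by (rule inner_commute)
  note im = L2_integrable[OF finite_measure_axioms m] and id = L2_integrable[OF finite_measure_axioms d]
  have Rid: "integrable M (\<lambda>\<omega>. Ri t *v \<delta> t \<omega>)" by (rule L2_integrable[OF finite_measure_axioms L2_mv[OF d]])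
  have E1: "expectation (\<lambda>\<omega>. ?c \<bullet> \<mu> t \<omega>) = ?c \<bullet> expectation (\<mu> t)" by (rule integral_inner_right) (rule im)
  have E2: "expectation (\<lambda>\<omega>. cr D t \<bullet> (Ri t *v \<delta> t \<omega>)) = cr D t \<bullet> (Ri t *v expectation (\<delta> t))"
    unfolding integral_bounded_linear[OF bounded_bilinear.bounded_linear_right[OF bounded_bilinear_mv] id, symmetric]
    by (rule integral_inner_right) (rule Rid)
  have ic: "integrable M (\<lambda>\<omega>. ?c \<bullet> \<mu> t \<omega>)" "integrable M (\<lambda>\<omega>. cr D t \<bullet> (Ri t *v \<delta> t \<omega>))"
    by (intro L2_inner_integrable L2_const finite_measure_axioms m L2_mv d)+
  have E: "expectation (\<lambda>\<omega>. run t (\<mu> t \<omega>) (am t \<omega>) (\<mu> t \<omega>)) =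
      - 1/2 * expectation (\<lambda>\<omega>. (cQbar D t *v \<mu> t \<omega>) \<bullet> \<mu> t \<omega>)
      - 1/2 * expectation (\<lambda>\<omega>. (M_coef D \<phi> t *v \<mu> t \<omega>) \<bullet> \<mu> t \<omega>)
      - 1/2 * expectation (\<lambda>\<omega>. (G_coef D \<psi> t *v \<mu> t \<omega>) \<bullet> \<mu> t \<omega>)
      - expectation (\<lambda>\<omega>. (N_coef D \<phi> \<psi> t *v \<mu> t \<omega>) \<bullet> \<mu> t \<omega>)
      + ?c \<bullet> expectation (\<mu> t)
      - expectation (\<lambda>\<omega>. ((transpose (B t) ** \<phi> t) *v \<mu> t \<omega>) \<bullet> (Ri t *v \<delta> t \<omega>))
      - expectation (\<lambda>\<omega>. ((transpose (B t) ** \<psi> t) *v \<mu> t \<omega>) \<bullet> (Ri t *v \<delta> t \<omega>))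
      - 1/2 * expectation (\<lambda>\<omega>. (Ri t *v \<delta> t \<omega>) \<bullet> \<delta> t \<omega>)
      + cr D t \<bullet> (Ri t *v expectation (\<delta> t))"
    unfolding am_def run_identity[OF t] RR E1[symmetric] E2[symmetric]
    by (simp add: ic L2_inner_integrable L2_mv m d del: transpose_matrix_vector)
  show ?case unfolding gap_def E amh_def run_identity[OF t] inner_diff_right by argo
qed

lemma payoff_gap: "payoff D lam \<mu> - payoff_det D ah mh =
    (LBINT t:{0..T}. gap t)
    + 1/2 * ((cHbar D *v mh T) \<bullet> mh T - expect D (\<lambda>\<omega>. (cHbar D *v \<mu> T \<omega>) \<bullet> \<mu> T \<omega>))
    + 1/2 * ((cH D *v mh T) \<bullet> mh T - expect D (\<lambda>\<omega>. (cH D *v \<mu> T \<omega>) \<bullet> \<mu> T \<omega>))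
    + (cHtil D *v mh T) \<bullet> mh T - expect D (\<lambda>\<omega>. (cHtil D *v \<mu> T \<omega>) \<bullet> \<mu> T \<omega>)"
proof -
  have i1: "integrable (TM T M) (\<lambda>x. run (fst x) (\<mu> (fst x) (snd x)) (am (fst x) (snd x)) (\<mu> (fst x) (snd x)))"
    by (rule run_integrable[OF mu_L2P am_L2P mu_L2P])
  have i2: "integrable (TM T M) (\<lambda>x. run (fst x) (mh (fst x)) (amh (fst x)) (mh (fst x)))"
    using run_integrable[OF mh_L2P amh_L2P mh_L2P] .
  note j1 = TM_time_integral(1)[OF i1, unfolded set_integrable_TL] and j2 = TM_time_integral(1)[OF i2, unfolded set_integrable_TL]
  have "(LBINT t:{0..T}. gap t) = (\<integral>t. expectation (\<lambda>\<omega>. run t (\<mu> t \<omega>) (am t \<omega>) (\<mu> t \<omega>)) - expectation (\<lambda>\<omega>. run t (mh t) (amh t) (mh t)) \<partial>TL T)"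
    unfolding LBINT_TL
    by (rule integral_cong_AE[OF gap_measurable borel_measurable_integrable[OF Bochner_Integration.integrable_diff[OF j1 j2]]])
       (use gap_eq in \<open>simp add: prob_space\<close>)
  also have "\<dots> = (\<integral>x. run (fst x) (\<mu> (fst x) (snd x)) (am (fst x) (snd x)) (\<mu> (fst x) (snd x)) \<partial>TM T M)
     - (\<integral>x. run (fst x) (mh (fst x)) (amh (fst x)) (mh (fst x)) \<partial>TM T M)"
    unfolding Bochner_Integration.integral_diff[OF j1 j2] TM_time_integral(2)[OF i1, symmetric] TM_time_integral(2)[OF i2, symmetric] LBINT_TL ..
  finally have r: "(LBINT t:{0..T}. gap t) = (\<integral>x. run (fst x) (\<mu> (fst x) (snd x)) (am (fst x) (snd x)) (\<mu> (fst x) (snd x)) \<partial>TM T M)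
     - (\<integral>x. run (fst x) (mh (fst x)) (amh (fst x)) (mh (fst x)) \<partial>TM T M)" .
  have m: "L2 M (\<mu> T)" by (rule bddL2_L2[OF mu_bddL2 T_mem])
  have e: "expectation (\<lambda>\<omega>. ter (\<mu> T \<omega>) (\<mu> T \<omega>)) = - 1/2 * expectation (\<lambda>\<omega>. (cHbar D *v \<mu> T \<omega>) \<bullet> \<mu> T \<omega>)
     - 1/2 * expectation (\<lambda>\<omega>. (cH D *v \<mu> T \<omega>) \<bullet> \<mu> T \<omega>) - expectation (\<lambda>\<omega>. (cHtil D *v \<mu> T \<omega>) \<bullet> \<mu> T \<omega>)"
    unfolding ter_def by (simp add: L2_inner_integrable L2_mv m)
  show ?thesis unfolding payoff_flow payoff_equilibrium r e ter_def[of "mh T"] by argo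
qed

end

theorem theorem4p6:
  fixes D :: "('d::finite, 'k::finite, 'w) lq_model"
    and d1 d2 :: real
    and \<phi> \<psi> :: "real \<Rightarrow> real^'d^'d"
    and \<theta> mh :: "real \<Rightarrow> real^'d"
    and ah lam \<delta> :: "real \<Rightarrow> 'w \<Rightarrow> real^'k"
    and \<mu> :: "real \<Rightarrow> 'w \<Rightarrow> real^'d"
  assumes "coefficient_assumptions D d1 d2"
    and "stochastic_assumptions D"
    and "phi_solution D \<phi>"
    and "psi_solution D \<phi> \<psi>"
    and "unique_mean_field_NE D ah mh"
    and "theta_solution D \<phi> \<psi> mh \<theta>"
    and "in_class_G D \<phi> \<psi> \<delta> lam \<mu>"
  shows "payoff D lam \<mu> \<ge> payoff_det D ah mh \<longleftrightarrow>
    (LBINT t:{0..horizon D}.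
        1/2 * ((cQbar D t *v mh t) \<bullet> mh t - expect D (\<lambda>\<omega>. (cQbar D t *v \<mu> t \<omega>) \<bullet> \<mu> t \<omega>))
      + 1/2 * ((M_coef D \<phi> t *v mh t) \<bullet> mh t - expect D (\<lambda>\<omega>. (M_coef D \<phi> t *v \<mu> t \<omega>) \<bullet> \<mu> t \<omega>))
      + 1/2 * ((G_coef D \<psi> t *v mh t) \<bullet> mh t - expect D (\<lambda>\<omega>. (G_coef D \<psi> t *v \<mu> t \<omega>) \<bullet> \<mu> t \<omega>))
      + (N_coef D \<phi> \<psi> t *v mh t) \<bullet> mh t - expect D (\<lambda>\<omega>. (N_coef D \<phi> \<psi> t *v \<mu> t \<omega>) \<bullet> \<mu> t \<omega>)
      + (cL D t - cq D t
          + transpose (Rinv D t ** (transpose (cB D t) ** (\<phi> t + \<psi> t) + cS D t)) *v cr D t)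
        \<bullet> (expect D (\<mu> t) - mh t)
      + ((transpose (cB D t) ** \<phi> t) *v mh t) \<bullet> Theta_coef D \<theta> t
      - expect D (\<lambda>\<omega>. ((transpose (cB D t) ** \<phi> t) *v \<mu> t \<omega>) \<bullet> (Rinv D t *v \<delta> t \<omega>))
      - expect D (\<lambda>\<omega>. ((transpose (cB D t) ** \<psi> t) *v \<mu> t \<omega>) \<bullet> (Rinv D t *v \<delta> t \<omega>))
      + ((transpose (cB D t) ** \<psi> t) *v mh t) \<bullet> Theta_coef D \<theta> t
      + 1/2 * ((cR D t *v Theta_coef D \<theta> t) \<bullet> Theta_coef D \<theta> t
               - expect D (\<lambda>\<omega>. (Rinv D t *v \<delta> t \<omega>) \<bullet> \<delta> t \<omega>))
      - cr D t \<bullet> (Theta_coef D \<theta> t - Rinv D t *v expect D (\<delta> t)))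
    + 1/2 * ((cHbar D *v mh (horizon D)) \<bullet> mh (horizon D)
             - expect D (\<lambda>\<omega>. (cHbar D *v \<mu> (horizon D) \<omega>) \<bullet> \<mu> (horizon D) \<omega>))
    + 1/2 * ((cH D *v mh (horizon D)) \<bullet> mh (horizon D)
             - expect D (\<lambda>\<omega>. (cH D *v \<mu> (horizon D) \<omega>) \<bullet> \<mu> (horizon D) \<omega>))
    + (cHtil D *v mh (horizon D)) \<bullet> mh (horizon D)
    - expect D (\<lambda>\<omega>. (cHtil D *v \<mu> (horizon D) \<omega>) \<bullet> \<mu> (horizon D) \<omega>)
    \<ge> 0"
proof -
  interpret lq_riccati D d1 d2 \<phi> \<psi>
    by (intro lq_riccati.intro lq.intro lq_riccati_axioms.intro assms(1-4))
  note G = assms(7)[unfolded in_class_G_def correlated_flow_def]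
  \<comment> \<open>The state supplied by the class G condition also witnesses that a state exists
    at all, from which the state of the equilibrium control is derived.\<close>
  obtain X where X: "is_state D lam X"
    and lam_eq: "AE \<omega> in M. AE t in lborel. t \<in> {0..T} \<longrightarrow>
           lam t \<omega> = - (Ri t *v ((transpose (B t) ** \<phi> t + S t) *v X t \<omega>
              + (transpose (B t) ** \<psi> t) *v \<mu> t \<omega> + \<delta> t \<omega>))"
    using G by blast
  have NE: "mean_field_NE D ah mh" using assms(5) unfolding unique_mean_field_NE_def by blast
  interpret lq_class_G D d1 d2 \<phi> \<psi> \<theta> mh ah lam X \<delta> \<mu>
  proof (intro lq_class_G.intro lq_equilibrium.intro lq_riccati_axioms lq_equilibrium_axioms.intro lq_class_G_axioms.intro
      NE assms(6) X lam_eq)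
  qed (use G in blast)+
  show ?thesis using payoff_gap unfolding gap_def by linarith
qed

end
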